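(* Let $G$ be the closure in $L^2(\mathbb{R}^{1+n},\nu)$ of the operator $G_0$. Then $$D(G)=H^{1,2}(\mathbb{R}^{1+n},\nu)=\left\{u\in H^{1,2}_{\mathrm{loc}}(\mathbb{R}^{1+n})\cap L^2(\mathbb{R}^{1+n},\nu):\ \mathcal{G}u\in L^2(\mathbb{R}^{1+n},\nu)\right\}.$$
   Context: Standing assumptions. $A,B:\mathbb{R}\to\mathcal{L}(\mathbb{R}^n)$ and $f:\mathbb{R}\to\mathbb{R}^n$ are continuous and bounded. There is $\mu_0>0$ with $\|B(t)x\|\ge\mu_0\|x\|$ for all $t\in\mathbb{R}$, $x\in\mathbb{R}^n$. $U(t,s)$ ($t,s\in\mathbb{R}$) is the evolution family generated by $A(\cdot)$, i.e. $\partial_tU(t,s)=A(t)U(t,s)$, $U(s,s)=I$, and its growth bound $\omega_0(U):=\inf\{\omega\in\mathbb{R}:\exists M=M(\omega)\text{ such that }\|U(t,s)\|\le Me^{\omega(t-s)},\ -\infty<s\le t<\infty\}$ satisfies $\omega_0(U)<0$. Operators. $\mathcal{L}(t)\varphi(x)=\frac12\mathrm{Tr}\big(B(t)B^*(t)D_x^2\varphi(x)\big)+\langle A(t)x+f(t),D_x\varphi(x)\rangle$ and $\mathcal{G}u(t,x)=\partial_tu(t,x)+\mathcal{L}(t)u(t,\cdot)(x)$ for $u\in H^{1,2}_{\mathrm{loc}}(\mathbb{R}^{1+n})$. Measures. For $-\infty\le s<t$ put $g(t,s)=\int_s^tU(t,r)f(r)\,dr$ and $Q(t,s)=\int_s^tU(t,r)B(r)B^*(r)U^*(t,r)\,dr$.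 $\mathcal{N}_{m,Q}$ is the Gaussian measure on $\mathbb{R}^n$ with mean $m$ and covariance $Q$. Set $\nu_t=\mathcal{N}_{g(t,-\infty),Q(t,-\infty)}$, and let $\nu$ be the Borel measure on $\mathbb{R}^{1+n}$ with $\nu(I\times K)=\int_I\nu_t(K)\,dt$ for Borel $I\subset\mathbb{R}$, $K\subset\mathbb{R}^n$. The operator $G_0$. $D(G_0)$ is the linear span of real and imaginary parts of functions $u(t,x)=\Phi(t)e^{i\langle x,h(t)\rangle}$ with $\Phi\in C^1_c(\mathbb{R})$ and $h\in C^1_b(\mathbb{R};\mathbb{R}^n)$ ($C^1$, bounded with bounded derivative), and $G_0u=\mathcal{G}u$ for $u\in D(G_0)$, as an operator in $L^2(\mathbb{R}^{1+n},\nu)$. $G_0$ is dissipative and densely defined, hence closable. Spaces. $H^{k,s}_{\mathrm{loc}}(\mathbb{R}^{1+n})$ is the space of functions $u(t,x)$ whose weak derivatives $\partial_t^lu$ ($0\le l\le k$) and $D_x^\alpha u$ ($|\alpha|\le s$) belong to $L^2_{\mathrm{loc}}(\mathbb{R}^{1+n})$. $H^{k,s}(\mathbb{R}^{1+n},\nu)$ is the space of $u\in H^{k,s}_{\mathrm{loc}}(\mathbb{R}^{1+n})$ such that $\partial_t^lu\in L^2(\mathbb{R}^{1+n},\nu)$ for all $0\le l\le k$ and $D_x^\alpha u\in L^2(\mathbb{R}^{1+n},\nu)$ for all $|\alpha|\le s$. *)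

theory Defs
  imports "HOL-Analysis.Analysis"
begin

text \<open>
  Points of the space-time \<open>\<real> \<times> \<real>\<^sup>n\<close> are pairs \<open>(t, x)\<close> of type \<open>real \<times> (real ^ 'n)\<close>; linear operators
  on \<open>\<real>\<^sup>n\<close> are matrices \<open>real ^ 'n ^ 'n\<close>, the adjoint being \<open>transpose\<close>.  Elements of the
  various \<open>L\<^sup>2\<close> spaces are represented by Borel measurable functions.  The \<open>L\<^sup>2\<close> and Sobolev
  spaces below contain with a function also its Borel modifications on null sets.
\<close>

subsection \<open>Evolution families and Gaussian measures\<close>

definition evolution_family ::
    "(real \<Rightarrow> real ^ 'n ^ 'n) \<Rightarrow> (real \<Rightarrow> real \<Rightarrow> real ^ 'n ^ 'n) \<Rightarrow> bool" where
  "evolution_family A U \<longleftrightarrow>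
     (\<forall>s. U s s = mat 1) \<and>
     (\<forall>s t. ((\<lambda>r. U r s) has_vector_derivative (A t ** U t s)) (at t))"

text \<open>The norm of the type \<open>real ^ 'n ^ 'n\<close> is not the operator norm, hence \<open>onorm\<close>.\<close>

definition growth_bound :: "(real \<Rightarrow> real \<Rightarrow> real ^ 'n ^ 'n) \<Rightarrow> ereal" where
  "growth_bound U =
     Inf {ereal \<omega> | \<omega>. \<exists>M::real. \<forall>s t. s \<le> t \<longrightarrow>
            onorm (\<lambda>x. U t s *v x) \<le> M * exp (\<omega> * (t - s))}"

text \<open>The lower limit \<open>s\<close> is an extended real, so that \<open>s = -\<infinity>\<close> is allowed.\<close>

definition gvec ::
    "(real \<Rightarrow> real \<Rightarrow> real ^ 'n ^ 'n) \<Rightarrow> (real \<Rightarrow> real ^ 'n) \<Rightarrow> real \<Rightarrow> ereal \<Rightarrow> real ^ 'n" where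
  "gvec U f t s = (LINT r:{r. s < ereal r \<and> r \<le> t}|lborel. U t r *v f r)"

definition Qmat ::
    "(real \<Rightarrow> real \<Rightarrow> real ^ 'n ^ 'n) \<Rightarrow> (real \<Rightarrow> real ^ 'n ^ 'n) \<Rightarrow> real \<Rightarrow> ereal \<Rightarrow> real ^ 'n ^ 'n" where
  "Qmat U B t s =
     (LINT r:{r. s < ereal r \<and> r \<le> t}|lborel.
        U t r ** B r ** transpose (B r) ** transpose (U t r))"

text \<open>
  The Gaussian measure with mean \<open>m\<close> and covariance \<open>Q\<close>, for symmetric positive
  definite \<open>Q\<close> only.  This covers \<open>Qmat U B t (-\<infinity>)\<close> as soon as all \<open>B r\<close> are
  invertible.
\<close>

definition gaussian_measure :: "real ^ 'n \<Rightarrow> real ^ 'n ^ 'n \<Rightarrow> (real ^ 'n) measure" where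
  "gaussian_measure m Q =
     density lborel (\<lambda>x. ennreal
       (exp (- (1/2) * ((x - m) \<bullet> (matrix_inv Q *v (x - m)))) /
        sqrt ((2 * pi) ^ CARD('n) * det Q)))"

definition nu_at ::
    "(real \<Rightarrow> real \<Rightarrow> real ^ 'n ^ 'n) \<Rightarrow> (real \<Rightarrow> real ^ 'n ^ 'n) \<Rightarrow> (real \<Rightarrow> real ^ 'n) \<Rightarrow>
     real \<Rightarrow> (real ^ 'n) measure" where
  "nu_at U B f t = gaussian_measure (gvec U f t (-\<infinity>)) (Qmat U B t (-\<infinity>))"

text \<open>
  \<open>is_nu U B f \<nu>\<close> determines \<open>\<nu>\<close> uniquely: the rectangles form a \<open>\<inter>\<close>-stable generator
  of the Borel sets, and bounded time strips have finite measure.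
\<close>

definition is_nu ::
    "(real \<Rightarrow> real \<Rightarrow> real ^ 'n ^ 'n) \<Rightarrow> (real \<Rightarrow> real ^ 'n ^ 'n) \<Rightarrow> (real \<Rightarrow> real ^ 'n) \<Rightarrow>
     (real \<times> (real ^ 'n)) measure \<Rightarrow> bool" where
  "is_nu U B f \<nu> \<longleftrightarrow>
     sets \<nu> = sets borel \<and>
     (\<forall>I\<in>sets borel. \<forall>K\<in>sets borel.
        emeasure \<nu> (I \<times> K) = (\<integral>\<^sup>+t\<in>I. emeasure (nu_at U B f t) K \<partial>lborel))"

subsection \<open>Weak derivatives\<close>

text \<open>\<open>iter_deriv [b\<^sub>1, \<dots>, b\<^sub>k] \<phi>\<close> is the iterated directional derivative of \<open>\<phi>\<close> along \<open>b\<^sub>k\<close>, \<dots>, \<open>b\<^sub>1\<close>.\<close>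

definition iter_deriv ::
    "'a::euclidean_space list \<Rightarrow> ('a \<Rightarrow> real) \<Rightarrow> 'a \<Rightarrow> real" where
  "iter_deriv bs \<phi> = foldr (\<lambda>b \<psi> z. frechet_derivative \<psi> (at z) b) bs \<phi>"

text \<open>Differentiability of all iterated partial derivatives amounts to \<open>C\<^sup>\<infinity>\<close>.\<close>

definition test_function :: "('a::euclidean_space \<Rightarrow> real) \<Rightarrow> bool" where
  "test_function \<phi> \<longleftrightarrow>
     (\<forall>bs. set bs \<subseteq> Basis \<longrightarrow> iter_deriv bs \<phi> differentiable_on UNIV) \<and>
     compact (closure {z. \<phi> z \<noteq> 0})"

definition L1_loc :: "('a::euclidean_space \<Rightarrow> real) set" where
  "L1_loc = {u \<in> borel_measurable borel. \<forall>K. compact K \<longrightarrow> set_integrable lborel K u}"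

definition L2_loc :: "('a::euclidean_space \<Rightarrow> real) set" where
  "L2_loc = {u \<in> borel_measurable borel.
               \<forall>K. compact K \<longrightarrow> set_integrable lborel K (\<lambda>z. (u z)\<^sup>2)}"

definition L2_space :: "'a measure \<Rightarrow> ('a \<Rightarrow> real) set" where
  "L2_space M = {u \<in> borel_measurable M. integrable M (\<lambda>z. (u z)\<^sup>2)}"

definition is_weak_deriv ::
    "'a::euclidean_space list \<Rightarrow> ('a \<Rightarrow> real) \<Rightarrow> ('a \<Rightarrow> real) \<Rightarrow> bool" where
  "is_weak_deriv bs u v \<longleftrightarrow>
     u \<in> L1_loc \<and> v \<in> L1_loc \<and>
     (\<forall>\<phi>. test_function \<phi> \<longrightarrow>
        (LINT z|lborel. u z * iter_deriv bs \<phi> z) =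
        (- 1) ^ length bs * (LINT z|lborel. v z * \<phi> z))"

text \<open>A version of the weak derivative, which is determined almost everywhere when it exists.\<close>

definition weak_deriv ::
    "'a::euclidean_space list \<Rightarrow> ('a \<Rightarrow> real) \<Rightarrow> 'a \<Rightarrow> real" where
  "weak_deriv bs u = (SOME v. is_weak_deriv bs u v)"

abbreviation e_time :: "real \<times> (real ^ 'n)" where
  "e_time \<equiv> (1, 0)"

abbreviation e_space :: "'n \<Rightarrow> real \<times> (real ^ 'n)" where
  "e_space i \<equiv> (0, axis i 1)"

definition Dt :: "nat \<Rightarrow> (real \<times> (real ^ 'n) \<Rightarrow> real) \<Rightarrow> real \<times> (real ^ 'n) \<Rightarrow> real" where
  "Dt l u = weak_deriv (replicate l e_time) u"

text \<open>
  Spatial multi-indices \<open>\<alpha>\<close> are encoded as lists of coordinate indices: \<open>\<alpha> i\<close> is the number of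
  occurrences of \<open>i\<close>, and \<open>|\<alpha>|\<close> is the length.  The order is irrelevant for weak derivatives.
\<close>

definition Dx :: "'n list \<Rightarrow> (real \<times> (real ^ 'n) \<Rightarrow> real) \<Rightarrow> real \<times> (real ^ 'n) \<Rightarrow> real" where
  "Dx \<alpha> u = weak_deriv (map e_space \<alpha>) u"

subsection \<open>Sobolev spaces\<close>

definition H_loc :: "nat \<Rightarrow> nat \<Rightarrow> (real \<times> (real ^ 'n) \<Rightarrow> real) set" where
  "H_loc k s = {u \<in> L2_loc.
     (\<forall>l\<le>k. \<exists>v\<in>L2_loc. is_weak_deriv (replicate l e_time) u v) \<and>
     (\<forall>\<alpha>. length \<alpha> \<le> s \<longrightarrow> (\<exists>v\<in>L2_loc. is_weak_deriv (map e_space \<alpha>) u v))}"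

definition H_space ::
    "nat \<Rightarrow> nat \<Rightarrow> (real \<times> (real ^ 'n)) measure \<Rightarrow> (real \<times> (real ^ 'n) \<Rightarrow> real) set" where
  "H_space k s \<nu> = {u \<in> H_loc k s.
     (\<forall>l\<le>k. Dt l u \<in> L2_space \<nu>) \<and>
     (\<forall>\<alpha>. length \<alpha> \<le> s \<longrightarrow> Dx \<alpha> u \<in> L2_space \<nu>)}"

subsection \<open>The operators\<close>

definition Gop ::
    "(real \<Rightarrow> real ^ 'n ^ 'n) \<Rightarrow> (real \<Rightarrow> real ^ 'n ^ 'n) \<Rightarrow> (real \<Rightarrow> real ^ 'n) \<Rightarrow>
     (real \<times> (real ^ 'n) \<Rightarrow> real) \<Rightarrow> real \<times> (real ^ 'n) \<Rightarrow> real" where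
  "Gop A B f u = (\<lambda>(t, x).
     Dt 1 u (t, x)
     + 1/2 * trace (B t ** transpose (B t) ** (\<chi> i j. Dx [i, j] u (t, x)))
     + (A t *v x + f t) \<bullet> (\<chi> i. Dx [i] u (t, x)))"

definition DG0_generators :: "(real \<times> (real ^ 'n) \<Rightarrow> real) set" where
  "DG0_generators =
     (\<Union>(\<Phi>, h) \<in> {(\<Phi> :: real \<Rightarrow> real, h :: real \<Rightarrow> real ^ 'n).
         \<Phi> C1_differentiable_on UNIV \<and> compact (closure {t. \<Phi> t \<noteq> 0}) \<and>
         h C1_differentiable_on UNIV \<and> bounded (range h) \<and>
         bounded (range (\<lambda>t. vector_derivative h (at t)))}.
       {\<lambda>(t, x). Re (complex_of_real (\<Phi> t) * exp (\<i> * complex_of_real (x \<bullet> h t))),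
        \<lambda>(t, x). Im (complex_of_real (\<Phi> t) * exp (\<i> * complex_of_real (x \<bullet> h t)))})"

definition DG0 :: "(real \<times> (real ^ 'n) \<Rightarrow> real) set" where
  "DG0 = {u. \<exists>S c. finite S \<and> S \<subseteq> DG0_generators \<and> u = (\<lambda>z. \<Sum>\<psi>\<in>S. c \<psi> * \<psi> z)}"

definition G0_graph ::
    "(real \<Rightarrow> real ^ 'n ^ 'n) \<Rightarrow> (real \<Rightarrow> real ^ 'n ^ 'n) \<Rightarrow> (real \<Rightarrow> real ^ 'n) \<Rightarrow>
     ((real \<times> (real ^ 'n) \<Rightarrow> real) \<times> (real \<times> (real ^ 'n) \<Rightarrow> real)) set" where
  "G0_graph A B f = {(u, Gop A B f u) | u. u \<in> DG0}"

text \<open>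
  The graph of the closure in \<open>L\<^sup>2(M)\<close> of the operator with graph \<open>R\<close>.  The guard on the
  approximating sequences expresses that \<open>R\<close> is read as an operator in \<open>L\<^sup>2(M)\<close>.
\<close>

definition L2_graph_closure ::
    "'a measure \<Rightarrow> (('a \<Rightarrow> real) \<times> ('a \<Rightarrow> real)) set \<Rightarrow> (('a \<Rightarrow> real) \<times> ('a \<Rightarrow> real)) set" where
  "L2_graph_closure M R = {(u, v). u \<in> L2_space M \<and> v \<in> L2_space M \<and>
     (\<exists>us vs. (\<forall>k::nat. (us k, vs k) \<in> R \<and> us k \<in> L2_space M \<and> vs k \<in> L2_space M) \<and>
        (\<lambda>k. LINT z|M. (us k z - u z)\<^sup>2) \<longlonglongrightarrow> 0 \<and>
        (\<lambda>k. LINT z|M. (vs k z - v z)\<^sup>2) \<longlonglongrightarrow> 0)}"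

end

theory Submission
  imports Defs "HOL-Probability.Probability"
begin

text \<open>
  The measure \<open>\<nu>\<close> has a positive density \<open>\<rho>\<close>, Gaussian in \<open>x\<close>, which solves the Fokker--Planck equation.
  Integrating \<open>G\<phi>\<close> by parts against suitable multipliers (the Gaussian number operator of \<open>\<nu>\<^sub>t\<close>, for which the terms
  containing \<open>A\<close> cancel) bounds the first and second spatial derivatives of a test function \<open>\<phi>\<close> by \<open>G\<phi>\<close>; a Gaussian
  weighted inequality then controls the drift term and hence the time derivative. By a Caccioppoli estimate,
  cut-off and mollification, test functions are a core for the maximal domain. Finally, spatial convolution with
  the trigonometric kernels proportional to \<open>cos (x\<^sub>i / k)\<close> raised to a high even power maps test functions into \<open>D(G\<^sub>0)\<close>.
\<close>

text \<open>The drift is unbounded in \<open>x\<close>, the coefficients are merely continuous in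
  \<open>t\<close> and \<nu> is infinite; the estimates therefore rest on exact integral identities
  instead of perturbation or compactness. Let X be the sum of the integrals of |D\<phi>|^2 and |D^2
  \<phi>|^2. The multiplier gives c X \<le> 2 ||G\<phi>|| ||N\<phi>||, and ||N\<phi>||^2 is itself
  at most a multiple of X; dividing by X closes the estimate. No time derivative of a test function
  is estimated: for a limit it is read off from the equation, once all other terms are known to be
  square integrable. Cutting off a function costs a term with its gradient, so the gradient bound
  has to precede the density of test functions. Mollifying afterwards produces no commutator to
  estimate, because every weak derivative in the equation exists separately. Elements of D(G0) do
  not decay in \<open>x\<close>, so a test function is reached by trigonometric polynomials with
  periodic kernels; these are not integrable over the whole space, and their distant periods are
  harmless only because they add polynomial growth against a Gaussian weight.\<close>

section \<open>Square integrable functions and convergence in mean square\<close>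

lemma L2_spaceD: "u \<in> L2_space M \<Longrightarrow> u \<in> borel_measurable M" "u \<in> L2_space M \<Longrightarrow> integrable M (\<lambda>z. (u z)\<^sup>2)"
  by (auto simp: L2_space_def)

lemma L2_space_mult_integrable:
  assumes "u \<in> L2_space M" "v \<in> L2_space M"
  shows "integrable M (\<lambda>z. u z * v z)"
proof (rule Bochner_Integration.integrable_bound)
  show "integrable M (\<lambda>z. (u z)\<^sup>2 + (v z)\<^sup>2)" using assms by (auto dest: L2_spaceD)
  show "(\<lambda>z. u z * v z) \<in> borel_measurable M" using assms[THEN L2_spaceD(1)] by measurable
  have "\<bar>a * b\<bar> \<le> a\<^sup>2 + b\<^sup>2" for a b :: real
  proof -
   have "2 * (\<bar>a\<bar> * \<bar>b\<bar>) \<le> a\<^sup>2 + b\<^sup>2" using sum_squares_bound[of "\<bar>a\<bar>" "\<bar>b\<bar>"] by simp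
   moreover have "0 \<le> \<bar>a\<bar> * \<bar>b\<bar>" by simp
   ultimately show ?thesis unfolding abs_mult by linarith
  qed
  then show "AE z in M. norm (u z * v z) \<le> norm ((u z)\<^sup>2 + (v z)\<^sup>2)" by auto
qed

lemma L2_space_add: assumes "u \<in> L2_space M" "v \<in> L2_space M" shows "(\<lambda>z. u z + v z) \<in> L2_space M"
  using assms L2_space_mult_integrable[OF assms] by (auto simp: L2_space_def power2_sum mult.assoc)

lemma L2_space_diff: assumes "u \<in> L2_space M" "v \<in> L2_space M" shows "(\<lambda>z. u z - v z) \<in> L2_space M"
  using assms L2_space_mult_integrable[OF assms] by (auto simp: L2_space_def power2_diff mult.assoc)

lemma L2_space_bounded_mult:
  assumes u: "u \<in> L2_space M" and c: "c \<in> borel_measurable M" "\<And>z. \<bar>c z\<bar> \<le> K"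
  shows "(\<lambda>z. c z * u z) \<in> L2_space M"
proof -
  have "integrable M (\<lambda>z. (c z * u z)\<^sup>2)"
  proof (rule Bochner_Integration.integrable_bound)
   show "integrable M (\<lambda>z. K\<^sup>2 * (u z)\<^sup>2)" using u by (auto dest: L2_spaceD)
   have "(c z)\<^sup>2 \<le> K\<^sup>2" for z using c(2)[of z] by (metis abs_ge_zero power2_abs power_mono)
   then show "AE z in M. norm ((c z * u z)\<^sup>2) \<le> norm (K\<^sup>2 * (u z)\<^sup>2)" by (auto simp: power_mult_distrib mult_right_mono)
  qed (use u c in \<open>auto dest: L2_spaceD\<close>)
  then show ?thesis using u c by (auto simp: L2_space_def)
qed

lemma L2_space_cmult: "u \<in> L2_space M \<Longrightarrow> (\<lambda>z. c * u z) \<in> L2_space M"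
  by (rule L2_space_bounded_mult[where K="\<bar>c\<bar>"]) auto

lemma L2_space_zero: "(\<lambda>z. 0) \<in> L2_space M" by (simp add: L2_space_def)

lemma L2_space_sum: "(\<And>i. i \<in> I \<Longrightarrow> u i \<in> L2_space M) \<Longrightarrow> (\<lambda>z. \<Sum>i\<in>I. u i z) \<in> L2_space M"
  by (induction I rule: infinite_finite_induct) (auto simp: L2_space_zero intro: L2_space_add)

lemma L2_space_bound:
  assumes "v \<in> L2_space M" "u \<in> borel_measurable M" "AE z in M. \<bar>u z\<bar> \<le> \<bar>v z\<bar>"
  shows "u \<in> L2_space M"
proof -
  have "integrable M (\<lambda>z. (u z)\<^sup>2)"
  proof (rule Bochner_Integration.integrable_bound[where f="\<lambda>z. (v z)\<^sup>2"])
   show "AE z in M. norm ((u z)\<^sup>2) \<le> norm ((v z)\<^sup>2)" using assms(3) by eventually_elim (simp add: abs_le_square_iff)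
  qed (use assms in \<open>auto dest: L2_spaceD\<close>)
  then show ?thesis using assms by (simp add: L2_space_def)
qed

lemma L2_space_AE_cong:
  assumes "v \<in> L2_space M" "u \<in> borel_measurable M" "AE z in M. u z = v z"
  shows "u \<in> L2_space M" by (rule L2_space_bound[OF assms(1,2)]) (use assms(3) in eventually_elim, simp)

lemma L2_integral_le_square_add:
  assumes "u \<in> L2_space M" "v \<in> L2_space M"
  shows "(LINT z|M. (u z + v z)\<^sup>2) \<le> 2 * (LINT z|M. (u z)\<^sup>2) + 2 * (LINT z|M. (v z)\<^sup>2)"
proof -
  have "(LINT z|M. (u z + v z)\<^sup>2) \<le> (LINT z|M. 2 * (u z)\<^sup>2 + 2 * (v z)\<^sup>2)" by (rule integral_mono)
    (use assms[THEN L2_spaceD(2)] L2_space_add[OF assms, THEN L2_spaceD(2)] in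
     \<open>auto simp: power2_sum sum_squares_bound[of "u _" "v _", simplified add.commute[of "(u _)\<^sup>2"]]\<close>)
  also have "\<dots> = 2 * (LINT z|M. (u z)\<^sup>2) + 2 * (LINT z|M. (v z)\<^sup>2)"
   using assms by (subst Bochner_Integration.integral_add) (auto dest: L2_spaceD)
  finally show ?thesis .
qed

lemma L2_Cauchy_Schwarz:
  assumes "u \<in> L2_space M" "v \<in> L2_space M"
  shows "(LINT z|M. u z * v z)\<^sup>2 \<le> (LINT z|M. (u z)\<^sup>2) * (LINT z|M. (v z)\<^sup>2)"
proof -
  define a where "a = (LINT z|M. (u z)\<^sup>2)"
  define b where "b = (LINT z|M. u z * v z)"
  define c where "c = (LINT z|M. (v z)\<^sup>2)"
  note int = L2_space_mult_integrable[OF assms] L2_spaceD(2)[OF assms(1)] L2_spaceD(2)[OF assms(2)]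
  have q: "0 \<le> a + 2 * s * b + s\<^sup>2 * c" for s
  proof -
   have "0 \<le> (LINT z|M. (u z + s * v z)\<^sup>2)" by simp
   also have "\<dots> = (LINT z|M. (u z)\<^sup>2 + 2 * s * (u z * v z) + s\<^sup>2 * (v z)\<^sup>2)"
    by (rule Bochner_Integration.integral_cong) (auto simp: power2_sum power_mult_distrib algebra_simps)
   also have "\<dots> = a + 2 * s * b + s\<^sup>2 * c" unfolding a_def b_def c_def using int by (subst Bochner_Integration.integral_add, auto)+
   finally show ?thesis .
  qed
  have c0: "c \<ge> 0" "a \<ge> 0" by (auto simp: a_def c_def)
  show ?thesis
  proof (cases "c = 0")
   case True
   have "b = 0"
   proof (rule ccontr)
    assume "b \<noteq> 0"
    \<comment> \<open>For \<open>c = 0\<close> the polynomial is affine in \<open>s\<close>, and at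
      this \<open>s\<close> its value is -1.\<close>
    then show False using q[of "- (a + 1) / (2 * b)"] True c0 by (simp add: field_simps)
   qed
   then show ?thesis using True by (simp add: a_def b_def c_def)
  next
   case False
   \<comment> \<open>\<open>- b / c\<close> minimises the quadratic, so this instance is the sharp
     one.\<close>
   have "0 \<le> a + 2 * (- b / c) * b + (- b / c)\<^sup>2 * c" by (rule q)
   then have "0 \<le> (a + 2 * (- b / c) * b + (- b / c)\<^sup>2 * c) * c" using c0 by simp
   also have "\<dots> = a * c - b\<^sup>2" using False by (simp add: field_simps power2_eq_square)
   finally show ?thesis by (simp add: a_def b_def c_def)
  qed
qed

lemma abs_le_sqrt_mult: fixes x :: real shows "x\<^sup>2 \<le> a * b \<Longrightarrow> \<bar>x\<bar> \<le> sqrt a * sqrt b"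
  by (metis real_sqrt_abs real_sqrt_le_iff real_sqrt_mult)

text \<open>Membership is built in because the Bochner integral of a non-integrable function is 0:
  the limit of the integrals alone would say nothing about functions outside L2.\<close>

definition l2_tends :: "'a measure \<Rightarrow> (nat \<Rightarrow> 'a \<Rightarrow> real) \<Rightarrow> ('a \<Rightarrow> real) \<Rightarrow> bool" where
  "l2_tends M F f \<longleftrightarrow> (\<forall>k. F k \<in> L2_space M) \<and> f \<in> L2_space M \<and>
   (\<lambda>k. LINT z|M. (F k z - f z)\<^sup>2) \<longlonglongrightarrow> 0"

lemma l2_tendsD:
  assumes "l2_tends M F f"
  shows "F k \<in> L2_space M" "f \<in> L2_space M" "(\<lambda>k. LINT z|M. (F k z - f z)\<^sup>2) \<longlonglongrightarrow> 0"
  using assms by (auto simp: l2_tends_def)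

lemma l2_tends_sandwich:
  assumes "\<And>k. F k \<in> L2_space M" "f \<in> L2_space M"
   and "\<And>k. (LINT z|M. (F k z - f z)\<^sup>2) \<le> b k" "b \<longlonglongrightarrow> 0"
  shows "l2_tends M F f" unfolding l2_tends_def using assms(1,2)
  by (auto intro!: tendsto_sandwich[OF _ _ tendsto_const assms(4)] always_eventually simp: assms(3))

lemma l2_tends_const: "f \<in> L2_space M \<Longrightarrow> l2_tends M (\<lambda>k. f) f" by (simp add: l2_tends_def)

lemma l2_tends_add:
  assumes "l2_tends M F f" "l2_tends M G g"
  shows "l2_tends M (\<lambda>k z. F k z + G k z) (\<lambda>z. f z + g z)"
proof (rule l2_tends_sandwich)
  note d = l2_tendsD[OF assms(1)] l2_tendsD[OF assms(2)]
  show "(\<lambda>k. 2 * (LINT z|M. (F k z - f z)\<^sup>2) + 2 * (LINT z|M. (G k z - g z)\<^sup>2)) \<longlonglongrightarrow> 0"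
   using tendsto_add[OF tendsto_mult_left[OF d(3), of 2] tendsto_mult_left[OF d(6), of 2]] by simp
  show "(LINT z|M. (F k z + G k z - (f z + g z))\<^sup>2) \<le>
   2 * (LINT z|M. (F k z - f z)\<^sup>2) + 2 * (LINT z|M. (G k z - g z)\<^sup>2)" for k
   using L2_integral_le_square_add[OF L2_space_diff[OF d(1)[of k] d(2)] L2_space_diff[OF d(4)[of k] d(5)]] by (simp add: algebra_simps)
qed (use l2_tendsD[OF assms(1)] l2_tendsD[OF assms(2)] in \<open>auto intro: L2_space_add\<close>)

lemma l2_tends_bounded_mult:
  assumes F: "l2_tends M F f" and c: "c \<in> borel_measurable M" "\<And>z. \<bar>c z\<bar> \<le> K"
  shows "l2_tends M (\<lambda>k z. c z * F k z) (\<lambda>z. c z * f z)"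
proof (rule l2_tends_sandwich)
  note d = l2_tendsD[OF F]
  show "(\<lambda>k. K\<^sup>2 * (LINT z|M. (F k z - f z)\<^sup>2)) \<longlonglongrightarrow> 0"
   using tendsto_mult_left[OF d(3), of "K\<^sup>2"] by simp
  show "(LINT z|M. (c z * F k z - c z * f z)\<^sup>2) \<le> K\<^sup>2 * (LINT z|M. (F k z - f z)\<^sup>2)" for k
  proof -
   have "(c z)\<^sup>2 \<le> K\<^sup>2" for z using c(2)[of z] by (metis abs_ge_zero power2_abs power_mono)
   then have *: "(c z * F k z - c z * f z)\<^sup>2 \<le> K\<^sup>2 * (F k z - f z)\<^sup>2" for z
    by (simp add: power_mult_distrib mult_right_mono flip: right_diff_distrib)
   have "(LINT z|M. (c z * F k z - c z * f z)\<^sup>2) \<le> (LINT z|M. K\<^sup>2 * (F k z - f z)\<^sup>2)"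
   proof (rule integral_mono)
    show "integrable M (\<lambda>z. (c z * F k z - c z * f z)\<^sup>2)"
     using L2_spaceD(2)[OF L2_space_bounded_mult[OF L2_space_diff[OF d(1)[of k] d(2)] c]] by (simp add: right_diff_distrib)
    show "integrable M (\<lambda>z. K\<^sup>2 * (F k z - f z)\<^sup>2)" using L2_spaceD(2)[OF L2_space_diff[OF d(1)[of k] d(2)]] by simp
   qed (rule *)
   then show ?thesis by simp
  qed
qed (use l2_tendsD[OF F] c in \<open>auto intro: L2_space_bounded_mult\<close>)

lemma l2_tends_cmult: "l2_tends M F f \<Longrightarrow> l2_tends M (\<lambda>k z. c * F k z) (\<lambda>z. c * f z)"
  by (rule l2_tends_bounded_mult[where K="\<bar>c\<bar>"]) auto

lemma l2_tends_sum:
  "(\<And>i. i \<in> I \<Longrightarrow> l2_tends M (F i) (f i)) \<Longrightarrow> l2_tends M (\<lambda>k z. \<Sum>i\<in>I. F i k z) (\<lambda>z. \<Sum>i\<in>I. f i z)"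
  by (induction I rule: infinite_finite_induct) (auto intro: l2_tends_add l2_tends_const L2_space_zero)

lemma l2_tends_integral_power2:
  assumes F: "l2_tends M F f" shows "(\<lambda>k. LINT z|M. (F k z)\<^sup>2) \<longlonglongrightarrow> (LINT z|M. (f z)\<^sup>2)"
proof -
  note d = l2_tendsD[OF F]
  let ?a = "\<lambda>k. LINT z|M. (F k z - f z)\<^sup>2" and ?b = "\<lambda>k. LINT z|M. (F k z - f z) * f z"
  have dL: "(\<lambda>z. F k z - f z) \<in> L2_space M" for k by (rule L2_space_diff[OF d(1,2)])
  have e: "(LINT z|M. (F k z)\<^sup>2) = ?a k + 2 * ?b k + (LINT z|M. (f z)\<^sup>2)" for k
  proof -
   have "(LINT z|M. (F k z)\<^sup>2) = (LINT z|M. (F k z - f z)\<^sup>2 + 2 * ((F k z - f z) * f z) + (f z)\<^sup>2)"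
    by (rule Bochner_Integration.integral_cong) (auto simp: power2_eq_square algebra_simps)
   then show ?thesis using L2_spaceD(2)[OF dL[of k]] L2_space_mult_integrable[OF dL[of k] d(2)] L2_spaceD(2)[OF d(2)] by simp
  qed
  have b: "?b \<longlonglongrightarrow> 0"
  proof (rule Lim_null_comparison)
   show "\<forall>\<^sub>F k in sequentially. norm (?b k) \<le> sqrt (?a k) * sqrt (LINT z|M. (f z)\<^sup>2)"
    using abs_le_sqrt_mult[OF L2_Cauchy_Schwarz[OF dL d(2)]] by simp
   show "(\<lambda>k. sqrt (?a k) * sqrt (LINT z|M. (f z)\<^sup>2)) \<longlonglongrightarrow> 0" using tendsto_mult_left_zero[OF tendsto_real_sqrt[OF d(3), simplified]] by simp
  qed
  show ?thesis unfolding e using tendsto_add[OF tendsto_add[OF d(3) tendsto_mult_right_zero[OF b, of 2]] tendsto_const] by simp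
qed

text \<open>Polarisation writes the product as a combination of two squares, so convergence of norms
  is enough.\<close>

lemma l2_tends_integral_mult:
  assumes F: "l2_tends M F f" and G: "l2_tends M G g"
  shows "(\<lambda>k. LINT z|M. F k z * G k z) \<longlonglongrightarrow> (LINT z|M. f z * g z)"
proof -
  have pol: "(LINT z|M. u z * v z) = 1/4 * (LINT z|M. (u z + v z)\<^sup>2) + (-1/4) * (LINT z|M. (u z + (-1) * v z)\<^sup>2)"
   if u: "u \<in> L2_space M" and v: "v \<in> L2_space M" for u v
  proof -
   have "(LINT z|M. u z * v z) = (LINT z|M. 1/4 * (u z + v z)\<^sup>2 + (-1/4) * (u z + (-1) * v z)\<^sup>2)"
    by (rule Bochner_Integration.integral_cong) (auto simp: power2_eq_square algebra_simps)
   then show ?thesis using L2_spaceD(2)[OF L2_space_add[OF u v]] L2_spaceD(2)[OF L2_space_add[OF u L2_space_cmult[OF v, of "-1"]]] by simp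
  qed
  show ?thesis unfolding pol[OF l2_tendsD(1)[OF F] l2_tendsD(1)[OF G]] pol[OF l2_tendsD(2)[OF F] l2_tendsD(2)[OF G]]
   by (intro tendsto_add tendsto_mult_left l2_tends_integral_power2 l2_tends_add l2_tends_cmult F G)
qed

lemma l2_tends_AE_subseq:
  assumes "l2_tends M F f"
  shows "\<exists>r::nat\<Rightarrow>nat. strict_mono r \<and> (AE x in M. (\<lambda>n. F (r n) x) \<longlonglongrightarrow> f x)"
proof -
  note d = l2_tendsD[OF assms]
  obtain r :: "nat \<Rightarrow> nat" where r: "strict_mono r" "AE x in M. (\<lambda>n. (F (r n) x - f x)\<^sup>2) \<longlonglongrightarrow> 0"
   using tendsto_L1_AE_subseq[of M "\<lambda>k z. (F k z - f z)\<^sup>2"] d L2_spaceD(2)[OF L2_space_diff[OF d(1) d(2)]] by auto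
  have "AE x in M. (\<lambda>n. F (r n) x) \<longlonglongrightarrow> f x" using r(2)
  proof eventually_elim
   case (elim x)
   then have "(\<lambda>n. sqrt ((F (r n) x - f x)\<^sup>2)) \<longlonglongrightarrow> 0" using tendsto_real_sqrt by fastforce
   then have "(\<lambda>n. F (r n) x - f x) \<longlonglongrightarrow> 0" by (simp add: tendsto_rabs_zero_iff)
   then show ?case using Lim_null by blast
  qed
  then show ?thesis using r(1) by auto
qed

lemma l2_tends_dominated:
  assumes F: "\<And>k. F k \<in> borel_measurable M" "f \<in> borel_measurable M" and w: "w \<in> L2_space M"
   and lim: "AE x in M. (\<lambda>k. F k x) \<longlonglongrightarrow> f x" and bd: "\<And>k. AE x in M. \<bar>F k x\<bar> \<le> w x"
  shows "l2_tends M F f"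
proof -
  have wn: "AE x in M. \<bar>w x\<bar> = w x" using bd[of 0] by eventually_elim auto
  have fw: "AE x in M. \<bar>f x\<bar> \<le> w x"
  proof -
   have "AE x in M. \<forall>k. \<bar>F k x\<bar> \<le> w x" using bd by (simp add: AE_all_countable)
   with lim show ?thesis by eventually_elim (rule LIMSEQ_le_const2[OF tendsto_rabs], auto)
  qed
  have L: "F k \<in> L2_space M" for k using bd[of k] wn by (intro L2_space_bound[OF w F(1)]) (auto elim!: eventually_elim2)
  have Lf: "f \<in> L2_space M" using fw wn by (intro L2_space_bound[OF w F(2)]) (auto elim!: eventually_elim2)
  have "(\<lambda>k. LINT z|M. (F k z - f z)\<^sup>2) \<longlonglongrightarrow> (LINT z|M. 0)"
  proof (rule integral_dominated_convergence[where w="\<lambda>z. 4 * (w z)\<^sup>2"])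
   show "integrable M (\<lambda>z. 4 * (w z)\<^sup>2)" using w by (auto dest: L2_spaceD)
   show "AE x in M. (\<lambda>k. (F k x - f x)\<^sup>2) \<longlonglongrightarrow> 0" using lim
   proof eventually_elim
    case (elim x)
    then have "(\<lambda>k. (F k x - f x)\<^sup>2) \<longlonglongrightarrow> (f x - f x)\<^sup>2" by (intro tendsto_intros)
    then show ?case by simp
   qed
   fix k show "AE x in M. norm ((F k x - f x)\<^sup>2) \<le> 4 * (w x)\<^sup>2" using bd[of k] fw
   proof eventually_elim
    case (elim x)
    then have "\<bar>F k x - f x\<bar> \<le> 2 * w x" by linarith
    then have "(F k x - f x)\<^sup>2 \<le> (2 * w x)\<^sup>2" by (metis abs_ge_zero power2_abs power_mono)
    then show ?case by (simp add: power_mult_distrib)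
   qed
  qed (use F in auto)
  then show ?thesis using L Lf by (simp add: l2_tends_def)
qed

text \<open>Membership of the limit is the point: this is how bounds on cut-off functions, uniform
  in the cut-off, pass to functions not yet known to be square integrable.\<close>

lemma L2_Fatou:
  assumes F: "\<And>k. F k \<in> L2_space M" and f: "f \<in> borel_measurable M" and lim: "AE x in M. (\<lambda>k. F k x) \<longlonglongrightarrow> f x"
   and b: "\<forall>\<^sub>F k in sequentially. (LINT z|M. (F k z)\<^sup>2) \<le> b"
  shows "f \<in> L2_space M" "(LINT z|M. (f z)\<^sup>2) \<le> b"
proof -
  obtain k where "(LINT z|M. (F k z)\<^sup>2) \<le> b" using b by (auto simp: eventually_sequentially)
  then have b0: "b \<ge> 0" by (rule order_trans[rotated]) simp
  have "(\<integral>\<^sup>+ z. ennreal ((f z)\<^sup>2) \<partial>M) = (\<integral>\<^sup>+ z. liminf (\<lambda>n. ennreal ((F n z)\<^sup>2)) \<partial>M)"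
  proof (rule nn_integral_cong_AE)
   show "AE z in M. ennreal ((f z)\<^sup>2) = liminf (\<lambda>n. ennreal ((F n z)\<^sup>2))" using lim
   proof eventually_elim
    case (elim z)
    then have "(\<lambda>n. ennreal ((F n z)\<^sup>2)) \<longlonglongrightarrow> ennreal ((f z)\<^sup>2)" by (intro tendsto_intros)
    then show ?case by (rule lim_imp_Liminf[OF sequentially_bot, symmetric])
   qed
  qed
  also have "\<dots> \<le> liminf (\<lambda>n. \<integral>\<^sup>+ z. ennreal ((F n z)\<^sup>2) \<partial>M)" using L2_spaceD(1)[OF F] by (intro nn_integral_liminf) auto
  also have "\<dots> \<le> ennreal b"
  proof -
   have "\<forall>\<^sub>F n in sequentially. (\<integral>\<^sup>+ z. ennreal ((F n z)\<^sup>2) \<partial>M) \<le> ennreal b" using b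
    by eventually_elim (use L2_spaceD(2)[OF F] in \<open>simp add: nn_integral_eq_integral ennreal_leI\<close>)
   then show ?thesis by (intro Liminf_le) auto
  qed
  finally have le: "(\<integral>\<^sup>+ z. ennreal ((f z)\<^sup>2) \<partial>M) \<le> ennreal b" .
  then have int: "integrable M (\<lambda>z. (f z)\<^sup>2)" using f by (intro integrableI_bounded) (auto simp: top_unique less_top[symmetric])
  then show "f \<in> L2_space M" using f by (simp add: L2_space_def)
  show "(LINT z|M. (f z)\<^sup>2) \<le> b" using le b0 nn_integral_eq_integral[OF int] by simp
qed

text \<open>The Riesz-Fischer argument for functions rather than classes: a fast subsequence
  converges almost everywhere, and Fatou in the second index turns the Cauchy condition into
  convergence in norm.\<close>

lemma L2_complete:
  assumes F: "\<And>k. F k \<in> L2_space M"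
   and C: "\<And>e. e > 0 \<Longrightarrow> \<exists>N. \<forall>m\<ge>N. \<forall>n\<ge>N. (LINT z|M. (F m z - F n z)\<^sup>2) < (e::real)"
  shows "\<exists>f. l2_tends M F f"
proof -
  have m[measurable]: "\<And>k. F k \<in> borel_measurable M" using F by (auto dest: L2_spaceD)
  \<comment> \<open>The rate \<open>(1/4)^k\<close> leaves room: the squared increments multiplied
    by \<open>2^k\<close> still have summable integrals, and finiteness of their sum at a point
    forces increments of order 2^(-k/2) there.\<close>
  have "\<forall>k::nat. \<exists>N. \<forall>m\<ge>N. \<forall>n\<ge>N. (LINT z|M. (F m z - F n z)\<^sup>2) < (1/4)^k" by (intro allI C) simp
  then obtain N where N: "\<And>k m n. m \<ge> N k \<Longrightarrow> n \<ge> N k \<Longrightarrow> (LINT z|M. (F m z - F n z)\<^sup>2) < (1/4)^(k::nat)"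
   unfolding choice_iff by blast
  \<comment> \<open>The sum dominates \<open>N k\<close>, and the added \<open>k\<close> makes
    \<open>r\<close> strictly increasing.\<close>
  define r where "r k = (\<Sum>i\<le>k. N i) + k" for k
  have rN: "r k \<ge> N k" for k unfolding r_def using member_le_sum[of k "{..k}" N] by auto
  have rS: "r (Suc k) > r k" for k by (simp add: r_def)
  then have rm: "strict_mono r" by (simp add: strict_mono_Suc_iff)
  define d where "d k z = \<bar>F (r (Suc k)) z - F (r k) z\<bar>" for k z
  have [measurable]: "d k \<in> borel_measurable M" for k unfolding d_def by measurable
  have di: "integrable M (\<lambda>z. (d k z)\<^sup>2)" "(LINT z|M. (d k z)\<^sup>2) \<le> (1/4)^k" for k
  proof -
   show "integrable M (\<lambda>z. (d k z)\<^sup>2)" unfolding d_def power2_abs by (intro L2_spaceD(2) L2_space_diff F)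
   have "r (Suc k) \<ge> N k" using rN[of k] rS[of k] by linarith
   then show "(LINT z|M. (d k z)\<^sup>2) \<le> (1/4)^k" unfolding d_def power2_abs using N[OF _ rN] by (simp add: less_imp_le)
  qed
  have "(\<integral>\<^sup>+ z. (\<Sum>k. ennreal (2^k * (d k z)\<^sup>2)) \<partial>M) = (\<Sum>k. \<integral>\<^sup>+ z. ennreal (2^k * (d k z)\<^sup>2) \<partial>M)"
   by (rule nn_integral_suminf) measurable
  also have "\<dots> \<le> (\<Sum>k. ennreal ((1/2)^k))"
  proof (rule suminf_le)
   fix k
   have "(\<integral>\<^sup>+ z. ennreal (2^k * (d k z)\<^sup>2) \<partial>M) = ennreal (2^k * (LINT z|M. (d k z)\<^sup>2))"
    using di[of k] by (subst nn_integral_eq_integral) auto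
   also have "\<dots> \<le> ennreal (2^k * (1/4)^k)" using di(2)[of k] by (intro ennreal_leI mult_left_mono) auto
   also have "2^k * (1/4)^k = (1/2::real)^k" using power_mult_distrib[of "2::real" "1/4" k] by simp
   finally show "(\<integral>\<^sup>+ z. ennreal (2^k * (d k z)\<^sup>2) \<partial>M) \<le> ennreal ((1/2)^k)" .
  qed auto
  also have "\<dots> = ennreal (\<Sum>k. (1/2)^k)" by (intro suminf_ennreal_eq) (auto intro!: summable_sums)
  also have "\<dots> < \<infinity>" by simp
  finally have "AE z in M. (\<Sum>k. ennreal (2^k * (d k z)\<^sup>2)) \<noteq> \<infinity>" by (intro nn_integral_noteq_infinite) auto
  then have conv: "AE z in M. convergent (\<lambda>k. F (r k) z)"
  proof eventually_elim
   case (elim z)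
   have sm: "summable (\<lambda>k. 2^k * (d k z)\<^sup>2)" by (rule summable_suminf_not_top) (use elim in auto)
   define S where "S = (\<Sum>k. 2^k * (d k z)\<^sup>2)"
   have S: "2^k * (d k z)\<^sup>2 \<le> S" for k unfolding S_def using sum_le_suminf[OF sm, of "{k}"] by simp
   have S0: "S \<ge> 0" using S[of 0] by (rule order_trans[rotated]) simp
   have dk: "d k z \<le> sqrt S * (1 / sqrt 2)^k" for k
   proof -
    have "(d k z)\<^sup>2 \<le> S / 2^k" using S[of k] by (simp add: field_simps)
    then have "d k z \<le> sqrt (S / 2^k)" by (rule real_le_rsqrt)
    also have "sqrt (S / 2^k) = sqrt S * (1 / sqrt 2)^k" by (simp only: real_sqrt_divide real_sqrt_power power_divide power_one) simp
    finally show ?thesis .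
   qed
   have "summable (\<lambda>k. F (r (Suc k)) z - F (r k) z)"
   proof (rule summable_comparison_test')
    show "summable (\<lambda>k. sqrt S * (1 / sqrt 2)^k)" by (intro summable_mult summable_geometric) simp
   qed (use dk in \<open>auto simp: d_def\<close>)
   then have "convergent (\<lambda>n. \<Sum>k<n. F (r (Suc k)) z - F (r k) z)" by (simp add: summable_iff_convergent)
   then have "convergent (\<lambda>n. F (r n) z - F (r 0) z)" by (simp add: sum_lessThan_telescope[of "\<lambda>k. F (r k) z"])
   then show ?case using convergent_diff_const_right_iff[of "\<lambda>n. F (r n) z"] by simp
  qed
  define f where "f z = lim (\<lambda>k. F (r k) z)" for z
  have [measurable]: "f \<in> borel_measurable M" unfolding f_def by measurable
  have lim: "AE z in M. (\<lambda>k. F (r k) z) \<longlonglongrightarrow> f z" using conv unfolding f_def convergent_LIMSEQ_iff .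
  have key: "(\<lambda>z. F m z - f z) \<in> L2_space M" "(LINT z|M. (F m z - f z)\<^sup>2) \<le> (1/4)^k" if "m \<ge> N k" for m k
  proof -
   have l: "AE z in M. (\<lambda>n. F m z - F (r n) z) \<longlonglongrightarrow> F m z - f z" using lim by eventually_elim (intro tendsto_intros)
   have e: "\<forall>\<^sub>F n in sequentially. (LINT z|M. (F m z - F (r n) z)\<^sup>2) \<le> (1/4)^k" using eventually_ge_at_top[of "N k"]
   proof eventually_elim
    case (elim n)
    have "r n \<ge> N k" using elim seq_suble[OF rm, of n] by linarith
    from N[OF that this] show ?case by simp
   qed
   have fm: "(\<lambda>z. F m z - f z) \<in> borel_measurable M" by measurable
   show "(\<lambda>z. F m z - f z) \<in> L2_space M" "(LINT z|M. (F m z - f z)\<^sup>2) \<le> (1/4)^k"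
    by (rule L2_Fatou[OF L2_space_diff[OF F F] fm l e])+
  qed
  have "(\<lambda>z. F (N 0) z - f z) \<in> L2_space M" using key(1)[of 0 "N 0"] by simp
  from L2_space_diff[OF F[of "N 0"] this] have fL: "f \<in> L2_space M" by simp
  have "(\<lambda>k. LINT z|M. (F k z - f z)\<^sup>2) \<longlonglongrightarrow> 0"
  proof (rule LIMSEQ_I)
   fix e :: real assume "e > 0"
   then obtain k where k: "(1/4::real)^k < e" using real_arch_pow_inv[of e "1/4"] by auto
   have "norm ((LINT z|M. (F n z - f z)\<^sup>2) - 0) < e" if "n \<ge> N k" for n using key(2)[OF that] k by simp
   then show "\<exists>no. \<forall>n\<ge>no. norm ((LINT z|M. (F n z - f z)\<^sup>2) - 0) < e" by blast
  qed
  then show ?thesis using F fL by (auto simp: l2_tends_def)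
qed

section \<open>Smooth functions and their partial derivatives\<close>

definition pd :: "'a::euclidean_space \<Rightarrow> ('a \<Rightarrow> real) \<Rightarrow> 'a \<Rightarrow> real" where
  "pd b \<phi> z = frechet_derivative \<phi> (at z) b"

definition smooth :: "('a::euclidean_space \<Rightarrow> real) \<Rightarrow> bool" where
  "smooth \<phi> \<longleftrightarrow> (\<forall>bs. set bs \<subseteq> Basis \<longrightarrow> iter_deriv bs \<phi> differentiable_on UNIV)"

lemma iter_deriv_Nil [simp]: "iter_deriv [] \<phi> = \<phi>" by (simp add: iter_deriv_def)

lemma iter_deriv_Cons [simp]: "iter_deriv (b # bs) \<phi> = pd b (iter_deriv bs \<phi>)" by (simp add: iter_deriv_def pd_def [abs_def])

lemma iter_deriv_snoc: "iter_deriv (bs @ [b]) \<phi> = iter_deriv bs (pd b \<phi>)" by (induction bs) auto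

text \<open>Smoothness by invariance: membership in a class of differentiable functions stable under
  partial derivatives propagates along every list of directions, so no formula for iterated
  derivatives is needed.\<close>

lemma smooth_coinduct:
  assumes "\<phi> \<in> X" "\<And>\<psi>. \<psi> \<in> X \<Longrightarrow> \<psi> differentiable_on UNIV"
   and "\<And>\<psi> b. \<psi> \<in> X \<Longrightarrow> b \<in> Basis \<Longrightarrow> pd b \<psi> \<in> X"
  shows "smooth \<phi>"
proof -
  have "\<phi> \<in> X \<Longrightarrow> set bs \<subseteq> Basis \<Longrightarrow> iter_deriv bs \<phi> \<in> X" for bs
   by (induction bs) (auto intro: assms(3))
  then show ?thesis using assms(1,2) by (auto simp: smooth_def)
qed

lemma smooth_imp_differentiable: "smooth \<phi> \<Longrightarrow> \<phi> differentiable at z"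
  unfolding smooth_def by (drule spec[of _ "[]"]) (simp add: differentiable_on_eq_differentiable_at)

lemma smooth_differentiable_on: "smooth \<phi> \<Longrightarrow> \<phi> differentiable_on UNIV"
  by (simp add: smooth_imp_differentiable differentiable_on_eq_differentiable_at)

lemma smooth_pd:
  fixes \<phi> :: "'a::euclidean_space \<Rightarrow> real"
  assumes "smooth \<phi>" "b \<in> Basis" shows "smooth (pd b \<phi>)" unfolding smooth_def
proof (intro allI impI)
  fix bs :: "'a list" assume "set bs \<subseteq> Basis"
  then have "set (bs @ [b]) \<subseteq> Basis" using assms by simp
  then have "iter_deriv (bs @ [b]) \<phi> differentiable_on UNIV" using assms(1) unfolding smooth_def by blast
  then show "iter_deriv bs (pd b \<phi>) differentiable_on UNIV" by (simp only: iter_deriv_snoc)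
qed

lemma smooth_iter_deriv: "smooth \<phi> \<Longrightarrow> set bs \<subseteq> Basis \<Longrightarrow> smooth (iter_deriv bs \<phi>)"
  by (induction bs) (auto intro: smooth_pd)

lemma smooth_continuous: "smooth \<phi> \<Longrightarrow> continuous_on UNIV \<phi>"
  by (simp add: smooth_differentiable_on differentiable_imp_continuous_on)

lemma smooth_measurable [measurable_dest]: "smooth \<phi> \<Longrightarrow> \<phi> \<in> borel_measurable borel"
  using smooth_continuous borel_measurable_continuous_onI by blast

lemma has_derivative_pd: "smooth \<phi> \<Longrightarrow> (\<phi> has_derivative (\<lambda>h. pd h \<phi> z)) (at z)"
  unfolding pd_def using frechet_derivative_works smooth_imp_differentiable by fastforce

lemma pd_eqI: "(\<phi> has_derivative D) (at z) \<Longrightarrow> pd b \<phi> z = D b" by (drule frechet_derivative_at) (simp add: pd_def)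

lemma pd_sum_Basis:
  assumes "smooth \<phi>" shows "pd h \<phi> z = (\<Sum>b\<in>Basis. (h \<bullet> b) * pd b \<phi> z)"
proof -
  interpret bounded_linear "\<lambda>h. pd h \<phi> z" using has_derivative_pd[OF assms] by (rule has_derivative_bounded_linear)
  show ?thesis by (subst euclidean_representation[of h, symmetric]) (simp add: sum scaleR)
qed

lemma pd_add: "smooth f \<Longrightarrow> smooth g \<Longrightarrow> pd b (\<lambda>z. f z + g z) = (\<lambda>z. pd b f z + pd b g z)"
  by (rule ext, rule pd_eqI) (auto intro!: has_derivative_add has_derivative_pd)

lemma pd_mult: "smooth f \<Longrightarrow> smooth g \<Longrightarrow> pd b (\<lambda>z. f z * g z) = (\<lambda>z. f z * pd b g z + pd b f z * g z)"
  by (rule ext, rule pd_eqI) (auto intro!: has_derivative_mult has_derivative_pd)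

lemma pd_const: "pd b (\<lambda>z. c) = (\<lambda>z. 0)" by (rule ext, rule pd_eqI) auto

lemma smooth_const: "smooth (\<lambda>z. c)"
proof (rule smooth_coinduct[of _ "range (\<lambda>c z. c)"])
  show "(\<lambda>z. c) \<in> range (\<lambda>c z. c)" by (rule rangeI)
qed (auto simp: pd_const)

text \<open>Differentiating a sum, product or reciprocal yields an expression of the same kind in
  the old functions and their derivatives. The generated class is thus stable under
  \<open>pd\<close>, and coinduction applies to it as a whole.\<close>

inductive_set smooth_alg :: "('a::euclidean_space \<Rightarrow> real) set" where
  base: "smooth f \<Longrightarrow> f \<in> smooth_alg"
| add: "f \<in> smooth_alg \<Longrightarrow> g \<in> smooth_alg \<Longrightarrow> (\<lambda>z. f z + g z) \<in> smooth_alg"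
| mult: "f \<in> smooth_alg \<Longrightarrow> g \<in> smooth_alg \<Longrightarrow> (\<lambda>z. f z * g z) \<in> smooth_alg"
| inv: "f \<in> smooth_alg \<Longrightarrow> (\<And>z. f z \<noteq> 0) \<Longrightarrow> (\<lambda>z. inverse (f z)) \<in> smooth_alg"

lemma smooth_alg_differentiable: "f \<in> smooth_alg \<Longrightarrow> f differentiable at z"
  by (induction rule: smooth_alg.induct) (auto intro: smooth_imp_differentiable differentiable_inverse)

lemma smooth_alg_pd: "f \<in> smooth_alg \<Longrightarrow> b \<in> Basis \<Longrightarrow> pd b f \<in> smooth_alg"
proof (induction rule: smooth_alg.induct)
  case (base f) then show ?case by (intro smooth_alg.base smooth_pd)
next
  case (add f g)
  have "pd b (\<lambda>z. f z + g z) = (\<lambda>z. pd b f z + pd b g z)" unfolding pd_def[of b f] pd_def[of b g] by (rule ext, rule pd_eqI)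
    (rule has_derivative_add frechet_derivative_works[THEN iffD1] smooth_alg_differentiable add.hyps)+
  then show ?case using smooth_alg.add[OF add.IH[OF add.prems]] by simp
next
  case (mult f g)
  have eq: "pd b (\<lambda>z. f z * g z) = (\<lambda>z. f z * pd b g z + pd b f z * g z)" unfolding pd_def[of b f] pd_def[of b g]
   by (rule ext, rule pd_eqI)
    (rule has_derivative_mult frechet_derivative_works[THEN iffD1] smooth_alg_differentiable mult.hyps)+
  show ?case unfolding eq by (rule smooth_alg.add; rule smooth_alg.mult) (rule mult)+
next
  case (inv f)
  have eq: "pd b (\<lambda>z. inverse (f z)) = (\<lambda>z. (- 1) * ((inverse (f z) * pd b f z) * inverse (f z)))" unfolding pd_def[of b f]
   by (rule ext, rule trans[OF pd_eqI[OF Deriv.has_derivative_inverse[OF inv.hyps(2)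
     frechet_derivative_works[THEN iffD1, OF smooth_alg_differentiable[OF inv.hyps(1)]]]]]) simp
  show ?case unfolding eq by (rule smooth_alg.mult[OF smooth_alg.base[OF smooth_const]], rule smooth_alg.mult, rule smooth_alg.mult)
    (rule smooth_alg.inv inv)+
qed

lemma smooth_alg_smooth: "f \<in> smooth_alg \<Longrightarrow> smooth f" by (rule smooth_coinduct[of _ smooth_alg])
   (simp_all add: smooth_alg_pd smooth_alg_differentiable differentiable_on_eq_differentiable_at)

lemma smooth_add: "smooth f \<Longrightarrow> smooth g \<Longrightarrow> smooth (\<lambda>z. f z + g z)"
  by (rule smooth_alg_smooth[OF smooth_alg.add]) (rule smooth_alg.base, assumption)+

lemma smooth_mult: "smooth f \<Longrightarrow> smooth g \<Longrightarrow> smooth (\<lambda>z. f z * g z)"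
  by (rule smooth_alg_smooth[OF smooth_alg.mult]) (rule smooth_alg.base, assumption)+

lemma smooth_inverse: "smooth f \<Longrightarrow> (\<And>z. f z \<noteq> 0) \<Longrightarrow> smooth (\<lambda>z. inverse (f z))"
  by (rule smooth_alg_smooth[OF smooth_alg.inv]) (rule smooth_alg.base, assumption)

lemma smooth_cmult: "smooth f \<Longrightarrow> smooth (\<lambda>z. c * f z)" by (rule smooth_mult[OF smooth_const])

lemma pd_cmult: "smooth g \<Longrightarrow> pd b (\<lambda>z. c * g z) = (\<lambda>z. c * pd b g z)" by (simp add: pd_mult[OF smooth_const] pd_const)

lemma smooth_diff: "smooth f \<Longrightarrow> smooth g \<Longrightarrow> smooth (\<lambda>z. f z - g z)"
  using smooth_add[OF _ smooth_cmult[of g "-1"], of f] by simp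

lemma pd_diff: "smooth f \<Longrightarrow> smooth g \<Longrightarrow> pd b (\<lambda>z. f z - g z) = (\<lambda>z. pd b f z - pd b g z)"
  using pd_add[OF _ smooth_cmult[of g "-1"], of f b] pd_cmult[of g b "-1"] by simp

lemma smooth_prod: "finite I \<Longrightarrow> (\<And>i. i \<in> I \<Longrightarrow> smooth (f i)) \<Longrightarrow> smooth (\<lambda>z. \<Prod>i\<in>I. f i z)"
  by (induction I rule: finite_induct) (auto intro: smooth_const smooth_mult)

lemma pd_affine:
  fixes \<phi> :: "'a::euclidean_space \<Rightarrow> real"
  assumes "smooth \<phi>" shows "pd b (\<lambda>z. \<phi> (r *\<^sub>R z + c)) = (\<lambda>z. r * pd b \<phi> (r *\<^sub>R z + c))"
proof (rule ext, rule pd_eqI[THEN trans])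
  fix z
  interpret bounded_linear "\<lambda>h. pd h \<phi> (r *\<^sub>R z + c)" using has_derivative_pd[OF assms] by (rule has_derivative_bounded_linear)
  show "((\<lambda>z. \<phi> (r *\<^sub>R z + c)) has_derivative (\<lambda>h. pd (r *\<^sub>R h) \<phi> (r *\<^sub>R z + c))) (at z)"
   by (rule has_derivative_compose[OF _ has_derivative_pd[OF assms]]) (auto intro!: derivative_eq_intros)
  show "pd (r *\<^sub>R b) \<phi> (r *\<^sub>R z + c) = r * pd b \<phi> (r *\<^sub>R z + c)" by (simp add: scaleR)
qed

lemma smooth_affine:
  assumes "smooth \<phi>" shows "smooth (\<lambda>z. \<phi> (r *\<^sub>R z + c))"
\<comment> \<open>The scalar \<open>k\<close> collects the factor \<open>r\<close> that each
  differentiation brings out; without it the class would not be stable.\<close>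
proof (rule smooth_coinduct[of _ "{\<lambda>z. k * \<psi> (r *\<^sub>R z + c) | k \<psi>. smooth \<psi>}"], goal_cases)
  case 1 show ?case using assms by (auto intro!: exI[of _ 1] exI[of _ \<phi>])
next
  case (2 \<psi>)
  then obtain k \<phi>' where *: "\<psi> = (\<lambda>z. k * \<phi>' (r *\<^sub>R z + c))" "smooth \<phi>'" by auto
  have "(\<lambda>z. \<phi>' (r *\<^sub>R z + c)) differentiable at z" for z
   by (rule differentiable_compose[of \<phi>']) (use * in \<open>auto intro: smooth_imp_differentiable\<close>)
  then show ?case unfolding * by (auto simp: differentiable_on_eq_differentiable_at)
next
  case (3 \<psi> b)
  then obtain k \<phi>' where *: "\<psi> = (\<lambda>z. k * \<phi>' (r *\<^sub>R z + c))" "smooth \<phi>'" by auto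
  have "pd b \<psi> = (\<lambda>z. (k * r) * pd b \<phi>' (r *\<^sub>R z + c))"
  proof (rule ext, rule pd_eqI[THEN trans])
   fix z
   interpret bounded_linear "\<lambda>h. pd h \<phi>' (r *\<^sub>R z + c)" using has_derivative_pd[OF *(2)] by (rule has_derivative_bounded_linear)
   show "(\<psi> has_derivative (\<lambda>h. k * pd (r *\<^sub>R h) \<phi>' (r *\<^sub>R z + c))) (at z)" unfolding *
    by (intro has_derivative_mult_right has_derivative_compose[OF _ has_derivative_pd[OF *(2)]])
     (auto intro!: derivative_eq_intros)
   show "k * pd (r *\<^sub>R b) \<phi>' (r *\<^sub>R z + c) = k * r * pd b \<phi>' (r *\<^sub>R z + c)" by (simp add: scaleR)
  qed
  then show ?case using 3 * by (auto intro: smooth_pd)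
qed

lemma iter_deriv_affine:
  assumes "smooth \<phi>" "set bs \<subseteq> Basis"
  shows "iter_deriv bs (\<lambda>z. \<phi> (r *\<^sub>R z + c)) = (\<lambda>z. r ^ length bs * iter_deriv bs \<phi> (r *\<^sub>R z + c))"
  using assms(2)
proof (induction bs)
  case (Cons b bs)
  have s: "smooth (iter_deriv bs \<phi>)" using assms(1) Cons by (auto intro: smooth_iter_deriv)
  show ?case using Cons by (simp add: pd_cmult[OF smooth_affine[OF s]] pd_affine[OF s] mult_ac)
qed simp

lemma has_derivative_real_pd:
  assumes "smooth (\<eta> :: real \<Rightarrow> real)" shows "(\<eta> has_real_derivative pd 1 \<eta> t) (at t)"
proof -
  have "(\<eta> has_derivative (\<lambda>h. pd h \<eta> t)) (at t)" using assms by (rule has_derivative_pd)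
  moreover have "(\<lambda>h. pd h \<eta> t) = (*) (pd 1 \<eta> t)" by (rule ext, subst pd_sum_Basis[OF assms]) (simp add: mult.commute)
  ultimately show ?thesis by (simp add: has_field_derivative_def)
qed

lemma has_derivative_ridge:
  fixes \<eta> :: "real \<Rightarrow> real" and v :: "'a::euclidean_space"
  assumes "smooth \<eta>"
  shows "((\<lambda>z. \<eta> (z \<bullet> v)) has_derivative (\<lambda>h. pd 1 \<eta> (z \<bullet> v) * (h \<bullet> v))) (at z)"
  by (rule has_derivative_compose[OF _ has_derivative_real_pd[OF assms, unfolded has_field_derivative_def]])
   (auto intro!: derivative_eq_intros)

text \<open>Each derivative along \<open>b\<close> brings out the constant
  \<open>b \<bullet> v\<close>, absorbed by the scalar \<open>k\<close> of the class. With basis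
  vectors for \<open>v\<close> this feeds the product cut-offs below.\<close>

lemma smooth_ridge:
  fixes v :: "'a::euclidean_space"
  assumes "smooth \<eta>" shows "smooth (\<lambda>z. \<eta> (z \<bullet> v))"
proof (rule smooth_coinduct[of _ "{\<lambda>z. k * \<psi> (z \<bullet> v) | k \<psi>. smooth \<psi>}"], goal_cases)
  case 1 show ?case using assms by (auto intro!: exI[of _ 1] exI[of _ \<eta>])
next
  case (2 \<psi>)
  then obtain k \<phi>' where *: "\<psi> = (\<lambda>z. k * \<phi>' (z \<bullet> v))" "smooth \<phi>'" by auto
  have "(\<lambda>z. \<phi>' (z \<bullet> v)) differentiable at z" for z using has_derivative_ridge[OF *(2)] differentiable_def by blast
  then show ?case unfolding * by (auto simp: differentiable_on_eq_differentiable_at)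
next
  case (3 \<psi> b)
  then obtain k \<phi>' where *: "\<psi> = (\<lambda>z. k * \<phi>' (z \<bullet> v))" "smooth \<phi>'" by auto
  have "pd b \<psi> = (\<lambda>z. (k * (b \<bullet> v)) * pd 1 \<phi>' (z \<bullet> v))"
   unfolding * by (rule ext, rule trans[OF pd_eqI[OF has_derivative_mult_right[OF has_derivative_ridge[OF *(2)]]]]) simp
  moreover have "smooth (pd 1 \<phi>')" using *(2) by (rule smooth_pd) simp
  ultimately show ?case by blast
qed

section \<open>Compact support, integration by parts, symmetry of second derivatives\<close>

text \<open>Schwarz's theorem, from the second-order difference along two directions.\<close>

definition csupp :: "('a::real_normed_vector \<Rightarrow> 'b::zero) \<Rightarrow> bool" where
  "csupp F \<longleftrightarrow> (\<exists>r. \<forall>z. r < norm z \<longrightarrow> F z = 0)"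

text \<open>The class in which integrability is automatic, for Lebesgue measure and for every
  continuous density; multiplying by a continuous coefficient, bounded or not, stays inside.\<close>

definition cc :: "('a::euclidean_space \<Rightarrow> real) \<Rightarrow> bool" where
  "cc F \<longleftrightarrow> continuous_on UNIV F \<and> csupp F"

lemma csuppI: "(\<And>z. r < norm z \<Longrightarrow> F z = 0) \<Longrightarrow> csupp F" by (auto simp: csupp_def)

lemma csupp_mult_left: "csupp F \<Longrightarrow> csupp (\<lambda>z. F z * (G z :: 'b::mult_zero))" by (fastforce simp: csupp_def)

lemma csupp_mult_right: "csupp G \<Longrightarrow> csupp (\<lambda>z. F z * (G z :: 'b::mult_zero))" by (fastforce simp: csupp_def)

lemma csupp_add:
  fixes F G :: "'a::real_normed_vector \<Rightarrow> real"
  assumes "csupp F" "csupp G" shows "csupp (\<lambda>z. F z + G z)"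
proof -
  obtain r s where "\<And>z. r < norm z \<Longrightarrow> F z = 0" "\<And>z. s < norm z \<Longrightarrow> G z = 0"
   using assms by (auto simp: csupp_def)
  then show ?thesis by (intro csuppI[of "max r s"]) auto
qed

lemma csupp_zero: "csupp (\<lambda>z. 0)" by (simp add: csupp_def)

lemma csupp_sum:
  fixes F :: "'i \<Rightarrow> 'a::real_normed_vector \<Rightarrow> real"
  shows "(\<And>i. i \<in> I \<Longrightarrow> csupp (F i)) \<Longrightarrow> csupp (\<lambda>z. \<Sum>i\<in>I. F i z)"
  by (induction I rule: infinite_finite_induct) (auto intro: csupp_add csupp_zero)

lemma pd_eq_0_outside:
  assumes "\<And>w. r < norm w \<Longrightarrow> \<phi> w = 0" "r < norm z" shows "pd b \<phi> z = 0"
proof -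
  have "open {w. r < norm w}" by (intro open_Collect_less continuous_intros)
  then show ?thesis by (rule pd_eqI[OF has_derivative_transform_within_open[OF has_derivative_const[of 0]]]) (use assms in auto)
qed

lemma csupp_pd: "csupp \<phi> \<Longrightarrow> csupp (pd b \<phi>)"
  unfolding csupp_def by (blast intro: pd_eq_0_outside)

lemma compact_support_iff_csupp:
  fixes \<phi> :: "'a::euclidean_space \<Rightarrow> real"
  shows "compact (closure {z. \<phi> z \<noteq> 0}) \<longleftrightarrow> csupp \<phi>"
proof -
  have "bounded {z. \<phi> z \<noteq> 0} \<longleftrightarrow> csupp \<phi>"
   unfolding bounded_iff csupp_def by (metis (mono_tags, lifting) linorder_not_le mem_Collect_eq)
  then show ?thesis by simp
qed

lemma test_function_iff: "test_function \<phi> \<longleftrightarrow> smooth \<phi> \<and> csupp \<phi>"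
  unfolding test_function_def smooth_def compact_support_iff_csupp ..

lemma test_function_pd: "test_function \<phi> \<Longrightarrow> b \<in> Basis \<Longrightarrow> test_function (pd b \<phi>)"
  by (auto simp: test_function_iff intro: smooth_pd csupp_pd)

lemma test_function_iter_deriv: "test_function \<phi> \<Longrightarrow> set bs \<subseteq> Basis \<Longrightarrow> test_function (iter_deriv bs \<phi>)"
  by (induction bs) (auto intro: test_function_pd)

lemma test_function_mult_smooth: "test_function \<phi> \<Longrightarrow> smooth \<psi> \<Longrightarrow> test_function (\<lambda>z. \<psi> z * \<phi> z)"
  by (auto simp: test_function_iff intro: smooth_mult csupp_mult_right)

lemma test_function_mult: "test_function \<phi> \<Longrightarrow> test_function \<psi> \<Longrightarrow> test_function (\<lambda>z. \<psi> z * \<phi> z)"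
  by (auto simp: test_function_iff intro: smooth_mult csupp_mult_right)

lemma test_function_cmult: "test_function \<phi> \<Longrightarrow> test_function (\<lambda>z. c * \<phi> z)"
  by (rule test_function_mult_smooth[OF _ smooth_const])

lemma test_function_diff: "test_function f \<Longrightarrow> test_function g \<Longrightarrow> test_function (\<lambda>z. f z - g z)"
  using csupp_add[of f "\<lambda>z. -1 * g z"] csupp_mult_right[of g "\<lambda>z. -1"] by (auto simp: test_function_iff intro: smooth_diff)

lemma test_function_cc: "test_function \<phi> \<Longrightarrow> cc \<phi>" by (auto simp: test_function_iff cc_def smooth_continuous)

lemma cc_mult_left: "cc F \<Longrightarrow> continuous_on UNIV G \<Longrightarrow> cc (\<lambda>z. F z * G z)"
  by (auto simp: cc_def intro: continuous_intros csupp_mult_left)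

lemma cc_mult_right: "cc F \<Longrightarrow> continuous_on UNIV G \<Longrightarrow> cc (\<lambda>z. G z * F z)"
  by (auto simp: cc_def intro: continuous_intros csupp_mult_right)

lemma cc_add: "cc F \<Longrightarrow> cc G \<Longrightarrow> cc (\<lambda>z. F z + G z)" by (auto simp: cc_def intro: continuous_intros csupp_add)

lemma cc_sum: "(\<And>i. i \<in> I \<Longrightarrow> cc (F i)) \<Longrightarrow> cc (\<lambda>z. \<Sum>i\<in>I. F i z)"
  by (auto simp: cc_def intro: continuous_on_sum csupp_sum)

lemma cc_measurable: "cc F \<Longrightarrow> F \<in> borel_measurable borel" by (auto simp: cc_def intro: borel_measurable_continuous_onI)

lemma cc_bounded:
  assumes "cc F" shows "\<exists>K>0. \<forall>z. \<bar>F z\<bar> \<le> K"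
proof -
  obtain r where r: "\<And>z. r < norm z \<Longrightarrow> F z = 0" using assms by (auto simp: cc_def csupp_def)
  have "compact (F ` cball 0 r)" using assms by (intro compact_continuous_image) (auto simp: cc_def intro: continuous_on_subset)
  then obtain K where K: "K > 0" "\<And>z. z \<in> cball 0 r \<Longrightarrow> \<bar>F z\<bar> \<le> K"
   using compact_imp_bounded bounded_pos[of "F ` cball 0 r"] by auto
  have "\<bar>F z\<bar> \<le> K" for z using K r[of z] by (cases "norm z \<le> r") auto
  then show ?thesis using K by auto
qed

lemma cc_integrable:
  assumes "cc F" shows "integrable lborel F"
proof -
  obtain r where r: "\<And>z. r < norm z \<Longrightarrow> F z = 0" using assms by (auto simp: cc_def csupp_def)
  have "integrable lborel (\<lambda>z. indicator (cball 0 r) z *\<^sub>R F z)"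
   using assms by (intro borel_integrable_compact) (auto simp: cc_def intro: continuous_on_subset)
  also have "(\<lambda>z. indicator (cball 0 r) z *\<^sub>R F z) = F" using r by (auto simp: indicator_def fun_eq_iff)
  finally show ?thesis .
qed

lemma cc_uniformly_continuous:
  assumes "cc F" "e > 0" shows "\<exists>d>0. \<forall>y z. dist y z < d \<longrightarrow> \<bar>F y - F z\<bar> < e"
proof -
  obtain r where r: "\<And>z. r < norm z \<Longrightarrow> F z = 0" using assms by (auto simp: cc_def csupp_def)
  \<comment> \<open>The margin 1 ensures that two points at distance below 1 either both lie in the
    larger ball or both lie outside the support.\<close>
  have "uniformly_continuous_on (cball 0 (r + 1)) F"
   using assms by (intro compact_uniformly_continuous) (auto simp: cc_def intro: continuous_on_subset)
  then obtain d where d: "d > 0" "\<And>y z. norm y \<le> r + 1 \<Longrightarrow> norm z \<le> r + 1 \<Longrightarrow> dist y z < d \<Longrightarrow> \<bar>F y - F z\<bar> < e"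
   using \<open>e > 0\<close> unfolding uniformly_continuous_on_def by (auto simp: dist_real_def dist_commute)
  have "\<bar>F y - F z\<bar> < e" if "dist y z < min d 1" for y z
  proof (cases "norm y \<le> r + 1 \<and> norm z \<le> r + 1")
   case True then show ?thesis using d that by auto
  next
   case False
   have "\<bar>norm y - norm z\<bar> < 1" using that norm_triangle_ineq3[of y z] by (simp add: dist_norm)
   then have "r < norm y" "r < norm z" using False by linarith+
   then have "F y = 0" "F z = 0" by (auto intro!: r)
   then show ?thesis using \<open>e > 0\<close> by simp
  qed
  then show ?thesis using d(1) by (intro exI[of _ "min d 1"]) auto
qed

lemma integrable_indicator_bounded:
  assumes "S \<in> sets borel" "bounded S"
  shows "integrable lborel (indicator S :: 'a::euclidean_space \<Rightarrow> real)"
proof (rule integrable_real_indicator)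
  show "emeasure lborel S < \<infinity>" using assms(2) by (rule emeasure_bounded_finite)
qed (use assms in simp)

text \<open>Differentiability along one direction is all that integration by parts uses. It is also
  all that is available: a product with a coefficient that is only continuous in \<open>t\<close>
  has spatial derivatives but no time derivative.\<close>

definition dirder :: "'a::euclidean_space \<Rightarrow> ('a \<Rightarrow> real) \<Rightarrow> ('a \<Rightarrow> real) \<Rightarrow> bool" where
  "dirder b F F' \<longleftrightarrow> (\<forall>z. ((\<lambda>s. F (z + s *\<^sub>R b)) has_real_derivative F' z) (at 0))"

lemma dirder_mult:
  assumes "dirder b F F'" "dirder b G G'"
  shows "dirder b (\<lambda>z. F z * G z) (\<lambda>z. F' z * G z + F z * G' z)" unfolding dirder_def
proof
  fix z
  show "((\<lambda>s. F (z + s *\<^sub>R b) * G (z + s *\<^sub>R b)) has_real_derivative F' z * G z + F z * G' z) (at 0)"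
   using assms unfolding dirder_def by (auto intro!: derivative_eq_intros)
qed

lemma dirder_line:
  assumes "dirder b F F'"
  shows "((\<lambda>s. F (z + s *\<^sub>R b)) has_real_derivative F' (z + s *\<^sub>R b)) (at s)"
proof -
  have "((\<lambda>h. F ((z + s *\<^sub>R b) + h *\<^sub>R b)) has_real_derivative F' (z + s *\<^sub>R b)) (at 0)"
   using assms by (simp add: dirder_def)
  then have "((\<lambda>h. F (z + (s + h) *\<^sub>R b)) has_real_derivative F' (z + s *\<^sub>R b)) (at 0)" by (simp add: algebra_simps)
  then show ?thesis using DERIV_shift[of "\<lambda>s. F (z + s *\<^sub>R b)" "F' (z + s *\<^sub>R b)" 0 s] by (simp add: add.commute)
qed

lemma dirder_pd: "smooth \<phi> \<Longrightarrow> dirder b \<phi> (pd b \<phi>)" unfolding dirder_def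
proof
  fix z assume s: "smooth \<phi>"
  interpret bounded_linear "\<lambda>h. pd h \<phi> z" using has_derivative_pd[OF s] by (rule has_derivative_bounded_linear)
  have "((\<lambda>s. \<phi> (z + s *\<^sub>R b)) has_derivative (\<lambda>h. pd (h *\<^sub>R b) \<phi> z)) (at 0)"
   using has_derivative_pd[OF s, of z]
   by (intro has_derivative_compose[where g=\<phi> and f="\<lambda>s. z + s *\<^sub>R b"]) (auto intro!: derivative_eq_intros)
  moreover have "(\<lambda>h. pd (h *\<^sub>R b) \<phi> z) = (*) (pd b \<phi> z)" by (rule ext) (simp add: scaleR)
  ultimately show "((\<lambda>s. \<phi> (z + s *\<^sub>R b)) has_real_derivative pd b \<phi> z) (at 0)" by (simp add: has_field_derivative_def)
qed

lemma lborel_has_bochner_integral_translate: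
  fixes F :: "'a::euclidean_space \<Rightarrow> real"
  assumes "integrable lborel F"
  shows "integrable lborel (\<lambda>z. F (z + c))" "(LINT z|lborel. F (z + c)) = (LINT z|lborel. F z)"
proof -
  have m: "F \<in> borel_measurable borel" using assms by auto
  have "integrable (distr lborel borel ((+) c)) F" using assms by (simp add: lborel_distr_plus)
  then show "integrable lborel (\<lambda>z. F (z + c))" using m by (subst (asm) integrable_distr_eq) (auto simp: add.commute)
  have "(LINT z|distr lborel borel ((+) c). F z) = (LINT z|lborel. F (c + z))" using m by (intro integral_distr) auto
  then show "(LINT z|lborel. F (z + c)) = (LINT z|lborel. F z)" by (simp add: lborel_distr_plus add.commute)
qed

text \<open>By translation invariance the integrals of the difference quotients of \<open>F\<close> vanish.\<close>

lemma has_bochner_integral_dirder: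
  assumes d: "dirder b F F'" and F: "cc F" and F': "cc F'"
  shows "has_bochner_integral lborel F' 0"
proof -
  obtain K where K: "K > 0" "\<And>z. \<bar>F' z\<bar> \<le> K" using cc_bounded[OF F'] by auto
  obtain r where r: "\<And>z. r < norm z \<Longrightarrow> F z = 0" using F by (auto simp: cc_def csupp_def)
  define q where "q n z = (F (z + (1 / real (Suc n)) *\<^sub>R b) - F z) * real (Suc n)" for n z
  \<comment> \<open>The mean value theorem bounds the quotient by \<open>K\<close>; as all steps are
    at most 1, enlarging the support by \<open>norm b\<close> gives one ball for all
    \<open>n\<close>, hence an integrable majorant.\<close>
  have q_bound: "\<bar>q n z\<bar> \<le> K * indicator (cball 0 (\<bar>r\<bar> + norm b)) z" for n z
  proof (cases "norm z \<le> \<bar>r\<bar> + norm b")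
   case True
   have "0 < 1 / real (Suc n)" by simp
   from MVT2[OF this dirder_line[OF d], of z] obtain s where
    "F (z + (1 / real (Suc n)) *\<^sub>R b) - F z = (1 / real (Suc n)) * F' (z + s *\<^sub>R b)" by auto
   then have "q n z = F' (z + s *\<^sub>R b)" by (simp add: q_def)
   then show ?thesis using K(2) True by auto
  next
   case False
   have "norm ((1 / real (Suc n)) *\<^sub>R b) \<le> norm b" using mult_right_mono[of "1 / real (Suc n)" 1 "norm b"] by (simp del: of_nat_Suc)
   moreover have "norm z \<le> norm (z + (1 / real (Suc n)) *\<^sub>R b) + norm ((1 / real (Suc n)) *\<^sub>R b)"
    by (metis add_diff_cancel_right' norm_triangle_ineq4)
   ultimately have "norm (z + (1 / real (Suc n)) *\<^sub>R b) > r" "norm z > r" using False norm_ge_zero[of b] by linarith+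
   then show ?thesis using r by (simp add: q_def K(1) less_imp_le)
  qed
  have Fm: "F \<in> borel_measurable borel" "F' \<in> borel_measurable borel" using F F' cc_measurable by auto
  have Fi: "integrable lborel F" using cc_integrable[OF F] .
  have q0: "(LINT z|lborel. q n z) = 0" for n
   unfolding q_def using lborel_has_bochner_integral_translate[OF Fi, of "(1 / real (Suc n)) *\<^sub>R b"] Fi by simp
  have "(\<lambda>n. LINT z|lborel. q n z) \<longlonglongrightarrow> (LINT z|lborel. F' z)"
  proof (rule integral_dominated_convergence[where w="\<lambda>z. K * indicator (cball 0 (\<bar>r\<bar> + norm b)) z"])
   show "integrable lborel (\<lambda>z. K * indicator (cball 0 (\<bar>r\<bar> + norm b)) z)"
    by (intro integrable_mult_right integrable_indicator_bounded) auto
   show "AE z in lborel. (\<lambda>n. q n z) \<longlonglongrightarrow> F' z"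
   proof (rule AE_I2)
    fix z
    have "((\<lambda>h. (F (z + h *\<^sub>R b) - F z) / h) \<longlongrightarrow> F' z) (at 0)"
     using d by (simp add: dirder_def has_field_derivative_iff)
    then have "(\<lambda>n. (F (z + (1 / real (Suc n)) *\<^sub>R b) - F z) / (1 / real (Suc n))) \<longlonglongrightarrow> F' z"
     by (rule filterlim_compose)
      (rule filterlim_atI[OF LIMSEQ_Suc[OF lim_1_over_n]], simp)
    then show "(\<lambda>n. q n z) \<longlonglongrightarrow> F' z" by (simp add: q_def)
   qed
   show "q n \<in> borel_measurable lborel" for n unfolding q_def using Fm by measurable
  qed (use Fm q_bound in auto)
  then have "(LINT z|lborel. F' z) = 0" unfolding q0 LIMSEQ_const_iff by (rule sym)
  then show ?thesis using cc_integrable[OF F'] by (simp add: has_bochner_integral_iff)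
qed

lemma pd_commute:
  fixes \<phi> :: "'a::euclidean_space \<Rightarrow> real"
  assumes s: "smooth \<phi>" and b: "b \<in> Basis" and c: "c \<in> Basis"
  shows "pd b (pd c \<phi>) = pd c (pd b \<phi>)"
proof (rule ext)
  fix z
  note line = dirder_line[OF dirder_pd]
  have dbl: "\<exists>w. dist w z < 2 * h \<and> \<phi> (z + h *\<^sub>R b + h *\<^sub>R c) - \<phi> (z + h *\<^sub>R b) - \<phi> (z + h *\<^sub>R c) + \<phi> z = h * h * pd c (pd b \<phi>) w"
   if h: "h > 0" and b: "b \<in> Basis" and c: "c \<in> Basis" for h b c
  proof -
   have "((\<lambda>s. \<phi> (z + s *\<^sub>R b + h *\<^sub>R c) - \<phi> (z + s *\<^sub>R b)) has_real_derivative
     pd b \<phi> (z + s *\<^sub>R b + h *\<^sub>R c) - pd b \<phi> (z + s *\<^sub>R b)) (at s)" for s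
    using line[OF s, of "z + h *\<^sub>R c" b s] line[OF s, of z b s] by (intro DERIV_diff) (simp_all add: algebra_simps)
   from MVT2[OF h this] obtain s where s': "0 < s" "s < h" and
    e1: "\<phi> (z + h *\<^sub>R b + h *\<^sub>R c) - \<phi> (z + h *\<^sub>R b) - (\<phi> (z + h *\<^sub>R c) - \<phi> z) =
    h * (pd b \<phi> (z + s *\<^sub>R b + h *\<^sub>R c) - pd b \<phi> (z + s *\<^sub>R b))" by auto
   obtain t where t: "0 < t" "t < h" and
    e2: "pd b \<phi> (z + s *\<^sub>R b + h *\<^sub>R c) - pd b \<phi> (z + s *\<^sub>R b) = h * pd c (pd b \<phi>) (z + s *\<^sub>R b + t *\<^sub>R c)"
    using MVT2[OF h line[OF smooth_pd[OF s b], of "z + s *\<^sub>R b" c]] by auto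
   have "norm (s *\<^sub>R b + t *\<^sub>R c) \<le> s + t" using norm_triangle_ineq[of "s *\<^sub>R b" "t *\<^sub>R c"] s' t b c by simp
   then have "dist (z + s *\<^sub>R b + t *\<^sub>R c) z < 2 * h" using s' t by (simp add: dist_norm)
   then show ?thesis using e1 e2 by (intro exI[of _ "z + s *\<^sub>R b + t *\<^sub>R c"]) (simp add: algebra_simps)
  qed
  let ?p = "pd c (pd b \<phi>)" and ?q = "pd b (pd c \<phi>)"
  have cont: "\<exists>d>0. \<forall>w. dist w z < d \<longrightarrow> dist (\<psi> w) (\<psi> z) < e" if "smooth \<psi>" "e > 0" for \<psi> :: "'a \<Rightarrow> real" and e
   using smooth_continuous[OF that(1)] that(2) unfolding continuous_on_iff by blast
  have sp: "smooth ?p" "smooth ?q" by (intro smooth_pd s b c)+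
  have "\<bar>?q z - ?p z\<bar> \<le> e" if e: "e > 0" for e
  proof -
   have e2: "e / 2 > 0" using e by simp
   obtain d1 where d1: "d1 > 0" "\<And>w. dist w z < d1 \<Longrightarrow> dist (?p w) (?p z) < e / 2" using cont[OF sp(1) e2] by blast
   obtain d2 where d2: "d2 > 0" "\<And>w. dist w z < d2 \<Longrightarrow> dist (?q w) (?q z) < e / 2" using cont[OF sp(2) e2] by blast
   define h where "h = min d1 d2 / 2"
   have h: "h > 0" "2 * h \<le> d1" "2 * h \<le> d2" using d1 d2 by (auto simp: h_def)
   obtain v where v: "dist v z < 2 * h" "\<phi> (z + h *\<^sub>R b + h *\<^sub>R c) - \<phi> (z + h *\<^sub>R b) - \<phi> (z + h *\<^sub>R c) + \<phi> z = h * h * ?p v" using dbl[OF h(1) b c] by blast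
   obtain w where w: "dist w z < 2 * h" "\<phi> (z + h *\<^sub>R c + h *\<^sub>R b) - \<phi> (z + h *\<^sub>R c) - \<phi> (z + h *\<^sub>R b) + \<phi> z = h * h * ?q w" using dbl[OF h(1) c b] by blast
   \<comment> \<open>The second difference is symmetric in \<open>b\<close> and \<open>c\<close>, so
     the two mixed derivatives agree at two points within \<open>2 * h\<close> of \<open>z\<close>;
     their continuity concludes.\<close>
   have "h * h * ?p v = h * h * ?q w" unfolding v(2)[symmetric] w(2)[symmetric] by (simp add: algebra_simps)
   then have "?p v = ?q w" using h(1) by simp
   then show ?thesis using d1(2)[OF order.strict_trans2[OF v(1) h(2)]] d2(2)[OF order.strict_trans2[OF w(1) h(3)]]
    unfolding dist_real_def by linarith
  qed
  then have "\<bar>?q z - ?p z\<bar> \<le> 0" by (rule field_le_epsilon[of _ 0, simplified])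
  then show "?q z = ?p z" by simp
qed

section \<open>Bump functions, cut-offs and mollifiers\<close>

text \<open>A polynomial in 1/x times the classical exp(-1/x): with y = 1/x, differentiation
  replaces p by y^2 (p - p'), so the family is closed under derivatives and smoothness at 0 needs
  only one limit.\<close>

definition flat :: "real poly \<Rightarrow> real \<Rightarrow> real" where
  "flat p x = (if x > 0 then poly p (1 / x) * exp (- (1 / x)) else 0)"

lemma tendsto_poly_exp_minus: "((\<lambda>y. poly p y * exp (- y)) \<longlongrightarrow> (0::real)) at_top"
proof -
  have "((\<lambda>y. \<Sum>i\<le>degree p. coeff p i * (y ^ i / exp y)) \<longlongrightarrow> (\<Sum>i\<le>degree p. coeff p i * 0)) at_top"
   by (intro tendsto_sum tendsto_mult tendsto_const tendsto_power_div_exp_0)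
  moreover have "(\<Sum>i\<le>degree p. coeff p i * (y ^ i / exp y)) = poly p y * exp (- y)" for y
   by (simp add: poly_altdef sum_distrib_right exp_minus divide_inverse mult.assoc)
  ultimately show ?thesis by simp
qed

lemma tendsto_flat_0: "(flat p \<longlongrightarrow> 0) (at 0)"
proof -
  have "((\<lambda>x. poly p (1 / x) * exp (- (1 / x))) \<longlongrightarrow> 0) (at_right 0)"
   using filterlim_compose[OF tendsto_poly_exp_minus filterlim_inverse_at_top_right, of p] by (simp add: inverse_eq_divide)
  then have r: "(flat p \<longlongrightarrow> 0) (at_right 0)" by (rule Lim_transform_eventually) (simp add: flat_def eventually_at_filter)
  have l: "(flat p \<longlongrightarrow> 0) (at_left 0)" by (rule tendsto_eventually) (simp add: flat_def eventually_at_filter)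
  show ?thesis using l r filterlim_at_split by blast
qed

lemma flat_has_derivative: "(flat p has_real_derivative flat ([:0, 0, 1:] * (p - pderiv p)) x) (at x)"
proof -
  consider "x > 0" | "x < 0" | "x = 0" by linarith
  then show ?thesis
  proof cases
   case 1
   have "((\<lambda>x. poly p (1 / x) * exp (- (1 / x))) has_real_derivative flat ([:0, 0, 1:] * (p - pderiv p)) x) (at x)"
    using 1 by (auto intro!: derivative_eq_intros DERIV_chain2[OF poly_DERIV]
      simp: flat_def field_simps power2_eq_square)
   then show ?thesis by (rule has_field_derivative_transform_within_open[where S="{0<..}"]) (use 1 in \<open>auto simp: flat_def\<close>)
  next
   case 2
   have "((\<lambda>x. 0) has_real_derivative flat ([:0, 0, 1:] * (p - pderiv p)) x) (at x)" using 2 by (simp add: flat_def)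
   then show ?thesis by (rule has_field_derivative_transform_within_open[where S="{..<0}"]) (use 2 in \<open>auto simp: flat_def\<close>)
  next
   case 3
   \<comment> \<open>The difference quotient at 0 is again a flat function, with the polynomial
     multiplied by its variable, so the limit already proved applies.\<close>
   have "((\<lambda>h. (flat p (0 + h) - flat p 0) / h) \<longlongrightarrow> 0) (at 0)"
    by (rule Lim_transform_eventually[OF tendsto_flat_0[of "[:0, 1:] * p"]])
     (auto simp: flat_def eventually_at_filter)
   then show ?thesis using 3 by (simp add: DERIV_def flat_def[of _ 0])
  qed
qed

lemma smooth_real_coinduct:
  fixes \<phi> :: "real \<Rightarrow> real"
  assumes "\<phi> \<in> X" "\<And>\<psi>. \<psi> \<in> X \<Longrightarrow> \<exists>\<psi>'\<in>X. \<forall>x. (\<psi> has_real_derivative \<psi>' x) (at x)"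
  shows "smooth \<phi>"
proof (rule smooth_coinduct[OF assms(1)])
  fix \<psi> assume "\<psi> \<in> X"
  then obtain \<psi>' where \<psi>': "\<psi>' \<in> X" "\<And>x. (\<psi> has_derivative (*) (\<psi>' x)) (at x)"
   using assms(2) unfolding has_field_derivative_def by blast
  then show "\<psi> differentiable_on UNIV" by (auto simp: differentiable_on_eq_differentiable_at differentiable_def)
  fix b :: real assume "b \<in> Basis"
  then have "pd b \<psi> = \<psi>'" using pd_eqI[OF \<psi>'(2)] by (auto simp: fun_eq_iff)
  then show "pd b \<psi> \<in> X" using \<psi>' by simp
qed

lemma smooth_flat: "smooth (flat p)" by (rule smooth_real_coinduct[of _ "range flat"]) (use flat_has_derivative in blast)+

text \<open>The usual smooth transition from 0 on the left of 0 to 1 on the right of 1; the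
  denominator cannot vanish because \<open>x\<close> and \<open>1 - x\<close> are never both
  nonpositive.\<close>

definition step :: "real \<Rightarrow> real" where
  "step x = flat 1 x * inverse (flat 1 x + flat 1 (1 - x))"

lemma flat_1: "flat 1 x \<ge> 0" "x > 0 \<Longrightarrow> flat 1 x > 0" "x \<le> 0 \<Longrightarrow> flat 1 x = 0" by (auto simp: flat_def)

lemma flat_1_sum_pos: "flat 1 x + flat 1 (1 - x) > 0" using flat_1(1)[of x] flat_1(1)[of "1 - x"] flat_1(2)[of x] flat_1(2)[of "1 - x"] by linarith

lemma smooth_step: "smooth step"
proof -
  have s: "smooth (\<lambda>x. flat 1 (1 - x))" using smooth_affine[OF smooth_flat, of 1 "-1" 1] by simp
  have "flat 1 x + flat 1 (1 - x) \<noteq> 0" for x using flat_1_sum_pos[of x] by simp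
  then have "smooth (\<lambda>x. inverse (flat 1 x + flat 1 (1 - x)))" by (rule smooth_inverse[OF smooth_add[OF smooth_flat s]])
  then show ?thesis unfolding step_def by (rule smooth_mult[OF smooth_flat])
qed

lemma step_simps: "0 \<le> step x" "step x \<le> 1" "x \<le> 0 \<Longrightarrow> step x = 0" "x \<ge> 1 \<Longrightarrow> step x = 1"
proof -
  show "0 \<le> step x" "step x \<le> 1" using flat_1_sum_pos[of x] flat_1(1)[of x] flat_1(1)[of "1 - x"] by (simp_all add: step_def field_simps)
  show "x \<le> 0 \<Longrightarrow> step x = 0" by (simp add: step_def flat_1)
  assume "x \<ge> 1"
  then have "flat 1 (1 - x) = 0" "flat 1 x \<noteq> 0" using flat_1(2)[of x] flat_1(3)[of "1 - x"] by auto
  then show "step x = 1" by (simp add: step_def)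
qed

definition plateau :: "real \<Rightarrow> real" where
  "plateau x = step (2 - x) * step (2 + x)"

lemma smooth_plateau: "smooth plateau"
proof -
  have "smooth (\<lambda>x. step (2 - x))" using smooth_affine[OF smooth_step, of "-1" 2] by simp
  moreover have "smooth (\<lambda>x. step (2 + x))" using smooth_affine[OF smooth_step, of 1 2] by (simp add: add.commute)
  ultimately show ?thesis unfolding plateau_def [abs_def] by (rule smooth_mult)
qed

lemma plateau_simps:
  "0 \<le> plateau x" "plateau x \<le> 1" "\<bar>x\<bar> \<le> 1 \<Longrightarrow> plateau x = 1" "2 \<le> \<bar>x\<bar> \<Longrightarrow> plateau x = 0"
proof -
  show "0 \<le> plateau x" "plateau x \<le> 1" using step_simps(1,2) by (auto simp: plateau_def mult_le_one)
  show "\<bar>x\<bar> \<le> 1 \<Longrightarrow> plateau x = 1" by (simp add: plateau_def step_simps(4))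
  assume "2 \<le> \<bar>x\<bar>"
  then have "2 - x \<le> 0 \<or> 2 + x \<le> 0" by linarith
  then show "plateau x = 0" by (auto simp: plateau_def step_simps(3))
qed

text \<open>A product over coordinates instead of a function of the norm, so that smoothness follows
  from one-dimensional pieces. It is 1 on the unit ball and lives in a cube of half-width 2, which
  the l1 bound on the norm places in a ball of radius 2 times the dimension.\<close>

definition cutoff :: "'a::euclidean_space \<Rightarrow> real" where
  "cutoff z = (\<Prod>b\<in>Basis. plateau (z \<bullet> b))"

lemma cutoff_nonneg: "0 \<le> cutoff z" and cutoff_le_1: "cutoff z \<le> 1" by (auto simp: cutoff_def plateau_simps intro: prod_nonneg prod_le_1)

lemma cutoff_eq_1: "norm z \<le> 1 \<Longrightarrow> cutoff z = 1"
  unfolding cutoff_def by (rule prod.neutral) (meson Basis_le_norm order_trans plateau_simps(3))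

lemma cutoff_eq_0:
  fixes z :: "'a::euclidean_space"
  assumes "2 * DIM('a) < norm z" shows "cutoff z = 0"
proof -
  have "\<exists>b\<in>Basis. 2 \<le> \<bar>z \<bullet> b\<bar>"
  proof (rule ccontr)
   assume "\<not> (\<exists>b\<in>Basis. 2 \<le> \<bar>z \<bullet> b\<bar>)"
   then have "(\<Sum>b\<in>Basis. \<bar>z \<bullet> b\<bar>) \<le> (\<Sum>b\<in>(Basis::'a set). 2)" by (intro sum_mono) force
   then show False using assms norm_le_l1[of z] by simp
  qed
  then show ?thesis unfolding cutoff_def using plateau_simps(4) by (meson finite_Basis prod_zero)
qed

lemma test_function_cutoff: "test_function (cutoff :: 'a::euclidean_space \<Rightarrow> real)" unfolding test_function_iff
proof
  show "smooth (cutoff :: 'a \<Rightarrow> real)" unfolding cutoff_def[abs_def] by (intro smooth_prod finite_Basis smooth_ridge smooth_plateau)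
  show "csupp (cutoff :: 'a \<Rightarrow> real)" by (rule csuppI[OF cutoff_eq_0])
qed

lemma test_function_affine:
  assumes "test_function \<phi>" "r \<noteq> 0" shows "test_function (\<lambda>z. \<phi> (r *\<^sub>R z + c))"
proof -
  obtain s where s: "\<And>z. s < norm z \<Longrightarrow> \<phi> z = 0" using assms(1) by (auto simp: test_function_iff csupp_def)
  have "csupp (\<lambda>z. \<phi> (r *\<^sub>R z + c))"
  proof (rule csuppI[of "(s + norm c) / \<bar>r\<bar>"])
   fix z assume "(s + norm c) / \<bar>r\<bar> < norm (z::'a)"
   then have "s + norm c < norm (r *\<^sub>R z)" using assms(2) by (simp add: field_simps)
   also have "\<dots> \<le> norm (r *\<^sub>R z + c) + norm c" by (metis add_diff_cancel_right' norm_triangle_ineq4)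
   finally show "\<phi> (r *\<^sub>R z + c) = 0" by (intro s) simp
  qed
  then show ?thesis using assms smooth_affine by (auto simp: test_function_iff)
qed

text \<open>The scaled bump is normalised by its own integral, so total mass 1 holds without a
  change of variables; the radius of the support is of order 1/(k+1).\<close>

definition moll :: "nat \<Rightarrow> 'a::euclidean_space \<Rightarrow> real" where
  "moll k z = cutoff (real (Suc k) *\<^sub>R z) / (LINT y|lborel. cutoff (real (Suc k) *\<^sub>R (y::'a)))"

lemma test_function_scaled_cutoff: "r \<noteq> 0 \<Longrightarrow> test_function (\<lambda>z. cutoff (r *\<^sub>R z))"
  using test_function_affine[OF test_function_cutoff, of r 0] by simp

lemma moll_integral_pos: "(LINT y|lborel. cutoff (real (Suc k) *\<^sub>R (y::'a::euclidean_space))) > 0"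
proof -
  let ?B = "ball 0 (1 / real (Suc k)) :: 'a set"
  have "0 < measure lborel ?B" by (rule content_ball_pos) simp
  also have "\<dots> = (LINT y|lborel. indicator ?B y)" by simp
  also have "\<dots> \<le> (LINT y|lborel. cutoff (real (Suc k) *\<^sub>R (y::'a)))"
  proof (rule integral_mono)
   show "integrable lborel (indicator ?B :: 'a \<Rightarrow> real)" by (intro integrable_indicator_bounded) auto
   show "integrable lborel (\<lambda>y. cutoff (real (Suc k) *\<^sub>R (y::'a)))"
    by (intro cc_integrable test_function_cc test_function_scaled_cutoff) simp
   show "indicator ?B y \<le> cutoff (real (Suc k) *\<^sub>R y)" for y
   proof (cases "y \<in> ?B")
    case True
    then have "norm (real (Suc k) *\<^sub>R y) \<le> 1" by (simp add: field_simps del: of_nat_Suc)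
    then show ?thesis using True by (simp add: cutoff_eq_1 del: of_nat_Suc)
   qed (simp add: cutoff_nonneg)
  qed
  finally show ?thesis .
qed

lemma test_function_moll: "test_function (moll k)"
  using test_function_cmult[OF test_function_scaled_cutoff[of "real (Suc k)"], of "1 / (LINT y|lborel. cutoff (real (Suc k) *\<^sub>R (y::'a)))"]
  by (simp add: moll_def[abs_def])

lemma moll_nonneg: "0 \<le> moll k z" using moll_integral_pos[of k, where 'a='a] by (simp add: moll_def cutoff_nonneg less_imp_le del: of_nat_Suc)

lemma moll_eq_0:
  fixes z :: "'a::euclidean_space"
  assumes "2 * DIM('a) / real (Suc k) < norm z" shows "moll k z = 0"
proof -
  have "2 * DIM('a) < norm (real (Suc k) *\<^sub>R z)" using assms by (simp add: field_simps del: of_nat_Suc)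
  then show ?thesis by (simp add: moll_def cutoff_eq_0 del: of_nat_Suc)
qed

lemma integral_moll: "(LINT z|lborel. moll k (z::'a::euclidean_space)) = 1"
  using moll_integral_pos[of k, where 'a='a] by (simp add: moll_def del: of_nat_Suc)

section \<open>Convolution with test functions\<close>

definition conv :: "('a::euclidean_space \<Rightarrow> real) \<Rightarrow> ('a \<Rightarrow> real) \<Rightarrow> 'a \<Rightarrow> real" where
  "conv v K z = (LINT y|lborel. v y * K (z - y))"

lemma cc_reflect:
  fixes K :: "'a::euclidean_space \<Rightarrow> real"
  assumes "cc K" shows "cc (\<lambda>y. K (z - y))"
proof -
  obtain s where s: "\<And>z. s < norm z \<Longrightarrow> K z = 0" using assms by (auto simp: cc_def csupp_def)
  have "csupp (\<lambda>y. K (z - y))"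
  proof (rule csuppI[of "s + norm z"])
   fix y :: 'a assume "s + norm z < norm y"
   moreover have "norm y \<le> norm (z - y) + norm z" by (metis norm_triangle_sub norm_minus_commute add.commute)
   ultimately show "K (z - y) = 0" by (intro s) linarith
  qed
  moreover have "continuous_on UNIV (\<lambda>y. K (z - y))"
   by (rule continuous_on_compose2[where t=UNIV and g=K]) (use assms in \<open>auto simp: cc_def intro!: continuous_intros\<close>)
  ultimately show ?thesis by (simp add: cc_def)
qed

lemma integrable_mult_cc:
  assumes "integrable M v" "cc K" and p: "p \<in> borel_measurable M" shows "integrable M (\<lambda>y. v y * K (p y))"
proof -
  obtain C where C: "\<And>z. \<bar>K z\<bar> \<le> C" using cc_bounded[OF assms(2)] by auto
  have m: "(\<lambda>y. K (p y)) \<in> borel_measurable M" using p cc_measurable[OF assms(2)] by (rule measurable_compose)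
  show ?thesis
  proof (rule Bochner_Integration.integrable_bound[where f="\<lambda>y. C * \<bar>v y\<bar>"])
   show "(\<lambda>y. v y * K (p y)) \<in> borel_measurable M" using assms(1) m by measurable
   show "AE y in M. norm (v y * K (p y)) \<le> norm (C * \<bar>v y\<bar>)"
   proof (rule AE_I2)
    fix y
    have "C \<ge> 0" using C[of "p y"] by linarith
    then show "norm (v y * K (p y)) \<le> norm (C * \<bar>v y\<bar>)"
     using mult_left_mono[OF C[of "p y"] abs_ge_zero[of "v y"]] by (simp add: abs_mult mult.commute)
   qed
  qed (use assms in auto)
qed

lemma integrable_conv: "integrable lborel v \<Longrightarrow> cc K \<Longrightarrow> integrable lborel (\<lambda>y. v y * K (z - y))"
  by (rule integrable_mult_cc) auto

text \<open>The remainder is uniform in \<open>z\<close> because the partial derivatives are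
  uniformly continuous; this uniformity is what allows differentiation under an integral
  sign.\<close>

lemma test_function_linearization:
  fixes K :: "'a::euclidean_space \<Rightarrow> real"
  assumes "test_function K" "e > 0"
  shows "\<exists>d>0. \<forall>z h. norm h < d \<longrightarrow> abs (K (z + h) - K z - (\<Sum>b\<in>Basis. (h \<bullet> b) * pd b K z)) \<le> e * norm h"
proof -
  have sm: "smooth K" using assms by (simp add: test_function_iff)
  \<comment> \<open>The error is divided equally among the coordinates of the gradient.\<close>
  define e' where "e' = e / DIM('a)"
  have e': "e' > 0" using assms by (simp add: e'_def)
  have "\<forall>b\<in>Basis. \<exists>d>0. \<forall>y z. dist y z < d \<longrightarrow> abs (pd b K y - pd b K z) < e'"
   using assms(1) e' by (auto intro!: cc_uniformly_continuous test_function_cc test_function_pd)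
  then obtain d where d: "\<And>b. b \<in> Basis \<Longrightarrow> d b > 0"
   "\<And>b y z. b \<in> Basis \<Longrightarrow> dist y z < d b \<Longrightarrow> abs (pd b K y - pd b K z) < e'"
   using bchoice[of Basis "\<lambda>b d. d > 0 \<and> (\<forall>y z. dist y z < d \<longrightarrow> abs (pd b K y - pd b K z) < e')"] by blast
  define d0 where "d0 = Min (d ` Basis)"
  have d0: "d0 > 0" "\<And>b. b \<in> Basis \<Longrightarrow> d0 \<le> d b" unfolding d0_def using d(1) by auto
  have "abs (K (z + h) - K z - (\<Sum>b\<in>Basis. (h \<bullet> b) * pd b K z)) \<le> e * norm h" if "norm h < d0" for z h
  proof -
   obtain s where s: "0 < s" "s < 1" "K (z + 1 *\<^sub>R h) - K (z + 0 *\<^sub>R h) = (1 - 0) * pd h K (z + s *\<^sub>R h)"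
    using MVT2[OF zero_less_one dirder_line[OF dirder_pd[OF sm]], of z h] by auto
   have eq: "K (z + h) - K z - (\<Sum>b\<in>Basis. (h \<bullet> b) * pd b K z) =
     (\<Sum>b\<in>Basis. (h \<bullet> b) * (pd b K (z + s *\<^sub>R h) - pd b K z))"
    using s(3) pd_sum_Basis[OF sm, of h "z + s *\<^sub>R h"] by (simp add: right_diff_distrib sum_subtractf)
   have "abs (K (z + h) - K z - (\<Sum>b\<in>Basis. (h \<bullet> b) * pd b K z))
     \<le> (\<Sum>b\<in>Basis. abs ((h \<bullet> b) * (pd b K (z + s *\<^sub>R h) - pd b K z)))" unfolding eq by (rule sum_abs)
   also have "\<dots> \<le> (\<Sum>b\<in>(Basis::'a set). norm h * e')"
   proof (rule sum_mono)
    fix b :: 'a assume b: "b \<in> Basis"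
    have "norm (s *\<^sub>R h) \<le> norm h" using s mult_right_mono[of s 1 "norm h"] by simp
    then have "dist (z + s *\<^sub>R h) z < d b" using that d0(2)[OF b] by (simp add: dist_norm)
    from d(2)[OF b this] show "abs ((h \<bullet> b) * (pd b K (z + s *\<^sub>R h) - pd b K z)) \<le> norm h * e'"
     unfolding abs_mult by (intro mult_mono Basis_le_norm b) auto
   qed
   also have "\<dots> = e * norm h" by (simp add: e'_def)
   finally show ?thesis .
  qed
  then show ?thesis using d0(1) by blast
qed

text \<open>Stated for an arbitrary measure and an arbitrary measurable shift \<open>p\<close> so as
  to serve twice: \<open>p y = y\<close> gives convolution in space-time,
  \<open>p x = (0, x)\<close> gives convolution in space alone.\<close>

lemma translates_has_derivative:
  assumes K: "test_function K" and v: "integrable M v" and p: "p \<in> borel_measurable M"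
  defines "cv \<equiv> (\<lambda>K z. LINT y|M. v y * K (z - p y))"
  shows "(cv K has_derivative (\<lambda>h. \<Sum>b\<in>Basis. (h \<bullet> b) * cv (pd b K) z)) (at z)" unfolding has_derivative_at_alt
proof (intro conjI allI impI)
  show "bounded_linear (\<lambda>h. \<Sum>b\<in>Basis. (h \<bullet> b) * cv (pd b K) z)"
   by (intro bounded_linear_sum bounded_linear_mult_const bounded_linear_inner_left)
  fix e :: real assume "e > 0"
  define I where "I = (LINT y|M. abs (v y))"
  have I: "I \<ge> 0" by (simp add: I_def)
  \<comment> \<open>\<open>I + 1\<close> replaces \<open>I\<close>, which is 0 when \<open>v\<close>
    vanishes almost everywhere.\<close>
  have "e / (I + 1) > 0" using \<open>e > 0\<close> I by simp
  from test_function_linearization[OF K this] obtain d where d: "d > 0"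
   "\<forall>z h. norm h < d \<longrightarrow> abs (K (z + h) - K z - (\<Sum>b\<in>Basis. (h \<bullet> b) * pd b K z)) \<le> e / (I + 1) * norm h"
   by (elim exE conjE) (rule that; assumption)
  have int: "integrable M (\<lambda>y. v y * L (z - p y))" if "test_function L" for L z
   by (rule integrable_mult_cc[OF v test_function_cc[OF that]]) (use p in measurable)
  have "norm (cv K w - cv K z - (\<Sum>b\<in>Basis. ((w - z) \<bullet> b) * cv (pd b K) z)) \<le> e * norm (w - z)"
   if w: "norm (w - z) < d" for w
  proof -
   let ?h = "w - z"
   let ?R = "\<lambda>y. K (w - p y) - K (z - p y) - (\<Sum>b\<in>Basis. (?h \<bullet> b) * pd b K (z - p y))"
   have "cv K w - cv K z - (\<Sum>b\<in>Basis. (?h \<bullet> b) * cv (pd b K) z) =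
    (LINT y|M. v y * K (w - p y)) - (LINT y|M. v y * K (z - p y))
    - (\<Sum>b\<in>Basis. LINT y|M. (?h \<bullet> b) * (v y * pd b K (z - p y)))" by (simp add: cv_def)
   also have "\<dots> = (LINT y|M. v y * K (w - p y) - v y * K (z - p y) - (\<Sum>b\<in>Basis. (?h \<bullet> b) * (v y * pd b K (z - p y))))"
   proof -
    have i: "integrable M (\<lambda>y. v y * K (w - p y))" "integrable M (\<lambda>y. v y * K (z - p y))" by (rule int[OF K])+
    have ib: "integrable M (\<lambda>y. (?h \<bullet> b) * (v y * pd b K (z - p y)))" if "b \<in> Basis" for b
     by (rule integrable_mult_right, rule int[OF test_function_pd[OF K that]])
    show ?thesis by (simp only: Bochner_Integration.integral_diff[OF Bochner_Integration.integrable_diff[OF i]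
       Bochner_Integration.integrable_sum[OF ib]] Bochner_Integration.integral_diff[OF i]
       Bochner_Integration.integral_sum[OF ib])
   qed
   also have "\<dots> = (LINT y|M. v y * ?R y)"
    by (rule Bochner_Integration.integral_cong) (simp_all only: right_diff_distrib sum_distrib_left mult.left_commute)
   finally have eq: "cv K w - cv K z - (\<Sum>b\<in>Basis. (?h \<bullet> b) * cv (pd b K) z) = (LINT y|M. v y * ?R y)" .
   have "abs (cv K w - cv K z - (\<Sum>b\<in>Basis. (?h \<bullet> b) * cv (pd b K) z)) \<le> (LINT y|M. abs (v y * ?R y))"
    unfolding eq using integral_norm_bound[of M "\<lambda>y. v y * ?R y"] unfolding real_norm_def .
   also have "\<dots> \<le> (LINT y|M. (e / (I + 1) * norm ?h) * abs (v y))"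
   proof (rule integral_mono')
    show "integrable M (\<lambda>y. (e / (I + 1) * norm ?h) * abs (v y))" using v by simp
    fix y
    have "z - p y + ?h = w - p y" by simp
    then have "abs (?R y) \<le> e / (I + 1) * norm ?h" using d(2)[rule_format, OF w, of "z - p y"] by (simp only:)
    then show "abs (v y * ?R y) \<le> (e / (I + 1) * norm ?h) * abs (v y)"
     unfolding abs_mult[of "v y"] mult.commute[of "abs (v y)"] by (rule mult_right_mono) simp
   qed (use \<open>e > 0\<close> I in simp_all)
   also have "\<dots> = e / (I + 1) * norm ?h * I" by (simp add: I_def)
   also have "\<dots> \<le> e * norm ?h"
   proof -
    have "e / (I + 1) * I \<le> e" using I \<open>e > 0\<close> by (simp add: field_simps)
    from mult_right_mono[OF this norm_ge_zero[of ?h]] show ?thesis by (simp only: mult_ac)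
   qed
   finally show ?thesis unfolding real_norm_def .
  qed
  then show "\<exists>d>0. \<forall>w. norm (w - z) < d \<longrightarrow>
    norm (cv K w - cv K z - (\<Sum>b\<in>Basis. ((w - z) \<bullet> b) * cv (pd b K) z)) \<le> e * norm (w - z)" using d(1) by blast
qed

lemma conv_has_derivative:
  assumes "test_function K" "integrable lborel v"
  shows "(conv v K has_derivative (\<lambda>h. \<Sum>b\<in>Basis. (h \<bullet> b) * conv v (pd b K) z)) (at z)"
  using translates_has_derivative[OF assms, of "\<lambda>y. y" z] by (simp add: conv_def[abs_def])

lemma basis_expansion:
  fixes b :: "'a::euclidean_space" and F :: "'a \<Rightarrow> real"
  assumes "b \<in> Basis" shows "(\<Sum>c\<in>Basis. (b \<bullet> c) * F c) = F b"
proof -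
  have "(\<Sum>c\<in>Basis. (b \<bullet> c) * F c) = (\<Sum>c\<in>Basis. if c = b then F b else 0)" by (rule sum.cong) (use assms in \<open>auto simp: inner_Basis\<close>)
  then show ?thesis using assms by simp
qed

lemma pd_conv:
  assumes "test_function K" "integrable lborel v" "b \<in> Basis"
  shows "pd b (conv v K) = conv v (pd b K)"
  by (rule ext) (rule pd_eqI[OF conv_has_derivative[OF assms(1,2)], of b, unfolded basis_expansion[OF assms(3)]])

lemma smooth_conv:
  assumes "test_function K" "integrable lborel v" shows "smooth (conv v K)"
proof (rule smooth_coinduct[of _ "{conv v K | K. test_function K}"])
  fix \<psi> assume "\<psi> \<in> {conv v K | K. test_function K}"
  then obtain L where L: "\<psi> = conv v L" "test_function L" by auto
  show "\<psi> differentiable_on UNIV" unfolding L differentiable_on_eq_differentiable_at[OF open_UNIV]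
   using conv_has_derivative[OF L(2) assms(2)] differentiable_def by blast
  fix b :: 'a assume b: "b \<in> Basis"
  show "pd b \<psi> \<in> {conv v K | K. test_function K}" unfolding L pd_conv[OF L(2) assms(2) b] using test_function_pd[OF L(2) b] by blast
qed (use assms in blast)

lemma iter_deriv_conv:
  assumes "test_function K" "integrable lborel v" "set bs \<subseteq> Basis"
  shows "iter_deriv bs (conv v K) = conv v (iter_deriv bs K)" using assms(3)
proof (induction bs)
  case (Cons b bs)
  then have "test_function (iter_deriv bs K)" using assms(1) by (intro test_function_iter_deriv) auto
  then show ?case using Cons pd_conv[OF _ assms(2)] by simp
qed simp

lemma conv_eq_0:
  assumes "\<And>y. r < norm y \<Longrightarrow> v y = 0" "\<And>y. s < norm y \<Longrightarrow> K y = 0" "r + s < norm z"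
  shows "conv v K z = 0"
proof -
  have "v y * K (z - y) = 0" for y
  proof (cases "r < norm y")
   case False
   then have "s < norm (z - y)" using assms(3) norm_triangle_sub[of z y] by linarith
   then show ?thesis using assms(2) by simp
  qed (use assms(1) in simp)
  then show ?thesis unfolding conv_def by (simp only: Bochner_Integration.integral_zero)
qed

lemma test_function_conv:
  assumes "test_function K" "integrable lborel v" "csupp v" shows "test_function (conv v K)"
proof -
  obtain r where r: "\<And>y. r < norm y \<Longrightarrow> v y = 0" using assms(3) by (auto simp: csupp_def)
  obtain s where s: "\<And>y. s < norm y \<Longrightarrow> K y = 0" using assms(1) by (auto simp: test_function_iff csupp_def)
  have "csupp (conv v K)" by (rule csuppI[of "r + s"]) (rule conv_eq_0[OF r s])
  then show ?thesis using smooth_conv[OF assms(1,2)] by (simp add: test_function_iff)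
qed

text \<open>The weak derivative is tested with the reflected kernel. Reflection contributes the sign
  (-1) to the number of derivatives, exactly the sign in the definition, and the two cancel. Weak
  derivatives thus pass through mollification unchanged.\<close>

lemma is_weak_deriv_conv:
  assumes "is_weak_deriv bs v w" "integrable lborel v" "test_function K" "set bs \<subseteq> Basis"
  shows "iter_deriv bs (conv v K) = conv w K"
proof (rule ext)
  fix z
  have sK: "smooth K" using assms(3) by (simp add: test_function_iff)
  have t: "test_function (\<lambda>y. K ((-1) *\<^sub>R y + z))" by (rule test_function_affine[OF assms(3)]) simp
  have "iter_deriv bs (conv v K) z = (LINT y|lborel. v y * iter_deriv bs K (z - y))" by (simp add: iter_deriv_conv[OF assms(3,2,4)] conv_def)
  also have "\<dots> = (- 1) ^ length bs * (LINT y|lborel. v y * ((- 1) ^ length bs * iter_deriv bs K ((-1) *\<^sub>R y + z)))"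
   by (subst integral_mult_right_zero[symmetric]) (simp add: mult_ac flip: power_add mult_2 power_mult_distrib)
  also have "\<dots> = (- 1) ^ length bs * ((- 1) ^ length bs * (LINT y|lborel. w y * K ((-1) *\<^sub>R y + z)))"
  proof -
   have "(LINT y|lborel. v y * iter_deriv bs (\<lambda>y. K ((-1) *\<^sub>R y + z)) y)
     = (- 1) ^ length bs * (LINT y|lborel. w y * K ((-1) *\<^sub>R y + z))" using assms(1) t unfolding is_weak_deriv_def by blast
   then show ?thesis by (simp only: iter_deriv_affine[OF sK assms(4)])
  qed
  also have "\<dots> = conv w K z" by (simp add: conv_def flip: power_add mult_2 power_mult_distrib mult.assoc)
  finally show "iter_deriv bs (conv v K) z = conv w K z" .
qed

section \<open>Density of continuous functions and convergence of mollifications\<close>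

lemma cc_L2_space: "cc g \<Longrightarrow> g \<in> L2_space lborel" using cc_integrable[OF cc_mult_left[of g g]] cc_measurable[of g]
  by (auto simp: L2_space_def power2_eq_square cc_def)

text \<open>Urysohn's lemma between a closed set inside and an open set outside, both within e/3 of
  \<open>E\<close> in measure; the squared error is at most 1 and lives on the gap between them. The
  bounds and the common support are recorded for later dominated convergence.\<close>

lemma indicator_approx:
  fixes E :: "'a::euclidean_space set"
  assumes E: "E \<in> sets borel" "E \<subseteq> cball 0 r" and e: "e > 0"
  shows "\<exists>g. cc g \<and> (\<forall>z. 0 \<le> g z \<and> g z \<le> 1) \<and> (\<forall>z. r + 1 < norm z \<longrightarrow> g z = 0) \<and>
   (LINT z|lborel. (indicator E z - g z)\<^sup>2) < e"
proof -
  have EL: "E \<in> sets lebesgue" using E by auto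
  have e3: "e / 3 > 0" using e by simp
  obtain T where T: "closed T" "T \<subseteq> E" "emeasure lebesgue (E - T) < ennreal (e/3)"
   by (rule sets_lebesgue_inner_closed[OF EL e3]) (rule that; assumption)
  obtain V where V: "open V" "E \<subseteq> V" "emeasure lebesgue (V - E) < ennreal (e/3)"
   by (rule sets_lebesgue_outer_open[OF EL e3]) (rule that; assumption)
  \<comment> \<open>Intersecting with a slightly larger ball makes the separating function compactly
    supported.\<close>
  define W where "W = V \<inter> ball 0 (r + 1)"
  have W: "open W" "E \<subseteq> W" using V E(2) by (auto simp: W_def)
  have "T \<inter> - W = {}" using T W by auto
  moreover have "closedin (top_of_set UNIV) T" "closedin (top_of_set UNIV) (- W)" using T W by auto
  ultimately obtain g :: "'a \<Rightarrow> real" where g: "continuous_on UNIV g" "\<And>x. g x \<in> closed_segment 1 0"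
   "\<And>x. x \<in> T \<Longrightarrow> g x = 1" "\<And>x. x \<in> - W \<Longrightarrow> g x = 0"
   using Urysohn_local[of UNIV T "- W" "1::real" 0] by (metis UNIV_I)
  have g01: "0 \<le> g z" "g z \<le> 1" for z using g(2)[of z] by (auto simp: closed_segment_eq_real_ivl)
  have g0: "g z = 0" if "r + 1 < norm z" for z using that by (intro g(4)) (auto simp: W_def)
  have ccg: "cc g" using g(1) g0 by (auto simp: cc_def intro!: csuppI[of "r + 1"])
  let ?D = "(V - E) \<union> (E - T)"
  have sets: "V - E \<in> sets borel" "E - T \<in> sets borel" using E T V by auto
  have "emeasure lborel ?D \<le> emeasure lborel (V - E) + emeasure lborel (E - T)" using sets by (intro emeasure_subadditive) auto
  also have "\<dots> = emeasure lebesgue (V - E) + emeasure lebesgue (E - T)" using sets by simp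
  also have "\<dots> \<le> ennreal (e/3) + ennreal (e/3)" using T(3) V(3) by (intro add_mono) auto
  also have "\<dots> = ennreal (2 * e / 3)" using e by (simp flip: ennreal_plus)
  finally have D: "emeasure lborel ?D \<le> ennreal (2 * e / 3)" .
  have Dm: "measure lborel ?D \<le> 2 * e / 3" unfolding measure_def using enn2real_mono[OF D] e by simp
  have "(LINT z|lborel. (indicator E z - g z)\<^sup>2) \<le> (LINT z|lborel. indicator ?D z)"
  proof (rule integral_mono')
   show "integrable lborel (indicator ?D :: 'a \<Rightarrow> real)"
    using D sets by (intro integrable_real_indicator) (auto intro: le_less_trans simp: ennreal_less_top)
   fix z
   show "(indicator E z - g z)\<^sup>2 \<le> indicator ?D z"
   proof (cases "z \<in> ?D")
    case True
    have "abs (indicator E z - g z) \<le> 1" using g01[of z] by (auto simp: indicator_def)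
    then have "(indicator E z - g z)\<^sup>2 \<le> 1" by (simp add: abs_square_le_1)
    then show ?thesis using True by simp
   next
    case False
    then have "z \<in> T \<or> z \<notin> V" using T V by auto
    then have "indicator E z - g z = 0" using T(2) V(2) g(3)[of z] g(4)[of z] by (auto simp: indicator_def W_def)
    then show ?thesis by simp
   qed
  qed simp
  also have "\<dots> = measure lborel ?D" by simp
  also have "\<dots> < e" using Dm e by simp
  finally show ?thesis using ccg g01 g0 by blast
qed

text \<open>Being approximable is stable under sums and under limits in the mean, which reduces
  density of C_c to indicators of bounded Borel sets.\<close>

definition cc_approx :: "('a::euclidean_space \<Rightarrow> real) \<Rightarrow> bool" where
  "cc_approx w \<longleftrightarrow> w \<in> L2_space lborel \<and> (\<forall>e>0. \<exists>g. cc g \<and> (LINT z|lborel. (w z - g z)\<^sup>2) < e)"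

lemma cc_approx_add:
  assumes "cc_approx u" "cc_approx v" shows "cc_approx (\<lambda>z. u z + v z)" unfolding cc_approx_def
proof (intro conjI allI impI)
  show "(\<lambda>z. u z + v z) \<in> L2_space lborel" using assms by (auto simp: cc_approx_def intro: L2_space_add)
  fix e :: real assume "e > 0"
  then have "e / 4 > 0" by simp
  then obtain f g where fg: "cc f" "(LINT z|lborel. (u z - f z)\<^sup>2) < e/4" "cc g" "(LINT z|lborel. (v z - g z)\<^sup>2) < e/4"
   using assms unfolding cc_approx_def by meson
  have "(LINT z|lborel. ((u z - f z) + (v z - g z))\<^sup>2) \<le> 2 * (LINT z|lborel. (u z - f z)\<^sup>2) + 2 * (LINT z|lborel. (v z - g z)\<^sup>2)"
   using assms cc_L2_space[OF fg(1)] cc_L2_space[OF fg(3)] by (intro L2_integral_le_square_add L2_space_diff) (auto simp: cc_approx_def)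
  then have "(LINT z|lborel. ((u z - f z) + (v z - g z))\<^sup>2) < e" using fg by linarith
  then show "\<exists>h. cc h \<and> (LINT z|lborel. (u z + v z - h z)\<^sup>2) < e"
   using cc_add[OF fg(1,3)] by (intro exI[of _ "\<lambda>z. f z + g z"]) (simp add: algebra_simps)
qed

lemma cc_approx_limit:
  assumes "l2_tends lborel F f" "\<And>k. cc_approx (F k)" shows "cc_approx f" unfolding cc_approx_def
proof (intro conjI allI impI)
  note d = l2_tendsD[OF assms(1)]
  show "f \<in> L2_space lborel" by (rule d)
  fix e :: real assume e: "e > 0"
  then have e4: "e / 4 > 0" by simp
  from LIMSEQ_D[OF d(3) e4] obtain k where k: "(LINT z|lborel. (F k z - f z)\<^sup>2) < e/4" by fastforce
  obtain g where g: "cc g" "(LINT z|lborel. (F k z - g z)\<^sup>2) < e/4" using assms(2)[of k] e4 unfolding cc_approx_def by blast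
  have "(LINT z|lborel. ((f z - F k z) + (F k z - g z))\<^sup>2) \<le> 2 * (LINT z|lborel. (f z - F k z)\<^sup>2) + 2 * (LINT z|lborel. (F k z - g z)\<^sup>2)"
   using d cc_L2_space[OF g(1)] by (intro L2_integral_le_square_add L2_space_diff) auto
  then show "\<exists>h. cc h \<and> (LINT z|lborel. (f z - h z)\<^sup>2) < e"
   using k g by (intro exI[of _ g]) (simp add: power2_commute[of "f _" "F k _"])
qed

lemma cc_approx_indicator:
  fixes E :: "'a::euclidean_space set"
  assumes E: "E \<in> sets borel" "bounded E" shows "cc_approx (\<lambda>z. c * indicator E z)" unfolding cc_approx_def
proof (intro conjI allI impI)
  obtain r where "\<forall>x\<in>E. norm x \<le> r" using E(2) unfolding bounded_iff by blast
  then have r: "E \<subseteq> cball 0 r" by auto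
  have "integrable lborel (\<lambda>z. c\<^sup>2 * indicator E z)" by (intro integrable_mult_right integrable_indicator_bounded E)
  moreover have "(\<lambda>z. (c * indicator E z)\<^sup>2) = (\<lambda>z. c\<^sup>2 * indicator E z)" by (auto simp: indicator_def fun_eq_iff)
  ultimately show L: "(\<lambda>z. c * indicator E z) \<in> L2_space lborel" using E by (simp add: L2_space_def)
  fix e :: real assume e: "e > 0"
  \<comment> \<open>The added 1 keeps the quotient meaningful when \<open>c = 0\<close>.\<close>
  then have "e / (c\<^sup>2 + 1) > 0" by (simp add: add_nonneg_pos)
  from indicator_approx[OF E(1) r this] obtain g where g: "cc g" "(LINT z|lborel. (indicator E z - g z)\<^sup>2) < e / (c\<^sup>2 + 1)" by blast
  have "(LINT z|lborel. (c * indicator E z - c * g z)\<^sup>2) = c\<^sup>2 * (LINT z|lborel. (indicator E z - g z)\<^sup>2)"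
   by (simp add: power_mult_distrib flip: right_diff_distrib integral_mult_right_zero)
  also have "\<dots> \<le> c\<^sup>2 * (e / (c\<^sup>2 + 1))" using g(2) by (intro mult_left_mono) auto
  also have "\<dots> < e"
  proof -
   have "1 + c\<^sup>2 > 0" by (simp add: add_pos_nonneg)
   then show ?thesis using e by (simp add: divide_less_eq algebra_simps)
  qed
  finally show "\<exists>h. cc h \<and> (LINT z|lborel. (c * indicator E z - h z)\<^sup>2) < e"
   using cc_mult_right[OF g(1), of "\<lambda>z. c"] by (intro exI[of _ "\<lambda>z. c * g z"]) simp
qed

lemma cc_approx_sum: "finite I \<Longrightarrow> (\<And>i. i \<in> I \<Longrightarrow> cc_approx (f i)) \<Longrightarrow> cc_approx (\<lambda>z. \<Sum>i\<in>I. f i z)"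
proof (induction I rule: finite_induct)
  case empty
  show ?case using cc_approx_indicator[of "{}" 0] by simp
qed (simp add: cc_approx_add)

text \<open>Simple functions truncated to growing balls converge pointwise and stay below 2|w|; each
  is a finite combination of indicators of bounded sets.\<close>

lemma L2_cc_approx:
  fixes w :: "'a::euclidean_space \<Rightarrow> real"
  assumes w: "w \<in> L2_space lborel" shows "cc_approx w"
proof -
  have wm: "w \<in> borel_measurable borel" using L2_spaceD(1)[OF w] by simp
  obtain s where s: "\<And>i. simple_function borel (s i)" "\<And>x. (\<lambda>i. s i x) \<longlonglongrightarrow> w x"
   "\<And>i x. dist (s i x) 0 \<le> 2 * dist (w x) 0" using borel_measurable_implies_sequence_metric[OF wm, of 0] by auto
  define F where "F i x = s i x * indicator (cball 0 (real i)) x" for i x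
  have sm: "s i \<in> borel_measurable borel" for i using s(1) by (rule borel_measurable_simple_function)
  have "l2_tends lborel F w"
  proof (rule l2_tends_dominated[where w="\<lambda>x. 2 * \<bar>w x\<bar>"])
   show "F k \<in> borel_measurable lborel" for k unfolding F_def using sm[of k] by (auto intro!: borel_measurable_times borel_measurable_indicator)
   show "w \<in> borel_measurable lborel" using wm by simp
   have "(\<lambda>z. \<bar>w z\<bar>) \<in> L2_space lborel" by (rule L2_space_bound[OF w]) (use wm in auto)
   then show "(\<lambda>x. 2 * \<bar>w x\<bar>) \<in> L2_space lborel" by (rule L2_space_cmult)
   show "AE x in lborel. (\<lambda>k. F k x) \<longlonglongrightarrow> w x"
   proof (rule AE_I2)
    fix x :: 'a
    obtain n where n: "norm x \<le> real n" using real_arch_simple by blast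
    have "\<forall>\<^sub>F k in sequentially. s k x = F k x"
     using eventually_ge_at_top[of n] by eventually_elim (use n in \<open>auto simp: F_def\<close>)
    then show "(\<lambda>k. F k x) \<longlonglongrightarrow> w x" by (rule Lim_transform_eventually[OF s(2)])
   qed
   show "AE x in lborel. \<bar>F k x\<bar> \<le> 2 * \<bar>w x\<bar>" for k using s(3)[of k] by (intro AE_I2) (auto simp: F_def indicator_def)
  qed
  moreover have "cc_approx (F i)" for i
  proof -
   have fin: "finite (range (s i))" using simple_functionD(1)[OF s(1)[of i]] by simp
   have eq: "F i = (\<lambda>x. \<Sum>c\<in>range (s i). c * indicator (s i -` {c} \<inter> cball 0 (real i)) x)"
   proof (rule ext)
    fix x
    have "(\<Sum>c\<in>range (s i). c * indicator (s i -` {c} \<inter> cball 0 (real i)) x)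
      = (\<Sum>c\<in>range (s i). if c = s i x then s i x * indicator (cball 0 (real i)) x else 0)" by (rule sum.cong) (auto simp: indicator_def)
    then show "F i x = (\<Sum>c\<in>range (s i). c * indicator (s i -` {c} \<inter> cball 0 (real i)) x)" using fin by (simp add: F_def)
   qed
   show ?thesis unfolding eq
   proof (rule cc_approx_sum[OF fin], rule cc_approx_indicator)
    fix c assume "c \<in> range (s i)"
    have "s i -` {c} \<inter> space borel \<in> sets borel" by (rule measurable_sets[OF sm]) simp
    then show "s i -` {c} \<inter> cball 0 (real i) \<in> sets borel" by simp
    show "bounded (s i -` {c} \<inter> cball 0 (real i))" by (rule bounded_Int) simp
   qed
  qed
  ultimately show ?thesis by (rule cc_approx_limit)
qed

lemma lborel_distr_reflect:
  fixes z :: "'a::euclidean_space"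
  shows "distr lborel borel (\<lambda>y. z - y) = lborel" using lborel_affine[of "-1" z] by (simp add: density_1)

lemma integral_reflect:
  fixes K :: "'a::euclidean_space \<Rightarrow> real"
  assumes "K \<in> borel_measurable borel"
  shows "(LINT y|lborel. K (z - y)) = (LINT y|lborel. K y)"
  using integral_distr[of "\<lambda>y. z - y" lborel borel K] assms by (simp add: lborel_distr_reflect)

text \<open>Young's inequality for a probability kernel. Cauchy-Schwarz on the factors w sqrt(K) and
  sqrt(K) bounds the square of the convolution by the convolution of the square, and Fubini
  integrates the kernel away.\<close>

lemma conv_L2_bound:
  assumes w: "w \<in> L2_space lborel" "integrable lborel w"
   and K: "test_function K" "\<And>z. 0 \<le> K z" "(LINT z|lborel. K z) = 1"
  shows "conv w K \<in> L2_space lborel" "(LINT z|lborel. (conv w K z)\<^sup>2) \<le> (LINT z|lborel. (w z)\<^sup>2)"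
proof -
  have ccK: "cc K" by (rule test_function_cc[OF K(1)])
  have Km[measurable]: "K \<in> borel_measurable borel" by (rule cc_measurable[OF ccK])
  have wm[measurable]: "w \<in> borel_measurable borel" using L2_spaceD(1)[OF w(1)] by simp
  have w2: "integrable lborel (\<lambda>y. (w y)\<^sup>2)" by (rule L2_spaceD(2)[OF w(1)])
  have Ki: "integrable lborel (\<lambda>y. K (z - y))" for z by (rule cc_integrable[OF cc_reflect[OF ccK]])
  have pt: "(conv w K z)\<^sup>2 \<le> (LINT y|lborel. (w y)\<^sup>2 * K (z - y))" for z
  proof -
   have i2: "integrable lborel (\<lambda>y. (w y)\<^sup>2 * K (z - y))" by (rule integrable_conv[OF w2 ccK])
   have 1: "(\<lambda>y. w y * sqrt (K (z - y))) \<in> L2_space lborel" using i2 by (simp add: L2_space_def power_mult_distrib K(2))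
   have 2: "(\<lambda>y. sqrt (K (z - y))) \<in> L2_space lborel" using Ki by (simp add: L2_space_def K(2))
   show ?thesis using L2_Cauchy_Schwarz[OF 1 2] by (simp add: power_mult_distrib K(2) integral_reflect K(3) mult.assoc conv_def)
  qed
  have cm[measurable]: "conv w K \<in> borel_measurable borel" by (rule smooth_measurable[OF smooth_conv[OF K(1) w(2)]])
  have "(\<integral>\<^sup>+ z. ennreal ((conv w K z)\<^sup>2) \<partial>lborel) \<le> (\<integral>\<^sup>+ z. \<integral>\<^sup>+ y. ennreal ((w y)\<^sup>2 * K (z - y)) \<partial>lborel \<partial>lborel)"
  proof (rule nn_integral_mono)
   fix z
   show "ennreal ((conv w K z)\<^sup>2) \<le> (\<integral>\<^sup>+ y. ennreal ((w y)\<^sup>2 * K (z - y)) \<partial>lborel)"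
    using pt[of z] by (subst nn_integral_eq_integral)
     (auto intro!: ennreal_leI integrable_conv[OF w2 ccK] simp: K(2))
  qed
  also have "\<dots> = (\<integral>\<^sup>+ y. \<integral>\<^sup>+ z. ennreal ((w y)\<^sup>2 * K (z - y)) \<partial>lborel \<partial>lborel)"
   by (rule lborel_pair.Fubini'[symmetric]) measurable
  also have "\<dots> = (\<integral>\<^sup>+ y. ennreal ((w y)\<^sup>2) \<partial>lborel)"
  proof (rule nn_integral_cong)
   fix y
   have "(\<integral>\<^sup>+ z. ennreal ((w y)\<^sup>2 * K (z - y)) \<partial>lborel) = ennreal (LINT z|lborel. (w y)\<^sup>2 * K (z + - y))"
    using lborel_has_bochner_integral_translate(1)[OF cc_integrable[OF ccK], of "- y"] by (subst nn_integral_eq_integral) (auto simp: K(2))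
   also have "\<dots> = ennreal ((w y)\<^sup>2)" using lborel_has_bochner_integral_translate(2)[OF cc_integrable[OF ccK], of "- y"] K(3) by simp
   finally show "(\<integral>\<^sup>+ z. ennreal ((w y)\<^sup>2 * K (z - y)) \<partial>lborel) = ennreal ((w y)\<^sup>2)" .
  qed
  also have "\<dots> = ennreal (LINT y|lborel. (w y)\<^sup>2)" by (rule nn_integral_eq_integral[OF w2]) simp
  finally have le: "(\<integral>\<^sup>+ z. ennreal ((conv w K z)\<^sup>2) \<partial>lborel) \<le> ennreal (LINT y|lborel. (w y)\<^sup>2)" .
  have i: "integrable lborel (\<lambda>z. (conv w K z)\<^sup>2)" using le by (intro integrableI_bounded) (auto simp: top_unique less_top[symmetric])
  show "conv w K \<in> L2_space lborel" using i by (simp add: L2_space_def)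
  show "(LINT z|lborel. (conv w K z)\<^sup>2) \<le> (LINT z|lborel. (w z)\<^sup>2)" using le nn_integral_eq_integral[OF i] by simp
qed

lemma conv_diff:
  assumes "integrable lborel u" "integrable lborel v" "cc K"
  shows "conv (\<lambda>z. u z - v z) K z = conv u K z - conv v K z" unfolding conv_def left_diff_distrib
  by (rule Bochner_Integration.integral_diff) (rule integrable_conv assms)+

lemma cc_conv_moll:
  fixes g :: "'a::euclidean_space \<Rightarrow> real"
  assumes g: "cc g"
  shows "\<exists>C r. (\<forall>k z. \<bar>conv g (moll k) z\<bar> \<le> C * indicator (cball 0 r) z)" "(\<lambda>k. conv g (moll k) z) \<longlonglongrightarrow> g z"
proof -
  let ?K = "moll :: nat \<Rightarrow> 'a \<Rightarrow> real"
  have K: "cc (?K k)" for k by (rule test_function_cc[OF test_function_moll])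
  have Ki: "integrable lborel (\<lambda>y. ?K k (z - y))" "(LINT y|lborel. ?K k (z - y)) = 1" for k z
   using cc_integrable[OF cc_reflect[OF K]] by (auto simp: integral_reflect cc_measurable[OF K] integral_moll)
  obtain C where C: "C > 0" "\<And>z. \<bar>g z\<bar> \<le> C" using cc_bounded[OF g] by auto
  obtain r where r: "\<And>z. r < norm z \<Longrightarrow> g z = 0" using g by (auto simp: cc_def csupp_def)
  have gm: "integrable lborel (\<lambda>y. g y * ?K k (z - y))" for k z by (rule integrable_conv[OF cc_integrable[OF g] K])
  \<comment> \<open>Used twice: with \<open>a = 0\<close> for the uniform bound, and with
    \<open>a = g z\<close> for the convergence, where only \<open>y\<close> close to
    \<open>z\<close> count.\<close>
  have diff: "\<bar>conv g (?K k) z - a\<bar> \<le> e" if "\<And>y. ?K k (z - y) \<noteq> 0 \<Longrightarrow> \<bar>g y - a\<bar> \<le> e" for k z a e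
  proof -
   have "conv g (?K k) z - a = (LINT y|lborel. g y * ?K k (z - y)) - (LINT y|lborel. a * ?K k (z - y))" using Ki by (simp add: conv_def)
   also have "\<dots> = (LINT y|lborel. (g y - a) * ?K k (z - y))"
    using Ki gm by (subst Bochner_Integration.integral_diff[symmetric]) (auto simp: left_diff_distrib)
   finally have eq: "conv g (?K k) z - a = (LINT y|lborel. (g y - a) * ?K k (z - y))" .
   have "\<bar>conv g (?K k) z - a\<bar> \<le> (LINT y|lborel. \<bar>(g y - a) * ?K k (z - y)\<bar>)"
    unfolding eq using integral_norm_bound[of lborel "\<lambda>y. (g y - a) * ?K k (z - y)"] unfolding real_norm_def .
   also have "\<dots> \<le> (LINT y|lborel. e * ?K k (z - y))"
   proof (rule integral_mono')
    show b: "\<bar>(g y - a) * ?K k (z - y)\<bar> \<le> e * ?K k (z - y)" for y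
    proof (cases "?K k (z - y) = 0")
     case False
     from that[OF this] show ?thesis using moll_nonneg[of k "z - y"] by (simp add: abs_mult mult_right_mono)
    qed simp
    show "0 \<le> e * ?K k (z - y)" for y by (rule order_trans[OF abs_ge_zero b])
   qed (use Ki in auto)
   also have "\<dots> = e" using Ki by simp
   finally show ?thesis .
  qed
  define R where "R = r + 2 * DIM('a)"
  have "\<bar>conv g (?K k) z\<bar> \<le> C * indicator (cball 0 R) z" for k z
  proof (cases "norm z \<le> R")
   case True
   then show ?thesis using diff[of k z 0 C] C(2) by auto
  next
   case False
   have "real (2 * DIM('a)) / real (Suc k) \<le> real (2 * DIM('a)) / 1" by (rule divide_left_mono) auto
   then have "moll k y = 0" if "real (2 * DIM('a)) < norm y" for y :: 'a using that by (intro moll_eq_0) simp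
   then have "conv g (?K k) z = 0" using False by (intro conv_eq_0[of r _ "real (2 * DIM('a))"]) (auto intro: r simp: R_def)
   then show ?thesis using C(1) by simp
  qed
  then show "\<exists>C r. (\<forall>k z. \<bar>conv g (moll k) z\<bar> \<le> C * indicator (cball 0 r) z)" by blast
  show "(\<lambda>k. conv g (moll k) z) \<longlonglongrightarrow> g z"
  proof (rule LIMSEQ_I)
   fix e :: real assume e: "e > 0"
   then have "e/2 > 0" by simp
   from cc_uniformly_continuous[OF g this] obtain d where d: "d > 0" "\<And>y z. dist y z < d \<Longrightarrow> \<bar>g y - g z\<bar> < e/2" by blast
   obtain n where n: "real (2 * DIM('a)) / d < real n" using reals_Archimedean2 by blast
   have "norm (conv g (?K k) z - g z) < e" if "k \<ge> n" for k
   proof -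
    have kn: "real (2 * DIM('a)) / real (Suc k) < d"
    proof -
     have "real (2 * DIM('a)) / d < real (Suc k)" using n that by linarith
     then show ?thesis using d(1) by (simp add: field_simps del: of_nat_Suc)
    qed
    have "\<bar>g y - g z\<bar> \<le> e/2" if "?K k (z - y) \<noteq> 0" for y
    proof -
     have "norm (z - y) \<le> real (2 * DIM('a)) / real (Suc k)" using moll_eq_0[of k "z - y"] that by force
     then have "dist y z < d" using kn by (simp add: dist_norm norm_minus_commute)
     from d(2)[OF this] show ?thesis by simp
    qed
    from diff[of k z "g z" "e/2", OF this] e show ?thesis by simp
   qed
   then show "\<exists>n. \<forall>k\<ge>n. norm (conv g (moll k) z - g z) < e" by blast
  qed
qed

lemma l2_tends_conv_moll_cc:
  assumes g: "cc g" shows "l2_tends lborel (\<lambda>k. conv g (moll k)) g"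
proof -
  obtain C r where Cr: "\<And>k z. \<bar>conv g (moll k) z\<bar> \<le> C * indicator (cball 0 r) z" using cc_conv_moll(1)[OF g] by blast
  show ?thesis
  proof (rule l2_tends_dominated[where w="\<lambda>z. C * indicator (cball 0 r) z"])
   show "conv g (moll k) \<in> borel_measurable lborel" for k
    using smooth_measurable[OF smooth_conv[OF test_function_moll cc_integrable[OF g]]] by simp
   show "g \<in> borel_measurable lborel" using cc_measurable[OF g] by simp
   show "(\<lambda>z. C * indicator (cball 0 r) z) \<in> L2_space lborel" by (rule conjunct1[OF cc_approx_indicator[unfolded cc_approx_def]]) auto
  qed (use Cr cc_conv_moll(2)[OF g] in auto)
qed

text \<open>Convolution with a mollifier is a contraction, so convergence on the dense class C_c
  extends to all of L2.\<close>

lemma l2_tends_conv_moll: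
  fixes w :: "'a::euclidean_space \<Rightarrow> real"
  assumes w: "w \<in> L2_space lborel" "integrable lborel w"
  shows "l2_tends lborel (\<lambda>k. conv w (moll k)) w" unfolding l2_tends_def
proof (intro conjI allI)
  note cb = conv_L2_bound[OF _ _ test_function_moll moll_nonneg integral_moll]
  show "conv w (moll k) \<in> L2_space lborel" for k by (rule cb(1)[OF w])
  show "w \<in> L2_space lborel" by (rule w)
  show "(\<lambda>k. LINT z|lborel. (conv w (moll k) z - w z)\<^sup>2) \<longlonglongrightarrow> 0"
  proof (rule LIMSEQ_I)
   fix e :: real assume e: "e > 0"
   \<comment> \<open>Splitting into three parts by two applications of (a+b)^2 \<le> 2a^2 + 2b^2
     gives the weights 2, 4, 4; the tolerances 1/12, 1/8, 1/12 then add up to exactly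
     \<open>e\<close>.\<close>
   then have "e/12 > 0" by simp
   then obtain g where g: "cc g" "(LINT z|lborel. (w z - g z)\<^sup>2) < e/12" using L2_cc_approx[OF w(1)] unfolding cc_approx_def by blast
   note gL = cc_L2_space[OF g(1)] cc_integrable[OF g(1)]
   have "e / 8 > 0" using e by simp
   from LIMSEQ_D[OF l2_tendsD(3)[OF l2_tends_conv_moll_cc[OF g(1)]] this] obtain n where
    n: "\<And>k. k \<ge> n \<Longrightarrow> (LINT z|lborel. (conv g (moll k) z - g z)\<^sup>2) < e/8" by auto
   have "norm ((LINT z|lborel. (conv w (moll k) z - w z)\<^sup>2) - 0) < e" if "k \<ge> n" for k
   proof -
    let ?a = "conv (\<lambda>z. w z - g z) (moll k)"
    let ?b = "\<lambda>z. conv g (moll k) z - g z"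
    let ?c = "\<lambda>z. g z - w z"
    have wg: "(\<lambda>z. w z - g z) \<in> L2_space lborel" "integrable lborel (\<lambda>z. w z - g z)" using w gL by (auto intro: L2_space_diff)
    have La: "?a \<in> L2_space lborel" by (rule cb(1)[OF wg])
    have Lb: "?b \<in> L2_space lborel" by (rule L2_space_diff[OF cb(1)[OF gL] gL(1)])
    have Lc: "?c \<in> L2_space lborel" by (rule L2_space_diff[OF gL(1) w(1)])
    have "conv w (moll k) z - w z = ?a z + (?b z + ?c z)" for z by (simp add: conv_diff[OF w(2) gL(2) test_function_cc[OF test_function_moll]])
    then have "(LINT z|lborel. (conv w (moll k) z - w z)\<^sup>2) = (LINT z|lborel. (?a z + (?b z + ?c z))\<^sup>2)" by (simp only:)
    moreover have "(LINT z|lborel. (?a z + (?b z + ?c z))\<^sup>2) \<le> 2 * (LINT z|lborel. (?a z)\<^sup>2) + 2 * (LINT z|lborel. (?b z + ?c z)\<^sup>2)"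
     by (rule L2_integral_le_square_add[OF La L2_space_add[OF Lb Lc]])
    moreover have "(LINT z|lborel. (?b z + ?c z)\<^sup>2) \<le> 2 * (LINT z|lborel. (?b z)\<^sup>2) + 2 * (LINT z|lborel. (?c z)\<^sup>2)"
     by (rule L2_integral_le_square_add[OF Lb Lc])
    moreover have "(LINT z|lborel. (?a z)\<^sup>2) \<le> (LINT z|lborel. (w z - g z)\<^sup>2)" by (rule cb(2)[OF wg])
    moreover have "(LINT z|lborel. (?c z)\<^sup>2) = (LINT z|lborel. (w z - g z)\<^sup>2)" by (simp add: power2_commute)
    ultimately have "(LINT z|lborel. (conv w (moll k) z - w z)\<^sup>2) < e" using g(2) n[OF that] by linarith
    then show ?thesis by simp
   qed
   then show "\<exists>n. \<forall>k\<ge>n. norm ((LINT z|lborel. (conv w (moll k) z - w z)\<^sup>2) - 0) < e" by blast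
  qed
qed

text \<open>The fundamental lemma of the calculus of variations. The vanishing of the integrals is
  carried by dominated convergence from test functions to C_c, then to indicators of bounded Borel
  sets, where uniqueness of densities applies.\<close>

lemma L1_loc_AE_0:
  fixes v :: "'a::euclidean_space \<Rightarrow> real"
  assumes v: "v \<in> L1_loc" and 0: "\<And>\<phi>. test_function \<phi> \<Longrightarrow> (LINT z|lborel. v z * \<phi> z) = 0"
  shows "AE z in lborel. v z = 0"
proof -
  have vm[measurable]: "v \<in> borel_measurable borel" using v by (simp add: L1_loc_def)
  have vi: "integrable lborel (\<lambda>z. indicator (cball 0 r) z * v z)" for r :: real
   using v compact_cball[of 0 r] by (auto simp: L1_loc_def set_integrable_def)
  have dom: "(LINT z|lborel. v z * f z) = 0"
   if g: "\<And>k. g k \<in> borel_measurable borel" "f \<in> borel_measurable borel" "\<And>k. (LINT z|lborel. v z * g k z) = 0"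
    "AE z in lborel. (\<lambda>k. g k z) \<longlonglongrightarrow> f z" "\<And>k z. \<bar>g k z\<bar> \<le> C * indicator (cball 0 r) z"
   for g :: "nat \<Rightarrow> 'a \<Rightarrow> real" and f C r
  proof -
   have "(\<lambda>k. LINT z|lborel. v z * g k z) \<longlonglongrightarrow> (LINT z|lborel. v z * f z)"
   proof (rule integral_dominated_convergence[where w="\<lambda>z. C * \<bar>indicator (cball 0 r) z * v z\<bar>"])
    show "integrable lborel (\<lambda>z. C * \<bar>indicator (cball 0 r) z * v z\<bar>)" using vi[of r] by auto
    show "AE z in lborel. (\<lambda>k. v z * g k z) \<longlonglongrightarrow> v z * f z"
     using g(4) by eventually_elim (intro tendsto_mult tendsto_const)
    show "AE z in lborel. norm (v z * g k z) \<le> C * \<bar>indicator (cball 0 r) z * v z\<bar>" for k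
    proof (rule AE_I2)
     fix z
     show "norm (v z * g k z) \<le> C * \<bar>indicator (cball 0 r) z * v z\<bar>"
      using mult_left_mono[OF g(5)[of k z] abs_ge_zero[of "v z"]] by (simp add: abs_mult mult_ac)
    qed
   qed (use g vm in auto)
   then show ?thesis using g(3) by (simp add: LIMSEQ_const_iff)
  qed
  have 1: "(LINT z|lborel. v z * g z) = 0" if g: "cc g" for g
  proof -
   obtain C r where Cr: "\<And>k z. \<bar>conv g (moll k) z\<bar> \<le> C * indicator (cball 0 r) z" using cc_conv_moll(1)[OF g] by blast
   have t: "test_function (conv g (moll k))" for k using g by (intro test_function_conv test_function_moll cc_integrable) (auto simp: cc_def)
   show ?thesis by (rule dom[of "\<lambda>k. conv g (moll k)" g C r])
     (use Cr cc_conv_moll(2)[OF g] 0[OF t] cc_measurable[OF g] cc_measurable[OF test_function_cc[OF t]] in auto)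
  qed
  have 2: "(LINT z|lborel. v z * indicator E z) = 0" if E: "E \<in> sets borel" "E \<subseteq> cball 0 r" for E r
  proof -
   have "\<forall>k::nat. \<exists>g. cc g \<and> (\<forall>z. 0 \<le> g z \<and> g z \<le> 1) \<and> (\<forall>z. r + 1 < norm z \<longrightarrow> g z = 0) \<and>
    (LINT z|lborel. (indicator E z - g z)\<^sup>2) < 1 / real (Suc k)" by (intro allI indicator_approx E) simp
   from choice[OF this] obtain g where g: "\<And>k::nat. cc (g k)" "\<And>k z. 0 \<le> g k z \<and> g k z \<le> 1"
    "\<And>k z. r + 1 < norm z \<Longrightarrow> g k z = 0" "\<And>k. (LINT z|lborel. (indicator E z - g k z)\<^sup>2) < 1 / real (Suc k)" by blast
   have "bounded E" using E(2) bounded_cball bounded_subset by blast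
   then have EL: "indicator E \<in> L2_space lborel" using cc_approx_indicator[OF E(1), of 1] by (simp add: cc_approx_def)
   have "l2_tends lborel g (indicator E)"
   proof (rule l2_tends_sandwich)
    show "(\<lambda>k. 1 / real (Suc k)) \<longlonglongrightarrow> 0" by (rule LIMSEQ_Suc[OF lim_1_over_n])
    show "(LINT z|lborel. (g k z - indicator E z)\<^sup>2) \<le> 1 / real (Suc k)" for k using g(4)[of k] by (simp add: power2_commute)
   qed (use EL cc_L2_space[OF g(1)] in auto)
   \<comment> \<open>Convergence in the mean yields convergence almost everywhere only along a
     subsequence, which is enough for the dominated passage.\<close>
   from l2_tends_AE_subseq[OF this] obtain s where s: "AE x in lborel. (\<lambda>n. g (s n) x) \<longlonglongrightarrow> indicator E x" by blast
   show ?thesis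
   proof (rule dom[OF _ _ _ s, where C=1 and r="r+1"])
    show "\<bar>g (s k) z\<bar> \<le> 1 * indicator (cball 0 (r + 1)) z" for k z
     using g(2)[of "s k" z] g(3)[of z "s k"] by (auto simp: indicator_def)
   qed (use g(1) 1 cc_measurable E in auto)
  qed
  have 3: "AE z in lborel. indicator (cball 0 (real n)) z * v z = 0" for n
  proof (rule density_unique_real)
   show "integrable lborel (\<lambda>z. indicator (cball 0 (real n)) z * v z)" by (rule vi)
   show "integrable lborel (\<lambda>z::'a. 0::real)" by simp
   fix A :: "'a set" assume "A \<in> sets lborel"
   then have "(LINT z|lborel. v z * indicator (A \<inter> cball 0 (real n)) z) = 0" by (intro 2[of _ "real n"]) auto
   then show "set_lebesgue_integral lborel A (\<lambda>z. indicator (cball 0 (real n)) z * v z) = set_lebesgue_integral lborel A (\<lambda>z. 0)"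
    by (simp add: set_lebesgue_integral_def indicator_inter_arith mult_ac)
  qed
  then have "AE z in lborel. \<forall>n. indicator (cball 0 (real n)) z * v z = 0" unfolding AE_all_countable by blast
  then show ?thesis
  proof eventually_elim
   case (elim z)
   obtain n where "norm z \<le> real n" using real_arch_simple by blast
   then show ?case using elim[rule_format, of n] by simp
  qed
qed

section \<open>Local spaces and weak derivatives\<close>

lemma compact_subset_cball_0:
  fixes K :: "'a::euclidean_space set"
  assumes "compact K" shows "\<exists>r>0. K \<subseteq> cball 0 r"
proof -
  obtain r where "r > 0" "\<forall>x\<in>K. norm x \<le> r" using compact_imp_bounded[OF assms] unfolding bounded_pos by blast
  then show ?thesis by (intro exI[of _ r]) auto
qed

lemma L2_locI:
  fixes u :: "'a::euclidean_space \<Rightarrow> real"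
  assumes "u \<in> borel_measurable borel" "\<And>r. integrable lborel (\<lambda>z. indicator (cball 0 r) z * (u z)\<^sup>2)"
  shows "u \<in> L2_loc" unfolding L2_loc_def set_integrable_def
proof (intro CollectI conjI allI impI)
  fix K :: "'a set" assume K: "compact K"
  then obtain r where r: "K \<subseteq> cball 0 r" using compact_subset_cball_0 by blast
  show "integrable lborel (\<lambda>x. indicat_real K x *\<^sub>R (u x)\<^sup>2)"
  proof (rule Bochner_Integration.integrable_bound[OF assms(2)[of r]])
   show "(\<lambda>x. indicat_real K x *\<^sub>R (u x)\<^sup>2) \<in> borel_measurable lborel" using assms(1) K borel_compact[OF K] by measurable
   show "AE x in lborel. norm (indicat_real K x *\<^sub>R (u x)\<^sup>2) \<le> norm (indicat_real (cball 0 r) x * (u x)\<^sup>2)"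
    using r by (intro AE_I2) (auto simp: indicator_def)
  qed
qed (rule assms)

lemma L2_locD:
  assumes "u \<in> L2_loc"
  shows "u \<in> borel_measurable borel" "integrable lborel (\<lambda>z. indicator (cball 0 r) z * (u z)\<^sup>2)"
  using assms compact_cball[of 0 r] by (auto simp: L2_loc_def set_integrable_def)

lemma L2_loc_iff:
  shows "u \<in> L2_loc \<longleftrightarrow> u \<in> borel_measurable borel \<and> (\<forall>r. (\<lambda>z. indicator (cball 0 r) z * u z) \<in> L2_space lborel)"
proof -
  have "(\<lambda>z. (indicator (cball 0 r) z * u z)\<^sup>2) = (\<lambda>z. indicator (cball 0 r) z * (u z)\<^sup>2)" for r
   by (auto simp: indicator_def fun_eq_iff)
  moreover have "(\<lambda>z. indicator (cball 0 r) z * u z) \<in> borel_measurable borel" if "u \<in> borel_measurable borel" for r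
   using that by (auto intro!: borel_measurable_times borel_measurable_indicator)
  ultimately show ?thesis by (auto simp: L2_space_def intro: L2_locI L2_locD)
qed

lemma L2_loc_add:
  shows "u \<in> L2_loc \<Longrightarrow> v \<in> L2_loc \<Longrightarrow> (\<lambda>z. u z + v z) \<in> L2_loc"
  unfolding L2_loc_iff distrib_left by (auto intro: L2_space_add)

lemma L2_loc_mult_continuous:
  assumes u: "u \<in> L2_loc" and c: "continuous_on UNIV c"
  shows "(\<lambda>z. c z * u z) \<in> L2_loc" unfolding L2_loc_iff
proof (intro conjI allI)
  have cm: "c \<in> borel_measurable borel" using c by (rule borel_measurable_continuous_onI)
  show "(\<lambda>z. c z * u z) \<in> borel_measurable borel" using cm L2_locD(1)[OF u] by (rule borel_measurable_times)
  fix r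
  have "compact (c ` cball 0 r)" using c by (intro compact_continuous_image) (auto intro: continuous_on_subset)
  then obtain K where K: "K > 0" "\<And>z. z \<in> cball 0 r \<Longrightarrow> \<bar>c z\<bar> \<le> K"
   using compact_imp_bounded bounded_pos[of "c ` cball 0 r"] by auto
  have "(\<lambda>z. (indicator (cball 0 r) z * c z) * (indicator (cball 0 r) z * u z)) \<in> L2_space lborel"
  proof (rule L2_space_bounded_mult)
   show "(\<lambda>z. indicator (cball 0 r) z * u z) \<in> L2_space lborel" using u by (simp add: L2_loc_iff)
   show "\<bar>indicator (cball 0 r) z * c z\<bar> \<le> K" for z using K by (auto simp: indicator_def)
   show "(\<lambda>z. indicator (cball 0 r) z * c z) \<in> borel_measurable lborel"
    using cm by (auto intro!: borel_measurable_times borel_measurable_indicator)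
  qed
  moreover have "(\<lambda>z. (indicator (cball 0 r) z * c z) * (indicator (cball 0 r) z * u z)) = (\<lambda>z. indicator (cball 0 r) z * (c z * u z))"
   by (auto simp: indicator_def)
  ultimately show "(\<lambda>z. indicator (cball 0 r) z * (c z * u z)) \<in> L2_space lborel" by simp
qed

lemma L2_loc_zero: "(\<lambda>z. 0) \<in> L2_loc" by (simp add: L2_loc_def set_integrable_def)

lemma L2_loc_sum:
  fixes u :: "'i \<Rightarrow> 'a::euclidean_space \<Rightarrow> real"
  shows "(\<And>i. i \<in> I \<Longrightarrow> u i \<in> L2_loc) \<Longrightarrow> (\<lambda>z. \<Sum>i\<in>I. u i z) \<in> L2_loc"
  by (induction I rule: infinite_finite_induct) (auto intro: L2_loc_zero L2_loc_add)

lemma L2_loc_continuous: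
  fixes c :: "'a::euclidean_space \<Rightarrow> real"
  assumes "continuous_on UNIV c" shows "c \<in> L2_loc"
proof -
  have "(\<lambda>z::'a. 1) \<in> L2_loc" by (rule L2_locI) (auto intro: integrable_indicator_bounded)
  from L2_loc_mult_continuous[OF this assms] show ?thesis by simp
qed

lemma L2_loc_imp_L1_loc:
  fixes u :: "'a::euclidean_space \<Rightarrow> real"
  assumes "u \<in> L2_loc" shows "u \<in> L1_loc" unfolding L1_loc_def set_integrable_def
proof (intro CollectI conjI allI impI)
  show um: "u \<in> borel_measurable borel" using assms by (rule L2_locD)
  fix K :: "'a set" assume K: "compact K"
  then obtain r where r: "K \<subseteq> cball 0 r" using compact_subset_cball_0 by blast
  have i: "integrable lborel (\<lambda>z. indicator (cball 0 r) z + indicator (cball 0 r) z * (u z)\<^sup>2)"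
   by (intro Bochner_Integration.integrable_add integrable_indicator_bounded L2_locD assms) auto
  show "integrable lborel (\<lambda>x. indicat_real K x *\<^sub>R u x)"
  proof (rule Bochner_Integration.integrable_bound[OF i])
   show "(\<lambda>x. indicat_real K x *\<^sub>R u x) \<in> borel_measurable lborel" using um borel_compact[OF K] by measurable
   have "\<bar>a\<bar> \<le> 1 + a\<^sup>2" for a :: real using sum_squares_bound[of "\<bar>a\<bar>" 1] by simp
   then show "AE x in lborel. norm (indicat_real K x *\<^sub>R u x) \<le> norm (indicat_real (cball 0 r) x + indicat_real (cball 0 r) x * (u x)\<^sup>2)"
    using r by (intro AE_I2) (auto simp: indicator_def)
  qed
qed

lemma L1_loc_integrable_cc:
  assumes u: "u \<in> L1_loc" and g: "cc g" shows "integrable lborel (\<lambda>z. u z * g z)"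
proof -
  obtain r where r: "\<And>z. r < norm z \<Longrightarrow> g z = 0" using g by (auto simp: cc_def csupp_def)
  have "integrable lborel (\<lambda>z. indicator (cball 0 r) z * u z)" using u compact_cball[of 0 r] by (auto simp: L1_loc_def set_integrable_def)
  from integrable_mult_cc[OF this g measurable_ident_sets[OF sets_lborel]] have "integrable lborel (\<lambda>z. indicator (cball 0 r) z * u z * g z)" .
  moreover have "(\<lambda>z. indicator (cball 0 r) z * u z * g z) = (\<lambda>z. u z * g z)" using r by (auto simp: indicator_def fun_eq_iff)
  ultimately show ?thesis by simp
qed

lemma L1_loc_add:
  shows "u \<in> L1_loc \<Longrightarrow> v \<in> L1_loc \<Longrightarrow> (\<lambda>z. u z + v z) \<in> L1_loc"
  by (auto simp: L1_loc_def set_integrable_def distrib_left intro: Bochner_Integration.integrable_add)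

lemma L1_loc_cmult:
  shows "u \<in> L1_loc \<Longrightarrow> (\<lambda>z. c * u z) \<in> L1_loc" by (auto simp: L1_loc_def set_integrable_def mult.left_commute[of _ c])

lemma csupp_L2_loc:
  assumes u: "u \<in> L2_loc" and "csupp u" shows "u \<in> L2_space lborel" "integrable lborel u"
proof -
  obtain r where r: "\<And>z. r < norm z \<Longrightarrow> u z = 0" using assms by (auto simp: csupp_def)
  have eq: "(\<lambda>z. indicator (cball 0 r) z * u z) = u" using r by (auto simp: indicator_def fun_eq_iff)
  have "(\<lambda>z. indicator (cball 0 r) z * u z) \<in> L2_space lborel" using u unfolding L2_loc_iff by blast
  then show "u \<in> L2_space lborel" unfolding eq .
  have "u \<in> L1_loc" by (rule L2_loc_imp_L1_loc[OF u])
  then have "integrable lborel (\<lambda>z. indicator (cball 0 r) z * u z)" using compact_cball[of 0 r] by (auto simp: L1_loc_def set_integrable_def)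
  then show "integrable lborel u" using eq by simp
qed

text \<open>The fundamental lemma for the difference; it is what makes the arbitrary choice in
  \<open>weak_deriv\<close> immaterial up to null sets.\<close>

lemma is_weak_deriv_unique:
  assumes "is_weak_deriv bs u v" "is_weak_deriv bs u w"
  shows "AE z in lborel. v z = w z"
proof -
  have L: "v \<in> L1_loc" "w \<in> L1_loc" using assms by (auto simp: is_weak_deriv_def)
  have "AE z in lborel. v z + (-1) * w z = 0"
  proof (rule L1_loc_AE_0)
   show "(\<lambda>z. v z + (-1) * w z) \<in> L1_loc" using L by (intro L1_loc_add L1_loc_cmult)
   fix \<phi> :: "'a \<Rightarrow> real" assume t: "test_function \<phi>"
   have "(- 1) ^ length bs * (LINT z|lborel. v z * \<phi> z) = (- 1) ^ length bs * (LINT z|lborel. w z * \<phi> z)"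
    using assms t unfolding is_weak_deriv_def by metis
   then have "(LINT z|lborel. v z * \<phi> z) = (LINT z|lborel. w z * \<phi> z)" by simp
   then show "(LINT z|lborel. (v z + (-1) * w z) * \<phi> z) = 0"
    using L1_loc_integrable_cc[OF L(1) test_function_cc[OF t]] L1_loc_integrable_cc[OF L(2) test_function_cc[OF t]] by (simp add: left_diff_distrib)
  qed
  then show ?thesis by eventually_elim simp
qed

lemma is_weak_deriv_add:
  fixes u v u' v' :: "'a::euclidean_space \<Rightarrow> real"
  assumes "is_weak_deriv bs u u'" "is_weak_deriv bs v v'" "set bs \<subseteq> Basis"
  shows "is_weak_deriv bs (\<lambda>z. u z + v z) (\<lambda>z. u' z + v' z)" unfolding is_weak_deriv_def
proof (intro conjI allI impI)
  have L: "u \<in> L1_loc" "v \<in> L1_loc" "u' \<in> L1_loc" "v' \<in> L1_loc" using assms by (auto simp: is_weak_deriv_def)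
  then show "(\<lambda>z. u z + v z) \<in> L1_loc" "(\<lambda>z. u' z + v' z) \<in> L1_loc" by (auto intro: L1_loc_add)
  fix \<phi> :: "'a \<Rightarrow> real" assume t: "test_function \<phi>"
  note c = L1_loc_integrable_cc[OF _ test_function_cc[OF t]]
   L1_loc_integrable_cc[OF _ test_function_cc[OF test_function_iter_deriv[OF t assms(3)]]]
  have "(LINT z|lborel. u z * iter_deriv bs \<phi> z) = (- 1) ^ length bs * (LINT z|lborel. u' z * \<phi> z)"
   "(LINT z|lborel. v z * iter_deriv bs \<phi> z) = (- 1) ^ length bs * (LINT z|lborel. v' z * \<phi> z)"
   using assms t unfolding is_weak_deriv_def by blast+
  then show "(LINT z|lborel. (u z + v z) * iter_deriv bs \<phi> z) = (- 1) ^ length bs * (LINT z|lborel. (u' z + v' z) * \<phi> z)"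
   using c L by (simp add: distrib_right distrib_left)
qed

lemma is_weak_deriv_Nil:
  assumes "u \<in> L1_loc" shows "is_weak_deriv [] u u" using assms by (simp add: is_weak_deriv_def)

text \<open>Continuity of a single directional derivative suffices, which covers elements of D(G0):
  they are only once differentiable in time.\<close>

lemma is_weak_deriv_dirder:
  fixes u :: "'a::euclidean_space \<Rightarrow> real"
  assumes "dirder b u u'" "continuous_on UNIV u" "continuous_on UNIV u'" "b \<in> Basis"
  shows "is_weak_deriv [b] u u'" unfolding is_weak_deriv_def
proof (intro conjI allI impI)
  show L: "u \<in> L1_loc" "u' \<in> L1_loc" using assms by (auto intro: L2_loc_imp_L1_loc L2_loc_continuous)
  fix \<phi> :: "'a \<Rightarrow> real" assume t: "test_function \<phi>"
  have cs: "cc \<phi>" "cc (pd b \<phi>)" using t assms(4) by (auto intro: test_function_cc test_function_pd)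
  have "has_bochner_integral lborel (\<lambda>z. u' z * \<phi> z + u z * pd b \<phi> z) 0"
   using t assms cs by (intro has_bochner_integral_dirder[OF dirder_mult[OF assms(1) dirder_pd]])
    (auto simp: test_function_iff intro!: cc_add cc_mult_right)
  then have "(LINT z|lborel. u' z * \<phi> z + u z * pd b \<phi> z) = 0" by (rule has_bochner_integral_integral_eq)
  then show "(LINT z|lborel. u z * iter_deriv [b] \<phi> z) = (- 1) ^ length [b] * (LINT z|lborel. u' z * \<phi> z)"
   using L1_loc_integrable_cc[OF L(2) cs(1)] L1_loc_integrable_cc[OF L(1) cs(2)] by simp
qed

lemma is_weak_deriv_pd: "smooth \<phi> \<Longrightarrow> b \<in> Basis \<Longrightarrow> is_weak_deriv [b] \<phi> (pd b \<phi>)"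
  by (intro is_weak_deriv_dirder dirder_pd smooth_continuous smooth_pd)

text \<open>The first entry of the list is the outermost derivative of the test function, so it is
  moved to \<open>u\<close> first, with \<open>pd b\<close> of the test function as the new test
  function.\<close>

lemma is_weak_deriv_two:
  assumes "is_weak_deriv [a] u ua" "b \<in> Basis" "uab \<in> L1_loc"
  shows "is_weak_deriv [a, b] u uab \<longleftrightarrow> is_weak_deriv [b] ua uab"
proof -
  have "(LINT z|lborel. u z * iter_deriv [a, b] \<phi> z) = - (LINT z|lborel. ua z * iter_deriv [b] \<phi> z)"
   if "test_function \<phi>" for \<phi> using assms(1) test_function_pd[OF that assms(2)] unfolding is_weak_deriv_def by simp
  then show ?thesis using assms by (auto simp: is_weak_deriv_def)
qed

text \<open>The derivative of \<open>u\<close> is tested with the product of \<zeta> and the test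
  function, and the classical product rule is rearranged.\<close>

lemma is_weak_deriv_mult:
  fixes u v \<zeta> :: "'a::euclidean_space \<Rightarrow> real"
  assumes w: "is_weak_deriv [b] u v" and L: "u \<in> L2_loc" "v \<in> L2_loc" and s: "smooth \<zeta>" and b: "b \<in> Basis"
  shows "is_weak_deriv [b] (\<lambda>z. \<zeta> z * u z) (\<lambda>z. \<zeta> z * v z + pd b \<zeta> z * u z)" unfolding is_weak_deriv_def
proof (intro conjI allI impI)
  note c = smooth_continuous[OF s] smooth_continuous[OF smooth_pd[OF s b]]
  show 1: "(\<lambda>z. \<zeta> z * u z) \<in> L1_loc" "(\<lambda>z. \<zeta> z * v z + pd b \<zeta> z * u z) \<in> L1_loc"
   by (intro L2_loc_imp_L1_loc L2_loc_add L2_loc_mult_continuous L c)+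
  fix \<phi> :: "'a \<Rightarrow> real" assume t: "test_function \<phi>"
  have sp: "smooth \<phi>" using t by (simp add: test_function_iff)
  have t': "test_function (\<lambda>z. \<zeta> z * \<phi> z)" by (rule test_function_mult_smooth[OF t s])
  have "(LINT z|lborel. u z * pd b (\<lambda>z. \<zeta> z * \<phi> z) z) = - (LINT z|lborel. v z * (\<zeta> z * \<phi> z))"
   using w t' unfolding is_weak_deriv_def by simp
  then have eq: "(LINT z|lborel. u z * (\<zeta> z * pd b \<phi> z + pd b \<zeta> z * \<phi> z)) = - (LINT z|lborel. v z * (\<zeta> z * \<phi> z))"
   unfolding pd_mult[OF s sp] .
  note cp = test_function_cc[OF t] test_function_cc[OF test_function_pd[OF t b]]
  have i: "integrable lborel (\<lambda>z. u z * (pd b \<phi> z * \<zeta> z))" "integrable lborel (\<lambda>z. u z * (\<phi> z * pd b \<zeta> z))"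
    "integrable lborel (\<lambda>z. v z * (\<phi> z * \<zeta> z))" by (intro L1_loc_integrable_cc L2_loc_imp_L1_loc L cc_mult_left cp c)+
  have "(LINT z|lborel. u z * (\<zeta> z * pd b \<phi> z + pd b \<zeta> z * \<phi> z))
    = (LINT z|lborel. u z * (pd b \<phi> z * \<zeta> z)) + (LINT z|lborel. u z * (\<phi> z * pd b \<zeta> z))"
   using i by (subst Bochner_Integration.integral_add[symmetric]) (auto simp: algebra_simps)
  moreover have "(LINT z|lborel. (\<zeta> z * v z + pd b \<zeta> z * u z) * \<phi> z)
    = (LINT z|lborel. v z * (\<phi> z * \<zeta> z)) + (LINT z|lborel. u z * (\<phi> z * pd b \<zeta> z))"
   using i by (subst Bochner_Integration.integral_add[symmetric]) (auto simp: algebra_simps)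
  moreover have "(LINT z|lborel. v z * (\<zeta> z * \<phi> z)) = (LINT z|lborel. v z * (\<phi> z * \<zeta> z))"
   "(LINT z|lborel. \<zeta> z * u z * iter_deriv [b] \<phi> z) = (LINT z|lborel. u z * (pd b \<phi> z * \<zeta> z))" by (simp_all add: mult_ac)
  ultimately show "(LINT z|lborel. \<zeta> z * u z * iter_deriv [b] \<phi> z) = (- 1) ^ length [b] * (LINT z|lborel. (\<zeta> z * v z + pd b \<zeta> z * u z) * \<phi> z)"
   using eq by simp
qed

lemma weak_deriv_is:
  assumes "is_weak_deriv bs u v"
  shows "is_weak_deriv bs u (weak_deriv bs u)" "AE z in lborel. weak_deriv bs u z = v z"
proof -
  show 1: "is_weak_deriv bs u (weak_deriv bs u)" unfolding weak_deriv_def using assms by (rule someI[of "is_weak_deriv bs u"])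
  show "AE z in lborel. weak_deriv bs u z = v z" by (rule is_weak_deriv_unique[OF 1 assms])
qed

section \<open>L2 spaces with a positive continuous density\<close>

definition dens :: "('a::euclidean_space \<Rightarrow> real) \<Rightarrow> 'a measure" where
  "dens \<rho> = density lborel (\<lambda>z. ennreal (\<rho> z))"

text \<open>On compact sets such a density lies between positive constants: null sets are those of
  Lebesgue measure, weighted L2 embeds in local L2, and compactly supported limits may be taken in
  either space.\<close>

locale weight =
  fixes \<rho> :: "'a::euclidean_space \<Rightarrow> real"
  assumes weight_continuous: "continuous_on UNIV \<rho>" and weight_pos: "\<rho> z > 0"
begin

lemma weight_measurable [measurable]: "\<rho> \<in> borel_measurable borel" using weight_continuous by (rule borel_measurable_continuous_onI)

lemma sets_dens [simp, measurable_cong]: "sets (dens \<rho>) = sets borel" by (simp add: dens_def)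

lemma space_dens [simp]: "space (dens \<rho>) = UNIV" by (simp add: dens_def)

lemma measurable_dens [simp]: "borel_measurable (dens \<rho>) = borel_measurable borel" by (intro measurable_cong_sets) auto

lemma integral_dens:
  fixes h :: "'a \<Rightarrow> real"
  assumes "h \<in> borel_measurable borel" shows "(LINT z|dens \<rho>. h z) = (LINT z|lborel. \<rho> z * h z)"
  unfolding dens_def using assms weight_pos by (subst integral_density) (auto intro: less_imp_le)

lemma integrable_dens:
  fixes h :: "'a \<Rightarrow> real"
  assumes "h \<in> borel_measurable borel" shows "integrable (dens \<rho>) h \<longleftrightarrow> integrable lborel (\<lambda>z. \<rho> z * h z)"
  unfolding dens_def using assms weight_pos by (subst integrable_density) (auto intro: less_imp_le)

lemma AE_dens: "(AE z in dens \<rho>. P z) \<longleftrightarrow> (AE z in lborel. P z)" unfolding dens_def using weight_pos by (subst AE_density) auto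

lemma sqrt_weight_square: "(sqrt (\<rho> z) * u)\<^sup>2 = \<rho> z * u\<^sup>2" using weight_pos[of z] by (simp add: power_mult_distrib)

text \<open>Multiplication by the square root of the density is an isometry onto unweighted L2; it
  transports the mollification results.\<close>

lemma L2_space_dens:
  "u \<in> L2_space (dens \<rho>) \<longleftrightarrow> u \<in> borel_measurable borel \<and> (\<lambda>z. sqrt (\<rho> z) * u z) \<in> L2_space lborel"
proof -
  have "(\<lambda>z. sqrt (\<rho> z) * u z) \<in> borel_measurable borel" if "u \<in> borel_measurable borel" using that by measurable
  then show ?thesis using integrable_dens[of "\<lambda>z. (u z)\<^sup>2"] by (auto simp: L2_space_def sqrt_weight_square)
qed

lemma l2_tends_dens:
  assumes "\<And>k. F k \<in> borel_measurable borel" "f \<in> borel_measurable borel"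
  shows "l2_tends (dens \<rho>) F f \<longleftrightarrow> l2_tends lborel (\<lambda>k z. sqrt (\<rho> z) * F k z) (\<lambda>z. sqrt (\<rho> z) * f z)"
proof -
  have "(LINT z|dens \<rho>. (F k z - f z)\<^sup>2) = (LINT z|lborel. (sqrt (\<rho> z) * F k z - sqrt (\<rho> z) * f z)\<^sup>2)" for k
   using assms by (subst integral_dens) (auto simp: sqrt_weight_square simp flip: right_diff_distrib)
  then show ?thesis using assms by (simp add: l2_tends_def L2_space_dens)
qed

lemma L2_space_dens_L2_loc:
  assumes "u \<in> L2_space (dens \<rho>)" shows "u \<in> L2_loc"
proof -
  have um: "u \<in> borel_measurable borel" and L: "(\<lambda>z. sqrt (\<rho> z) * u z) \<in> L2_space lborel"
   using assms by (auto simp: L2_space_dens)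
  have "(\<lambda>z. sqrt (\<rho> z) * u z) \<in> L2_loc"
  proof (rule L2_locI)
   show "(\<lambda>z. sqrt (\<rho> z) * u z) \<in> borel_measurable borel" using um by measurable
   show "integrable lborel (\<lambda>z. indicator (cball 0 r) z * (sqrt (\<rho> z) * u z)\<^sup>2)" for r
    using integrable_mult_indicator[OF _ L2_spaceD(2)[OF L], of "cball 0 r"] by simp
  qed
  then have "(\<lambda>z. (1 / sqrt (\<rho> z)) * (sqrt (\<rho> z) * u z)) \<in> L2_loc"
  proof (rule L2_loc_mult_continuous)
   show "continuous_on UNIV (\<lambda>z. 1 / sqrt (\<rho> z))"
    using weight_pos weight_continuous by (intro continuous_intros) (auto simp: less_imp_neq[THEN not_sym])
  qed
  moreover have "(\<lambda>z. (1 / sqrt (\<rho> z)) * (sqrt (\<rho> z) * u z)) = u"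
   using weight_pos by (auto simp: fun_eq_iff less_imp_neq[THEN not_sym])
  ultimately show ?thesis by simp
qed

text \<open>The root of the density is inserted and removed: \<open>g\<close> divided by it is still
  in C_c, so weighted convergence implies convergence of unweighted integrals against
  \<open>g\<close>.\<close>

lemma l2_tends_dens_integral_cc:
  assumes F: "l2_tends (dens \<rho>) F f" and g: "cc g"
  shows "(\<lambda>k. LINT z|lborel. F k z * g z) \<longlonglongrightarrow> (LINT z|lborel. f z * g z)"
proof -
  have c: "cc (\<lambda>z. g z * (1 / sqrt (\<rho> z)))" using weight_pos weight_continuous
   by (intro cc_mult_left g continuous_intros) (auto simp: less_imp_neq[THEN not_sym])
  have "f \<in> borel_measurable borel" "F k \<in> borel_measurable borel" for k
   using l2_tendsD(1)[OF F, of k] l2_tendsD(2)[OF F] by (auto simp: L2_space_dens)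
  then have "l2_tends lborel (\<lambda>k z. sqrt (\<rho> z) * F k z) (\<lambda>z. sqrt (\<rho> z) * f z)" using F l2_tends_dens by blast
  from l2_tends_integral_mult[OF this l2_tends_const[OF cc_L2_space[OF c]]]
  show ?thesis using weight_pos by (simp add: less_imp_neq[THEN not_sym] mult_ac)
qed

text \<open>Closedness of weak differentiation: for a fixed test function both sides of the
  definition are continuous in the weighted mean.\<close>

lemma is_weak_deriv_limit:
  assumes F: "l2_tends (dens \<rho>) F f" and G: "l2_tends (dens \<rho>) G g"
   and w: "\<And>k. is_weak_deriv bs (F k) (G k)" and bs: "set bs \<subseteq> Basis"
  shows "is_weak_deriv bs f g" unfolding is_weak_deriv_def
proof (intro conjI allI impI)
  show "f \<in> L1_loc" "g \<in> L1_loc" using l2_tendsD[OF F] l2_tendsD[OF G] by (auto intro: L2_loc_imp_L1_loc L2_space_dens_L2_loc)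
  fix \<phi> :: "'a \<Rightarrow> real" assume t: "test_function \<phi>"
  have "(LINT z|lborel. F k z * iter_deriv bs \<phi> z) = (- 1) ^ length bs * (LINT z|lborel. G k z * \<phi> z)" for k
   using w[of k] t unfolding is_weak_deriv_def by blast
  moreover have "(\<lambda>k. LINT z|lborel. F k z * iter_deriv bs \<phi> z) \<longlonglongrightarrow> (LINT z|lborel. f z * iter_deriv bs \<phi> z)"
   by (rule l2_tends_dens_integral_cc[OF F test_function_cc[OF test_function_iter_deriv[OF t bs]]])
  moreover have "(\<lambda>k. (- 1) ^ length bs * (LINT z|lborel. G k z * \<phi> z)) \<longlonglongrightarrow> (- 1) ^ length bs * (LINT z|lborel. g z * \<phi> z)"
   by (intro tendsto_mult_left l2_tends_dens_integral_cc[OF G test_function_cc[OF t]])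
  ultimately show "(LINT z|lborel. f z * iter_deriv bs \<phi> z) = (- 1) ^ length bs * (LINT z|lborel. g z * \<phi> z)"
   by (simp only:) (rule LIMSEQ_unique)
qed

text \<open>With one ball containing all supports, the coefficient may be any continuous function;
  the unbounded drift and the weight \<open>norm (y z)\<close> enter this way.\<close>

lemma l2_tends_local:
  assumes F: "l2_tends lborel F f" and z: "\<And>k z. r < norm z \<Longrightarrow> F k z = 0" "\<And>z. r < norm z \<Longrightarrow> f z = 0"
   and c: "continuous_on UNIV c"
  shows "l2_tends (dens \<rho>) (\<lambda>k z. c z * F k z) (\<lambda>z. c z * f z)"
proof -
  have m: "f \<in> borel_measurable borel" "F k \<in> borel_measurable borel" "c \<in> borel_measurable borel" for k
   using L2_spaceD(1)[OF l2_tendsD(1)[OF F, of k]] L2_spaceD(1)[OF l2_tendsD(2)[OF F]] borel_measurable_continuous_onI[OF c] by simp_all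
  let ?c = "\<lambda>z. sqrt (\<rho> z) * c z"
  have cont: "continuous_on UNIV ?c" using c weight_continuous by (intro continuous_intros)
  have "compact (?c ` cball 0 r)" using cont by (intro compact_continuous_image) (auto intro: continuous_on_subset)
  then obtain K where K: "K > 0" "\<And>z. z \<in> cball 0 r \<Longrightarrow> \<bar>?c z\<bar> \<le> K"
   using compact_imp_bounded bounded_pos[of "?c ` cball 0 r"] by auto
  have "l2_tends lborel (\<lambda>k z. (indicator (cball 0 r) z * ?c z) * F k z) (\<lambda>z. (indicator (cball 0 r) z * ?c z) * f z)"
  proof (rule l2_tends_bounded_mult[OF F])
   show "\<bar>indicator (cball 0 r) z * ?c z\<bar> \<le> K" for z using K by (auto simp: indicator_def)
   show "(\<lambda>z. indicator (cball 0 r) z * ?c z) \<in> borel_measurable lborel"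
    using m by (auto intro!: borel_measurable_times borel_measurable_indicator borel_measurable_sqrt)
  qed
  moreover have "(\<lambda>k z. (indicator (cball 0 r) z * ?c z) * F k z) = (\<lambda>k z. sqrt (\<rho> z) * (c z * F k z))"
   using z by (auto simp: indicator_def fun_eq_iff)
  moreover have "(\<lambda>z. (indicator (cball 0 r) z * ?c z) * f z) = (\<lambda>z. sqrt (\<rho> z) * (c z * f z))"
   using z by (auto simp: indicator_def fun_eq_iff)
  ultimately show ?thesis using m by (subst l2_tends_dens) auto
qed

lemma cc_L2_dens: "cc g \<Longrightarrow> g \<in> L2_space (dens \<rho>)"
proof -
  assume g: "cc g"
  then obtain r where r: "\<And>z. r < norm z \<Longrightarrow> g z = 0" by (auto simp: cc_def csupp_def)
  have "l2_tends (dens \<rho>) (\<lambda>k z. 1 * g z) (\<lambda>z. 1 * g z)"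
   by (rule l2_tends_local[OF l2_tends_const[OF cc_L2_space[OF g]]]) (auto intro: r)
  then show ?thesis by (simp add: l2_tends_def)
qed

lemma integrable_dens_cc: "cc g \<Longrightarrow> integrable (dens \<rho>) g"
  using cc_integrable[OF cc_mult_right[OF _ weight_continuous], of g] cc_measurable[of g] by (simp add: integrable_dens)

abbreviation "L2w \<equiv> L2_space (dens \<rho>)"
abbreviation "tendsw \<equiv> l2_tends (dens \<rho>)"
abbreviation "sq F \<equiv> LINT z|dens \<rho>. (F z)\<^sup>2"

end

section \<open>Matrix bounds and the evolution family\<close>

lemma bounded_bilinear_matrix_vector:
  "bounded_bilinear ((*v) :: real ^ 'n ^ 'm \<Rightarrow> real ^ 'n \<Rightarrow> real ^ 'm)"
  unfolding bilinear_conv_bounded_bilinear[symmetric] bilinear_def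
  by (auto simp: linear_iff matrix_vector_mult_add_rdistrib matrix_vector_right_distrib
    scaleR_matrix_vector_assoc matrix_vector_mult_scaleR)

lemma bounded_bilinear_matrix_matrix:
  "bounded_bilinear ((**) :: real ^ 'n ^ 'm \<Rightarrow> real ^ 'k ^ 'n \<Rightarrow> real ^ 'k ^ 'm)"
  unfolding bilinear_conv_bounded_bilinear[symmetric] bilinear_def
  by (auto simp: linear_iff vec_eq_iff matrix_matrix_mult_def sum.distrib sum_distrib_left algebra_simps)

lemma bounded_linear_transpose: "bounded_linear (transpose :: real ^ 'n ^ 'm \<Rightarrow> real ^ 'm ^ 'n)"
  unfolding linear_conv_bounded_linear[symmetric] by (auto simp: linear_iff transpose_def vec_eq_iff)

lemma norm_transpose_mult_le:
  fixes M :: "real ^ 'n ^ 'm"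
  assumes "\<And>x. norm (M *v x) \<le> C * norm x" shows "norm (transpose M *v y) \<le> C * norm y"
proof (cases "transpose M *v y = 0")
  case True
  \<comment> \<open>The sign of \<open>C\<close> is extracted from the hypothesis at one unit
    vector.\<close>
  have "0 \<le> C * norm (axis undefined 1 :: real ^ 'n)" using assms[of "axis undefined 1"] norm_ge_zero order_trans by blast
  then have "0 \<le> C" by simp
  then show ?thesis using True by simp
next
  case False
  let ?z = "transpose M *v y"
  have "norm ?z * norm ?z = (M *v ?z) \<bullet> y" by (metis dot_lmul_matrix dot_square_norm inner_commute power2_eq_square transpose_matrix_vector)
  also have "\<dots> \<le> norm (M *v ?z) * norm y" by (rule norm_cauchy_schwarz)
  also have "\<dots> \<le> C * norm ?z * norm y" by (intro mult_right_mono assms) simp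
  finally have "norm ?z * norm ?z \<le> norm ?z * (C * norm y)" by (simp add: mult_ac)
  then show ?thesis using False by simp
qed

text \<open>Bounds are obtained for operators, whereas integrability and limits of matrix functions
  refer to the norm of the type; comparing entries links the two.\<close>

lemma norm_matrix_le:
  fixes M :: "real ^ 'n ^ 'm"
  assumes "\<And>x. norm (M *v x) \<le> C * norm x"
  shows "norm M \<le> real CARD('m) * (real CARD('n) * C)"
proof -
  have e: "\<bar>M $ i $ j\<bar> \<le> C" for i j
  proof -
   have "\<bar>(M *v axis j 1) $ i\<bar> \<le> norm (M *v axis j 1)" by (rule component_le_norm_cart)
   also have "\<dots> \<le> C" using assms[of "axis j 1"] by simp
   finally show ?thesis by (simp add: matrix_vector_mult_basis column_def)
  qed
  have "norm M \<le> (\<Sum>i\<in>UNIV. norm (M $ i))" unfolding norm_vec_def by (rule L2_set_le_sum) simp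
  also have "\<dots> \<le> (\<Sum>i\<in>(UNIV::'m set). real CARD('n) * C)"
  proof (rule sum_mono)
   fix i
   have "norm (M $ i) \<le> (\<Sum>j\<in>UNIV. \<bar>M $ i $ j\<bar>)" by (rule norm_le_l1_cart)
   also have "\<dots> \<le> (\<Sum>j\<in>(UNIV::'n set). C)" by (intro sum_mono e)
   finally show "norm (M $ i) \<le> real CARD('n) * C" by simp
  qed
  finally show ?thesis by simp
qed

text \<open>Both time directions are needed, since \<open>U t s\<close> is used for
  \<open>t < s\<close> too: one exponential factor makes the function decrease, the opposite one
  makes it increase.\<close>

lemma gronwall:
  fixes \<phi> :: "real \<Rightarrow> real"
  assumes d: "\<And>t. (\<phi> has_real_derivative \<phi>' t) (at t)" and b: "\<And>t. \<bar>\<phi>' t\<bar> \<le> L * \<phi> t"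
  shows "\<phi> t \<le> exp (L * \<bar>t - s\<bar>) * \<phi> s"
proof (cases "s \<le> t")
  case True
  have "\<phi> t * exp (- L * t) \<le> \<phi> s * exp (- L * s)"
  proof (rule DERIV_nonpos_imp_nonincreasing[OF True])
   fix x
   have "((\<lambda>x. \<phi> x * exp (- L * x)) has_real_derivative (\<phi>' x - L * \<phi> x) * exp (- L * x)) (at x)"
    by (auto intro!: derivative_eq_intros d simp: algebra_simps)
   moreover have "(\<phi>' x - L * \<phi> x) * exp (- L * x) \<le> 0" using b[of x] by (intro mult_nonpos_nonneg) auto
   ultimately show "\<exists>y. ((\<lambda>x. \<phi> x * exp (- L * x)) has_real_derivative y) (at x) \<and> y \<le> 0" by blast
  qed
  then have "\<phi> t * exp (- L * t) * exp (L * t) \<le> \<phi> s * exp (- L * s) * exp (L * t)" by (rule mult_right_mono) simp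
  then have "\<phi> t \<le> \<phi> s * (exp (- L * s) * exp (L * t))" by (simp add: exp_minus mult.assoc)
  then show ?thesis using True by (simp add: algebra_simps flip: exp_add)
next
  case False
  then have "t \<le> s" by simp
  have "\<phi> t * exp (L * t) \<le> \<phi> s * exp (L * s)"
  proof (rule DERIV_nonneg_imp_nondecreasing[OF \<open>t \<le> s\<close>])
   fix x
   have "((\<lambda>x. \<phi> x * exp (L * x)) has_real_derivative (\<phi>' x + L * \<phi> x) * exp (L * x)) (at x)"
    by (auto intro!: derivative_eq_intros d simp: algebra_simps)
   moreover have "(\<phi>' x + L * \<phi> x) * exp (L * x) \<ge> 0" using b[of x] by (intro mult_nonneg_nonneg) auto
   ultimately show "\<exists>y. ((\<lambda>x. \<phi> x * exp (L * x)) has_real_derivative y) (at x) \<and> y \<ge> 0" by blast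
  qed
  then have "\<phi> t * exp (L * t) * exp (- L * t) \<le> \<phi> s * exp (L * s) * exp (- L * t)" by (rule mult_right_mono) simp
  then have "\<phi> t \<le> \<phi> s * (exp (L * s) * exp (- L * t))" by (simp add: exp_minus mult.assoc)
  then show ?thesis using False by (simp add: algebra_simps flip: exp_add)
qed

text \<open>Up to the factor 1/\<kappa> this is the density of the exponential distribution
  reflected at \<open>t\<close>, whose total mass is 1.\<close>

lemma integrable_exponential_left:
  assumes "\<kappa> > (0::real)"
  shows "integrable lborel (\<lambda>r. indicator {..t} r * exp (- \<kappa> * (t - r)))"
   "(LINT r|lborel. indicator {..t} r * exp (- \<kappa> * (t - r))) = 1 / \<kappa>"
proof -
  let ?f = "\<lambda>x. exponential_density \<kappa> x"
  have nn: "(\<integral>\<^sup>+ x. ennreal (?f x) \<partial>lborel) = 1"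
   using prob_space.emeasure_space_1[OF prob_space_exponential_density[OF assms]] by (simp add: emeasure_density)
  have pos: "0 \<le> ?f x" for x using assms by (simp add: exponential_density_def)
  have i: "integrable lborel ?f" using nn pos by (intro integrableI_nonneg) auto
  have v: "(LINT x|lborel. ?f x) = 1" using nn nn_integral_eq_integral[OF i] pos by simp
  have eq: "indicator {..t} r * exp (- \<kappa> * (t - r)) = (1 / \<kappa>) * ?f (t + (-1) * r)" for r
   using assms by (auto simp: indicator_def exponential_density_def algebra_simps)
  have "integrable lborel (\<lambda>r. ?f (t + (-1) * r))" using lborel_integrable_real_affine[OF i, of "-1" t] by simp
  then show "integrable lborel (\<lambda>r. indicator {..t} r * exp (- \<kappa> * (t - r)))" unfolding eq by (rule integrable_mult_right)
  have "(LINT r|lborel. ?f (t + (-1) * r)) = 1" using lborel_integral_real_affine[of "-1" ?f t] v by simp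
  then show "(LINT r|lborel. indicator {..t} r * exp (- \<kappa> * (t - r))) = 1 / \<kappa>" unfolding eq by simp
qed

lemma set_integrable_exponential_bound:
  fixes h :: "real \<Rightarrow> 'b::euclidean_space"
  assumes \<kappa>: "\<kappa> > 0" and h: "continuous_on UNIV h" and b: "\<And>r. r \<le> t \<Longrightarrow> norm (h r) \<le> C * exp (- \<kappa> * (t - r))"
  shows "set_integrable lborel {..t} h" "norm (LINT r:{..t}|lborel. h r) \<le> C / \<kappa>"
proof -
  note e = integrable_exponential_left[OF \<kappa>, of t]
  have i: "integrable lborel (\<lambda>r. C * (indicator {..t} r * exp (- \<kappa> * (t - r))))" using e by simp
  have le: "norm (indicator {..t} r *\<^sub>R h r) \<le> C * (indicator {..t} r * exp (- \<kappa> * (t - r)))" for r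
   using b[of r] by (auto simp: indicator_def)
  have hm: "(\<lambda>r. indicator {..t} r *\<^sub>R h r) \<in> borel_measurable lborel" using borel_measurable_continuous_onI[OF h] by measurable
  show si: "set_integrable lborel {..t} h" unfolding set_integrable_def
   by (rule Bochner_Integration.integrable_bound[OF i hm]) (use le order_trans[OF _ abs_ge_self] in \<open>force intro!: AE_I2\<close>)
  have "norm (LINT r:{..t}|lborel. h r) \<le> (LINT r|lborel. C * (indicator {..t} r * exp (- \<kappa> * (t - r))))"
   unfolding set_lebesgue_integral_def by (rule Bochner_Integration.integral_norm_bound_integral) (use si i le in \<open>auto simp: set_integrable_def\<close>)
  then show "norm (LINT r:{..t}|lborel. h r) \<le> C / \<kappa>" using e by simp
qed

lemma set_integral_atMost_has_vector_derivative:
  fixes h :: "real \<Rightarrow> 'b::euclidean_space"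
  assumes h: "continuous_on UNIV h" and i: "\<And>t. set_integrable lborel {..t} h"
  shows "((\<lambda>t. LINT r:{..t}|lborel. h r) has_vector_derivative h t) (at t)"
proof -
  \<comment> \<open>Only a neighbourhood of \<open>t\<close> matters: splitting at
    \<open>t - 1\<close> leaves a constant and an integral over a compact interval, to which the
    fundamental theorem of calculus applies.\<close>
  define a b where "a = t - 1" and "b = t + 1"
  have eq: "(LINT r:{..u}|lborel. h r) = (LINT r:{..a}|lborel. h r) + integral {a..u} h" if "u \<in> {a<..<b}" for u
  proof -
   have "(LINT r:{..u}|lborel. h r) = (LINT r:{..a} \<union> {a<..u}|lborel. h r)"
    by (rule arg_cong[where f="\<lambda>S. LINT r:S|lborel. h r"]) (use that in auto)
   also have "\<dots> = (LINT r:{..a}|lborel. h r) + (LINT r:{a<..u}|lborel. h r)"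
    by (rule set_integral_Un) (auto intro: set_integrable_subset[OF i[of u]] i)
   also have "(LINT r:{a<..u}|lborel. h r) = integral {a<..u} h"
    by (rule set_borel_integral_eq_integral) (auto intro: set_integrable_subset[OF i[of u]])
   also have "\<dots> = integral {a..u} h" by (rule integral_spike_set) (auto intro: negligible_subset[OF negligible_sing[of a]])
   finally show ?thesis .
  qed
  have "((\<lambda>u. integral {a..u} h) has_vector_derivative h t) (at t within {a..b})"
   by (rule integral_has_vector_derivative) (auto simp: a_def b_def intro: continuous_on_subset[OF h])
  moreover have "at t within {a..b} = at t" by (rule at_within_interior) (simp add: a_def b_def)
  ultimately have d: "((\<lambda>u. integral {a..u} h) has_vector_derivative h t) (at t)" by simp
  have "((\<lambda>u. (LINT r:{..a}|lborel. h r) + integral {a..u} h) has_vector_derivative h t) (at t)"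
   using has_vector_derivative_add[OF has_vector_derivative_const d] by simp
  then show ?thesis by (rule has_vector_derivative_transform_within_open[of _ _ _ "{a<..<b}"]) (auto simp: eq a_def b_def)
qed

text \<open>A resolvent-type identity plus local boundedness gives continuity. It serves for the
  second argument of \<open>U\<close> and for the inverse covariance \<open>P\<close>, both inverses
  of functions known to be continuous.\<close>

lemma tendsto_matrix_perturbation:
  fixes N D :: "real \<Rightarrow> real ^ 'n ^ 'n"
  assumes eq: "\<And>s. N s - N r = N s ** (D s ** N r)" and D: "(D \<longlongrightarrow> 0) (at r)" and b: "\<forall>\<^sub>F s in at r. norm (N s) \<le> C"
  shows "(N \<longlongrightarrow> N r) (at r)"
proof -
  obtain K where K: "K > 0" "\<And>(M::real^'n^'n) (L::real^'n^'n). norm (M ** L) \<le> norm M * norm L * K"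
   using bounded_bilinear.pos_bounded[OF bounded_bilinear_matrix_matrix] by blast
  have "((\<lambda>s. N s - N r) \<longlongrightarrow> 0) (at r)"
  proof (rule Lim_null_comparison)
   show "\<forall>\<^sub>F s in at r. norm (N s - N r) \<le> C * (norm (D s) * norm (N r) * K) * K" using b
   proof eventually_elim
    case (elim s)
    have "norm (N s - N r) \<le> norm (N s) * norm (D s ** N r) * K" unfolding eq[of s] by (rule K)
    also have "\<dots> \<le> C * (norm (D s) * norm (N r) * K) * K"
     using K(1) by (intro mult_right_mono mult_mono elim K(2)) (auto intro: order_trans[OF norm_ge_zero elim])
    finally show ?case .
   qed
   show "((\<lambda>s. C * (norm (D s) * norm (N r) * K) * K) \<longlongrightarrow> 0) (at r)"
    by (intro tendsto_mult_left_zero tendsto_mult_right_zero tendsto_norm_zero D)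
  qed
  then show ?thesis by (subst Lim_null)
qed

locale ou_family =
  fixes A B :: "real \<Rightarrow> real ^ 'n ^ 'n" and f :: "real \<Rightarrow> real ^ 'n"
   and U :: "real \<Rightarrow> real \<Rightarrow> real ^ 'n ^ 'n" and \<mu>0 :: real
  assumes A_continuous: "continuous_on UNIV A" and A_bounded: "bounded (range A)"
   and B_continuous: "continuous_on UNIV B" and B_bounded: "bounded (range B)"
   and f_continuous: "continuous_on UNIV f" and f_bounded: "bounded (range f)"
   and \<mu>0_pos: "\<mu>0 > 0" and B_lower: "\<And>t x. norm (B t *v x) \<ge> \<mu>0 * norm x"
   and U_evolution: "evolution_family A U" and U_decay: "growth_bound U < 0"
begin

lemmas continuous_intros_matrix =
  bounded_bilinear.continuous_on[OF bounded_bilinear_matrix_vector]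
  bounded_bilinear.continuous_on[OF bounded_bilinear_matrix_matrix]
  bounded_linear.continuous_on[OF bounded_linear_transpose]

lemma ex_operator_bound:
  fixes M :: "real \<Rightarrow> real ^ 'n ^ 'n"
  assumes "bounded (range M)" shows "\<exists>K>0. \<forall>t x. norm (M t *v x) \<le> K * norm x"
proof -
  obtain K1 where K1: "K1 > 0" "\<And>(N::real^'n^'n) x. norm (N *v x) \<le> norm N * norm x * K1"
   using bounded_bilinear.pos_bounded[OF bounded_bilinear_matrix_vector] by blast
  obtain K2 where K2: "K2 > 0" "\<And>t. norm (M t) \<le> K2" using assms unfolding bounded_pos by auto
  have "norm (M t *v x) \<le> K2 * K1 * norm x" for t x
  proof -
   have "norm (M t) * norm x * K1 \<le> K2 * norm x * K1" using K2(2)[of t] K1(1) by (intro mult_right_mono) auto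
   then show ?thesis using K1(2)[of "M t" x] by (simp add: mult_ac)
  qed
  then show ?thesis using K1 K2 by (intro exI[of _ "K2 * K1"]) auto
qed

definition "KA = (SOME K. K > 0 \<and> (\<forall>t x. norm (A t *v x) \<le> K * norm x))"

lemma KA: "KA > 0" "norm (A t *v x) \<le> KA * norm x" unfolding KA_def using someI_ex[OF ex_operator_bound[OF A_bounded]] by auto

lemma U_refl: "U s s = mat 1" using U_evolution by (simp add: evolution_family_def)

lemma U_deriv: "((\<lambda>r. U r s) has_vector_derivative (A t ** U t s)) (at t)" using U_evolution by (simp add: evolution_family_def)

lemma U_vec_deriv: "((\<lambda>r. U r s *v x) has_vector_derivative (A t *v (U t s *v x))) (at t)"
  using bounded_linear.has_vector_derivative[OF bounded_bilinear.bounded_linear_left[OF bounded_bilinear_matrix_vector] U_deriv]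
  by (simp add: matrix_vector_mul_assoc)

text \<open>Gronwall for the squared norm. The case of zero data at \<open>s\<close> is uniqueness
  for the linear equation.\<close>

lemma solution_bound:
  assumes w: "\<And>t. (w has_vector_derivative (A t *v w t)) (at t)"
  shows "norm (w t) \<le> exp (KA * \<bar>t - s\<bar>) * norm (w s)"
proof -
  have "(w t \<bullet> w t) \<le> exp (2 * KA * \<bar>t - s\<bar>) * (w s \<bullet> w s)"
  proof (rule gronwall)
   fix t
   have "((\<lambda>t. w t \<bullet> w t) has_derivative (\<lambda>h. w t \<bullet> (h *\<^sub>R (A t *v w t)) + (h *\<^sub>R (A t *v w t)) \<bullet> w t)) (at t)"
    using w[of t] unfolding has_vector_derivative_def by (intro has_derivative_inner)
   moreover have "(\<lambda>h. w t \<bullet> (h *\<^sub>R (A t *v w t)) + (h *\<^sub>R (A t *v w t)) \<bullet> w t) = (*) (2 * (w t \<bullet> (A t *v w t)))"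
    by (rule ext) (simp add: inner_commute)
   ultimately show "((\<lambda>t. w t \<bullet> w t) has_real_derivative 2 * (w t \<bullet> (A t *v w t))) (at t)"
    by (simp add: has_field_derivative_def)
   have "\<bar>w t \<bullet> (A t *v w t)\<bar> \<le> norm (w t) * norm (A t *v w t)" by (rule Cauchy_Schwarz_ineq2)
   also have "\<dots> \<le> norm (w t) * (KA * norm (w t))" by (intro mult_left_mono KA) simp
   finally show "\<bar>2 * (w t \<bullet> (A t *v w t))\<bar> \<le> 2 * KA * (w t \<bullet> w t)"
    by (simp add: dot_square_norm power2_eq_square mult_ac)
  qed
  also have "\<dots> = (exp (KA * \<bar>t - s\<bar>) * norm (w s))\<^sup>2"
   by (simp add: power_mult_distrib dot_square_norm exp_double[symmetric] mult.assoc)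
  finally have "(norm (w t))\<^sup>2 \<le> (exp (KA * \<bar>t - s\<bar>) * norm (w s))\<^sup>2" by (simp add: dot_square_norm)
  then show ?thesis by (rule power2_le_imp_le) simp
qed

lemma U_bound: "norm (U t s *v x) \<le> exp (KA * \<bar>t - s\<bar>) * norm x"
  using solution_bound[where w="\<lambda>r. U r s *v x" and s=s and t=t, OF U_vec_deriv] by (simp add: U_refl)

text \<open>Both sides solve the same equation in \<open>t\<close> and agree at
  \<open>t = s\<close>; their difference is bounded by a multiple of 0.\<close>

lemma U_cocycle: "U t s ** U s r = U t r"
proof -
  have "U t s *v (U s r *v x) = U t r *v x" for x
  proof -
   have d: "((\<lambda>t. U t s *v (U s r *v x) - U t r *v x) has_vector_derivative
     (A t *v (U t s *v (U s r *v x) - U t r *v x))) (at t)" for t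
    using has_vector_derivative_diff[OF U_vec_deriv U_vec_deriv] by (simp add: matrix_vector_mult_diff_distrib)
   show ?thesis using solution_bound[OF d, where s=s and t=t] by (simp add: U_refl)
  qed
  then show ?thesis by (simp add: matrix_eq matrix_vector_mul_assoc)
qed

lemma U_inverse: "U t s ** U s t = mat 1" by (simp add: U_cocycle U_refl)

text \<open>The equation controls the first argument only. Continuity in the second comes from
  \<open>U s r\<close> being the inverse of \<open>U r s\<close>.\<close>

lemma U_continuous_right: "continuous_on UNIV (\<lambda>r. U s r)"
proof (rule continuous_at_imp_continuous_on, rule ballI)
  fix r :: real
  have b: "\<forall>\<^sub>F r' in at r. norm (U s r') \<le> real CARD('n) * (real CARD('n) * exp (KA * (\<bar>s - r\<bar> + 1)))"
   using eventually_at_in_open'[OF open_ball centre_in_ball[of r 1, THEN iffD2, OF zero_less_one]]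
  proof eventually_elim
   case (elim r')
   show ?case
   proof (rule norm_matrix_le)
    fix x
    have "\<bar>s - r'\<bar> \<le> \<bar>s - r\<bar> + 1" using elim unfolding mem_ball dist_real_def by linarith
    then have "exp (KA * \<bar>s - r'\<bar>) \<le> exp (KA * (\<bar>s - r\<bar> + 1))" using KA(1) by simp
    then show "norm (U s r' *v x) \<le> exp (KA * (\<bar>s - r\<bar> + 1)) * norm x"
     using U_bound[of s r' x] mult_right_mono[OF _ norm_ge_zero[of x]] by (meson order_trans)
   qed
  qed
  have eq: "U s r' - U s r = U s r' ** ((U r s - U r' s) ** U s r)" for r' by (simp add: bounded_bilinear.diff_left[OF bounded_bilinear_matrix_matrix]
     bounded_bilinear.diff_right[OF bounded_bilinear_matrix_matrix] U_inverse U_cocycle)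
  have "((\<lambda>r'. U r' s) \<longlongrightarrow> U r s) (at r)" using U_deriv[of s r] has_vector_derivative_continuous continuous_within by blast
  from tendsto_diff[OF tendsto_const[of "U r s"] this] have "((\<lambda>r'. U r s - U r' s) \<longlongrightarrow> 0) (at r)" by simp
  from tendsto_matrix_perturbation[OF eq this b] show "isCont (\<lambda>r. U s r) r" by (simp add: isCont_def)
qed

lemma ex_decay: "\<exists>\<kappa>>0. \<exists>M>0. \<forall>s t x. s \<le> t \<longrightarrow> norm (U t s *v x) \<le> M * exp (- \<kappa> * (t - s)) * norm x"
proof -
  obtain \<omega> M where \<omega>: "\<omega> < 0" "\<And>s t. s \<le> t \<Longrightarrow> onorm (\<lambda>x. U t s *v x) \<le> M * exp (\<omega> * (t - s))"
  proof -
   obtain \<omega> where "ereal \<omega> < 0" "\<exists>M::real. \<forall>s t. s \<le> t \<longrightarrow> onorm (\<lambda>x. U t s *v x) \<le> M * exp (\<omega> * (t - s))"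
    using U_decay unfolding growth_bound_def Inf_less_iff by blast
   then obtain M where "\<forall>s t. s \<le> t \<longrightarrow> onorm (\<lambda>x. U t s *v x) \<le> M * exp (\<omega> * (t - s))" by blast
   moreover have "\<omega> < 0" using \<open>ereal \<omega> < 0\<close> by (simp add: zero_ereal_def)
   ultimately show ?thesis by (intro that[of \<omega> M]) simp_all
  qed
  \<comment> \<open>\<open>\<bar>M\<bar> + 1\<close> makes the constant positive whatever the sign
    of \<open>M\<close>.\<close>
  have "norm (U t s *v x) \<le> (\<bar>M\<bar> + 1) * exp (- (- \<omega>) * (t - s)) * norm x" if "s \<le> t" for s t x
  proof -
   have "norm (U t s *v x) \<le> onorm (\<lambda>x. U t s *v x) * norm x" by (rule onorm) simp
   also have "\<dots> \<le> (M * exp (\<omega> * (t - s))) * norm x" by (intro mult_right_mono \<omega> that) simp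
   also have "\<dots> \<le> ((\<bar>M\<bar> + 1) * exp (- (- \<omega>) * (t - s))) * norm x" by (intro mult_right_mono) auto
   finally show ?thesis .
  qed
  then show ?thesis using \<omega>(1) by (intro exI[of _ "-\<omega>"] conjI exI[of _ "\<bar>M\<bar> + 1"]) auto
qed

definition "C t = B t ** transpose (B t)"
definition "g t = gvec U f t (- \<infinity>)"
definition "Q t = Qmat U B t (- \<infinity>)"

lemma C_continuous: "continuous_on UNIV C" unfolding C_def[abs_def] by (intro continuous_intros_matrix B_continuous)

lemma f_along: "continuous_on UNIV (\<lambda>r. U s r *v f r)" by (intro continuous_intros_matrix U_continuous_right f_continuous)

lemma C_along: "continuous_on UNIV (\<lambda>r. U s r ** C r ** transpose (U s r))"
  by (intro continuous_intros_matrix U_continuous_right C_continuous)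

text \<open>The first index \<open>s\<close> is kept apart from the upper limit \<open>t\<close>, so
  that the dependence on \<open>t\<close> can later be factored out through \<open>U t 0\<close>;
  the bound on the integrals then uses \<open>s = t\<close>.\<close>

lemma f_integrable: "set_integrable lborel {..t} (\<lambda>r. U s r *v f r)"
  and C_integrable: "set_integrable lborel {..t} (\<lambda>r. U s r ** C r ** transpose (U s r))"
  and g_Q_bounded: "\<exists>K. \<forall>t. norm (g t) \<le> K \<and> norm (Q t) \<le> K"
proof -
  obtain \<kappa> M where \<kappa>: "\<kappa> > 0" "M > 0" and d: "\<And>s t x. s \<le> t \<Longrightarrow> norm (U t s *v x) \<le> M * exp (- \<kappa> * (t - s)) * norm x"
   using ex_decay by blast
  obtain Kf where Kf: "Kf > 0" "\<And>t. norm (f t) \<le> Kf" using f_bounded unfolding bounded_pos by auto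
  obtain KB where KB: "KB > 0" "\<And>t x. norm (B t *v x) \<le> KB * norm x" using ex_operator_bound[OF B_bounded] by auto
  \<comment> \<open>For r \<le> t the factorisation U(s,r) = U(s,t) U(t,r) leaves the exponential
    decay times this constant; \<open>V\<close> adds the two factors of \<open>B\<close> and the
    passage from operator norm to matrix norm.\<close>
  define W where "W = (\<lambda>s t. exp (KA * \<bar>s - t\<bar>) * M)"
  define V where "V = (\<lambda>w. real CARD('n) * (real CARD('n) * (w * (KB * (KB * w)))))"
  have W: "W s t > 0" "W t t = M" for s t using \<kappa> by (simp_all add: W_def)
  have u: "norm (U s r *v v) \<le> W s t * exp (- \<kappa> * (t - r)) * norm v" if "r \<le> t" for s r t v
  proof -
   have "norm (U s r *v v) = norm (U s t *v (U t r *v v))" by (simp add: matrix_vector_mul_assoc U_cocycle)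
   also have "\<dots> \<le> exp (KA * \<bar>s - t\<bar>) * (M * exp (- \<kappa> * (t - r)) * norm v)"
    by (rule order_trans[OF U_bound]) (intro mult_left_mono d that, simp)
   finally show ?thesis by (simp add: W_def mult_ac)
  qed
  have 1: "norm (U s r *v f r) \<le> W s t * Kf * exp (- \<kappa> * (t - r))" if "r \<le> t" for s r t
  proof -
   have "W s t * exp (- \<kappa> * (t - r)) * norm (f r) \<le> W s t * exp (- \<kappa> * (t - r)) * Kf"
    using W(1)[of s t] by (intro mult_left_mono Kf) (simp add: less_imp_le)
   then show ?thesis using u[OF that, of s "f r"] by (simp add: mult_ac)
  qed
  have 2: "norm (U s r ** C r ** transpose (U s r)) \<le> V (W s t) * exp (- \<kappa> * (t - r))" if "r \<le> t" for s r t
  proof -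
   \<comment> \<open>One exponential factor is enough for integrability, so the transposed factor is
     only bounded.\<close>
   have u': "norm (U s r *v v) \<le> W s t * norm v" for v
   proof (rule order_trans[OF u[OF that]])
    have "exp (- \<kappa> * (t - r)) \<le> 1" using \<kappa> that by simp
    then have "W s t * exp (- \<kappa> * (t - r)) \<le> W s t * 1" using W(1)[of s t] by (intro mult_left_mono) auto
    then show "W s t * exp (- \<kappa> * (t - r)) * norm v \<le> W s t * norm v" by (intro mult_right_mono) auto
   qed
   have "norm ((U s r ** C r ** transpose (U s r)) *v x) \<le> (W s t * exp (- \<kappa> * (t - r))) * (KB * (KB * (W s t * norm x)))" for x
   proof -
    have "norm ((U s r ** C r ** transpose (U s r)) *v x) = norm (U s r *v (B r *v (transpose (B r) *v (transpose (U s r) *v x))))"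
     by (simp only: C_def matrix_vector_mul_assoc matrix_mul_assoc)
    also have "\<dots> \<le> (W s t * exp (- \<kappa> * (t - r))) * norm (B r *v (transpose (B r) *v (transpose (U s r) *v x)))" by (rule u[OF that])
    also have "\<dots> \<le> (W s t * exp (- \<kappa> * (t - r))) * (KB * (KB * (W s t * norm x)))"
     using W(1)[of s t] KB by (intro mult_left_mono order_trans[OF KB(2)] order_trans[OF norm_transpose_mult_le[OF KB(2)]]
      norm_transpose_mult_le[OF u']) (auto simp: less_imp_le)
    finally show ?thesis .
   qed
   then show ?thesis using norm_matrix_le[of "U s r ** C r ** transpose (U s r)" "(W s t * exp (- \<kappa> * (t - r))) * (KB * (KB * W s t))"]
    by (simp add: V_def mult_ac)
  qed
  show "set_integrable lborel {..t} (\<lambda>r. U s r *v f r)" by (rule set_integrable_exponential_bound(1)[OF \<kappa>(1) f_along 1])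
  show "set_integrable lborel {..t} (\<lambda>r. U s r ** C r ** transpose (U s r))" by (rule set_integrable_exponential_bound(1)[OF \<kappa>(1) C_along 2])
  have "norm (g t) \<le> M * Kf / \<kappa>" "norm (Q t) \<le> V M / \<kappa>" for t
   using set_integrable_exponential_bound(2)[OF \<kappa>(1) f_along 1, of t t] set_integrable_exponential_bound(2)[OF \<kappa>(1) C_along 2, of t t]
   unfolding g_def gvec_def Q_def Qmat_def by (simp_all add: atMost_def C_def matrix_mul_assoc W)
  then show "\<exists>K. \<forall>t. norm (g t) \<le> K \<and> norm (Q t) \<le> K" by (intro exI[of _ "max (M * Kf / \<kappa>) (V M / \<kappa>)"]) (simp add: le_max_iff_disj)
qed

lemma set_integral_bounded_linear:
  fixes T :: "'b::euclidean_space \<Rightarrow> 'c::euclidean_space"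
  assumes "bounded_linear T" "set_integrable M S h"
  shows "(LINT r:S|M. T (h r)) = T (LINT r:S|M. h r)"
  using integral_bounded_linear[OF assms(1), of M "\<lambda>r. indicator S r *\<^sub>R h r"] assms(2)
  by (simp add: set_lebesgue_integral_def set_integrable_def linear_simps[OF assms(1)])

text \<open>The integrand depends on \<open>t\<close>; writing \<open>U t r = U t 0 ** U 0 r\<close>
  moves that dependence outside, and only a product of a known derivative and a primitive has to be
  differentiated.\<close>

lemma g_deriv: "(g has_vector_derivative (A t *v g t + f t)) (at t)"
proof -
  have eq: "g t = U t 0 *v (LINT r:{..t}|lborel. U 0 r *v f r)" for t
  proof -
   have "g t = (LINT r:{..t}|lborel. U t 0 *v (U 0 r *v f r))" by (simp add: g_def gvec_def atMost_def matrix_vector_mul_assoc U_cocycle)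
   then show ?thesis by (simp add: set_integral_bounded_linear[OF matrix_vector_mul_bounded_linear f_integrable])
  qed
  have "((\<lambda>t. U t 0 *v (LINT r:{..t}|lborel. U 0 r *v f r)) has_vector_derivative
   (U t 0 *v (U 0 t *v f t) + (A t ** U t 0) *v (LINT r:{..t}|lborel. U 0 r *v f r))) (at t)"
   by (intro bounded_bilinear.has_vector_derivative[OF bounded_bilinear_matrix_vector] U_deriv
     set_integral_atMost_has_vector_derivative f_along f_integrable)
  then show ?thesis unfolding eq[abs_def] by (simp add: matrix_vector_mul_assoc U_inverse add.commute matrix_mul_assoc)
qed

text \<open>The same factorisation, with conjugation by \<open>U t 0\<close>. The outcome is the
  differential Lyapunov equation on which the cancellation of \<open>A\<close> rests.\<close>

lemma Q_deriv: "(Q has_vector_derivative (A t ** Q t + Q t ** transpose (A t) + C t)) (at t)"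
proof -
  let ?N = "\<lambda>t. LINT r:{..t}|lborel. U 0 r ** C r ** transpose (U 0 r)"
  have eq: "Q t = U t 0 ** (?N t ** transpose (U t 0))" for t
  proof -
   let ?T = "\<lambda>M. U t 0 ** (M ** transpose (U t 0))"
   have T: "bounded_linear ?T" by (rule bounded_linear_compose[OF bounded_bilinear.bounded_linear_right[OF bounded_bilinear_matrix_matrix]
      bounded_bilinear.bounded_linear_left[OF bounded_bilinear_matrix_matrix]])
   have "U t r ** C r ** transpose (U t r) = ?T (U 0 r ** C r ** transpose (U 0 r))" for r
    by (subst (1 2) U_cocycle[of t 0 r, symmetric]) (simp only: matrix_transpose_mul matrix_mul_assoc)
   then have "Q t = (LINT r:{..t}|lborel. ?T (U 0 r ** C r ** transpose (U 0 r)))" by (simp add: Q_def Qmat_def atMost_def C_def matrix_mul_assoc)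
   then show ?thesis by (simp only: set_integral_bounded_linear[OF T C_integrable])
  qed
  have dT: "((\<lambda>t. transpose (U t 0)) has_vector_derivative (transpose (A t ** U t 0))) (at t)"
   by (rule bounded_linear.has_vector_derivative[OF bounded_linear_transpose U_deriv])
  have dN: "(?N has_vector_derivative (U 0 t ** C t ** transpose (U 0 t))) (at t)"
   by (rule set_integral_atMost_has_vector_derivative[OF C_along C_integrable])
  have "((\<lambda>t. U t 0 ** (?N t ** transpose (U t 0))) has_vector_derivative
   (U t 0 ** (?N t ** transpose (A t ** U t 0) + (U 0 t ** C t ** transpose (U 0 t)) ** transpose (U t 0))
    + (A t ** U t 0) ** (?N t ** transpose (U t 0)))) (at t)"
   by (intro bounded_bilinear.has_vector_derivative[OF bounded_bilinear_matrix_matrix] U_deriv dT dN)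
  moreover have "U t 0 ** ((U 0 t ** C t ** transpose (U 0 t)) ** transpose (U t 0)) = C t"
  proof -
   have "transpose (U 0 t) ** transpose (U t 0) = mat 1" by (simp add: matrix_transpose_mul[symmetric] U_inverse transpose_mat)
   then show ?thesis by (metis (no_types, lifting) matrix_mul_assoc matrix_mul_lid matrix_mul_rid U_inverse)
  qed
  ultimately show ?thesis unfolding eq[abs_def] by (simp add: matrix_add_ldistrib matrix_transpose_mul matrix_mul_assoc add_ac)
qed

end

section \<open>Determinants, inverses and nondegeneracy of the covariance\<close>

lemma norm_le_transpose_if_inverse:
  fixes M N :: "real ^ 'n ^ 'n"
  assumes "M ** N = mat 1" "\<And>y. norm (N *v y) \<le> c * norm y"
  shows "norm x \<le> c * norm (transpose M *v x)"
proof -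
  have "transpose N ** transpose M = mat 1" using assms(1) by (metis matrix_transpose_mul transpose_mat)
  then have "x = transpose N *v (transpose M *v x)" by (simp only: matrix_vector_mul_assoc matrix_vector_mul_lid)
  then show ?thesis using norm_transpose_mult_le[OF assms(2), of "transpose M *v x"] by (simp only:)
qed

lemma inner_transpose_mult: "x \<bullet> (M *v y) = (transpose M *v x) \<bullet> (y :: real ^ 'n)"
  for x :: "real ^ 'm" by (metis dot_lmul_matrix inner_commute transpose_matrix_vector)

lemma matrix_inv_right: "invertible M \<Longrightarrow> M ** matrix_inv M = mat 1"
  and matrix_inv_left: "invertible M \<Longrightarrow> matrix_inv M ** M = mat 1" for M :: "real ^ 'n ^ 'n"
  unfolding invertible_def matrix_inv_def by (drule someI_ex, simp)+

lemma has_vector_derivative_iff_tendsto: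
  fixes f :: "real \<Rightarrow> 'b::real_normed_vector"
  shows "(f has_vector_derivative d) (at t) \<longleftrightarrow> ((\<lambda>s. (1 / (s - t)) *\<^sub>R (f s - f t)) \<longlongrightarrow> d) (at t)"
proof -
  have "(f has_vector_derivative d) (at t) \<longleftrightarrow> ((\<lambda>s. norm (f s - f t - (s - t) *\<^sub>R d) / norm (s - t)) \<longlongrightarrow> 0) (at t)"
   by (simp add: has_vector_derivative_def has_derivative_iff_norm bounded_linear_scaleR_left)
  also have "\<dots> \<longleftrightarrow> ((\<lambda>s. norm ((1 / (s - t)) *\<^sub>R (f s - f t) - d)) \<longlongrightarrow> 0) (at t)"
  proof (rule filterlim_cong[OF refl refl])
   have "norm (f s - f t - (s - t) *\<^sub>R d) / norm (s - t) = norm ((1 / (s - t)) *\<^sub>R (f s - f t) - d)" if "s \<noteq> t" for s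
   proof -
    have "(1 / (s - t)) *\<^sub>R (f s - f t - (s - t) *\<^sub>R d) = (1 / (s - t)) *\<^sub>R (f s - f t) - d"
     using that by (simp add: scaleR_diff_right)
    then show ?thesis using norm_scaleR[of "1 / (s - t)" "f s - f t - (s - t) *\<^sub>R d"] by simp
   qed
   then show "\<forall>\<^sub>F s in at t. norm (f s - f t - (s - t) *\<^sub>R d) / norm (s - t) = norm ((1 / (s - t)) *\<^sub>R (f s - f t) - d)"
    by (simp add: eventually_at_filter)
  qed
  also have "\<dots> \<longleftrightarrow> ((\<lambda>s. (1 / (s - t)) *\<^sub>R (f s - f t)) \<longlongrightarrow> d) (at t)"
   unfolding tendsto_norm_zero_iff by (rule Lim_null[symmetric])
  finally show ?thesis .
qed

lemma matrix_inv_unique: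
  fixes M N :: "real ^ 'n ^ 'n"
  assumes "M ** N = mat 1" shows "matrix_inv M = N" "invertible M"
proof -
  have 2: "N ** M = mat 1" using assms matrix_left_right_inverse by blast
  show i: "invertible M" unfolding invertible_def using assms 2 by blast
  have "matrix_inv M ** M = mat 1" using i by (rule matrix_inv_left)
  then have "matrix_inv M ** M ** N = N" by simp
  then show "matrix_inv M = N" using assms by (simp flip: matrix_mul_assoc)
qed

text \<open>A permutation other than the identity moves at least two indices; after differentiating
  one factor, an off-diagonal entry of the identity matrix remains in the product. Only the diagonal
  term survives.\<close>

lemma det_has_derivative_at_identity:
  fixes N :: "real \<Rightarrow> real ^ 'n ^ 'n"
  assumes d: "(N has_vector_derivative N') (at t)" and N: "N t = mat 1"
  shows "((\<lambda>t. det (N t)) has_real_derivative trace N') (at t)"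
proof -
  have e: "((\<lambda>t. N t $ i $ j) has_derivative (\<lambda>h. h * N' $ i $ j)) (at t)" for i j
   using bounded_linear.has_derivative[OF bounded_linear_vec_nth bounded_linear.has_derivative[OF bounded_linear_vec_nth
    d[unfolded has_vector_derivative_def]], of i j] by simp
  have "((\<lambda>t. det (N t)) has_derivative (\<lambda>h. \<Sum>p\<in>{p. p permutes UNIV}. of_int (sign p) *
    (\<Sum>i\<in>UNIV. (h * N' $ i $ p i) * (\<Prod>j\<in>UNIV - {i}. N t $ j $ p j)))) (at t)"
   unfolding det_def by (intro has_derivative_sum has_derivative_mult_right has_derivative_prod e)
  moreover have "(\<Sum>p\<in>{p. p permutes UNIV}. of_int (sign p) *
    (\<Sum>i\<in>UNIV. (h * N' $ i $ p i) * (\<Prod>j\<in>UNIV - {i}. N t $ j $ p j))) = trace N' * h" for h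
  proof -
   have z: "(\<Prod>j\<in>UNIV - {i}. N t $ j $ p j) = 0" if p: "p permutes (UNIV::'n set)" "p \<noteq> id" for p i
   proof -
    obtain k where k: "p k \<noteq> k" using p(2) by (auto simp: fun_eq_iff)
    have "\<exists>j. j \<noteq> i \<and> p j \<noteq> j"
    proof (cases "k = i")
     case True
     then have "p (p k) \<noteq> p k" using k permutes_inj[OF p(1)] by (metis injD)
     then show ?thesis using k True by blast
    qed (use k in blast)
    then obtain j where "j \<noteq> i" "p j \<noteq> j" by blast
    then show ?thesis unfolding N by (intro prod_zero bexI[of _ j]) (auto simp: mat_def)
   qed
   have "(\<Sum>p\<in>{p. p permutes UNIV}. of_int (sign p) * (\<Sum>i\<in>UNIV. (h * N' $ i $ p i) * (\<Prod>j\<in>UNIV - {i}. N t $ j $ p j)))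
    = (\<Sum>p\<in>{p. p permutes (UNIV::'n set)}. if p = id then (\<Sum>i\<in>UNIV. h * N' $ i $ i) else 0)"
   proof (rule sum.cong[OF refl])
    fix p :: "'n \<Rightarrow> 'n" assume "p \<in> {p. p permutes UNIV}"
    then show "of_int (sign p) * (\<Sum>i\<in>UNIV. (h * N' $ i $ p i) * (\<Prod>j\<in>UNIV - {i}. N t $ j $ p j))
     = (if p = id then (\<Sum>i\<in>UNIV. h * N' $ i $ i) else 0)"
    proof (cases "p = id")
     case False
     have "p permutes UNIV" using \<open>p \<in> _\<close> by simp
     then show ?thesis by (simp only: z[OF _ False] mult_zero_right sum.neutral_const False if_False)
    qed (simp add: N mat_def sign_id)
   qed
   also have "\<dots> = trace N' * h" by (simp add: permutes_id trace_def sum_distrib_left mult.commute)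
   finally show ?thesis .
  qed
  ultimately show ?thesis by (simp add: has_field_derivative_def mult_commute_abs)
qed

text \<open>Jacobi's formula, reduced to the identity matrix by multiplying with the fixed inverse
  of \<open>M t\<close>.\<close>

lemma det_has_derivative:
  fixes M :: "real \<Rightarrow> real ^ 'n ^ 'n"
  assumes d: "(M has_vector_derivative M') (at t)" and inv: "invertible (M t)"
  shows "((\<lambda>t. det (M t)) has_real_derivative det (M t) * trace (matrix_inv (M t) ** M')) (at t)"
proof -
  let ?R = "matrix_inv (M t)"
  have MR: "M t ** ?R = mat 1" "?R ** M t = mat 1" using inv by (auto intro: matrix_inv_right matrix_inv_left)
  have "((\<lambda>s. ?R ** M s) has_vector_derivative ?R ** M') (at t)"
   by (rule bounded_linear.has_vector_derivative[OF bounded_bilinear.bounded_linear_right[OF bounded_bilinear_matrix_matrix] d])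
  from det_has_derivative_at_identity[OF this MR(2)]
  have "((\<lambda>s. det (M t) * det (?R ** M s)) has_real_derivative det (M t) * trace (?R ** M')) (at t)" by (rule DERIV_cmult)
  moreover have "det (M t) * det (?R ** M s) = det (M s)" for s by (simp flip: det_mul add: matrix_mul_assoc MR)
  ultimately show ?thesis by simp
qed

text \<open>Positivity holds along the whole segment from the identity to \<open>M\<close>, so the
  determinant has no zero there, while a nonpositive end value would force one.\<close>

lemma det_pos_if_positive_definite:
  fixes M :: "real ^ 'n ^ 'n"
  assumes "\<And>x. x \<noteq> 0 \<Longrightarrow> x \<bullet> (M *v x) > 0" shows "det M > 0"
proof (rule ccontr)
  assume neg: "\<not> det M > 0"
  let ?N = "\<lambda>s::real. (1 - s) *\<^sub>R mat 1 + s *\<^sub>R M"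
  have "continuous_on {0..1} (\<lambda>s. det (?N s))" unfolding det_def by (intro continuous_intros)
  from IVT2'[OF _ _ _ this, of 0] obtain s where s: "0 \<le> s" "s \<le> 1" "det (?N s) = 0" using neg by auto
  have "\<not> invertible (?N s)" using s(3) by (simp add: invertible_det_nz)
  then obtain x where x: "x \<noteq> 0" "?N s *v x = 0" by (metis matrix_left_invertible_ker invertible_left_inverse)
  have "x \<bullet> (?N s *v x) = (1 - s) * (x \<bullet> x) + s * (x \<bullet> (M *v x))"
   by (simp add: matrix_vector_mult_add_rdistrib scaleR_matrix_vector_assoc[symmetric] inner_add_right)
  moreover have "\<dots> > 0"
  proof (cases "s = 0")
   case False
   then show ?thesis using s x assms[OF x(1)] by (intro add_nonneg_pos) auto
  qed (use x in simp)
  ultimately show False using x(2) by simp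
qed

context ou_family
begin

text \<open>The lower bound makes the square matrix injective, hence invertible with inverse of norm
  at most 1/\<mu>0, and transposition preserves that norm.\<close>

lemma B_transpose_lower: "norm (transpose (B t) *v x) \<ge> \<mu>0 * norm x"
proof -
  have "inj ((*v) (B t))"
  proof (rule injI)
   fix x y assume "B t *v x = B t *v y"
   then have "B t *v (x - y) = 0" by (simp add: matrix_vector_mult_diff_distrib)
   then have "\<mu>0 * norm (x - y) \<le> 0" using B_lower[of "x - y" t] by simp
   then show "x = y" using \<mu>0_pos by (simp add: mult_le_0_iff)
  qed
  then obtain N where N: "N ** B t = mat 1" using matrix_left_invertible_injective[of "B t"] by blast
  then have N': "B t ** N = mat 1" using matrix_left_right_inverse by blast
  have "norm (N *v y) \<le> (1 / \<mu>0) * norm y" for y using B_lower[of "N *v y" t] \<mu>0_pos by (simp add: matrix_vector_mul_assoc N' field_simps)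
  note norm_le_transpose_if_inverse[OF N' this, of x]
  moreover have "norm x \<le> 1 / \<mu>0 * a \<Longrightarrow> \<mu>0 * norm x \<le> a" for a using \<mu>0_pos by (simp add: field_simps)
  ultimately show ?thesis by blast
qed

lemma C_quadratic: "x \<bullet> (C t *v x) = (norm (transpose (B t) *v x))\<^sup>2"
proof -
  have "C t *v x = B t *v (transpose (B t) *v x)" by (simp only: C_def matrix_vector_mul_assoc)
  then show ?thesis by (simp only: inner_transpose_mult dot_square_norm)
qed

lemma C_lower: "x \<bullet> (C t *v x) \<ge> \<mu>0\<^sup>2 * (norm x)\<^sup>2" unfolding C_quadratic power_mult_distrib[symmetric]
  using B_transpose_lower[of x t] \<mu>0_pos by (intro power_mono) auto

lemma C_symmetric: "transpose (C t) = C t" by (simp add: C_def matrix_transpose_mul)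

lemma C_bounded: "\<exists>K. \<forall>t. norm (C t) \<le> K"
proof -
  obtain KB where KB: "KB > 0" "\<And>t x. norm (B t *v x) \<le> KB * norm x" using ex_operator_bound[OF B_bounded] by auto
  have "norm (C t *v x) \<le> (KB * KB) * norm x" for t x
  proof -
   have "norm (C t *v x) = norm (B t *v (transpose (B t) *v x))" by (simp only: C_def matrix_vector_mul_assoc)
   also have "\<dots> \<le> KB * (KB * norm x)" using KB by (intro order_trans[OF KB(2)] mult_left_mono norm_transpose_mult_le[OF KB(2)]) auto
   finally show ?thesis by simp
  qed
  then show ?thesis using norm_matrix_le by blast
qed

lemma Q_symmetric: "transpose (Q t) = Q t"
proof -
  have "transpose (Q t) = (LINT r:{..t}|lborel. transpose (U t r ** C r ** transpose (U t r)))"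
   unfolding Q_def Qmat_def set_integral_bounded_linear[OF bounded_linear_transpose C_integrable] by (simp add: atMost_def C_def matrix_mul_assoc)
  also have "\<dots> = Q t" unfolding Q_def Qmat_def by (simp add: atMost_def C_def matrix_mul_assoc matrix_transpose_mul)
  finally show ?thesis .
qed

text \<open>What the last unit of time contributes to the covariance: within time 1 the transposed
  evolution shrinks a vector by at most exp(-KA), and the transpose of \<open>B\<close> by at most
  \<mu>0.\<close>

definition "q0 = (\<mu>0 * exp (- KA))\<^sup>2"

lemma q0_pos: "q0 > 0" using \<mu>0_pos by (simp add: q0_def)

lemma Q_lower: "x \<bullet> (Q t *v x) \<ge> q0 * (norm x)\<^sup>2"
proof -
  let ?h = "\<lambda>r. x \<bullet> ((U t r ** C r ** transpose (U t r)) *v x)"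
  have T: "bounded_linear (\<lambda>M. x \<bullet> (M *v x))"
   using bounded_linear_compose[OF bounded_linear_inner_right bounded_bilinear.bounded_linear_left[OF bounded_bilinear_matrix_vector]] .
  have eq: "x \<bullet> (Q t *v x) = (LINT r:{..t}|lborel. ?h r)" unfolding set_integral_bounded_linear[OF T C_integrable]
   by (simp add: Q_def Qmat_def atMost_def C_def matrix_mul_assoc)
  have hq: "?h r = (transpose (U t r) *v x) \<bullet> (C r *v (transpose (U t r) *v x))" for r
   by (simp only: matrix_vector_mul_assoc[symmetric] inner_transpose_mult)
  have h0: "?h r \<ge> 0" for r unfolding hq C_quadratic by simp
  \<comment> \<open>The integrand is nonnegative, so restricting to an interval of length 1 gives a
    lower bound independent of \<open>t\<close>.\<close>
  have h1: "?h r \<ge> q0 * (norm x)\<^sup>2" if "r \<in> {t-1..t}" for r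
  proof -
   have "norm x \<le> exp (KA * \<bar>r - t\<bar>) * norm (transpose (U t r) *v x)" by (rule norm_le_transpose_if_inverse[OF U_inverse U_bound])
   also have "\<dots> \<le> exp KA * norm (transpose (U t r) *v x)" using that KA(1) by (intro mult_right_mono) auto
   finally have "exp (- KA) * norm x \<le> norm (transpose (U t r) *v x)" by (simp add: exp_minus field_simps)
   then have "(\<mu>0 * (exp (- KA) * norm x))\<^sup>2 \<le> (\<mu>0 * norm (transpose (U t r) *v x))\<^sup>2"
    using \<mu>0_pos by (intro power_mono mult_left_mono) auto
   also have "\<dots> \<le> ?h r" unfolding hq power_mult_distrib by (rule C_lower)
   finally show ?thesis by (simp add: q0_def power_mult_distrib mult.assoc)
  qed
  have i: "set_integrable lborel {..t} ?h" using integrable_bounded_linear[OF T C_integrable[unfolded set_integrable_def, of t t]]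
   by (simp add: set_integrable_def linear_simps[OF T])
  have "q0 * (norm x)\<^sup>2 = (LINT r|lborel. (q0 * (norm x)\<^sup>2) * indicator {t-1..t} r)" by simp
  also have "\<dots> \<le> (LINT r|lborel. indicator {..t} r *\<^sub>R ?h r)"
  proof (rule integral_mono)
   show "integrable lborel (\<lambda>r. (q0 * (norm x)\<^sup>2) * indicator {t-1..t} r)"
    by (intro integrable_mult_right integrable_indicator_bounded) auto
   show "integrable lborel (\<lambda>r. indicator {..t} r *\<^sub>R ?h r)" using i by (simp add: set_integrable_def)
   show "(q0 * (norm x)\<^sup>2) * indicator {t-1..t} r \<le> indicator {..t} r *\<^sub>R ?h r" for r
    using h0[of r] h1[of r] by (auto simp: indicator_def)
  qed
  finally show ?thesis unfolding eq set_lebesgue_integral_def .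
qed

definition "P t = matrix_inv (Q t)"

lemma Q_invertible: "invertible (Q t)"
proof -
  have "inj ((*v) (Q t))"
  proof (rule injI)
   fix x y assume "Q t *v x = Q t *v y"
   then have "Q t *v (x - y) = 0" by (simp add: matrix_vector_mult_diff_distrib)
   then have "q0 * (norm (x - y))\<^sup>2 \<le> 0" using Q_lower[of "x - y" t] by simp
   then show "x = y" using q0_pos by (simp add: mult_le_0_iff)
  qed
  then show ?thesis using matrix_left_invertible_injective invertible_left_inverse by blast
qed

lemma QP: "Q t ** P t = mat 1" and PQ: "P t ** Q t = mat 1" unfolding P_def using Q_invertible by (auto intro: matrix_inv_right matrix_inv_left)

lemma P_symmetric: "transpose (P t) = P t"
proof -
  have "Q t ** transpose (P t) = mat 1" using arg_cong[OF PQ[of t], of transpose] by (simp add: matrix_transpose_mul Q_symmetric transpose_mat)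
  then show ?thesis using matrix_inv_unique(1) P_def by metis
qed

lemma P_bound: "norm (P t *v y) \<le> (1 / q0) * norm y"
proof (cases "P t *v y = 0")
  case False
  let ?x = "P t *v y"
  have "Q t *v ?x = y" by (simp only: matrix_vector_mul_assoc QP matrix_vector_mul_lid)
  then have "q0 * (norm ?x)\<^sup>2 \<le> ?x \<bullet> y" using Q_lower[of ?x t] by (simp only:)
  also have "\<dots> \<le> norm ?x * norm y" by (rule norm_cauchy_schwarz)
  finally have "norm ?x * (q0 * norm ?x) \<le> norm ?x * norm y" by (simp add: power2_eq_square mult_ac)
  then have "q0 * norm ?x \<le> norm y" using False by simp
  then show ?thesis using q0_pos by (simp add: field_simps)
qed (use q0_pos in simp)

text \<open>With x = P y one has y.Py = x.Qx, so nondegeneracy and boundedness of \<open>Q\<close>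
  combine; this yields the Gaussian decay of the density uniformly in time.\<close>

lemma P_lower: "\<exists>p0>0. \<forall>t y. y \<bullet> (P t *v y) \<ge> p0 * (norm y)\<^sup>2"
proof -
  obtain K where "\<And>t. norm (Q t) \<le> K" using g_Q_bounded by blast
  then have "bounded (range Q)" by (auto simp: bounded_iff)
  from ex_operator_bound[OF this] obtain KQ where KQ: "KQ > 0" "\<And>t x. norm (Q t *v x) \<le> KQ * norm x" by auto
  have "y \<bullet> (P t *v y) \<ge> (q0 / KQ\<^sup>2) * (norm y)\<^sup>2" for t y
  proof -
   let ?x = "P t *v y"
   have x: "Q t *v ?x = y" by (simp only: matrix_vector_mul_assoc QP matrix_vector_mul_lid)
   have "norm y \<le> KQ * norm ?x" using KQ(2)[of t ?x] unfolding x .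
   then have "(norm y)\<^sup>2 \<le> (KQ * norm ?x)\<^sup>2" by (intro power_mono) auto
   then have "(q0 / KQ\<^sup>2) * (norm y)\<^sup>2 \<le> (q0 / KQ\<^sup>2) * (KQ * norm ?x)\<^sup>2" using q0_pos by (intro mult_left_mono) auto
   also have "\<dots> = q0 * (norm ?x)\<^sup>2" using KQ(1) by (simp add: power_mult_distrib)
   also have "\<dots> \<le> ?x \<bullet> (Q t *v ?x)" by (rule Q_lower)
   finally show ?thesis unfolding x by (simp only: inner_commute)
  qed
  then show ?thesis using q0_pos KQ(1) by (intro exI[of _ "q0 / KQ\<^sup>2"]) auto
qed

definition "Q' t = A t ** Q t + Q t ** transpose (A t) + C t"
definition "g' t = A t *v g t + f t"

lemma Q_deriv': "(Q has_vector_derivative Q' t) (at t)" using Q_deriv by (simp add: Q'_def)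

lemma g_deriv': "(g has_vector_derivative g' t) (at t)" using g_deriv by (simp add: g'_def)

lemma continuous_Q: "continuous_on UNIV Q" and continuous_g: "continuous_on UNIV g"
  by (rule continuous_at_imp_continuous_on, rule ballI, rule has_vector_derivative_continuous[OF Q_deriv'])
   (rule continuous_at_imp_continuous_on, rule ballI, rule has_vector_derivative_continuous[OF g_deriv'])

lemma continuous_Q': "continuous_on UNIV Q'" and continuous_g': "continuous_on UNIV g'" unfolding Q'_def[abs_def] g'_def[abs_def]
  by (intro continuous_on_add continuous_intros_matrix A_continuous continuous_Q continuous_g C_continuous f_continuous)+

lemma P_diff: "P s - P t = - (P s ** ((Q s - Q t) ** P t))" by (simp add: bounded_bilinear.diff_left[OF bounded_bilinear_matrix_matrix]
    bounded_bilinear.diff_right[OF bounded_bilinear_matrix_matrix] QP)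
   (simp add: matrix_mul_assoc PQ)

lemma P_bounded: "\<exists>K>0. \<forall>t. norm (P t) \<le> K"
  using norm_matrix_le[OF P_bound] q0_pos by (intro exI[of _ "real CARD('n) * (real CARD('n) * (1 / q0))"]) auto

text \<open>The difference quotient of the inverse is minus \<open>P s\<close> times the quotient of
  \<open>Q\<close> times \<open>P t\<close>; continuity of \<open>P\<close> at \<open>t\<close>,
  from the same identity, gives the limit.\<close>

lemma P_deriv: "(P has_vector_derivative - (P t ** (Q' t ** P t))) (at t)"
proof -
  obtain KP where KP: "\<And>t. norm (P t) \<le> KP" using P_bounded by blast
  have "(Q \<longlongrightarrow> Q t) (at t)" using has_vector_derivative_continuous[OF Q_deriv'] by (simp add: continuous_within)
  from tendsto_diff[OF tendsto_const[of "Q t"] this] have qt: "((\<lambda>s. Q t - Q s) \<longlongrightarrow> 0) (at t)" by simp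
  have eq: "P s - P t = P s ** ((Q t - Q s) ** P t)" for s
   using P_diff[of s t] by (simp add: bounded_bilinear.diff_left[OF bounded_bilinear_matrix_matrix] bounded_bilinear.diff_right[OF bounded_bilinear_matrix_matrix])
  have "\<forall>\<^sub>F s in at t. norm (P s) \<le> KP" using KP by simp
  from tendsto_matrix_perturbation[OF eq qt this] have pt: "(P \<longlongrightarrow> P t) (at t)" .
  have "((\<lambda>s. (1 / (s - t)) *\<^sub>R (Q s - Q t)) \<longlongrightarrow> Q' t) (at t)"
   using Q_deriv' has_vector_derivative_iff_tendsto by blast
  then have "((\<lambda>s. - (P s ** (((1 / (s - t)) *\<^sub>R (Q s - Q t)) ** P t))) \<longlongrightarrow> - (P t ** (Q' t ** P t))) (at t)"
   by (intro tendsto_minus bounded_bilinear.tendsto[OF bounded_bilinear_matrix_matrix] pt tendsto_const)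
  moreover have "- (P s ** (((1 / (s - t)) *\<^sub>R (Q s - Q t)) ** P t)) = (1 / (s - t)) *\<^sub>R (P s - P t)" for s unfolding P_diff[of s t]
   by (simp add: bounded_bilinear.scaleR_left[OF bounded_bilinear_matrix_matrix]
     bounded_bilinear.scaleR_right[OF bounded_bilinear_matrix_matrix])
  ultimately show ?thesis by (simp add: has_vector_derivative_iff_tendsto)
qed

lemma continuous_P: "continuous_on UNIV P" by (rule continuous_at_imp_continuous_on, rule ballI, rule has_vector_derivative_continuous[OF P_deriv])

lemma det_Q_pos: "det (Q t) > 0"
proof (rule det_pos_if_positive_definite)
  fix x :: "real ^ 'n" assume "x \<noteq> 0"
  then have "0 < q0 * (norm x)\<^sup>2" using q0_pos by simp
  then show "x \<bullet> (Q t *v x) > 0" using Q_lower[of x t] by linarith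
qed

lemma det_Q_deriv: "((\<lambda>t. det (Q t)) has_real_derivative det (Q t) * trace (P t ** Q' t)) (at t)"
  unfolding P_def by (rule det_has_derivative[OF Q_deriv' Q_invertible])

end

section \<open>The density of the measure\<close>

lemma dirder_fst:
  fixes \<alpha> :: "real \<Rightarrow> real"
  assumes "\<And>t. (\<alpha> has_real_derivative \<alpha>' t) (at t)"
  shows "dirder (e_time :: real \<times> (real ^ 'n)) (\<lambda>z. \<alpha> (fst z)) (\<lambda>z. \<alpha>' (fst z))" unfolding dirder_def
proof
  fix z :: "real \<times> (real ^ 'n)"
  have "((\<lambda>s. \<alpha> (s + fst z)) has_real_derivative \<alpha>' (fst z)) (at 0)"
   using assms[of "fst z"] DERIV_shift[of \<alpha> "\<alpha>' (fst z)" 0 "fst z"] by simp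
  then show "((\<lambda>s. \<alpha> (fst (z + s *\<^sub>R e_time))) has_real_derivative \<alpha>' (fst z)) (at 0)" by (simp add: add.commute)
qed

lemma dirder_fst_space: "dirder (e_space i) (\<lambda>z. \<alpha> (fst z)) (\<lambda>z. 0)" unfolding dirder_def by simp

lemma dirder_time_fixed_space:
  assumes "\<And>t x. ((\<lambda>t. F (t, x)) has_real_derivative F' (t, x)) (at t)"
  shows "dirder (e_time :: real \<times> (real ^ 'n)) F F'" unfolding dirder_def
proof
  fix z :: "real \<times> (real ^ 'n)"
  obtain t x where z: "z = (t, x)" by (cases z)
  have "((\<lambda>s. F (s + t, x)) has_real_derivative F' (t, x)) (at 0)"
   using assms[of x t] DERIV_shift[of "\<lambda>t. F (t, x)" "F' (t, x)" 0 t] by simp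
  then show "((\<lambda>s. F (z + s *\<^sub>R e_time)) has_real_derivative F' z) (at 0)" by (simp add: z add.commute)
qed

context ou_family
begin

definition "y z = snd z - g (fst z)"
text \<open>\<open>pv\<close> is minus the spatial gradient of log \<rho>, and
  \<open>\<rho>\<^sub>t\<close> is the logarithmic time derivative of \<rho>. Since \<open>Q\<close>
  applied to \<open>pv\<close> returns \<open>y\<close>, every derivative that falls on the density
  leads back to the centred variable.\<close>

definition "pv z = P (fst z) *v y z"
definition "\<rho> z = exp (- (1/2) * (y z \<bullet> pv z)) / sqrt ((2 * pi) ^ CARD('n) * det (Q (fst z)))"
definition "\<rho>\<^sub>t z = (g' (fst z) \<bullet> pv z + 1/2 * (pv z \<bullet> (Q' (fst z) *v pv z)) - 1/2 * trace (P (fst z) ** Q' (fst z)))"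
definition "drift z = A (fst z) *v snd z + f (fst z)"

lemma \<rho>_pos: "\<rho> z > 0" using det_Q_pos[of "fst z"] by (simp add: \<rho>_def)

lemma continuous_fst_comp: "continuous_on UNIV h \<Longrightarrow> continuous_on UNIV (\<lambda>z. h (fst z))"
  by (rule continuous_on_compose2[where t=UNIV and g=h]) (auto intro: continuous_intros)

lemma continuous_y: "continuous_on UNIV y" unfolding y_def[abs_def] by (intro continuous_intros continuous_fst_comp continuous_g)

lemma continuous_pv: "continuous_on UNIV pv"
  unfolding pv_def[abs_def] by (intro continuous_intros_matrix continuous_fst_comp continuous_P continuous_y)

lemma continuous_det_Q: "continuous_on UNIV (\<lambda>t. det (Q t))"
  by (rule continuous_at_imp_continuous_on, rule ballI, rule DERIV_isCont[OF det_Q_deriv])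

lemma continuous_\<rho>: "continuous_on UNIV \<rho>"
proof -
  have "sqrt ((2 * pi) ^ CARD('n) * det (Q (fst z))) \<noteq> 0" for z :: "real \<times> (real ^ 'n)" using det_Q_pos[of "fst z"] by simp
  then show ?thesis unfolding \<rho>_def[abs_def] by (intro continuous_intros continuous_y continuous_pv continuous_fst_comp continuous_det_Q) auto
qed

lemma continuous_drift: "continuous_on UNIV drift" unfolding drift_def[abs_def]
  by (intro continuous_on_add continuous_intros_matrix continuous_fst_comp A_continuous f_continuous continuous_on_snd continuous_on_id)

lemma dirder_y: "dirder (e_space j) (\<lambda>z. y z $ i) (\<lambda>z. if i = j then 1 else 0)"
proof -
  have "y (z + s *\<^sub>R e_space j) $ i = y z $ i + s * (if i = j then 1 else 0)" for z s by (simp add: y_def axis_def)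
  then show ?thesis unfolding dirder_def by (auto intro!: derivative_eq_intros)
qed

lemma pv_line: "pv (z + s *\<^sub>R e_space j) = pv z + s *\<^sub>R column j (P (fst z))"
proof -
  have "y (z + s *\<^sub>R e_space j) = y z + s *\<^sub>R axis j 1" by (simp add: y_def)
  then show ?thesis by (simp add: pv_def matrix_vector_right_distrib matrix_vector_mult_scaleR matrix_vector_mult_basis)
qed

lemma dirder_pv: "dirder (e_space j) (\<lambda>z. pv z $ i) (\<lambda>z. P (fst z) $ i $ j)"
  unfolding dirder_def pv_line by (auto intro!: derivative_eq_intros simp: column_def)

lemma dirder_\<rho>_space: "dirder (e_space i) \<rho> (\<lambda>z. - (pv z $ i) * \<rho> z)" unfolding dirder_def
proof
  fix z :: "real \<times> (real ^ 'n)"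
  let ?t = "fst z"
  define c where "c = sqrt ((2 * pi) ^ CARD('n) * det (Q ?t))"
  have c: "c \<noteq> 0" using det_Q_pos[of ?t] by (simp add: c_def)
  have col: "y z \<bullet> column i (P ?t) = pv z $ i"
  proof -
   have "y z \<bullet> (P ?t *v axis i 1) = (transpose (P ?t) *v y z) \<bullet> axis i 1" by (rule inner_transpose_mult)
   then show ?thesis by (simp add: matrix_vector_mult_basis P_symmetric pv_def inner_axis)
  qed
  have col2: "column i (P ?t) $ i = P ?t $ i $ i" by (simp add: column_def)
  have e: "y (z + s *\<^sub>R e_space i) \<bullet> pv (z + s *\<^sub>R e_space i) =
    y z \<bullet> pv z + 2 * s * (pv z $ i) + s\<^sup>2 * (P ?t $ i $ i)" for s
  proof -
   have "y (z + s *\<^sub>R e_space i) = y z + s *\<^sub>R axis i 1" by (simp add: y_def)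
   then show ?thesis unfolding pv_line by (simp add: inner_add_left inner_add_right col col2 inner_axis' power2_eq_square algebra_simps)
  qed
  have "((\<lambda>s. exp (- (1/2) * (y z \<bullet> pv z + 2 * s * (pv z $ i) + s\<^sup>2 * (P ?t $ i $ i))) / c)
    has_real_derivative (- (pv z $ i)) * (exp (- (1/2) * (y z \<bullet> pv z)) / c)) (at 0)"
   using c by (auto intro!: derivative_eq_intros simp: field_simps)
  moreover have "\<rho> (z + s *\<^sub>R e_space i) = exp (- (1/2) * (y z \<bullet> pv z + 2 * s * (pv z $ i) + s\<^sup>2 * (P ?t $ i $ i))) / c" for s
   unfolding \<rho>_def e c_def by simp
  moreover have "\<rho> z = exp (- (1/2) * (y z \<bullet> pv z)) / c" unfolding \<rho>_def c_def ..
  ultimately show "((\<lambda>s. \<rho> (z + s *\<^sub>R e_space i)) has_real_derivative - (pv z $ i) * \<rho> z) (at 0)" by (simp only:)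
qed

lemma dirder_\<rho>_time: "dirder e_time \<rho> (\<lambda>z. \<rho>\<^sub>t z * \<rho> z)"
proof (rule dirder_time_fixed_space)
  fix t and x :: "real ^ 'n"
  let ?Y = "\<lambda>t. x - g t"
  let ?q = "\<lambda>t. ?Y t \<bullet> (P t *v ?Y t)"
  let ?q' = "- 2 * (g' t \<bullet> (P t *v ?Y t)) - (P t *v ?Y t) \<bullet> (Q' t *v (P t *v ?Y t))"
  let ?T = "trace (P t ** Q' t)"
  have dY: "(?Y has_vector_derivative - g' t) (at t)" using has_vector_derivative_diff[OF has_vector_derivative_const g_deriv', of x t] by simp
  have dPY: "((\<lambda>t. P t *v ?Y t) has_vector_derivative (P t *v (- g' t) + (- (P t ** (Q' t ** P t))) *v ?Y t)) (at t)"
   by (rule bounded_bilinear.has_vector_derivative[OF bounded_bilinear_matrix_vector P_deriv dY])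
  have "(?q has_vector_derivative
    (?Y t \<bullet> (P t *v (- g' t) + (- (P t ** (Q' t ** P t))) *v ?Y t) + (- g' t) \<bullet> (P t *v ?Y t))) (at t)"
   by (rule bounded_bilinear.has_vector_derivative[OF bounded_bilinear_inner dY dPY])
  moreover have "?Y t \<bullet> (P t *v (- g' t)) = - (g' t \<bullet> (P t *v ?Y t))"
  proof -
   have "?Y t \<bullet> (P t *v (- g' t)) = (transpose (P t) *v ?Y t) \<bullet> (- g' t)" by (rule inner_transpose_mult)
   also have "\<dots> = (P t *v ?Y t) \<bullet> (- g' t)" by (simp only: P_symmetric)
   finally show ?thesis by (simp add: inner_commute)
  qed
  moreover have "?Y t \<bullet> ((- (P t ** (Q' t ** P t))) *v ?Y t) = - ((P t *v ?Y t) \<bullet> (Q' t *v (P t *v ?Y t)))"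
  proof -
   have "(- (P t ** (Q' t ** P t))) *v ?Y t = - (P t *v (Q' t *v (P t *v ?Y t)))"
    by (simp only: bounded_bilinear.minus_left[OF bounded_bilinear_matrix_vector] matrix_vector_mul_assoc matrix_mul_assoc)
   moreover have "?Y t \<bullet> (P t *v (Q' t *v (P t *v ?Y t))) = (transpose (P t) *v ?Y t) \<bullet> (Q' t *v (P t *v ?Y t))"
    by (rule inner_transpose_mult)
   ultimately show ?thesis by (simp only: P_symmetric inner_minus_right)
  qed
  ultimately have dq: "(?q has_real_derivative ?q') (at t)" unfolding has_real_derivative_iff_has_vector_derivative by (simp add: inner_add_right)
  define k where "k = (2 * pi) ^ CARD('n)"
  \<comment> \<open>The logarithm turns Jacobi's formula into a trace without the determinant as a
    factor.\<close>
  have dl: "((\<lambda>t. ln (det (Q t))) has_real_derivative ?T) (at t)"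
   using DERIV_chain2[OF DERIV_ln_divide[OF det_Q_pos[of t]] det_Q_deriv[of t]] det_Q_pos[of t] by (auto split: if_splits)
  have "((\<lambda>t. - (1/2) * ?q t + - (1/2) * ln (det (Q t))) has_real_derivative (- (1/2) * ?q' + - (1/2) * ?T)) (at t)"
   by (intro DERIV_add DERIV_cmult dq dl)
  note d = DERIV_cmult[OF DERIV_chain2[OF DERIV_exp this], of "1 / sqrt k"]
  \<comment> \<open>The whole density is put into one exponential, whose logarithmic derivative is
    then the derivative of the exponent.\<close>
  have r: "\<rho> (t, x) = 1 / sqrt k * exp (- (1/2) * ?q t + - (1/2) * ln (det (Q t)))" for t
  proof -
   have "exp (1/2 * ln (det (Q t))) = sqrt (det (Q t))" using det_Q_pos[of t] by (simp add: powr_half_sqrt[symmetric] powr_def)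
   moreover have "exp (- (1/2) * ?q t + - (1/2) * ln (det (Q t))) = exp (- (1/2) * ?q t) / exp (1/2 * ln (det (Q t)))"
    by (simp only: exp_add exp_minus mult_minus_left divide_inverse)
   ultimately show ?thesis by (simp add: \<rho>_def k_def pv_def y_def real_sqrt_mult)
  qed
  have "\<rho>\<^sub>t (t, x) = - (1/2) * ?q' + - (1/2) * ?T" by (simp add: \<rho>\<^sub>t_def pv_def y_def field_simps)
  then show "((\<lambda>t. \<rho> (t, x)) has_real_derivative \<rho>\<^sub>t (t, x) * \<rho> (t, x)) (at t)" using d unfolding r by (simp only: mult_ac)
qed

lemma quadratic_sum: "v \<bullet> (M *v w) = (\<Sum>i\<in>UNIV. \<Sum>j\<in>UNIV. M $ i $ j * (v $ i * w $ j))" for v w :: "real ^ 'n"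
  by (simp add: inner_vec_def matrix_vector_mult_def sum_distrib_left mult_ac)

text \<open>The Fokker--Planck equation for \<open>\<rho>\<close>, divided by \<open>\<rho>\<close>.\<close>

lemma fokker_planck:
  "1/2 * (\<Sum>i\<in>UNIV. \<Sum>j\<in>UNIV. C (fst z) $ i $ j * (pv z $ i * pv z $ j - P (fst z) $ i $ j))
   - trace (A (fst z)) + drift z \<bullet> pv z = \<rho>\<^sub>t z"
proof -
  let ?t = "fst z"
  have Qp: "Q ?t *v pv z = y z" by (simp only: pv_def matrix_vector_mul_assoc QP matrix_vector_mul_lid)
  have q: "pv z \<bullet> (Q' ?t *v pv z) = 2 * (pv z \<bullet> (A ?t *v y z)) + pv z \<bullet> (C ?t *v pv z)"
  proof -
   have "pv z \<bullet> ((Q ?t ** transpose (A ?t)) *v pv z) = (Q ?t *v pv z) \<bullet> (transpose (A ?t) *v pv z)"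
    by (simp only: matrix_vector_mul_assoc[symmetric] inner_transpose_mult[of "pv z" "Q ?t"] Q_symmetric)
   also have "\<dots> = (A ?t *v y z) \<bullet> pv z" unfolding Qp inner_transpose_mult transpose_transpose ..
   finally have 1: "pv z \<bullet> ((Q ?t ** transpose (A ?t)) *v pv z) = pv z \<bullet> (A ?t *v y z)" by (simp only: inner_commute)
   have 2: "pv z \<bullet> ((A ?t ** Q ?t) *v pv z) = pv z \<bullet> (A ?t *v y z)" by (simp only: matrix_vector_mul_assoc[symmetric] Qp)
   show ?thesis unfolding Q'_def matrix_vector_mult_add_rdistrib inner_add_right 1 2 by simp
  qed
  have tr: "trace (P ?t ** Q' ?t) = 2 * trace (A ?t) + trace (P ?t ** C ?t)"
  proof -
   have "trace (P ?t ** (A ?t ** Q ?t)) = trace ((A ?t ** Q ?t) ** P ?t)" by (rule trace_mul_sym)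
   also have "\<dots> = trace (A ?t)" by (simp add: matrix_mul_assoc[symmetric] QP)
   finally have 1: "trace (P ?t ** (A ?t ** Q ?t)) = trace (A ?t)" .
   have 2: "trace (P ?t ** (Q ?t ** transpose (A ?t))) = trace (A ?t)" by (simp add: matrix_mul_assoc PQ) (simp add: trace_def transpose_def)
   show ?thesis unfolding Q'_def matrix_add_ldistrib trace_add 1 2 by simp
  qed
  have trC: "trace (P ?t ** C ?t) = (\<Sum>i\<in>UNIV. \<Sum>j\<in>UNIV. C ?t $ i $ j * P ?t $ i $ j)"
  proof -
   have "C ?t $ j $ i = C ?t $ i $ j" for i j using arg_cong[OF C_symmetric[of ?t], of "\<lambda>M. M $ i $ j"] by (simp add: transpose_def)
   then show ?thesis by (simp add: trace_def matrix_matrix_mult_def mult.commute)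
  qed
  have d: "drift z \<bullet> pv z = pv z \<bullet> (A ?t *v y z) + g' ?t \<bullet> pv z"
  proof -
   have "drift z = A ?t *v y z + g' ?t" by (simp add: drift_def g'_def y_def matrix_vector_mult_diff_distrib)
   then show ?thesis by (simp add: inner_add_left inner_add_right inner_commute[of _ "pv z"])
  qed
  show ?thesis unfolding \<rho>\<^sub>t_def q tr d trC
   by (simp add: quadratic_sum[of "pv z" "C ?t"] right_diff_distrib sum_subtractf add_divide_distrib diff_divide_distrib)
qed

lemma weight_\<rho>: "weight \<rho>" by unfold_locales (rule continuous_\<rho>, rule \<rho>_pos)

sublocale weight \<rho> by (rule weight_\<rho>)

lemma nu_at_eq: "nu_at U B f t = density lborel (\<lambda>x. ennreal (\<rho> (t, x)))"
  by (simp add: nu_at_def gaussian_measure_def \<rho>_def pv_def y_def P_def g_def Q_def)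

text \<open>From here on the measure is an explicit density. Rectangles generate the Borel sets and
  are stable under intersection; compact boxes exhaust the space and have finite measure because
  \<rho> is continuous.\<close>

lemma is_nu_eq_dens:
  assumes "is_nu U B f \<nu>" shows "\<nu> = dens \<rho>"
proof (rule measure_eqI_generator_eq)
  let ?E = "{I \<times> K | I K. I \<in> sets (borel :: real measure) \<and> K \<in> sets (borel :: (real ^ 'n) measure)}"
  let ?A = "\<lambda>i::nat. {- real i..real i} \<times> cball (0 :: real ^ 'n) (real i)"
  have rm: "(\<lambda>x. ennreal (\<rho> (t, x))) \<in> borel_measurable borel" for t
   by (intro measurable_compose[OF _ measurable_ennreal] measurable_compose[OF _ weight_measurable]) measurable
  have e: "emeasure \<nu> (I \<times> K) = emeasure (dens \<rho>) (I \<times> K)" if "I \<in> sets borel" "K \<in> sets borel" for I K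
  proof -
   have "emeasure \<nu> (I \<times> K) = (\<integral>\<^sup>+t\<in>I. emeasure (nu_at U B f t) K \<partial>lborel)"
    using assms that by (simp add: is_nu_def)
   also have "\<dots> = (\<integral>\<^sup>+t. \<integral>\<^sup>+x. ennreal (\<rho> (t, x)) * indicator (I \<times> K) (t, x) \<partial>lborel \<partial>lborel)"
   proof (rule nn_integral_cong)
    fix t
    have "emeasure (nu_at U B f t) K * indicator I t = (\<integral>\<^sup>+x. ennreal (\<rho> (t, x)) * indicator K x \<partial>lborel) * indicator I t"
     using that rm by (simp add: nu_at_eq emeasure_density)
    also have "\<dots> = (\<integral>\<^sup>+x. ennreal (\<rho> (t, x)) * indicator K x * indicator I t \<partial>lborel)"
     using that rm by (intro nn_integral_multc[symmetric] borel_measurable_times_ennreal borel_measurable_indicator) auto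
    also have "\<dots> = (\<integral>\<^sup>+x. ennreal (\<rho> (t, x)) * indicator (I \<times> K) (t, x) \<partial>lborel)"
     by (intro nn_integral_cong) (auto simp: indicator_def)
    finally show "emeasure (nu_at U B f t) K * indicator I t = (\<integral>\<^sup>+x. ennreal (\<rho> (t, x)) * indicator (I \<times> K) (t, x) \<partial>lborel)" .
   qed
   also have "\<dots> = (\<integral>\<^sup>+z. ennreal (\<rho> z) * indicator (I \<times> K) z \<partial>(lborel \<Otimes>\<^sub>M lborel))"
   proof (rule lborel.nn_integral_fst)
    have "I \<times> K \<in> sets borel" using that borel_Times by blast
    then have "(\<lambda>z. ennreal (\<rho> z) * indicator (I \<times> K) z) \<in> borel_measurable borel" by measurable
    then show "(\<lambda>z. ennreal (\<rho> z) * indicator (I \<times> K) z) \<in> borel_measurable (lborel \<Otimes>\<^sub>M lborel)"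
     by (simp add: lborel_prod)
   qed
   also have "\<dots> = emeasure (dens \<rho>) (I \<times> K)" unfolding lborel_prod dens_def using that borel_Times by (subst emeasure_density) auto
   finally show ?thesis .
  qed
  show "Int_stable ?E"
  proof (rule Int_stableI)
   fix X Y assume "X \<in> ?E" "Y \<in> ?E"
   then obtain I K I' K' where "X = I \<times> K" "Y = I' \<times> K'" "I \<in> sets borel" "K \<in> sets borel" "I' \<in> sets borel" "K' \<in> sets borel"
    by blast
   then have "X \<inter> Y = (I \<inter> I') \<times> (K \<inter> K')" "I \<inter> I' \<in> sets borel" "K \<inter> K' \<in> sets borel"
    by (auto simp: Times_Int_Times)
   then show "X \<inter> Y \<in> ?E" by blast
  qed
  show "?E \<subseteq> Pow UNIV" by simp
  show "\<And>X. X \<in> ?E \<Longrightarrow> emeasure \<nu> X = emeasure (dens \<rho>) X" using e by auto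
  have b: "sets (borel :: (real \<times> (real ^ 'n)) measure) = sigma_sets UNIV ?E" by (simp add: borel_prod[symmetric] sets_pair_measure)
  show "sets \<nu> = sigma_sets UNIV ?E" using assms b by (simp add: is_nu_def)
  show "sets (dens \<rho>) = sigma_sets UNIV ?E" using b by simp
  have "{- real i..real i} \<in> sets borel" "cball (0 :: real ^ 'n) (real i) \<in> sets borel" for i by auto
  then show "range ?A \<subseteq> ?E" by blast
  show "(\<Union>i. ?A i) = UNIV"
  proof -
   have "z \<in> (\<Union>i. ?A i)" for z :: "real \<times> (real ^ 'n)"
   proof -
    obtain i where "max \<bar>fst z\<bar> (norm (snd z)) \<le> real i" using real_arch_simple by blast
    then show ?thesis by (intro UN_I[of i]) (auto simp: mem_Times_iff)
   qed
   then show ?thesis by blast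
  qed
  fix i
  have cp: "compact (?A i)" by (intro compact_Times) auto
  have "emeasure (dens \<rho>) (?A i) < \<infinity>"
  proof -
   have int: "integrable lborel (\<lambda>z. indicator (?A i) z * \<rho> z)"
    using borel_integrable_compact[OF cp continuous_on_subset[OF continuous_\<rho> subset_UNIV]] by (simp add: set_integrable_def)
   have "emeasure (dens \<rho>) (?A i) = (\<integral>\<^sup>+z. ennreal (indicator (?A i) z * \<rho> z) \<partial>lborel)"
    unfolding dens_def using borel_compact[OF cp] by (subst emeasure_density) (auto intro!: nn_integral_cong simp: indicator_def)
   also have "\<dots> < \<infinity>" using int by (subst nn_integral_eq_integral) (auto simp: less_imp_le[OF \<rho>_pos] indicator_def)
   finally show ?thesis .
  qed
  then show "emeasure \<nu> (?A i) \<noteq> \<infinity>" using e[of "{- real i..real i}" "cball 0 (real i)"] by simp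
qed

end

section \<open>Integral identities against the density\<close>

lemma e_time_Basis: "(e_time :: real \<times> (real ^ 'n)) \<in> Basis" by (simp add: Basis_prod_def)

lemma e_space_Basis: "(e_space i :: real \<times> (real ^ 'n)) \<in> Basis" by (simp add: Basis_prod_def axis_in_Basis_iff)

lemma dirder_csupp:
  fixes F :: "'a::euclidean_space \<Rightarrow> real"
  assumes d: "dirder b F F'" and s: "csupp F" shows "csupp F'"
proof -
  obtain r where r: "\<And>z. r < norm z \<Longrightarrow> F z = 0" using s by (auto simp: csupp_def)
  show ?thesis
  proof (rule csuppI[of r])
   fix z :: 'a assume z: "r < norm z"
   let ?S = "{s. r < norm (z + s *\<^sub>R b)}"
   have o: "open ?S" by (intro open_Collect_less continuous_intros)
   have "((\<lambda>s. F (z + s *\<^sub>R b)) has_real_derivative 0) (at 0)"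
    by (rule has_field_derivative_transform_within_open[OF DERIV_const o]) (use z r in auto)
   then show "F' z = 0" using d DERIV_unique unfolding dirder_def by blast
  qed
qed

lemma ibp:
  fixes F :: "'a::euclidean_space \<Rightarrow> real"
  assumes "dirder b F F'" "csupp F" "continuous_on UNIV F" "continuous_on UNIV F'"
  shows "has_bochner_integral lborel F' 0"
  using assms dirder_csupp[OF assms(1,2)] by (intro has_bochner_integral_dirder[of b F F']) (auto simp: cc_def)

lemma dirder_add:
  "dirder b F F' \<Longrightarrow> dirder b G G' \<Longrightarrow> dirder b (\<lambda>z. F z + G z) (\<lambda>z. F' z + G' z)"
  unfolding dirder_def by (auto intro: DERIV_add)

lemma dirder_cmult: "dirder b F F' \<Longrightarrow> dirder b (\<lambda>z. c * F z) (\<lambda>z. c * F' z)"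
  unfolding dirder_def by (auto intro: DERIV_cmult)

lemma dirder_sum:
  "(\<And>i. i \<in> I \<Longrightarrow> dirder b (F i) (F' i)) \<Longrightarrow> dirder b (\<lambda>z. \<Sum>i\<in>I. F i z) (\<lambda>z. \<Sum>i\<in>I. F' i z)"
  unfolding dirder_def by (auto intro!: DERIV_sum)

lemma dirder_cong: "dirder b F F' \<Longrightarrow> (\<And>z. F' z = G' z) \<Longrightarrow> dirder b F G'" by (simp add: dirder_def)

lemma dirder_coeff_space:
  assumes "dirder (e_space i) F F'" shows "dirder (e_space i) (\<lambda>z. \<alpha> (fst z) * F z) (\<lambda>z. \<alpha> (fst z) * F' z)"
  using dirder_mult[OF dirder_fst_space[of i \<alpha>] assms] by simp

abbreviation dx :: "'n::finite \<Rightarrow> (real \<times> (real ^ 'n) \<Rightarrow> real) \<Rightarrow> real \<times> (real ^ 'n) \<Rightarrow> real" where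
  "dx i \<equiv> pd (e_space i)"

abbreviation dt :: "(real \<times> (real ^ 'n) \<Rightarrow> real) \<Rightarrow> real \<times> (real ^ 'n) \<Rightarrow> real" where
  "dt \<equiv> pd e_time"

lemmas smooth_dx = smooth_pd[OF _ e_space_Basis]
lemmas smooth_dt = smooth_pd[OF _ e_time_Basis]
lemmas test_function_dx = test_function_pd[OF _ e_space_Basis]
lemmas test_function_dt = test_function_pd[OF _ e_time_Basis]

lemma test_function_smooth: "test_function \<phi> \<Longrightarrow> smooth \<phi>" and test_function_csupp: "test_function \<phi> \<Longrightarrow> csupp \<phi>"
  by (auto simp: test_function_iff)

lemma has_bochner_integral_zero_sum:
  fixes h :: "'i::finite \<Rightarrow> 'a \<Rightarrow> real"
  assumes "\<And>i. has_bochner_integral M (h i) 0" shows "has_bochner_integral M (\<lambda>z. \<Sum>i\<in>UNIV. h i z) 0"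
  using has_bochner_integral_sum[of UNIV M h "\<lambda>i. 0"] assms by simp

lemma has_bochner_integral_zero_cmult:
  fixes h :: "'a \<Rightarrow> real"
  shows "has_bochner_integral M h 0 \<Longrightarrow> has_bochner_integral M (\<lambda>z. c * h z) 0"
  using has_bochner_integral_mult_right[of c M h 0] by simp

lemma has_bochner_integral_zero_add:
  fixes h k :: "'a \<Rightarrow> real"
  shows "has_bochner_integral M h 0 \<Longrightarrow> has_bochner_integral M k 0 \<Longrightarrow> has_bochner_integral M (\<lambda>z. h z + k z) 0"
  using has_bochner_integral_add[of M h 0 k 0] by simp

lemma has_bochner_integral_zero_cong:
  "has_bochner_integral M h 0 \<Longrightarrow> (\<And>z. h z = k z) \<Longrightarrow> has_bochner_integral M k 0" by (metis ext)

context ou_family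
begin

text \<open>The generator with classical derivatives, for smooth arguments, as opposed to
  \<open>Gop\<close>, whose values depend on chosen versions of weak derivatives.\<close>

definition Gc :: "(real \<times> (real ^ 'n) \<Rightarrow> real) \<Rightarrow> real \<times> (real ^ 'n) \<Rightarrow> real" where
  "Gc \<phi> z = dt \<phi> z + 1/2 * (\<Sum>i\<in>UNIV. \<Sum>j\<in>UNIV. C (fst z) $ i $ j * dx j (dx i \<phi>) z) + (\<Sum>i\<in>UNIV. drift z $ i * dx i \<phi> z)"

text \<open>In the coordinates that turn \<open>\<nu>\<^sub>t\<close> into the standard Gaussian measure, \<open>Nc\<close> is the number operator.\<close>

definition Nc :: "(real \<times> (real ^ 'n) \<Rightarrow> real) \<Rightarrow> real \<times> (real ^ 'n) \<Rightarrow> real" where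
  "Nc \<phi> z = - (\<Sum>i\<in>UNIV. \<Sum>j\<in>UNIV. Q (fst z) $ i $ j * dx j (dx i \<phi>) z) + (\<Sum>i\<in>UNIV. y z $ i * dx i \<phi> z)"

lemma continuous_entries:
  "continuous_on UNIV (\<lambda>z::real \<times> (real ^ 'n). C (fst z) $ i $ j)" "continuous_on UNIV (\<lambda>z::real \<times> (real ^ 'n). Q (fst z) $ i $ j)"
  "continuous_on UNIV (\<lambda>z::real \<times> (real ^ 'n). P (fst z) $ i $ j)" "continuous_on UNIV (\<lambda>z::real \<times> (real ^ 'n). A (fst z) $ i $ j)"
  "continuous_on UNIV (\<lambda>z::real \<times> (real ^ 'n). Q' (fst z) $ i $ j)"
  "continuous_on UNIV (\<lambda>z. y z $ i)" "continuous_on UNIV (\<lambda>z. pv z $ i)" "continuous_on UNIV (\<lambda>z. drift z $ i)"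
  "continuous_on UNIV \<rho>" using continuous_fst_comp[OF C_continuous] continuous_fst_comp[OF continuous_Q] continuous_fst_comp[OF continuous_P]
   continuous_fst_comp[OF A_continuous] continuous_fst_comp[OF continuous_Q']
   continuous_y continuous_pv continuous_drift continuous_\<rho> by (auto intro!: bounded_linear.continuous_on[OF bounded_linear_vec_nth])

lemma continuous_\<rho>\<^sub>t: "continuous_on UNIV \<rho>\<^sub>t"
proof -
  have "trace (P t ** Q' t) = (\<Sum>i\<in>UNIV. \<Sum>k\<in>UNIV. P t $ i $ k * Q' t $ k $ i)" for t by (simp add: trace_def matrix_matrix_mult_def)
  moreover have "continuous_on UNIV (\<lambda>z::real \<times> (real ^ 'n). \<Sum>i\<in>UNIV. \<Sum>k\<in>UNIV. P (fst z) $ i $ k * Q' (fst z) $ k $ i)"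
   by (intro continuous_on_sum continuous_on_mult continuous_entries)
  ultimately have "continuous_on UNIV (\<lambda>z::real \<times> (real ^ 'n). trace (P (fst z) ** Q' (fst z)))" by simp
  then show ?thesis unfolding \<rho>\<^sub>t_def[abs_def]
   by (intro continuous_on_add continuous_on_diff continuous_on_mult continuous_on_const continuous_on_inner
     continuous_intros_matrix continuous_pv continuous_fst_comp[OF continuous_g'] continuous_fst_comp[OF continuous_Q'])
qed

lemma C_sym: "C t $ j $ i = C t $ i $ j" and Q_sym: "Q t $ j $ i = Q t $ i $ j" and P_sym: "P t $ j $ i = P t $ i $ j"
  using arg_cong[OF C_symmetric[of t], of "\<lambda>M. M $ i $ j"] arg_cong[OF Q_symmetric[of t], of "\<lambda>M. M $ i $ j"]
   arg_cong[OF P_symmetric[of t], of "\<lambda>M. M $ i $ j"] by (simp_all add: transpose_def)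

lemma Q_pv: "(\<Sum>j\<in>UNIV. Q (fst z) $ i $ j * pv z $ j) = y z $ i"
proof -
  have "Q (fst z) *v pv z = y z" by (simp only: pv_def matrix_vector_mul_assoc QP matrix_vector_mul_lid)
  then have "(Q (fst z) *v pv z) $ i = y z $ i" by simp
  then show ?thesis by (simp add: matrix_vector_mult_def)
qed

lemma dirder_drift: "dirder (e_space j) (\<lambda>z. drift z $ i) (\<lambda>z. A (fst z) $ i $ j)"
proof -
  have "drift (z + s *\<^sub>R e_space j) $ i = drift z $ i + s * A (fst z) $ i $ j" for z s
   by (simp add: drift_def matrix_vector_right_distrib matrix_vector_mult_scaleR matrix_vector_mult_basis column_def)
  then show ?thesis unfolding dirder_def by (auto intro!: derivative_eq_intros)
qed

text \<open>Invariance of \<open>\<nu>\<close>: integrals of \<open>G (\<alpha> r)\<close> vanish.\<close>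

lemma invariance:
  assumes r: "test_function r" and a: "\<And>t. (\<alpha> has_real_derivative \<alpha>' t) (at t)" and a': "continuous_on UNIV \<alpha>'"
  shows "has_bochner_integral lborel (\<lambda>z. \<rho> z * (\<alpha>' (fst z) * r z + \<alpha> (fst z) * Gc r z)) 0"
proof -
  have sm: "smooth r" "smooth (dx i r)" "smooth (dt r)" "smooth (dx j (dx i r))" for i j
   using r by (auto intro: test_function_smooth smooth_dx smooth_dt)
  note ct = continuous_on_mult continuous_on_add continuous_on_minus continuous_on_const sm[THEN smooth_continuous] continuous_entries continuous_\<rho>\<^sub>t
  have ac: "continuous_on UNIV \<alpha>" by (rule continuous_at_imp_continuous_on, rule ballI, rule DERIV_isCont[OF a])
  note ca = continuous_fst_comp[OF ac] continuous_fst_comp[OF a']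
  have sup: "csupp (\<lambda>z. k z * (r z * h z))" "csupp (\<lambda>z. k z * (dx i r z * h z))" for k h i
   by (rule csupp_mult_right[OF csupp_mult_left], intro test_function_csupp test_function_dx r)+
  have I0: "has_bochner_integral lborel (\<lambda>z. \<alpha>' (fst z) * (r z * \<rho> z) + \<alpha> (fst z) * (dt r z * \<rho> z + r z * (\<rho>\<^sub>t z * \<rho> z))) 0"
   by (rule ibp[OF dirder_mult[OF dirder_fst[OF a] dirder_mult[OF dirder_pd[OF sm(1)] dirder_\<rho>_time]] sup(1)]; intro ct ca)
  \<comment> \<open>The second-order term is treated in two rounds: \<open>I1\<close> moves one
    derivative to the density, \<open>I2\<close> the other. The term with \<open>dx i r\<close> and
    \<open>pv z $ j\<close> cancels between them and a multiple of \<open>r\<close> remains, as in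
    \<open>I0\<close> and \<open>I3\<close>.\<close>
  have I1: "has_bochner_integral lborel (\<lambda>z. (\<alpha> (fst z) * C (fst z) $ i $ j) * (dx j (dx i r) z * \<rho> z + dx i r z * (- pv z $ j * \<rho> z))) 0" for i j
   by (rule ibp[OF dirder_coeff_space[OF dirder_mult[OF dirder_pd[OF sm(2)] dirder_\<rho>_space]] sup(2)]; intro ct ca)
  have I2: "has_bochner_integral lborel (\<lambda>z. (\<alpha> (fst z) * C (fst z) $ i $ j) * (dx i r z * (pv z $ j * \<rho> z)
    + r z * (P (fst z) $ j $ i * \<rho> z + pv z $ j * (- pv z $ i * \<rho> z)))) 0" for i j
   by (rule ibp[OF dirder_coeff_space[OF dirder_mult[OF dirder_pd[OF sm(1)] dirder_mult[OF dirder_pv dirder_\<rho>_space]]] sup(1)]; intro ct ca)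
  have I3: "has_bochner_integral lborel (\<lambda>z. \<alpha> (fst z) * (dx i r z * (drift z $ i * \<rho> z)
    + r z * (A (fst z) $ i $ i * \<rho> z + drift z $ i * (- pv z $ i * \<rho> z)))) 0" for i
   by (rule ibp[OF dirder_coeff_space[OF dirder_mult[OF dirder_pd[OF sm(1)] dirder_mult[OF dirder_drift dirder_\<rho>_space]]] sup(1)]; intro ct ca)
  note I12 = has_bochner_integral_zero_add[OF I1 I2]
  note S12 = has_bochner_integral_zero_cmult[OF has_bochner_integral_zero_sum[OF has_bochner_integral_zero_sum[OF I12]], of "1/2"]
  note S = has_bochner_integral_zero_add[OF I0 has_bochner_integral_zero_add[OF S12 has_bochner_integral_zero_sum[OF I3]]]
  show ?thesis
  proof (rule has_bochner_integral_zero_cong[OF S])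
   fix z :: "real \<times> (real ^ 'n)"
   let ?a = "\<alpha> (fst z)" and ?a' = "\<alpha>' (fst z)" and ?C = "\<lambda>i j. C (fst z) $ i $ j" and ?P = "\<lambda>i j. P (fst z) $ i $ j"
   have e12: "(\<Sum>i\<in>UNIV. \<Sum>j\<in>UNIV. (?a * ?C i j) * (dx j (dx i r) z * \<rho> z + dx i r z * (- pv z $ j * \<rho> z)) +
     (?a * ?C i j) * (dx i r z * (pv z $ j * \<rho> z) + r z * (?P j i * \<rho> z + pv z $ j * (- pv z $ i * \<rho> z))))
    = ?a * \<rho> z * (\<Sum>i\<in>UNIV. \<Sum>j\<in>UNIV. ?C i j * dx j (dx i r) z) - ?a * \<rho> z * r z * (\<Sum>i\<in>UNIV. \<Sum>j\<in>UNIV. ?C i j * (pv z $ i * pv z $ j - ?P i j))"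
    unfolding sum_distrib_left sum_subtractf[symmetric] by (intro sum.cong refl) (simp add: P_sym[of "fst z"] algebra_simps)
   have e3: "(\<Sum>i\<in>UNIV. ?a * (dx i r z * (drift z $ i * \<rho> z) + r z * (A (fst z) $ i $ i * \<rho> z + drift z $ i * (- pv z $ i * \<rho> z))))
    = ?a * \<rho> z * (\<Sum>i\<in>UNIV. drift z $ i * dx i r z) + ?a * \<rho> z * r z * trace (A (fst z)) - ?a * \<rho> z * r z * (drift z \<bullet> pv z)"
    unfolding trace_def inner_vec_def sum_distrib_left sum_subtractf[symmetric] sum.distrib[symmetric]
    by (intro sum.cong refl) (simp add: algebra_simps)
   show "?a' * (r z * \<rho> z) + ?a * (dt r z * \<rho> z + r z * (\<rho>\<^sub>t z * \<rho> z)) + (1/2 *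
    (\<Sum>i\<in>UNIV. \<Sum>j\<in>UNIV. (?a * ?C i j) * (dx j (dx i r) z * \<rho> z + dx i r z * (- pv z $ j * \<rho> z)) +
     (?a * ?C i j) * (dx i r z * (pv z $ j * \<rho> z) + r z * (?P j i * \<rho> z + pv z $ j * (- pv z $ i * \<rho> z)))) +
    (\<Sum>i\<in>UNIV. ?a * (dx i r z * (drift z $ i * \<rho> z) + r z * (A (fst z) $ i $ i * \<rho> z + drift z $ i * (- pv z $ i * \<rho> z)))))
    = \<rho> z * (?a' * r z + ?a * Gc r z)" unfolding e12 e3 Gc_def fokker_planck[of z, symmetric] by (simp add: algebra_simps)
  qed
qed

text \<open>\<open>Nc\<close> is the operator of the Dirichlet form with matrix \<open>Q\<close>.
  Only spatial derivatives are moved, so \<alpha> need not be differentiable; compact support comes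
  from \<phi>, which leaves room for \<open>w = Gc \<phi>\<close> with coefficients merely
  continuous in time.\<close>

lemma number_ibp:
  assumes \<phi>: "test_function \<phi>" and w: "\<And>a. dirder (e_space a) w (w' a)" and cw: "continuous_on UNIV w" "\<And>a. continuous_on UNIV (w' a)"
   and a: "continuous_on UNIV \<alpha>"
  shows "has_bochner_integral lborel (\<lambda>z. \<rho> z * (\<alpha> (fst z) * ((\<Sum>b\<in>UNIV. \<Sum>a\<in>UNIV. Q (fst z) $ b $ a * (dx b \<phi> z * w' a z)) - w z * Nc \<phi> z))) 0"
proof -
  have sm: "smooth \<phi>" "smooth (dx i \<phi>)" "smooth (dx j (dx i \<phi>))" for i j using \<phi> by (auto intro: test_function_smooth smooth_dx)
  note ct = continuous_on_mult continuous_on_add continuous_on_minus continuous_on_const sm[THEN smooth_continuous] continuous_entries cw continuous_fst_comp[OF a]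
  have sup: "csupp (\<lambda>z. k z * (dx i \<phi> z * h z))" for k h i
   by (rule csupp_mult_right[OF csupp_mult_left], intro test_function_csupp test_function_dx \<phi>)
  have I: "has_bochner_integral lborel (\<lambda>z. (\<alpha> (fst z) * Q (fst z) $ b $ a) * (dx a (dx b \<phi>) z * (w z * \<rho> z)
    + dx b \<phi> z * (w' a z * \<rho> z + w z * (- pv z $ a * \<rho> z)))) 0" for a b
   by (rule ibp[OF dirder_coeff_space[OF dirder_mult[OF dirder_pd[OF sm(2)] dirder_mult[OF w dirder_\<rho>_space]]] sup]; intro ct)
  show ?thesis
  proof (rule has_bochner_integral_zero_cong[OF has_bochner_integral_zero_sum[OF has_bochner_integral_zero_sum[OF I]]])
   fix z :: "real \<times> (real ^ 'n)"
   let ?a = "\<alpha> (fst z)" and ?Q = "\<lambda>i j. Q (fst z) $ i $ j"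
   have e: "(\<Sum>b\<in>UNIV. \<Sum>a\<in>UNIV. (?a * ?Q b a) * (dx a (dx b \<phi>) z * (w z * \<rho> z) + dx b \<phi> z * (w' a z * \<rho> z + w z * (- pv z $ a * \<rho> z))))
    = \<rho> z * ?a * (\<Sum>b\<in>UNIV. \<Sum>a\<in>UNIV. ?Q b a * (dx b \<phi> z * w' a z)) + \<rho> z * ?a * w z * (\<Sum>b\<in>UNIV. \<Sum>a\<in>UNIV. ?Q b a * dx a (dx b \<phi>) z)
     - \<rho> z * ?a * w z * (\<Sum>b\<in>UNIV. (\<Sum>a\<in>UNIV. ?Q b a * pv z $ a) * dx b \<phi> z)"
    unfolding sum_distrib_left sum_distrib_right sum_subtractf[symmetric] sum.distrib[symmetric] by (intro sum.cong refl) (simp add: algebra_simps)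
   show "(\<Sum>b\<in>UNIV. \<Sum>a\<in>UNIV. (?a * ?Q b a) * (dx a (dx b \<phi>) z * (w z * \<rho> z) + dx b \<phi> z * (w' a z * \<rho> z + w z * (- pv z $ a * \<rho> z))))
    = \<rho> z * (?a * ((\<Sum>b\<in>UNIV. \<Sum>a\<in>UNIV. ?Q b a * (dx b \<phi> z * w' a z)) - w z * Nc \<phi> z))"
    unfolding e Q_pv Nc_def by (simp add: algebra_simps)
  qed
qed

text \<open>The divergence of the field \<rho> p^2 Q y. As Q pv = y, the derivative of the density
  produces the weight |y|^2, while the derivative of \<open>y\<close> produces the trace of
  \<open>Q\<close>.\<close>

lemma weighted_ibp:
  assumes p: "test_function p"
  shows "has_bochner_integral lborel (\<lambda>z. \<rho> z * ((\<Sum>i\<in>UNIV. Q (fst z) $ i $ i) * (p z)\<^sup>2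
   + 2 * p z * (\<Sum>i\<in>UNIV. \<Sum>j\<in>UNIV. Q (fst z) $ i $ j * (y z $ i * dx j p z)) - (y z \<bullet> y z) * (p z)\<^sup>2)) 0"
proof -
  have sm: "smooth p" "smooth (dx i p)" for i using p by (auto intro: test_function_smooth smooth_dx)
  note ct = continuous_on_mult continuous_on_add continuous_on_minus continuous_on_const sm[THEN smooth_continuous] continuous_entries
  have sup: "csupp (\<lambda>z. k z * (p z * h z))" for k h by (rule csupp_mult_right[OF csupp_mult_left], intro test_function_csupp p)
  have I: "has_bochner_integral lborel (\<lambda>z. Q (fst z) $ i $ j * (dx j p z * (p z * (y z $ i * \<rho> z)) + p z * (dx j p z * (y z $ i * \<rho> z)
    + p z * ((if i = j then 1 else 0) * \<rho> z + y z $ i * (- pv z $ j * \<rho> z))))) 0" for i j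
   by (rule ibp[OF dirder_coeff_space[OF dirder_mult[OF dirder_pd[OF sm(1)] dirder_mult[OF dirder_pd[OF sm(1)] dirder_mult[OF dirder_y dirder_\<rho>_space]]]] sup]; intro ct)
  show ?thesis
  proof (rule has_bochner_integral_zero_cong[OF has_bochner_integral_zero_sum[OF has_bochner_integral_zero_sum[OF I]]])
   fix z :: "real \<times> (real ^ 'n)"
   let ?Q = "\<lambda>i j. Q (fst z) $ i $ j"
   have d: "(\<Sum>j\<in>UNIV. ?Q i j * (if i = j then 1 else 0)) = ?Q i i" for i by (simp add: if_distrib[of "\<lambda>x. _ * x"] cong: if_cong)
   have e: "(\<Sum>i\<in>UNIV. \<Sum>j\<in>UNIV. ?Q i j * (dx j p z * (p z * (y z $ i * \<rho> z)) + p z * (dx j p z * (y z $ i * \<rho> z)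
    + p z * ((if i = j then 1 else 0) * \<rho> z + y z $ i * (- pv z $ j * \<rho> z)))))
   = \<rho> z * (p z)\<^sup>2 * (\<Sum>i\<in>UNIV. \<Sum>j\<in>UNIV. ?Q i j * (if i = j then 1 else 0)) + \<rho> z * 2 * p z * (\<Sum>i\<in>UNIV. \<Sum>j\<in>UNIV. ?Q i j * (y z $ i * dx j p z))
    - \<rho> z * (p z)\<^sup>2 * (\<Sum>i\<in>UNIV. (\<Sum>j\<in>UNIV. ?Q i j * pv z $ j) * y z $ i)"
    unfolding sum_distrib_left sum_distrib_right sum_subtractf[symmetric] sum.distrib[symmetric]
    by (intro sum.cong refl) (simp add: algebra_simps power2_eq_square)
   show "(\<Sum>i\<in>UNIV. \<Sum>j\<in>UNIV. ?Q i j * (dx j p z * (p z * (y z $ i * \<rho> z)) + p z * (dx j p z * (y z $ i * \<rho> z)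
    + p z * ((if i = j then 1 else 0) * \<rho> z + y z $ i * (- pv z $ j * \<rho> z)))))
   = \<rho> z * ((\<Sum>i\<in>UNIV. ?Q i i) * (p z)\<^sup>2 + 2 * p z * (\<Sum>i\<in>UNIV. \<Sum>j\<in>UNIV. ?Q i j * (y z $ i * dx j p z)) - (y z \<bullet> y z) * (p z)\<^sup>2)"
    unfolding e Q_pv d by (simp add: algebra_simps inner_vec_def)
  qed
qed

end

section \<open>A priori estimates for test functions\<close>

lemma sum2_bound:
  fixes h :: "'i::finite \<Rightarrow> 'j::finite \<Rightarrow> real"
  assumes "\<And>i j. h i j \<le> c" shows "(\<Sum>i\<in>UNIV. \<Sum>j\<in>UNIV. h i j) \<le> real CARD('i) * (real CARD('j) * c)"
proof -
  have "(\<Sum>i\<in>UNIV. \<Sum>j\<in>UNIV. h i j) \<le> (\<Sum>i\<in>(UNIV::'i set). \<Sum>j\<in>(UNIV::'j set). c)" by (intro sum_mono assms)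
  then show ?thesis by simp
qed

lemma sum2_abs_bound:
  fixes h :: "'i::finite \<Rightarrow> 'j::finite \<Rightarrow> real"
  assumes "\<And>i j. \<bar>h i j\<bar> \<le> c" shows "\<bar>\<Sum>i\<in>UNIV. \<Sum>j\<in>UNIV. h i j\<bar> \<le> real CARD('i) * (real CARD('j) * c)"
proof -
  have "\<bar>\<Sum>i\<in>UNIV. \<Sum>j\<in>UNIV. h i j\<bar> \<le> (\<Sum>i\<in>UNIV. \<Sum>j\<in>UNIV. \<bar>h i j\<bar>)"
   by (rule order_trans[OF sum_abs]) (intro sum_mono sum_abs)
  also have "\<dots> \<le> real CARD('i) * (real CARD('j) * c)" by (rule sum2_bound[OF assms])
  finally show ?thesis .
qed

lemma power2_le_if_abs_le: "\<bar>a\<bar> \<le> b \<Longrightarrow> a\<^sup>2 \<le> b\<^sup>2" for a b :: real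
  using power_mono[of "\<bar>a\<bar>" b 2] by simp

text \<open>Young's inequality with a free parameter \<open>e\<close>, chosen later so that one of
  the two terms can be absorbed.\<close>

lemma bilinear_young:
  fixes a :: "'i::finite \<Rightarrow> real" and b :: "'j::finite \<Rightarrow> real"
  assumes M: "\<And>i j. \<bar>M i j\<bar> \<le> K" and e: "e > 0"
  shows "2 * (\<Sum>i\<in>UNIV. \<Sum>j\<in>UNIV. M i j * (a i * b j)) \<le> real CARD('j) * (K\<^sup>2 / e) * (\<Sum>i\<in>UNIV. (a i)\<^sup>2) + real CARD('i) * e * (\<Sum>j\<in>UNIV. (b j)\<^sup>2)"
proof -
  have "2 * (M i j * (a i * b j)) \<le> K\<^sup>2 / e * (a i)\<^sup>2 + e * (b j)\<^sup>2" for i j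
  proof -
   have "0 \<le> e * (b j - M i j * a i / e)\<^sup>2" using e by simp
   also have "\<dots> = e * (b j)\<^sup>2 - 2 * (M i j * (a i * b j)) + (M i j)\<^sup>2 / e * (a i)\<^sup>2" using e by (simp add: field_simps power2_eq_square)
   finally show ?thesis using mult_right_mono[OF divide_right_mono[OF power2_le_if_abs_le[OF M] less_imp_le[OF e]], of "(a i)\<^sup>2" i j] by simp
  qed
  then have "2 * (\<Sum>i\<in>UNIV. \<Sum>j\<in>UNIV. M i j * (a i * b j)) \<le> (\<Sum>i\<in>(UNIV::'i set). \<Sum>j\<in>(UNIV::'j set). K\<^sup>2 / e * (a i)\<^sup>2 + e * (b j)\<^sup>2)"
   unfolding sum_distrib_left by (intro sum_mono)
  also have "\<dots> = real CARD('j) * (K\<^sup>2 / e) * (\<Sum>i\<in>UNIV. (a i)\<^sup>2) + real CARD('i) * e * (\<Sum>j\<in>UNIV. (b j)\<^sup>2)"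
   by (simp add: sum.distrib sum_distrib_left mult.assoc)
  finally show ?thesis .
qed

lemma abs_mult_le_square_bound:
  fixes a b :: real
  assumes "a\<^sup>2 \<le> s" "b\<^sup>2 \<le> s" shows "\<bar>a * b\<bar> \<le> s"
proof -
  have "2 * (\<bar>a\<bar> * \<bar>b\<bar>) \<le> \<bar>a\<bar>\<^sup>2 + \<bar>b\<bar>\<^sup>2" using sum_squares_bound[of "\<bar>a\<bar>" "\<bar>b\<bar>"] by simp
  then show ?thesis using assms by (simp add: abs_mult)
qed

context ou_family
begin

lemma pd_commute_dx:
  assumes "smooth \<phi>"
  shows "dx a (dt \<phi>) = dt (dx a \<phi>)" "dx a (dx j (dx i \<phi>)) = dx j (dx i (dx a \<phi>))"
  using assms pd_commute[OF _ e_space_Basis e_time_Basis] pd_commute[OF _ e_space_Basis e_space_Basis] smooth_dx by metis+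

lemma dx_dx_mult:
  assumes "smooth p" "smooth q"
  shows "dx j (dx i (\<lambda>z. p z * q z)) = (\<lambda>z. p z * dx j (dx i q) z + dx j p z * dx i q z + (dx i p z * dx j q z + dx j (dx i p) z * q z))"
proof -
  have s: "smooth (\<lambda>z. p z * dx i q z)" "smooth (\<lambda>z. dx i p z * q z)" using assms by (auto intro: smooth_mult smooth_dx)
  show ?thesis unfolding pd_mult[OF assms] pd_add[OF s] pd_mult[OF assms(1) smooth_dx[OF assms(2)]] pd_mult[OF smooth_dx[OF assms(1)] assms(2)] ..
qed

text \<open>The defect from a derivation is the carre du champ: both mixed terms of the second
  derivative agree by symmetry of \<open>C\<close>, which cancels the factor 1/2.\<close>

lemma Gc_mult:
  assumes "smooth p" "smooth q"
  shows "Gc (\<lambda>z. p z * q z) z = p z * Gc q z + q z * Gc p z + (\<Sum>i\<in>UNIV. \<Sum>j\<in>UNIV. C (fst z) $ i $ j * (dx i p z * dx j q z))"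
proof -
  let ?C = "\<lambda>i j. C (fst z) $ i $ j"
  have sw: "(\<Sum>i\<in>UNIV. \<Sum>j\<in>UNIV. ?C i j * (dx j p z * dx i q z)) = (\<Sum>i\<in>UNIV. \<Sum>j\<in>UNIV. ?C i j * (dx i p z * dx j q z))"
   by (subst sum.swap) (simp add: C_sym)
  have e: "(\<Sum>i\<in>UNIV. \<Sum>j\<in>UNIV. ?C i j * (p z * dx j (dx i q) z + dx j p z * dx i q z + (dx i p z * dx j q z + dx j (dx i p) z * q z)))
   = p z * (\<Sum>i\<in>UNIV. \<Sum>j\<in>UNIV. ?C i j * dx j (dx i q) z) + q z * (\<Sum>i\<in>UNIV. \<Sum>j\<in>UNIV. ?C i j * dx j (dx i p) z)
    + (\<Sum>i\<in>UNIV. \<Sum>j\<in>UNIV. ?C i j * (dx j p z * dx i q z)) + (\<Sum>i\<in>UNIV. \<Sum>j\<in>UNIV. ?C i j * (dx i p z * dx j q z))"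
   unfolding sum_distrib_left sum.distrib[symmetric] by (intro sum.cong refl) (simp add: algebra_simps)
  have e1: "(\<Sum>i\<in>UNIV. drift z $ i * (p z * dx i q z + dx i p z * q z)) = p z * (\<Sum>i\<in>UNIV. drift z $ i * dx i q z) + q z * (\<Sum>i\<in>UNIV. drift z $ i * dx i p z)"
   unfolding sum_distrib_left sum.distrib[symmetric] by (intro sum.cong refl) (simp add: algebra_simps)
  show ?thesis unfolding Gc_def unfolding dx_dx_mult[OF assms] unfolding pd_mult[OF assms] unfolding e e1 sw by (simp add: algebra_simps)
qed

lemma continuous_Gc: "smooth \<phi> \<Longrightarrow> continuous_on UNIV (Gc \<phi>)" unfolding Gc_def[abs_def]
  by (intro continuous_on_add continuous_on_mult continuous_on_sum continuous_on_const continuous_entries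
    smooth_continuous smooth_dx smooth_dt)

lemma continuous_Nc: "smooth \<phi> \<Longrightarrow> continuous_on UNIV (Nc \<phi>)" unfolding Nc_def[abs_def]
  by (intro continuous_on_add continuous_on_minus continuous_on_mult continuous_on_sum continuous_on_const continuous_entries
    smooth_continuous smooth_dx smooth_dt)

lemma cc_Gc: "test_function \<phi> \<Longrightarrow> cc (Gc \<phi>)" unfolding Gc_def[abs_def]
  by (intro cc_add cc_sum cc_mult_right continuous_on_const continuous_entries test_function_cc test_function_dx test_function_dt)

lemma cc_Nc: assumes "test_function \<phi>" shows "cc (Nc \<phi>)"
proof -
  have "cc (\<lambda>z. (-1) * (\<Sum>i\<in>UNIV. \<Sum>j\<in>UNIV. Q (fst z) $ i $ j * dx j (dx i \<phi>) z) + (\<Sum>i\<in>UNIV. y z $ i * dx i \<phi> z))"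
   by (intro cc_add cc_sum cc_mult_right continuous_on_const continuous_entries test_function_cc test_function_dx test_function_dt assms)
  then show ?thesis by (simp add: Nc_def[abs_def])
qed

text \<open>The commutator of a spatial derivative with G comes from the linear drift only; it is
  the one place where \<open>A\<close> survives and has to be compensated by the derivative of
  \<open>Q\<close>.\<close>

lemma dirder_Gc:
  assumes s: "smooth \<phi>"
  shows "dirder (e_space a) (Gc \<phi>) (\<lambda>z. Gc (dx a \<phi>) z + (\<Sum>i\<in>UNIV. A (fst z) $ i $ a * dx i \<phi> z))"
proof -
  have 1: "dirder (e_space a) (Gc \<phi>) (\<lambda>z. dx a (dt \<phi>) z + 1/2 * (\<Sum>i\<in>UNIV. \<Sum>j\<in>UNIV. C (fst z) $ i $ j * dx a (dx j (dx i \<phi>)) z)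
   + (\<Sum>i\<in>UNIV. A (fst z) $ i $ a * dx i \<phi> z + drift z $ i * dx a (dx i \<phi>) z))" unfolding Gc_def[abs_def]
   by (intro dirder_add dirder_cmult dirder_sum dirder_coeff_space dirder_mult dirder_drift dirder_pd smooth_dx smooth_dt s)
  have 2: "dx a (dx i \<phi>) = dx i (dx a \<phi>)" for i by (rule pd_commute[OF s e_space_Basis e_space_Basis])
  show ?thesis by (rule dirder_cong[OF 1]) (simp add: Gc_def pd_commute_dx[OF s] 2 sum.distrib)
qed

text \<open>Here the commutator is the derivative itself, as for the number operator with a ladder
  operator; it is the source of the form \<open>bil\<close> in the identity for the norm of
  \<open>Nc \<phi>\<close>.\<close>

lemma dirder_Nc:
  assumes s: "smooth \<phi>"
  shows "dirder (e_space a) (Nc \<phi>) (\<lambda>z. Nc (dx a \<phi>) z + dx a \<phi> z)"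
proof -
  have "dirder (e_space a) (\<lambda>z. (-1) * (\<Sum>i\<in>UNIV. \<Sum>j\<in>UNIV. Q (fst z) $ i $ j * dx j (dx i \<phi>) z) + (\<Sum>i\<in>UNIV. y z $ i * dx i \<phi> z))
   (\<lambda>z. (-1) * (\<Sum>i\<in>UNIV. \<Sum>j\<in>UNIV. Q (fst z) $ i $ j * dx a (dx j (dx i \<phi>)) z)
   + (\<Sum>i\<in>UNIV. (if i = a then 1 else 0) * dx i \<phi> z + y z $ i * dx a (dx i \<phi>) z))"
   by (intro dirder_add dirder_cmult dirder_sum dirder_coeff_space dirder_mult dirder_y dirder_pd smooth_dx s)
  moreover have "dx a (dx i \<phi>) = dx i (dx a \<phi>)" for i by (rule pd_commute[OF s e_space_Basis e_space_Basis])
  moreover have "(\<Sum>i\<in>UNIV. (if i = a then 1 else 0) * dx i \<phi> z) = dx a \<phi> z" for z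
   by (simp add: if_distrib[of "\<lambda>x. x * _"] cong: if_cong)
  ultimately have "dirder (e_space a) (\<lambda>z. (-1) * (\<Sum>i\<in>UNIV. \<Sum>j\<in>UNIV. Q (fst z) $ i $ j * dx j (dx i \<phi>) z) + (\<Sum>i\<in>UNIV. y z $ i * dx i \<phi> z))
   (\<lambda>z. Nc (dx a \<phi>) z + dx a \<phi> z)" by (elim dirder_cong) (simp add: Nc_def pd_commute_dx[OF s] sum.distrib)
  then show ?thesis by (simp add: Nc_def[abs_def])
qed

definition "bil M \<phi> z = (\<Sum>b\<in>UNIV. \<Sum>a\<in>UNIV. M $ b $ a * (dx b \<phi> z * dx a \<phi> z))"

text \<open>With H the spatial Hessian this is the trace of Q H M H.\<close>

definition "hess_form M \<phi> z = (\<Sum>b\<in>UNIV. \<Sum>a\<in>UNIV. Q (fst z) $ b $ a *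
  (\<Sum>d\<in>UNIV. \<Sum>c\<in>UNIV. M $ d $ c * (dx d (dx a \<phi>) z * dx c (dx b \<phi>) z)))"

lemma Q_entry_deriv: "((\<lambda>t. Q t $ b $ a) has_real_derivative Q' t $ b $ a) (at t)" unfolding has_real_derivative_iff_has_vector_derivative
  by (intro bounded_linear.has_vector_derivative[OF bounded_linear_vec_nth] Q_deriv')

lemma Q'_entry_continuous: "continuous_on UNIV (\<lambda>t. Q' t $ b $ a)"
  by (intro bounded_linear.continuous_on[OF bounded_linear_vec_nth] continuous_Q')

lemma Q_entry_continuous: "continuous_on UNIV (\<lambda>t. Q t $ b $ a)"
  by (intro bounded_linear.continuous_on[OF bounded_linear_vec_nth] continuous_Q)

text \<open>Differentiating \<open>\<integral> \<langle>Q D\<phi>, D\<phi>\<rangle> d\<nu>\<^sub>t\<close> in time; all terms with \<open>A\<close> cancel because of \<open>Q' = A Q + Q A\<^sup>* + C\<close>.\<close>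

lemma energy_identity:
  assumes \<phi>: "test_function \<phi>"
  shows "has_bochner_integral lborel (\<lambda>z. \<rho> z * (bil (C (fst z)) \<phi> z + hess_form (C (fst z)) \<phi> z + 2 * (Gc \<phi> z * Nc \<phi> z))) 0"
proof -
  have s: "smooth \<phi>" using \<phi> by (rule test_function_smooth)
  have tp: "test_function (\<lambda>z. dx a \<phi> z * dx b \<phi> z)" for a b by (intro test_function_mult test_function_dx \<phi>)
  \<comment> \<open>Invariance is applied to the product of two partial derivatives with the entry
    of \<open>Q\<close> as time factor, then summed; the sum differentiates the weighted gradient
    energy.\<close>
  note I1 = has_bochner_integral_zero_sum[OF has_bochner_integral_zero_sum[OF invariance[OF tp Q_entry_deriv Q'_entry_continuous]]]
  have cw: "continuous_on UNIV (\<lambda>z. Gc (dx a \<phi>) z + (\<Sum>i\<in>UNIV. A (fst z) $ i $ a * dx i \<phi> z))" for a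
   by (intro continuous_on_add continuous_Gc continuous_on_sum continuous_on_mult continuous_entries smooth_continuous smooth_dx s)
  \<comment> \<open>The factor -2 removes both terms in which G meets a partial derivative of
    \<phi>; they are equal by symmetry of \<open>Q\<close>. In return the product of
    \<open>Gc \<phi>\<close> and \<open>Nc \<phi>\<close> appears, together with a commutator term
    in \<open>A\<close>.\<close>
  note I2 = has_bochner_integral_zero_cmult[OF number_ibp[OF \<phi> dirder_Gc[OF s] continuous_Gc[OF s] cw continuous_on_const[of _ 1]], of "-2"]
  show ?thesis
  proof (rule has_bochner_integral_zero_cong[OF has_bochner_integral_zero_add[OF I1 I2]])
   fix z :: "real \<times> (real ^ 'n)"
   let ?Q = "\<lambda>b a. Q (fst z) $ b $ a" and ?Q' = "\<lambda>b a. Q' (fst z) $ b $ a"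
   let ?d = "\<chi> i. dx i \<phi> z"
   have e1: "(\<Sum>b\<in>UNIV. \<Sum>a\<in>UNIV. \<rho> z * (?Q' b a * (dx a \<phi> z * dx b \<phi> z) + ?Q b a * Gc (\<lambda>z. dx a \<phi> z * dx b \<phi> z) z))
    = \<rho> z * ((\<Sum>b\<in>UNIV. \<Sum>a\<in>UNIV. ?Q' b a * (dx b \<phi> z * dx a \<phi> z)) + (\<Sum>b\<in>UNIV. \<Sum>a\<in>UNIV. ?Q b a * (dx a \<phi> z * Gc (dx b \<phi>) z))
     + (\<Sum>b\<in>UNIV. \<Sum>a\<in>UNIV. ?Q b a * (dx b \<phi> z * Gc (dx a \<phi>) z)) + hess_form (C (fst z)) \<phi> z)"
    unfolding hess_form_def Gc_mult[OF smooth_dx[OF s] smooth_dx[OF s]] sum.distrib[symmetric] sum_distrib_left[of "\<rho> z"]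
    by (intro sum.cong refl) (simp add: algebra_simps)
   have sw: "(\<Sum>b\<in>UNIV. \<Sum>a\<in>UNIV. ?Q b a * (dx a \<phi> z * Gc (dx b \<phi>) z)) = (\<Sum>b\<in>UNIV. \<Sum>a\<in>UNIV. ?Q b a * (dx b \<phi> z * Gc (dx a \<phi>) z))"
    by (subst sum.swap) (simp add: Q_sym)
   have e2: "(\<Sum>b\<in>UNIV. \<Sum>a\<in>UNIV. ?Q b a * (dx b \<phi> z * (Gc (dx a \<phi>) z + (\<Sum>i\<in>UNIV. A (fst z) $ i $ a * dx i \<phi> z))))
    = (\<Sum>b\<in>UNIV. \<Sum>a\<in>UNIV. ?Q b a * (dx b \<phi> z * Gc (dx a \<phi>) z)) + ?d \<bullet> (Q (fst z) *v (transpose (A (fst z)) *v ?d))"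
    unfolding quadratic_sum sum.distrib[symmetric]
    by (intro sum.cong refl) (simp add: distrib_left del: transpose_matrix_vector, simp add: matrix_vector_mult_def transpose_def)
   \<comment> \<open>The two halves of the Lyapunov equation give the same quadratic form, so the
     derivative of \<open>Q\<close> contributes twice the commutator term, cancelling it, plus the
     form of \<open>C\<close>.\<close>
   have e3: "(\<Sum>b\<in>UNIV. \<Sum>a\<in>UNIV. ?Q' b a * (dx b \<phi> z * dx a \<phi> z)) = 2 * (?d \<bullet> (Q (fst z) *v (transpose (A (fst z)) *v ?d))) + bil (C (fst z)) \<phi> z"
   proof -
    have "(\<Sum>b\<in>UNIV. \<Sum>a\<in>UNIV. ?Q' b a * (dx b \<phi> z * dx a \<phi> z)) = ?d \<bullet> (Q' (fst z) *v ?d)" by (simp add: quadratic_sum)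
    also have "\<dots> = ?d \<bullet> ((A (fst z) ** Q (fst z)) *v ?d) + ?d \<bullet> ((Q (fst z) ** transpose (A (fst z))) *v ?d) + ?d \<bullet> (C (fst z) *v ?d)"
     by (simp only: Q'_def matrix_vector_mult_add_rdistrib inner_add_right)
    also have "?d \<bullet> ((A (fst z) ** Q (fst z)) *v ?d) = ?d \<bullet> (Q (fst z) *v (transpose (A (fst z)) *v ?d))"
    proof -
     have "?d \<bullet> ((A (fst z) ** Q (fst z)) *v ?d) = (transpose (A (fst z)) *v ?d) \<bullet> (Q (fst z) *v ?d)"
      by (simp only: matrix_vector_mul_assoc[symmetric] inner_transpose_mult[of _ "A (fst z)"])
     also have "\<dots> = (Q (fst z) *v (transpose (A (fst z)) *v ?d)) \<bullet> ?d"
      by (simp only: inner_transpose_mult[of _ "Q (fst z)" ?d] Q_symmetric)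
     finally show ?thesis by (simp only: inner_commute)
    qed
    also have "?d \<bullet> ((Q (fst z) ** transpose (A (fst z))) *v ?d) = ?d \<bullet> (Q (fst z) *v (transpose (A (fst z)) *v ?d))"
     by (simp only: matrix_vector_mul_assoc)
    also have "?d \<bullet> (C (fst z) *v ?d) = bil (C (fst z)) \<phi> z" by (simp add: quadratic_sum bil_def)
    finally show ?thesis by simp
   qed
   show "(\<Sum>b\<in>UNIV. \<Sum>a\<in>UNIV. \<rho> z * (?Q' b a * (dx a \<phi> z * dx b \<phi> z) + ?Q b a * Gc (\<lambda>z. dx a \<phi> z * dx b \<phi> z) z))
    + (-2) * (\<rho> z * (1 * ((\<Sum>b\<in>UNIV. \<Sum>a\<in>UNIV. ?Q b a * (dx b \<phi> z * (Gc (dx a \<phi>) z + (\<Sum>i\<in>UNIV. A (fst z) $ i $ a * dx i \<phi> z)))) - Gc \<phi> z * Nc \<phi> z)))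
    = \<rho> z * (bil (C (fst z)) \<phi> z + hess_form (C (fst z)) \<phi> z + 2 * (Gc \<phi> z * Nc \<phi> z))"
    unfolding e1 sw e2 e3 by (simp add: algebra_simps)
  qed
qed

text \<open>The Bochner identity of Gaussian analysis, from integrating by parts twice: first with w
  = N\<phi>, then for each derivative of \<phi> with w another derivative.\<close>

lemma number_identity:
  assumes \<phi>: "test_function \<phi>"
  shows "has_bochner_integral lborel (\<lambda>z. \<rho> z * (bil (Q (fst z)) \<phi> z + hess_form (Q (fst z)) \<phi> z - Nc \<phi> z * Nc \<phi> z)) 0"
proof -
  have s: "smooth \<phi>" using \<phi> by (rule test_function_smooth)
  have cw: "continuous_on UNIV (\<lambda>z. Nc (dx a \<phi>) z + dx a \<phi> z)" for a
   by (intro continuous_on_add continuous_Nc smooth_continuous smooth_dx s)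
  note I1 = number_ibp[OF \<phi> dirder_Nc[OF s] continuous_Nc[OF s] cw continuous_on_const[of _ 1]]
  have I2: "has_bochner_integral lborel (\<lambda>z. \<rho> z * (Q (fst z) $ b $ a * ((\<Sum>d\<in>UNIV. \<Sum>c\<in>UNIV. Q (fst z) $ d $ c * (dx d (dx a \<phi>) z * dx c (dx b \<phi>) z))
   - dx b \<phi> z * Nc (dx a \<phi>) z))) 0" for a b
   by (rule number_ibp[OF test_function_dx[OF \<phi>] dirder_pd[OF smooth_dx[OF s]] _ _ Q_entry_continuous])
    (intro smooth_continuous smooth_dx s)+
  show ?thesis
  proof (rule has_bochner_integral_zero_cong[OF has_bochner_integral_zero_add[OF I1
     has_bochner_integral_zero_sum[OF has_bochner_integral_zero_sum[OF I2]]]])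
   fix z :: "real \<times> (real ^ 'n)"
   let ?Q = "\<lambda>b a. Q (fst z) $ b $ a"
   have e1: "(\<Sum>b\<in>UNIV. \<Sum>a\<in>UNIV. ?Q b a * (dx b \<phi> z * (Nc (dx a \<phi>) z + dx a \<phi> z))) =
    (\<Sum>b\<in>UNIV. \<Sum>a\<in>UNIV. ?Q b a * (dx b \<phi> z * Nc (dx a \<phi>) z)) + bil (Q (fst z)) \<phi> z"
    unfolding bil_def sum.distrib[symmetric] by (intro sum.cong refl) (simp add: algebra_simps)
   have e2: "(\<Sum>b\<in>UNIV. \<Sum>a\<in>UNIV. \<rho> z * (?Q b a * ((\<Sum>d\<in>UNIV. \<Sum>c\<in>UNIV. ?Q d c * (dx d (dx a \<phi>) z * dx c (dx b \<phi>) z)) - dx b \<phi> z * Nc (dx a \<phi>) z)))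
    = \<rho> z * (hess_form (Q (fst z)) \<phi> z - (\<Sum>b\<in>UNIV. \<Sum>a\<in>UNIV. ?Q b a * (dx b \<phi> z * Nc (dx a \<phi>) z)))"
    unfolding hess_form_def sum_subtractf[symmetric] sum_distrib_left[of "\<rho> z"] by (intro sum.cong refl) (simp add: algebra_simps)
   show "\<rho> z * (1 * ((\<Sum>b\<in>UNIV. \<Sum>a\<in>UNIV. ?Q b a * (dx b \<phi> z * (Nc (dx a \<phi>) z + dx a \<phi> z))) - Nc \<phi> z * Nc \<phi> z))
    + (\<Sum>b\<in>UNIV. \<Sum>a\<in>UNIV. \<rho> z * (?Q b a * ((\<Sum>d\<in>UNIV. \<Sum>c\<in>UNIV. ?Q d c * (dx d (dx a \<phi>) z * dx c (dx b \<phi>) z)) - dx b \<phi> z * Nc (dx a \<phi>) z)))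
    = \<rho> z * (bil (Q (fst z)) \<phi> z + hess_form (Q (fst z)) \<phi> z - Nc \<phi> z * Nc \<phi> z)"
    unfolding e1 e2 by (simp add: algebra_simps)
  qed
qed

definition "grad_sq \<phi> z = (\<Sum>i\<in>UNIV. (dx i \<phi> z)\<^sup>2)"
definition "hess_sq \<phi> z = (\<Sum>a\<in>UNIV. \<Sum>i\<in>UNIV. (dx i (dx a \<phi>) z)\<^sup>2)"

lemma grad_sq_ge: "(dx i \<phi> z)\<^sup>2 \<le> grad_sq \<phi> z"
  unfolding grad_sq_def by (rule member_le_sum[where f="\<lambda>i. (dx i \<phi> z)\<^sup>2"]) auto

lemma hess_sq_ge: "(dx i (dx a \<phi>) z)\<^sup>2 \<le> hess_sq \<phi> z"
proof -
  have "(dx i (dx a \<phi>) z)\<^sup>2 \<le> (\<Sum>i\<in>UNIV. (dx i (dx a \<phi>) z)\<^sup>2)" by (rule member_le_sum[where f="\<lambda>i. (dx i (dx a \<phi>) z)\<^sup>2"]) auto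
  also have "\<dots> \<le> hess_sq \<phi> z" unfolding hess_sq_def
   by (rule member_le_sum[where f="\<lambda>a. \<Sum>i\<in>UNIV. (dx i (dx a \<phi>) z)\<^sup>2"]) (auto intro: sum_nonneg)
  finally show ?thesis .
qed

lemma bil_C_lower: "bil (C (fst z)) \<phi> z \<ge> \<mu>0\<^sup>2 * grad_sq \<phi> z" using C_lower[of "\<chi> i. dx i \<phi> z" "fst z"]
  by (simp add: quadratic_sum bil_def grad_sq_def norm_vec_def L2_set_def sum_nonneg)

text \<open>Factoring C = B B^T turns the form into a sum of quadratic forms of \<open>Q\<close>,
  one for each component of B^T applied to the rows of the Hessian; the lower bounds of
  \<open>Q\<close> and of B^T then apply one after the other.\<close>

lemma hess_form_C_lower: "hess_form (C (fst z)) \<phi> z \<ge> q0 * \<mu>0\<^sup>2 * hess_sq \<phi> z"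
proof -
  let ?t = "fst z"
  let ?H = "\<lambda>a. \<chi> i. dx i (dx a \<phi>) z"
  define V where "V a = transpose (B ?t) *v ?H a" for a
  have inner: "(\<Sum>d\<in>UNIV. \<Sum>c\<in>UNIV. C ?t $ d $ c * (dx d (dx a \<phi>) z * dx c (dx b \<phi>) z)) = V a \<bullet> V b" for a b
  proof -
   have "(\<Sum>d\<in>UNIV. \<Sum>c\<in>UNIV. C ?t $ d $ c * (dx d (dx a \<phi>) z * dx c (dx b \<phi>) z)) = ?H a \<bullet> (C ?t *v ?H b)"
    by (simp add: quadratic_sum)
   also have "C ?t *v ?H b = B ?t *v V b" by (simp only: C_def V_def matrix_vector_mul_assoc)
   finally show ?thesis by (simp only: inner_transpose_mult V_def)
  qed
  have "hess_form (C ?t) \<phi> z = (\<Sum>k\<in>UNIV. (\<chi> a. V a $ k) \<bullet> (Q ?t *v (\<chi> a. V a $ k)))"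
  proof -
   have "hess_form (C ?t) \<phi> z = (\<Sum>b\<in>UNIV. \<Sum>a\<in>UNIV. \<Sum>k\<in>UNIV. Q ?t $ b $ a * (V a $ k * V b $ k))"
    unfolding hess_form_def inner by (simp add: inner_vec_def sum_distrib_left)
   also have "\<dots> = (\<Sum>b\<in>UNIV. \<Sum>k\<in>UNIV. \<Sum>a\<in>UNIV. Q ?t $ b $ a * (V a $ k * V b $ k))"
    by (rule sum.cong[OF refl], rule sum.swap)
   also have "\<dots> = (\<Sum>k\<in>UNIV. \<Sum>b\<in>UNIV. \<Sum>a\<in>UNIV. Q ?t $ b $ a * (V a $ k * V b $ k))" by (rule sum.swap)
   also have "\<dots> = (\<Sum>k\<in>UNIV. (\<chi> a. V a $ k) \<bullet> (Q ?t *v (\<chi> a. V a $ k)))" by (simp add: quadratic_sum mult_ac)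
   finally show ?thesis .
  qed
  also have "\<dots> \<ge> (\<Sum>k\<in>UNIV. q0 * (norm (\<chi> a. V a $ k))\<^sup>2)" by (intro sum_mono Q_lower)
  also have "(\<Sum>k\<in>UNIV. q0 * (norm (\<chi> a. V a $ k))\<^sup>2) = q0 * (\<Sum>a\<in>UNIV. (norm (V a))\<^sup>2)"
  proof -
   have "(\<Sum>k\<in>UNIV. (norm (\<chi> a. V a $ k))\<^sup>2) = (\<Sum>k\<in>UNIV. \<Sum>a\<in>UNIV. (V a $ k)\<^sup>2)"
    by (simp add: norm_vec_def L2_set_def sum_nonneg)
   also have "\<dots> = (\<Sum>a\<in>UNIV. (norm (V a))\<^sup>2)" by (subst sum.swap) (simp add: norm_vec_def L2_set_def sum_nonneg)
   finally show ?thesis by (simp add: sum_distrib_left[symmetric])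
  qed
  finally have 1: "q0 * (\<Sum>a\<in>UNIV. (norm (V a))\<^sup>2) \<le> hess_form (C ?t) \<phi> z" .
  have "\<mu>0\<^sup>2 * hess_sq \<phi> z = (\<Sum>a\<in>UNIV. \<mu>0\<^sup>2 * (norm (?H a))\<^sup>2)"
   by (simp add: hess_sq_def norm_vec_def L2_set_def sum_nonneg sum_distrib_left)
  also have "\<dots> \<le> (\<Sum>a\<in>UNIV. (norm (V a))\<^sup>2)"
  proof (rule sum_mono)
   fix a
   have "(\<mu>0 * norm (?H a))\<^sup>2 \<le> (norm (V a))\<^sup>2" unfolding V_def
    using B_transpose_lower[of "?H a" ?t] \<mu>0_pos by (intro power_mono) auto
   then show "\<mu>0\<^sup>2 * (norm (?H a))\<^sup>2 \<le> (norm (V a))\<^sup>2" by (simp only: power_mult_distrib)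
  qed
  finally have "q0 * (\<mu>0\<^sup>2 * hess_sq \<phi> z) \<le> q0 * (\<Sum>a\<in>UNIV. (norm (V a))\<^sup>2)" using q0_pos by (intro mult_left_mono) auto
  then show ?thesis using 1 by (simp add: mult.assoc)
qed

lemma ex_entry_bound:
  "\<exists>K>0. \<forall>t i j. \<bar>Q t $ i $ j\<bar> \<le> K \<and> \<bar>C t $ i $ j\<bar> \<le> K \<and> \<bar>A t $ i $ j\<bar> \<le> K \<and> \<bar>g' t $ i\<bar> \<le> K \<and> \<bar>g t $ i\<bar> \<le> K"
proof -
  obtain K1 where K1: "\<And>t. norm (g t) \<le> K1" "\<And>t. norm (Q t) \<le> K1" using g_Q_bounded by blast
  obtain K2 where K2: "\<And>t. norm (C t) \<le> K2" using C_bounded by blast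
  obtain K3 where K3: "\<And>t. norm (A t) \<le> K3" using A_bounded unfolding bounded_iff by blast
  obtain K4 where K4: "\<And>t. norm (f t) \<le> K4" using f_bounded unfolding bounded_iff by blast
  have g': "norm (g' t) \<le> KA * K1 + K4" for t
  proof -
   have "norm (g' t) \<le> norm (A t *v g t) + norm (f t)" unfolding g'_def by (rule norm_triangle_ineq)
   also have "\<dots> \<le> KA * K1 + K4" using KA by (intro add_mono order_trans[OF KA(2)] mult_left_mono K1 K4) auto
   finally show ?thesis .
  qed
  have e: "\<bar>M $ i $ j\<bar> \<le> norm M" for M :: "real ^ 'n ^ 'n" and i j
   by (rule order_trans[OF component_le_norm_cart Finite_Cartesian_Product.norm_nth_le])
  let ?K = "\<bar>K1\<bar> + \<bar>K2\<bar> + \<bar>K3\<bar> + \<bar>KA * K1 + K4\<bar> + 1"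
  have "\<bar>Q t $ i $ j\<bar> \<le> ?K \<and> \<bar>C t $ i $ j\<bar> \<le> ?K \<and> \<bar>A t $ i $ j\<bar> \<le> ?K \<and> \<bar>g' t $ i\<bar> \<le> ?K \<and> \<bar>g t $ i\<bar> \<le> ?K" for t i j
  proof (intro conjI)
   have le: "K1 \<le> ?K" "K2 \<le> ?K" "K3 \<le> ?K" "KA * K1 + K4 \<le> ?K" by simp_all
   show "\<bar>Q t $ i $ j\<bar> \<le> ?K" by (rule order_trans[OF order_trans[OF e K1(2)] le(1)])
   show "\<bar>C t $ i $ j\<bar> \<le> ?K" by (rule order_trans[OF order_trans[OF e K2] le(2)])
   show "\<bar>A t $ i $ j\<bar> \<le> ?K" by (rule order_trans[OF order_trans[OF e K3] le(3)])
   show "\<bar>g' t $ i\<bar> \<le> ?K" by (rule order_trans[OF order_trans[OF component_le_norm_cart g'] le(4)])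
   show "\<bar>g t $ i\<bar> \<le> ?K" by (rule order_trans[OF order_trans[OF component_le_norm_cart K1(1)] le(1)])
  qed
  note b = this
  have k: "0 < ?K" by (intro add_nonneg_pos add_nonneg_nonneg) simp_all
  show ?thesis by (rule exI[of _ ?K], rule conjI[OF k], intro allI, rule b)
qed

lemma cc_forms:
  assumes "test_function \<phi>"
  shows "cc (\<lambda>z. bil (C (fst z)) \<phi> z)" "cc (\<lambda>z. bil (Q (fst z)) \<phi> z)" "cc (\<lambda>z. hess_form (C (fst z)) \<phi> z)"
   "cc (\<lambda>z. hess_form (Q (fst z)) \<phi> z)" "cc (grad_sq \<phi>)" "cc (hess_sq \<phi>)"
proof -
  have pp: "cc (\<lambda>z. dx a \<phi> z * dx b \<phi> z)" "cc (\<lambda>z. dx d (dx a \<phi>) z * dx c (dx b \<phi>) z)" for a b c d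
   by (rule test_function_cc[OF test_function_mult]; intro test_function_dx assms)+
  show "cc (\<lambda>z. bil (C (fst z)) \<phi> z)" "cc (\<lambda>z. bil (Q (fst z)) \<phi> z)" "cc (\<lambda>z. hess_form (C (fst z)) \<phi> z)"
   "cc (\<lambda>z. hess_form (Q (fst z)) \<phi> z)" unfolding bil_def hess_form_def by (rule pp continuous_entries cc_sum cc_mult_right)+
  show "cc (grad_sq \<phi>)" "cc (hess_sq \<phi>)" unfolding grad_sq_def[abs_def] hess_sq_def[abs_def] power2_eq_square by (rule pp cc_sum)+
qed

lemma dens_integral_zero:
  assumes "has_bochner_integral lborel (\<lambda>z. \<rho> z * h z) 0" "h \<in> borel_measurable borel"
  shows "(LINT z|dens \<rho>. h z) = 0" using has_bochner_integral_integral_eq[OF assms(1)] by (simp add: integral_dens assms(2))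

text \<open>Energy identity, Cauchy-Schwarz and number identity close on themselves: the norm of
  \<open>Nc \<phi>\<close> that appears on the right is controlled by the square root of the
  quantity being estimated.\<close>

lemma a_priori_space:
  "\<exists>K>0. \<forall>\<phi>. test_function \<phi> \<longrightarrow> (LINT z|dens \<rho>. grad_sq \<phi> z) + (LINT z|dens \<rho>. hess_sq \<phi> z) \<le> K * sq (Gc \<phi>)"
proof -
  obtain K where K: "K > 0" "\<And>t i j. \<bar>Q t $ i $ j\<bar> \<le> K" using ex_entry_bound by blast
  define n where "n = real CARD('n)"
  \<comment> \<open>The summands bound the gradient form (Young with parameter \<open>K\<close>) and
    the Hessian form (four sums over coordinates, two entries of \<open>Q\<close>); the final 1 only
    secures positivity.\<close>
  define KN where "KN = n * K + n * (n * (K * (n * (n * K)))) + 1"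
  define c where "c = min (\<mu>0\<^sup>2) (q0 * \<mu>0\<^sup>2)"
  have c: "c > 0" using \<mu>0_pos q0_pos by (simp add: c_def)
  have n: "n \<ge> 0" by (simp add: n_def)
  have KN: "KN > 0" using K(1) n by (simp add: KN_def add_nonneg_pos)
  have "(LINT z|dens \<rho>. grad_sq \<phi> z) + (LINT z|dens \<rho>. hess_sq \<phi> z) \<le> (4 * KN / c\<^sup>2) * sq (Gc \<phi>)"
   if \<phi>: "test_function \<phi>" for \<phi>
  proof -
   note cc = cc_forms[OF \<phi>] cc_Gc[OF \<phi>] cc_Nc[OF \<phi>]
   note ccGN = cc_mult_left[OF cc(7), of "Nc \<phi>"] and ccNN = cc_mult_left[OF cc(8), of "Nc \<phi>"]
   have cont: "continuous_on UNIV (Nc \<phi>)" using cc(8) by (simp add: cc_def)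
   note i = cc[THEN integrable_dens_cc] integrable_dens_cc[OF ccGN[OF cont]] integrable_dens_cc[OF ccNN[OF cont]]
   note m = cc[THEN cc_measurable]
   define X where "X = (LINT z|dens \<rho>. grad_sq \<phi> z) + (LINT z|dens \<rho>. hess_sq \<phi> z)"
   define GN where "GN = (LINT z|dens \<rho>. Gc \<phi> z * Nc \<phi> z)"
   define GG where "GG = sq (Gc \<phi>)"
   define NN where "NN = sq (Nc \<phi>)"
   have "(LINT z|dens \<rho>. bil (C (fst z)) \<phi> z + hess_form (C (fst z)) \<phi> z + 2 * (Gc \<phi> z * Nc \<phi> z)) = 0"
    by (intro dens_integral_zero energy_identity[OF \<phi>] borel_measurable_add borel_measurable_times borel_measurable_const m)
   then have 1: "(LINT z|dens \<rho>. bil (C (fst z)) \<phi> z) + (LINT z|dens \<rho>. hess_form (C (fst z)) \<phi> z) = - 2 * GN"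
    using i by (simp add: GN_def)
   have "(LINT z|dens \<rho>. bil (Q (fst z)) \<phi> z + hess_form (Q (fst z)) \<phi> z - Nc \<phi> z * Nc \<phi> z) = 0"
    by (intro dens_integral_zero number_identity[OF \<phi>] borel_measurable_add borel_measurable_diff borel_measurable_times m)
   then have 2: "NN = (LINT z|dens \<rho>. bil (Q (fst z)) \<phi> z) + (LINT z|dens \<rho>. hess_form (Q (fst z)) \<phi> z)"
    using i by (simp add: NN_def power2_eq_square)
   have "c * X \<le> (LINT z|dens \<rho>. bil (C (fst z)) \<phi> z) + (LINT z|dens \<rho>. hess_form (C (fst z)) \<phi> z)"
   proof -
    have "c * (LINT z|dens \<rho>. grad_sq \<phi> z) \<le> (LINT z|dens \<rho>. bil (C (fst z)) \<phi> z)"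
    proof -
     have "c * grad_sq \<phi> z \<le> bil (C (fst z)) \<phi> z" for z
      by (rule order_trans[OF mult_right_mono bil_C_lower]) (auto simp: c_def grad_sq_def sum_nonneg)
     then have "(LINT z|dens \<rho>. c * grad_sq \<phi> z) \<le> (LINT z|dens \<rho>. bil (C (fst z)) \<phi> z)"
      using i by (intro integral_mono) auto
     then show ?thesis by simp
    qed
    moreover have "c * (LINT z|dens \<rho>. hess_sq \<phi> z) \<le> (LINT z|dens \<rho>. hess_form (C (fst z)) \<phi> z)"
    proof -
     have "c * hess_sq \<phi> z \<le> hess_form (C (fst z)) \<phi> z" for z
      by (rule order_trans[OF mult_right_mono hess_form_C_lower]) (auto simp: c_def hess_sq_def sum_nonneg)
     then have "(LINT z|dens \<rho>. c * hess_sq \<phi> z) \<le> (LINT z|dens \<rho>. hess_form (C (fst z)) \<phi> z)"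
      using i by (intro integral_mono) auto
     then show ?thesis by simp
    qed
    ultimately show ?thesis by (simp add: X_def distrib_left)
   qed
   then have 3: "c * X \<le> - 2 * GN" using 1 by simp
   have 4: "NN \<le> KN * X"
   proof -
    have "bil (Q (fst z)) \<phi> z \<le> KN * grad_sq \<phi> z" for z
    proof -
     have "2 * bil (Q (fst z)) \<phi> z \<le> n * (K\<^sup>2 / K) * grad_sq \<phi> z + n * K * grad_sq \<phi> z"
      unfolding bil_def grad_sq_def n_def by (rule bilinear_young[OF K(2,1)])
     then have "bil (Q (fst z)) \<phi> z \<le> n * K * grad_sq \<phi> z" using K(1) by (simp add: power2_eq_square mult_ac)
     also have "\<dots> \<le> KN * grad_sq \<phi> z" using K(1) n by (intro mult_right_mono) (auto simp: KN_def grad_sq_def sum_nonneg)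
     finally show ?thesis .
    qed
    then have a: "(LINT z|dens \<rho>. bil (Q (fst z)) \<phi> z) \<le> (LINT z|dens \<rho>. KN * grad_sq \<phi> z)"
     using i by (intro integral_mono) auto
    have "hess_form (Q (fst z)) \<phi> z \<le> KN * hess_sq \<phi> z" for z
    proof -
     have h: "hess_sq \<phi> z \<ge> 0" by (simp add: hess_sq_def sum_nonneg)
     have in1: "\<bar>Q (fst z) $ d $ c * (dx d (dx a \<phi>) z * dx c (dx b \<phi>) z)\<bar> \<le> K * hess_sq \<phi> z" for a b c d
      unfolding abs_mult[of "Q (fst z) $ d $ c"] using K(1) by (intro mult_mono K(2) abs_mult_le_square_bound hess_sq_ge) auto
     have in2: "\<bar>\<Sum>d\<in>UNIV. \<Sum>c\<in>UNIV. Q (fst z) $ d $ c * (dx d (dx a \<phi>) z * dx c (dx b \<phi>) z)\<bar> \<le> n * (n * (K * hess_sq \<phi> z))" for a b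
      unfolding n_def by (rule sum2_abs_bound[OF in1])
     have "Q (fst z) $ b $ a * (\<Sum>d\<in>UNIV. \<Sum>c\<in>UNIV. Q (fst z) $ d $ c * (dx d (dx a \<phi>) z * dx c (dx b \<phi>) z)) \<le> K * (n * (n * (K * hess_sq \<phi> z)))" for a b
     proof -
      have "\<bar>Q (fst z) $ b $ a * (\<Sum>d\<in>UNIV. \<Sum>c\<in>UNIV. Q (fst z) $ d $ c * (dx d (dx a \<phi>) z * dx c (dx b \<phi>) z))\<bar> \<le> K * (n * (n * (K * hess_sq \<phi> z)))"
       unfolding abs_mult[of "Q (fst z) $ b $ a"] using K(1) by (intro mult_mono K(2) in2) auto
      then show ?thesis by linarith
     qed
     from sum2_bound[OF this] have "hess_form (Q (fst z)) \<phi> z \<le> n * (n * (K * (n * (n * K)))) * hess_sq \<phi> z"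
      by (simp add: hess_form_def n_def mult_ac)
     also have "\<dots> \<le> KN * hess_sq \<phi> z" using K(1) n h by (intro mult_right_mono) (auto simp: KN_def)
     finally show ?thesis .
    qed
    then have b: "(LINT z|dens \<rho>. hess_form (Q (fst z)) \<phi> z) \<le> (LINT z|dens \<rho>. KN * hess_sq \<phi> z)"
     using i by (intro integral_mono) auto
    show ?thesis using a b unfolding 2 X_def by (simp add: distrib_left)
   qed
   have X0: "X \<ge> 0" by (simp add: X_def grad_sq_def hess_sq_def sum_nonneg)
   have cs: "GN\<^sup>2 \<le> GG * NN" unfolding GN_def GG_def NN_def by (rule L2_Cauchy_Schwarz[OF cc_L2_dens[OF cc(7)] cc_L2_dens[OF cc(8)]])
   have GG0: "GG \<ge> 0" by (simp add: GG_def)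
   have "(c * X)\<^sup>2 \<le> (- 2 * GN)\<^sup>2" using 3 c X0 by (intro power_mono) auto
   also have "\<dots> = 4 * GN\<^sup>2" by (simp add: power_mult_distrib)
   also have "\<dots> \<le> 4 * (GG * (KN * X))" using cs mult_left_mono[OF 4 GG0] by linarith
   finally have main: "c\<^sup>2 * X\<^sup>2 \<le> 4 * GG * KN * X" by (simp add: power_mult_distrib mult_ac)
   \<comment> \<open>Division by \<open>X\<close> is legitimate since for a test function it is
     finite from the start; the estimate needs no lower-order term.\<close>
   have "X \<le> (4 * KN / c\<^sup>2) * GG"
   proof (cases "X = 0")
    case True then show ?thesis using GG0 KN by simp
   next
    case False
    then have "X > 0" using X0 by simp
    have "(c\<^sup>2 * X) * X \<le> (4 * GG * KN) * X" using main by (simp add: power2_eq_square mult_ac)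
    then have "c\<^sup>2 * X \<le> 4 * GG * KN" using \<open>X > 0\<close> by (rule mult_right_le_imp_le)
    then show ?thesis using c by (simp add: field_simps)
   qed
   then show ?thesis by (simp add: X_def GG_def)
  qed
  then show ?thesis using KN c by (intro exI[of _ "4 * KN / c\<^sup>2"]) auto
qed

end

context ou_family
begin

lemma dens_integral_le_imp:
  assumes "cc h" "cc k" "\<And>z. h z \<le> k z" shows "(LINT z|dens \<rho>. h z) \<le> (LINT z|dens \<rho>. k z)"
  using assms by (intro integral_mono integrable_dens_cc)

lemma continuous_y_sq: "continuous_on UNIV (\<lambda>z. y z \<bullet> y z)" by (intro continuous_on_inner continuous_y)

lemma cc_square: "cc h \<Longrightarrow> cc (\<lambda>z. (h z)\<^sup>2)" unfolding power2_eq_square by (rule cc_mult_left) (simp_all add: cc_def)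

text \<open>One factor |y| costs one derivative: a property of Gaussian weights that compensates the
  linear growth of the drift.\<close>

lemma weighted_bound:
  "\<exists>K>0. \<forall>p. test_function p \<longrightarrow> (LINT z|dens \<rho>. (norm (y z) * p z)\<^sup>2) \<le> K * (sq p + (LINT z|dens \<rho>. grad_sq p z))"
proof -
  obtain K where K: "K > 0" "\<And>t i j. \<bar>Q t $ i $ j\<bar> \<le> K" using ex_entry_bound by blast
  define n where "n = real CARD('n)"
  have n: "n > 0" by (simp add: n_def)
  \<comment> \<open>Chosen so that the cross term carries exactly half of the integral of |y|^2 p^2,
    which is then absorbed on the left.\<close>
  define e where "e = 2 * n * K\<^sup>2"
  have e: "e > 0" "n * (K\<^sup>2 / e) = 1/2" using n K(1) by (simp_all add: e_def)
  have "(LINT z|dens \<rho>. (norm (y z) * p z)\<^sup>2) \<le> (2 * n * K + 2 * (n * e)) * (sq p + (LINT z|dens \<rho>. grad_sq p z))"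
   if p: "test_function p" for p
  proof -
   have ccp: "cc p" "\<And>i. cc (dx i p)" using p by (auto intro: test_function_cc test_function_dx)
   have cp: "continuous_on UNIV p" using ccp by (simp add: cc_def)
   have c1: "cc (\<lambda>z. (\<Sum>i\<in>UNIV. Q (fst z) $ i $ i) * (p z)\<^sup>2)"
    by (intro cc_mult_right cc_square ccp continuous_on_sum continuous_entries)
   have c2: "cc (\<lambda>z. 2 * p z * (\<Sum>i\<in>UNIV. \<Sum>j\<in>UNIV. Q (fst z) $ i $ j * (y z $ i * dx j p z)))"
    by (intro cc_mult_right cc_sum ccp continuous_on_mult continuous_on_const cp continuous_entries)
   have c3: "cc (\<lambda>z. (y z \<bullet> y z) * (p z)\<^sup>2)" by (intro cc_mult_right cc_square ccp continuous_y_sq)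
   have g: "cc (grad_sq p)" by (rule cc_forms(5)[OF p])
   note i = integrable_dens_cc[OF c1] integrable_dens_cc[OF c2] integrable_dens_cc[OF c3] integrable_dens_cc[OF g]
    integrable_dens_cc[OF cc_square[OF ccp(1)]]
   note m = cc_measurable[OF c1] cc_measurable[OF c2] cc_measurable[OF c3]
   have "(LINT z|dens \<rho>. (\<Sum>i\<in>UNIV. Q (fst z) $ i $ i) * (p z)\<^sup>2
    + 2 * p z * (\<Sum>i\<in>UNIV. \<Sum>j\<in>UNIV. Q (fst z) $ i $ j * (y z $ i * dx j p z)) - (y z \<bullet> y z) * (p z)\<^sup>2) = 0"
    by (intro dens_integral_zero weighted_ibp[OF p] borel_measurable_diff borel_measurable_add m)
   then have 1: "(LINT z|dens \<rho>. (y z \<bullet> y z) * (p z)\<^sup>2) = (LINT z|dens \<rho>. (\<Sum>i\<in>UNIV. Q (fst z) $ i $ i) * (p z)\<^sup>2)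
    + (LINT z|dens \<rho>. 2 * p z * (\<Sum>i\<in>UNIV. \<Sum>j\<in>UNIV. Q (fst z) $ i $ j * (y z $ i * dx j p z)))" using i by simp
   have 2: "(LINT z|dens \<rho>. (\<Sum>i\<in>UNIV. Q (fst z) $ i $ i) * (p z)\<^sup>2) \<le> (LINT z|dens \<rho>. (n * K) * (p z)\<^sup>2)"
   proof (rule dens_integral_le_imp[OF c1 cc_mult_right[OF cc_square[OF ccp(1)] continuous_on_const]])
    fix z :: "real \<times> (real ^ 'n)"
    have "(\<Sum>i\<in>UNIV. Q (fst z) $ i $ i) \<le> (\<Sum>i\<in>(UNIV::'n set). K)" using K(2) by (intro sum_mono) (auto dest: abs_le_D1)
    then show "(\<Sum>i\<in>UNIV. Q (fst z) $ i $ i) * (p z)\<^sup>2 \<le> (n * K) * (p z)\<^sup>2" by (intro mult_right_mono) (auto simp: n_def)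
   qed
   have c4: "cc (\<lambda>z. 1/2 * ((y z \<bullet> y z) * (p z)\<^sup>2) + n * e * grad_sq p z)"
    by (intro cc_add cc_mult_right c3 g continuous_on_const)
   have 3: "(LINT z|dens \<rho>. 2 * p z * (\<Sum>i\<in>UNIV. \<Sum>j\<in>UNIV. Q (fst z) $ i $ j * (y z $ i * dx j p z)))
     \<le> (LINT z|dens \<rho>. 1/2 * ((y z \<bullet> y z) * (p z)\<^sup>2) + n * e * grad_sq p z)"
   proof (rule dens_integral_le_imp[OF c2 c4])
    fix z :: "real \<times> (real ^ 'n)"
    have "2 * p z * (\<Sum>i\<in>UNIV. \<Sum>j\<in>UNIV. Q (fst z) $ i $ j * (y z $ i * dx j p z)) = 2 * (\<Sum>i\<in>UNIV. \<Sum>j\<in>UNIV. Q (fst z) $ i $ j * ((p z * y z $ i) * dx j p z))"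
     by (simp add: sum_distrib_left mult_ac)
    also have "\<dots> \<le> n * (K\<^sup>2 / e) * (\<Sum>i\<in>UNIV. (p z * y z $ i)\<^sup>2) + n * e * (\<Sum>j\<in>UNIV. (dx j p z)\<^sup>2)"
     unfolding n_def by (rule bilinear_young[OF K(2) e(1)])
    also have "(\<Sum>i\<in>UNIV. (p z * y z $ i)\<^sup>2) = (y z \<bullet> y z) * (p z)\<^sup>2"
     by (simp add: inner_vec_def sum_distrib_left power2_eq_square mult_ac)
    finally show "2 * p z * (\<Sum>i\<in>UNIV. \<Sum>j\<in>UNIV. Q (fst z) $ i $ j * (y z $ i * dx j p z)) \<le> 1/2 * ((y z \<bullet> y z) * (p z)\<^sup>2) + n * e * grad_sq p z"
     unfolding e(2) grad_sq_def .
   qed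
   have 4: "(LINT z|dens \<rho>. 1/2 * ((y z \<bullet> y z) * (p z)\<^sup>2) + n * e * grad_sq p z)
    = 1/2 * (LINT z|dens \<rho>. (y z \<bullet> y z) * (p z)\<^sup>2) + n * e * (LINT z|dens \<rho>. grad_sq p z)"
    using i by (subst Bochner_Integration.integral_add) auto
   have 5: "(LINT z|dens \<rho>. (norm (y z) * p z)\<^sup>2) = (LINT z|dens \<rho>. (y z \<bullet> y z) * (p z)\<^sup>2)"
    by (simp add: power_mult_distrib dot_square_norm)
   have nn: "sq p \<ge> 0" "(LINT z|dens \<rho>. grad_sq p z) \<ge> 0" by (auto simp: grad_sq_def sum_nonneg)
   define a b where "a = n * K * sq p" and "b = n * e * (LINT z|dens \<rho>. grad_sq p z)"
   have 2: "(LINT z|dens \<rho>. (\<Sum>i\<in>UNIV. Q (fst z) $ i $ i) * (p z)\<^sup>2) \<le> a" using 2 by (simp add: a_def)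
   have 4: "(LINT z|dens \<rho>. 1/2 * ((y z \<bullet> y z) * (p z)\<^sup>2) + n * e * grad_sq p z)
    = 1/2 * (LINT z|dens \<rho>. (y z \<bullet> y z) * (p z)\<^sup>2) + b" using 4 by (simp only: b_def mult.assoc)
   have "(LINT z|dens \<rho>. (y z \<bullet> y z) * (p z)\<^sup>2) \<le> 2 * a + 2 * b" using 1 2 3 4 by linarith
   also have "2 * a + 2 * b = 2 * n * K * sq p + 2 * (n * e) * (LINT z|dens \<rho>. grad_sq p z)"
    by (simp add: a_def b_def)
   also have "\<dots> \<le> (2 * n * K + 2 * (n * e)) * sq p + (2 * n * K + 2 * (n * e)) * (LINT z|dens \<rho>. grad_sq p z)"
    using nn n K(1) e(1) by (intro add_mono mult_right_mono) auto
   finally show ?thesis unfolding 5 by (simp add: distrib_left)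
  qed
  then show ?thesis using n K(1) e(1) by (intro exI[of _ "2 * n * K + 2 * (n * e)"]) (auto intro!: add_pos_nonneg)
qed

lemma a_priori:
  "\<exists>K>0. \<forall>\<phi>. test_function \<phi> \<longrightarrow> (\<forall>i. sq (dx i \<phi>) \<le> K * sq (Gc \<phi>)) \<and>
   (\<forall>i j. sq (dx j (dx i \<phi>)) \<le> K * sq (Gc \<phi>))"
proof -
  obtain K where K: "K > 0" "\<And>\<phi>. test_function \<phi> \<Longrightarrow>
    (LINT z|dens \<rho>. grad_sq \<phi> z) + (LINT z|dens \<rho>. hess_sq \<phi> z) \<le> K * sq (Gc \<phi>)"
   using a_priori_space by blast
  { fix \<phi> :: "real \<times> (real ^ 'n) \<Rightarrow> real" and i j assume \<phi>: "test_function \<phi>"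
   have "(LINT z|dens \<rho>. grad_sq \<phi> z) \<ge> 0" "(LINT z|dens \<rho>. hess_sq \<phi> z) \<ge> 0" by (auto simp: grad_sq_def hess_sq_def sum_nonneg)
   moreover have "sq (dx i \<phi>) \<le> (LINT z|dens \<rho>. grad_sq \<phi> z)"
    by (intro dens_integral_le_imp cc_square cc_forms grad_sq_ge test_function_cc test_function_dx \<phi>)
   moreover have "sq (dx j (dx i \<phi>)) \<le> (LINT z|dens \<rho>. hess_sq \<phi> z)"
    by (intro dens_integral_le_imp cc_square cc_forms hess_sq_ge test_function_cc test_function_dx \<phi>)
   ultimately have "sq (dx i \<phi>) \<le> K * sq (Gc \<phi>)"
    "sq (dx j (dx i \<phi>)) \<le> K * sq (Gc \<phi>)" using K(2)[OF \<phi>] by linarith+ }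
  then show ?thesis using K(1) by blast
qed

end

section \<open>Approximation in the graph norm\<close>

text \<open>The closure in epsilon form: iterated closures compose by the triangle inequality,
  without diagonal sequences.\<close>

definition graph_approx :: "'a measure \<Rightarrow> (('a \<Rightarrow> real) \<times> ('a \<Rightarrow> real)) set \<Rightarrow> ('a \<Rightarrow> real) \<Rightarrow> ('a \<Rightarrow> real) \<Rightarrow> bool" where
  "graph_approx M S u w \<longleftrightarrow> u \<in> L2_space M \<and> w \<in> L2_space M \<and>
   (\<forall>e>0. \<exists>p q. (p, q) \<in> S \<and> p \<in> L2_space M \<and> q \<in> L2_space M \<and>
     (LINT z|M. (p z - u z)\<^sup>2) < e \<and> (LINT z|M. (q z - w z)\<^sup>2) < e)"

lemma L2_dist_triangle:
  assumes "p \<in> L2_space M" "r \<in> L2_space M" "u \<in> L2_space M"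
   and "(LINT z|M. (p z - r z)\<^sup>2) < e / 4" "(LINT z|M. (r z - u z)\<^sup>2) < e / 4"
  shows "(LINT z|M. (p z - u z)\<^sup>2) < e"
  using L2_integral_le_square_add[OF L2_space_diff[OF assms(1,2)] L2_space_diff[OF assms(2,3)]] assms(4,5) by simp

text \<open>Transitivity lets test functions mediate between the maximal domain and D(G0).\<close>

lemma graph_approx_trans:
  assumes "graph_approx M S u w" "\<And>p q. (p, q) \<in> S \<Longrightarrow> p \<in> L2_space M \<Longrightarrow> q \<in> L2_space M \<Longrightarrow> graph_approx M R p q"
  shows "graph_approx M R u w" unfolding graph_approx_def
proof (intro conjI allI impI)
  show L: "u \<in> L2_space M" "w \<in> L2_space M" using assms(1) by (auto simp: graph_approx_def)
  fix e :: real assume "e > 0"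
  then have e: "e / 4 > 0" by simp
  obtain p q where pq: "(p, q) \<in> S" "p \<in> L2_space M" "q \<in> L2_space M"
   "(LINT z|M. (p z - u z)\<^sup>2) < e/4" "(LINT z|M. (q z - w z)\<^sup>2) < e/4" using assms(1) e unfolding graph_approx_def by blast
  obtain p' q' where pq': "(p', q') \<in> R" "p' \<in> L2_space M" "q' \<in> L2_space M"
   "(LINT z|M. (p' z - p z)\<^sup>2) < e/4" "(LINT z|M. (q' z - q z)\<^sup>2) < e/4" using assms(2)[OF pq(1-3)] e unfolding graph_approx_def by blast
  have "(LINT z|M. (p' z - u z)\<^sup>2) < e" by (rule L2_dist_triangle[OF pq'(2) pq(2) L(1) pq'(4) pq(4)])
  moreover have "(LINT z|M. (q' z - w z)\<^sup>2) < e" by (rule L2_dist_triangle[OF pq'(3) pq(3) L(2) pq'(5) pq(5)])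
  ultimately show "\<exists>p q. (p, q) \<in> R \<and> p \<in> L2_space M \<and> q \<in> L2_space M \<and> (LINT z|M. (p z - u z)\<^sup>2) < e \<and> (LINT z|M. (q z - w z)\<^sup>2) < e"
   using pq' by blast
qed

lemma graph_approx_base: "(p, q) \<in> S \<Longrightarrow> p \<in> L2_space M \<Longrightarrow> q \<in> L2_space M \<Longrightarrow> graph_approx M S p q"
  unfolding graph_approx_def by (intro conjI allI impI exI[of _ p] exI[of _ q]) auto

lemma graph_approx_limit:
  assumes U: "l2_tends M U u" and W: "l2_tends M W w" and a: "\<And>k. graph_approx M S (U k) (W k)"
  shows "graph_approx M S u w"
proof (rule graph_approx_trans[of M "range (\<lambda>k. (U k, W k))"])
  show "graph_approx M (range (\<lambda>k. (U k, W k))) u w" unfolding graph_approx_def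
  proof (intro conjI allI impI l2_tendsD(2)[OF U] l2_tendsD(2)[OF W])
   fix e :: real assume e: "e > 0"
   obtain n1 where n1: "\<And>k. k \<ge> n1 \<Longrightarrow> norm ((LINT z|M. (U k z - u z)\<^sup>2) - 0) < e" using LIMSEQ_D[OF l2_tendsD(3)[OF U] e] by blast
   obtain n2 where n2: "\<And>k. k \<ge> n2 \<Longrightarrow> norm ((LINT z|M. (W k z - w z)\<^sup>2) - 0) < e" using LIMSEQ_D[OF l2_tendsD(3)[OF W] e] by blast
   have "(LINT z|M. (U (max n1 n2) z - u z)\<^sup>2) < e" "(LINT z|M. (W (max n1 n2) z - w z)\<^sup>2) < e"
    using n1[of "max n1 n2"] n2[of "max n1 n2"] by simp_all
   then show "\<exists>p q. (p, q) \<in> range (\<lambda>k. (U k, W k)) \<and> p \<in> L2_space M \<and> q \<in> L2_space M \<and>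
     (LINT z|M. (p z - u z)\<^sup>2) < e \<and> (LINT z|M. (q z - w z)\<^sup>2) < e" using l2_tendsD(1)[OF U] l2_tendsD(1)[OF W] by blast
  qed
qed (use a in auto)

lemma graph_approx_seq:
  assumes "graph_approx M S u w"
  shows "\<exists>p q. (\<forall>k. (p k, q k) \<in> S) \<and> l2_tends M p u \<and> l2_tends M q w"
proof -
  have "\<forall>k::nat. \<exists>pq. pq \<in> S \<and> fst pq \<in> L2_space M \<and> snd pq \<in> L2_space M \<and>
   (LINT z|M. (fst pq z - u z)\<^sup>2) < 1 / real (Suc k) \<and> (LINT z|M. (snd pq z - w z)\<^sup>2) < 1 / real (Suc k)"
  proof
   fix k :: nat
   have "1 / real (Suc k) > 0" by simp
   then obtain p q where "(p, q) \<in> S" "p \<in> L2_space M" "q \<in> L2_space M"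
    "(LINT z|M. (p z - u z)\<^sup>2) < 1 / real (Suc k)" "(LINT z|M. (q z - w z)\<^sup>2) < 1 / real (Suc k)"
    using assms unfolding graph_approx_def by blast
   then show "\<exists>pq. pq \<in> S \<and> fst pq \<in> L2_space M \<and> snd pq \<in> L2_space M \<and>
   (LINT z|M. (fst pq z - u z)\<^sup>2) < 1 / real (Suc k) \<and> (LINT z|M. (snd pq z - w z)\<^sup>2) < 1 / real (Suc k)"
    by (intro exI[of _ "(p, q)"]) simp
  qed
  from choice[OF this] obtain h where h: "\<And>k. h k \<in> S" "\<And>k. fst (h k) \<in> L2_space M" "\<And>k. snd (h k) \<in> L2_space M"
   "\<And>k::nat. (LINT z|M. (fst (h k) z - u z)\<^sup>2) < 1 / real (Suc k)" "\<And>k. (LINT z|M. (snd (h k) z - w z)\<^sup>2) < 1 / real (Suc k)"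
   by blast
  have L: "u \<in> L2_space M" "w \<in> L2_space M" using assms by (auto simp: graph_approx_def)
  have lim: "(\<lambda>k. 1 / real (Suc k)) \<longlonglongrightarrow> 0" by (rule LIMSEQ_Suc[OF lim_1_over_n])
  have "l2_tends M (\<lambda>k. fst (h k)) u" "l2_tends M (\<lambda>k. snd (h k)) w"
   by (rule l2_tends_sandwich[OF h(2) L(1) less_imp_le[OF h(4)] lim] l2_tends_sandwich[OF h(3) L(2) less_imp_le[OF h(5)] lim])+
  then show ?thesis using h(1) by (intro exI[of _ "\<lambda>k. fst (h k)"] exI[of _ "\<lambda>k. snd (h k)"]) simp
qed

lemma L2_graph_closure_iff: "(u, w) \<in> L2_graph_closure M R \<longleftrightarrow> graph_approx M R u w"
proof
  assume "(u, w) \<in> L2_graph_closure M R"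
  then obtain us vs where h: "\<And>k::nat. (us k, vs k) \<in> R \<and> us k \<in> L2_space M \<and> vs k \<in> L2_space M"
   "(\<lambda>k. LINT z|M. (us k z - u z)\<^sup>2) \<longlonglongrightarrow> 0" "(\<lambda>k. LINT z|M. (vs k z - w z)\<^sup>2) \<longlonglongrightarrow> 0" "u \<in> L2_space M" "w \<in> L2_space M"
   unfolding L2_graph_closure_def by blast
  have "l2_tends M us u" "l2_tends M vs w" using h by (auto simp: l2_tends_def)
  then show "graph_approx M R u w" by (rule graph_approx_limit) (use h in \<open>blast intro: graph_approx_base\<close>)
next
  assume a: "graph_approx M R u w"
  from graph_approx_seq[OF a] obtain p q where "\<And>k. (p k, q k) \<in> R" "l2_tends M p u" "l2_tends M q w" by blast
  then show "(u, w) \<in> L2_graph_closure M R" unfolding L2_graph_closure_def l2_tends_def by blast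
qed

text \<open>Required because \<open>Gop\<close> involves arbitrary versions of weak derivatives,
  while the limits constructed below are specific functions.\<close>

lemma graph_approx_AE_cong:
  assumes "graph_approx M S u w" "w' \<in> borel_measurable M" "AE z in M. w' z = w z"
  shows "graph_approx M S u w'"
proof (rule graph_approx_limit[where U="\<lambda>k. u" and W="\<lambda>k. w"])
  have L: "u \<in> L2_space M" "w \<in> L2_space M" using assms(1) by (auto simp: graph_approx_def)
  show "l2_tends M (\<lambda>k. u) u" by (rule l2_tends_const[OF L(1)])
  have L': "w' \<in> L2_space M" by (rule L2_space_AE_cong[OF L(2) assms(2,3)])
  have "AE z in M. (w z - w' z)\<^sup>2 = 0" using assms(3) by eventually_elim simp
  then have "(LINT z|M. (w z - w' z)\<^sup>2) = 0" by (rule integral_eq_zero_AE)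
  then show "l2_tends M (\<lambda>k. w) w'" using L L' by (simp add: l2_tends_def)
qed (rule assms)

section \<open>Cut-offs on large balls\<close>

definition cut :: "nat \<Rightarrow> 'a::euclidean_space \<Rightarrow> real" where
  "cut k z = cutoff ((1 / real (Suc k)) *\<^sub>R z)"

lemma test_function_cut: "test_function (cut k)" unfolding cut_def[abs_def] by (rule test_function_scaled_cutoff) simp

lemma cut_bounds: "0 \<le> cut k z" "cut k z \<le> 1" by (simp_all add: cut_def cutoff_nonneg cutoff_le_1)

lemma cut_eq_1: "norm z \<le> real (Suc k) \<Longrightarrow> cut k z = 1" by (simp add: cut_def cutoff_eq_1 del: of_nat_Suc)

lemma pd_cut: "pd b (cut k) z = (1 / real (Suc k)) * pd b cutoff ((1 / real (Suc k)) *\<^sub>R z)"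
  using pd_affine[OF test_function_cutoff[unfolded test_function_iff, THEN conjunct1], of b "1 / real (Suc k)" 0] by (simp add: cut_def[abs_def])

lemma pd_pd_cut:
  assumes "b \<in> Basis" shows "pd c (pd b (cut k)) z = (1 / real (Suc k)) * ((1 / real (Suc k)) * pd c (pd b cutoff) ((1 / real (Suc k)) *\<^sub>R z))"
proof -
  have s: "smooth (pd b (cutoff :: 'a \<Rightarrow> real))" using test_function_cutoff assms by (auto simp: test_function_iff intro: smooth_pd)
  have s': "smooth (\<lambda>z. pd b cutoff ((1 / real (Suc k)) *\<^sub>R z))" using smooth_affine[OF s, of "1 / real (Suc k)" 0] by simp
  have e: "pd b (cut k) = (\<lambda>z. (1 / real (Suc k)) * pd b cutoff ((1 / real (Suc k)) *\<^sub>R z))" by (rule ext) (rule pd_cut)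
  show ?thesis unfolding e pd_cmult[OF s'] using pd_affine[OF s, of c "1 / real (Suc k)" 0] by simp
qed

lemma pd_cut_eventually:
  fixes z :: "'a::euclidean_space"
  assumes "norm z < real (Suc k)" shows "pd b (cut k) z = 0"
proof -
  have "((cut k :: 'a \<Rightarrow> real) has_derivative (\<lambda>h. 0)) (at z)"
   by (rule has_derivative_transform_within_open[OF has_derivative_const[of 1] open_ball[of 0 "real (Suc k)"]])
    (use assms in \<open>auto simp: cut_eq_1 simp del: of_nat_Suc\<close>)
  then show ?thesis by (rule pd_eqI)
qed

lemma pd_pd_cut_eventually:
  fixes z :: "'a::euclidean_space"
  assumes "norm z < real (Suc k)" shows "pd c (pd b (cut k)) z = 0"
proof -
  have "((pd b (cut k) :: 'a \<Rightarrow> real) has_derivative (\<lambda>h. 0)) (at z)"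
   by (rule has_derivative_transform_within_open[OF has_derivative_const[of 0] open_ball[of 0 "real (Suc k)"]])
    (use assms in \<open>auto simp: pd_cut_eventually simp del: of_nat_Suc\<close>)
  then show ?thesis by (rule pd_eqI)
qed

lemma eventually_norm_less: "\<forall>\<^sub>F k in sequentially. norm z < real (Suc k)"
proof -
  obtain n where "norm z < real n" using reals_Archimedean2 by blast
  then have "norm z < real (Suc k)" if "k \<ge> n" for k using that by simp
  then show ?thesis using eventually_ge_at_top[of n] by (rule eventually_mono[rotated])
qed

lemma tendsto_cut: "(\<lambda>k. cut k z) \<longlonglongrightarrow> 1"
  by (rule tendsto_eventually) (use eventually_norm_less[of z] in eventually_elim, simp add: cut_eq_1 less_imp_le del: of_nat_Suc)

context ou_family
begin

text \<open>Growth in |x| is what the cut-offs compensate, growth in |y| is what the weighted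
  inequality compensates; boundedness of the mean \<open>g\<close> makes both available.\<close>

lemma ex_drift_bound: "\<exists>D>0. \<forall>z i. \<bar>drift z $ i\<bar> \<le> D * (1 + norm (snd z)) \<and> \<bar>drift z $ i\<bar> \<le> D * (1 + norm (y z))"
proof -
  obtain E where E: "E > 0" "\<And>t i j. \<bar>A t $ i $ j\<bar> \<le> E" using ex_entry_bound by blast
  obtain F where F: "F > 0" "\<And>t. norm (f t) \<le> F" using f_bounded unfolding bounded_pos by auto
  obtain G where G: "\<And>t. norm (g t) \<le> G" using g_Q_bounded by blast
  have G0: "G \<ge> 0" using G[of 0] norm_ge_zero order_trans by blast
  define a where "a = real CARD('n) * E"
  have a: "a > 0" using E(1) by (simp add: a_def)
  have le: "\<bar>drift z $ i\<bar> \<le> a * norm (snd z) + F" for z i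
  proof -
   have "\<bar>(A (fst z) *v snd z) $ i\<bar> \<le> (\<Sum>j\<in>UNIV. \<bar>A (fst z) $ i $ j * snd z $ j\<bar>)" unfolding matrix_vector_mult_def by (simp add: sum_abs)
   also have "\<dots> \<le> (\<Sum>j\<in>(UNIV::'n set). E * norm (snd z))" unfolding abs_mult using E by (intro sum_mono mult_mono component_le_norm_cart) auto
   finally have "\<bar>(A (fst z) *v snd z) $ i\<bar> \<le> a * norm (snd z)" by (simp add: a_def)
   moreover have "\<bar>f (fst z) $ i\<bar> \<le> F" by (rule order_trans[OF component_le_norm_cart F(2)])
   ultimately show ?thesis unfolding drift_def by simp
  qed
  have ny: "norm (snd z) \<le> norm (y z) + G" for z using norm_triangle_ineq[of "y z" "g (fst z)"] G[of "fst z"] by (simp add: y_def)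
  define D where "D = a + a * G + F"
  have "\<bar>drift z $ i\<bar> \<le> D * (1 + norm (snd z)) \<and> \<bar>drift z $ i\<bar> \<le> D * (1 + norm (y z))" for z i
  proof -
   have nn: "0 \<le> a * G" "0 \<le> a * G * norm (y z)" "0 \<le> F * norm (y z)" "0 \<le> a * G * norm (snd z)" "0 \<le> F * norm (snd z)" using a G0 F(1) by simp_all
   have "a * norm (snd z) \<le> a * (norm (y z) + G)" using ny a by (intro mult_left_mono) auto
   then show ?thesis using le[of z i] nn a unfolding D_def by (simp add: algebra_simps)
  qed
  moreover have "D > 0" using a F(1) G0 by (simp add: D_def add_nonneg_pos)
  ultimately show ?thesis by blast
qed

lemma cc_bounded_family:
  fixes F :: "'i::finite \<Rightarrow> 'a::euclidean_space \<Rightarrow> real"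
  assumes "\<And>i. cc (F i)" shows "\<exists>K>0. \<forall>i z. \<bar>F i z\<bar> \<le> K"
proof -
  have "\<forall>i. \<exists>K>0. \<forall>z. \<bar>F i z\<bar> \<le> K" using cc_bounded assms by blast
  then obtain K where K: "\<And>i. K i > 0" "\<And>i z. \<bar>F i z\<bar> \<le> K i" by metis
  have "K i \<le> sum K UNIV" for i by (rule member_le_sum) (auto intro: less_imp_le K)
  then show ?thesis using order_trans[OF K(2)] K(1) by (intro exI[of _ "sum K UNIV"]) (auto intro!: sum_pos)
qed

text \<open>Uniformity in \<open>k\<close> is the point: the drift grows linearly, but each
  derivative of \<open>cut k\<close> gains a factor 1/(k+1), and at the rescaled point the product
  of the two stays bounded.\<close>

lemma ex_cut_bound:
  "\<exists>K>0. \<forall>k z. (\<forall>i. \<bar>dx i (cut k) z\<bar> \<le> K) \<and> \<bar>Gc (cut k) z\<bar> \<le> K"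
proof -
  obtain E where E: "E > 0" "\<And>t i j. \<bar>C t $ i $ j\<bar> \<le> E" using ex_entry_bound by blast
  obtain D where D: "D > 0" "\<And>z i. \<bar>drift z $ i\<bar> \<le> D * (1 + norm (snd z))" using ex_drift_bound by blast
  define n where "n = real CARD('n)"
  let ?c = "cutoff :: real \<times> (real ^ 'n) \<Rightarrow> real"
  have t: "test_function ?c" by (rule test_function_cutoff)
  obtain K1 where K1: "K1 > 0" "\<And>i z. \<bar>dx i ?c z\<bar> \<le> K1"
   using cc_bounded_family[of "\<lambda>i. dx i ?c"] test_function_cc[OF test_function_dx[OF t]] by blast
  obtain K2 where K2: "K2 > 0" "\<And>p z. \<bar>dx (snd p) (dx (fst p) ?c) z\<bar> \<le> K2"
   using cc_bounded_family[of "\<lambda>p. dx (snd p) (dx (fst p) ?c)"] test_function_cc[OF test_function_dx[OF test_function_dx[OF t]]] by blast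
  obtain K3 where K3: "K3 > 0" "\<And>z. \<bar>dt ?c z\<bar> \<le> K3" using cc_bounded[OF test_function_cc[OF test_function_dt[OF t]]] by blast
  \<comment> \<open>The norm times a derivative of the fixed bump is bounded; evaluated at the
    rescaled point it controls the linear growth of the drift for every \<open>k\<close>.\<close>
  have "cc (\<lambda>z. norm z * dx i ?c z)" for i by (intro cc_mult_right test_function_cc test_function_dx t continuous_intros)
  then obtain K4 where K4: "K4 > 0" "\<And>i z. \<bar>norm z * dx i ?c z\<bar> \<le> K4" using cc_bounded_family[of "\<lambda>i z. norm z * dx i ?c z"] by blast
  define M where "M = K1 + (K3 + n * (n * (E * K2)) + n * (D * (K1 + K4)))"
  have n: "n \<ge> 0" by (simp add: n_def)
  have b: "(\<forall>i. \<bar>dx i (cut k) z\<bar> \<le> M) \<and> \<bar>Gc (cut k) z\<bar> \<le> M" for k and z :: "real \<times> (real ^ 'n)"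
  proof -
   define r where "r = 1 / real (Suc k)"
   have r: "0 < r" "r \<le> 1" by (simp_all add: r_def)
   have le: "\<bar>r * a\<bar> \<le> b" if "\<bar>a\<bar> \<le> b" for a b using mult_mono[OF r(2) that] r by (simp add: abs_mult)
   have d1: "\<bar>dx i (cut k) z\<bar> \<le> K1" for i unfolding pd_cut r_def[symmetric] by (rule le[OF K1(2)])
   have d2: "\<bar>dx j (dx i (cut k)) z\<bar> \<le> K2" for i j
    unfolding pd_pd_cut[OF e_space_Basis] r_def[symmetric] using le[OF le[OF K2(2)[of "(i, j)"]]] by simp
   have d3: "\<bar>dt (cut k) z\<bar> \<le> K3" unfolding pd_cut r_def[symmetric] by (rule le[OF K3(2)])
   \<comment> \<open>The factor \<open>r\<close> from differentiating the cut-off is moved onto the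
     point, so that the scale-free bound \<open>K4\<close> applies.\<close>
   have d4: "norm (snd z) * \<bar>dx i (cut k) z\<bar> \<le> K4" for i
   proof -
    have "norm (snd z) * \<bar>dx i (cut k) z\<bar> = r * norm (snd z) * \<bar>dx i ?c (r *\<^sub>R z)\<bar>"
     unfolding pd_cut r_def[symmetric] using r by (simp add: abs_mult)
    also have "\<dots> \<le> norm (r *\<^sub>R z) * \<bar>dx i ?c (r *\<^sub>R z)\<bar>"
     using r norm_snd_le[of "snd z" "fst z"] by (intro mult_right_mono) auto
    finally show ?thesis using K4(2)[of "r *\<^sub>R z" i] by (simp add: abs_mult)
   qed
   have d5: "\<bar>drift z $ i * dx i (cut k) z\<bar> \<le> D * (K1 + K4)" for i
   proof -
    have "\<bar>drift z $ i * dx i (cut k) z\<bar> \<le> D * (1 + norm (snd z)) * \<bar>dx i (cut k) z\<bar>" unfolding abs_mult by (rule mult_right_mono[OF D(2)]) simp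
    also have "\<dots> = D * (\<bar>dx i (cut k) z\<bar> + norm (snd z) * \<bar>dx i (cut k) z\<bar>)" by (simp add: algebra_simps)
    also have "\<dots> \<le> D * (K1 + K4)" using D(1) by (intro mult_left_mono add_mono d1 d4) auto
    finally show ?thesis .
   qed
   have b: "\<bar>C (fst z) $ i $ j * dx j (dx i (cut k)) z\<bar> \<le> E * K2" for i j unfolding abs_mult using E by (intro mult_mono d2) auto
   have h: "\<bar>\<Sum>i\<in>UNIV. \<Sum>j\<in>UNIV. C (fst z) $ i $ j * dx j (dx i (cut k)) z\<bar> \<le> n * (n * (E * K2))" unfolding n_def by (rule sum2_abs_bound[OF b])
   have d: "\<bar>\<Sum>i\<in>UNIV. drift z $ i * dx i (cut k) z\<bar> \<le> n * (D * (K1 + K4))"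
    unfolding n_def by (rule order_trans[OF sum_abs sum_bounded_above[OF d5]])
   have "\<bar>x + 1/2 * y + w\<bar> \<le> \<bar>x\<bar> + \<bar>y\<bar> + \<bar>w\<bar>" for x y w :: real by arith
   then have "\<bar>Gc (cut k) z\<bar> \<le> K3 + n * (n * (E * K2)) + n * (D * (K1 + K4))"
    unfolding Gc_def by (rule order_trans) (intro add_mono d3 h d)
   moreover have "0 \<le> n * (n * (E * K2))" "0 \<le> n * (D * (K1 + K4))" using E(1) D(1) K1(1) K2(1) K4(1) n by simp_all
   ultimately show ?thesis using d1 K1(1) K3(1) unfolding M_def by (auto intro: order_trans[OF d1])
  qed
  have "M > 0" using E(1) D(1) K1(1) K2(1) K3(1) K4(1) n by (simp add: M_def add_pos_nonneg)
  then show ?thesis using b by blast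
qed

end

context weight
begin

text \<open>All mollifications live in one ball, so any continuous coefficient may be multiplied in;
  in particular the drift.\<close>

lemma l2_tends_conv_moll_dens:
  assumes w: "w \<in> L2_loc" "\<And>z. r < norm z \<Longrightarrow> w z = 0" and c: "continuous_on UNIV c"
  shows "tendsw (\<lambda>k z. c z * conv w (moll k) z) (\<lambda>z. c z * w z)"
proof (rule l2_tends_local[OF _ _ _ c])
  note s = csupp_L2_loc[OF w(1) csuppI[OF w(2)]]
  show "l2_tends lborel (\<lambda>k. conv w (moll k)) w" by (rule l2_tends_conv_moll[OF s])
  show "conv w (moll k) z = 0" if "r + 2 * DIM('a) < norm z" for k z
  proof (rule conv_eq_0[OF w(2) _ that])
   fix y :: 'a assume "real (2 * DIM('a)) < norm y"
   moreover have "real (2 * DIM('a)) / real (Suc k) \<le> real (2 * DIM('a))" by (simp add: field_simps)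
   ultimately show "moll k y = 0" by (intro moll_eq_0) linarith
  qed
  show "w z = 0" if "r + 2 * DIM('a) < norm z" for z by (rule w(2)) (use that in linarith)
qed

end

lemma test_function_csupp_cut: "\<exists>r. \<forall>z::'a::euclidean_space. r < norm z \<longrightarrow> cut k z = 0 \<and> (\<forall>b. pd b (cut k) z = 0) \<and> (\<forall>b c. pd c (pd b (cut k)) z = 0)"
proof -
  obtain r where r: "\<And>z::'a. r < norm z \<Longrightarrow> cut k z = 0" using test_function_csupp[OF test_function_cut] by (auto simp: csupp_def)
  have 1: "pd b (cut k) z = 0" if "r < norm z" for b and z :: 'a by (rule pd_eq_0_outside[OF _ that]) (rule r)
  have 2: "pd c (pd b (cut k)) z = 0" if "r < norm z" for b c and z :: 'a by (rule pd_eq_0_outside[OF _ that]) (rule 1)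
  show ?thesis
  proof (intro exI[of _ r] allI impI conjI)
   show "cut k z = 0" if "r < norm z" for z :: 'a by (rule r[OF that])
   show "pd b (cut k) z = 0" if "r < norm z" for b and z :: 'a by (rule 1[OF that])
   show "pd c (pd b (cut k)) z = 0" if "r < norm z" for b c and z :: 'a by (rule 2[OF that])
  qed
qed

section \<open>Tuples of weak derivatives and the generator on them\<close>

text \<open>Fixed versions are carried along explicitly to avoid the choice hidden in
  \<open>Dt\<close> and \<open>Dx\<close>. Second derivatives are derivatives of the first ones, the
  form suited to the product rule and to closedness.\<close>

definition weak_derivs ::
   "(real \<times> (real ^ 'n) \<Rightarrow> real) \<Rightarrow> (real \<times> (real ^ 'n) \<Rightarrow> real) \<Rightarrow> ('n \<Rightarrow> real \<times> (real ^ 'n) \<Rightarrow> real) \<Rightarrow>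
   ('n \<Rightarrow> 'n \<Rightarrow> real \<times> (real ^ 'n) \<Rightarrow> real) \<Rightarrow> bool" where
  "weak_derivs u ut ux uxx \<longleftrightarrow> u \<in> L2_loc \<and> ut \<in> L2_loc \<and> (\<forall>i. ux i \<in> L2_loc) \<and> (\<forall>i j. uxx i j \<in> L2_loc) \<and>
   is_weak_deriv [e_time] u ut \<and> (\<forall>i. is_weak_deriv [e_space i] u (ux i)) \<and>
   (\<forall>i j. is_weak_deriv [e_space j] (ux i) (uxx i j))"

lemma weak_derivsD:
  assumes "weak_derivs u ut ux uxx"
  shows "u \<in> L2_loc" "ut \<in> L2_loc" "ux i \<in> L2_loc" "uxx i j \<in> L2_loc"
   "is_weak_deriv [e_time] u ut" "is_weak_deriv [e_space i] u (ux i)" "is_weak_deriv [e_space j] (ux i) (uxx i j)"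
  using assms by (auto simp: weak_derivs_def)

lemma weak_derivs_two:
  assumes "weak_derivs u ut ux uxx" shows "is_weak_deriv [e_space i, e_space j] u (uxx i j)"
  using is_weak_deriv_two[OF weak_derivsD(6)[OF assms] e_space_Basis L2_loc_imp_L1_loc[OF weak_derivsD(4)[OF assms]]] weak_derivsD(7)[OF assms]
  by blast

lemma le_Suc_0_cases: "l \<le> Suc 0 \<Longrightarrow> l = 0 \<or> l = 1" by auto

lemma length_le_2_cases: "length \<alpha> \<le> 2 \<Longrightarrow> \<alpha> = [] \<or> (\<exists>i. \<alpha> = [i]) \<or> (\<exists>i j. \<alpha> = [i, j])"
  by (cases \<alpha>; cases "tl \<alpha>") auto

lemma weak_derivs_H_loc:
  assumes "weak_derivs u ut ux uxx" shows "u \<in> H_loc 1 2"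
proof -
  note d = weak_derivsD[OF assms]
  have 0: "is_weak_deriv [] u u" by (rule is_weak_deriv_Nil[OF L2_loc_imp_L1_loc[OF d(1)]])
  have "\<exists>v\<in>L2_loc. is_weak_deriv (replicate l e_time) u v" if "l \<le> 1" for l using le_Suc_0_cases[of l] that 0 d(1,2,5) by auto
  moreover have "\<exists>v\<in>L2_loc. is_weak_deriv (map e_space \<alpha>) u v" if "length \<alpha> \<le> 2" for \<alpha>
   using length_le_2_cases[OF that]
  proof (elim disjE exE)
   assume "\<alpha> = []" then show ?thesis using 0 d(1) by auto
  next
   fix i assume "\<alpha> = [i]" then show ?thesis using d(3,6)[of i] by auto
  next
   fix i j assume "\<alpha> = [i, j]" then show ?thesis using d(4)[of i j] weak_derivs_two[OF assms, of i j] by auto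
  qed
  ultimately show ?thesis unfolding H_loc_def using d(1) by blast
qed

lemma H_loc_weak_derivs:
  assumes "u \<in> H_loc 1 2" shows "\<exists>ut ux uxx. weak_derivs u ut ux uxx"
proof -
  have u: "u \<in> L2_loc" and t: "\<And>l. l \<le> 1 \<Longrightarrow> \<exists>v\<in>L2_loc. is_weak_deriv (replicate l e_time) u v"
   and x: "\<And>\<alpha>. length \<alpha> \<le> 2 \<Longrightarrow> \<exists>v\<in>L2_loc. is_weak_deriv (map e_space \<alpha>) u v"
   using assms unfolding H_loc_def by blast+
  from t[of 1] obtain ut where ut: "ut \<in> L2_loc" "is_weak_deriv [e_time] u ut" by auto
  have "\<forall>i. \<exists>v. v \<in> L2_loc \<and> is_weak_deriv [e_space i] u v"
  proof
   fix i show "\<exists>v. v \<in> L2_loc \<and> is_weak_deriv [e_space i] u v" using x[of "[i]"] by auto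
  qed
  from choice[OF this] obtain ux where ux: "\<And>i. ux i \<in> L2_loc" "\<And>i. is_weak_deriv [e_space i] u (ux i)" by auto
  have "\<forall>i. \<forall>j. \<exists>v. v \<in> L2_loc \<and> is_weak_deriv [e_space i, e_space j] u v"
  proof (intro allI)
   fix i j show "\<exists>v. v \<in> L2_loc \<and> is_weak_deriv [e_space i, e_space j] u v" using x[of "[i, j]"] by auto
  qed
  then obtain uxx where uxx: "\<And>i j. uxx i j \<in> L2_loc" "\<And>i j. is_weak_deriv [e_space i, e_space j] u (uxx i j)" by metis
  have "is_weak_deriv [e_space j] (ux i) (uxx i j)" for i j
   using is_weak_deriv_two[OF ux(2) e_space_Basis L2_loc_imp_L1_loc[OF uxx(1)]] uxx(2) by blast
  then have "weak_derivs u ut ux uxx" using u ut ux uxx(1) by (simp add: weak_derivs_def)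
  then show ?thesis by blast
qed

lemma weak_derivs_AE:
  assumes "weak_derivs u ut ux uxx"
  shows "AE z in lborel. Dt 0 u z = u z" "AE z in lborel. Dt 1 u z = ut z" "AE z in lborel. Dx [] u z = u z"
   "AE z in lborel. Dx [i] u z = ux i z" "AE z in lborel. Dx [i, j] u z = uxx i j z" unfolding Dt_def Dx_def
  using weak_deriv_is(2)[OF is_weak_deriv_Nil[OF L2_loc_imp_L1_loc[OF weak_derivsD(1)[OF assms]]]]
   weak_deriv_is(2)[OF weak_derivsD(5)[OF assms]] weak_deriv_is(2)[OF weak_derivsD(6)[OF assms]] weak_deriv_is(2)[OF weak_derivs_two[OF assms]]
  by simp_all

lemma is_weak_deriv_measurable: "is_weak_deriv bs u v \<Longrightarrow> v \<in> borel_measurable borel" by (simp add: is_weak_deriv_def L1_loc_def)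

lemma weak_derivs_measurable:
  assumes "weak_derivs u ut ux uxx"
  shows "Dt 0 u \<in> borel_measurable borel" "Dt 1 u \<in> borel_measurable borel" "Dx [] u \<in> borel_measurable borel"
   "Dx [i] u \<in> borel_measurable borel" "Dx [i, j] u \<in> borel_measurable borel" unfolding Dt_def Dx_def
  using is_weak_deriv_measurable[OF weak_deriv_is(1)[OF is_weak_deriv_Nil[OF L2_loc_imp_L1_loc[OF weak_derivsD(1)[OF assms]]]]]
   is_weak_deriv_measurable[OF weak_deriv_is(1)[OF weak_derivsD(5)[OF assms]]]
   is_weak_deriv_measurable[OF weak_deriv_is(1)[OF weak_derivsD(6)[OF assms]]]
   is_weak_deriv_measurable[OF weak_deriv_is(1)[OF weak_derivs_two[OF assms]]] by simp_all

definition "mult_t \<zeta> u ut z = \<zeta> z * ut z + dt \<zeta> z * u z"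

definition "mult_x \<zeta> u ux i z = \<zeta> z * ux i z + dx i \<zeta> z * u z"

definition "mult_xx \<zeta> u ux uxx i j z = (\<zeta> z * uxx i j z + dx j \<zeta> z * ux i z) + (dx i \<zeta> z * ux j z + dx j (dx i \<zeta>) z * u z)"

lemmas mult_defs = mult_t_def[abs_def] mult_x_def[abs_def] mult_xx_def[abs_def]

lemma weak_derivs_mult:
  assumes d: "weak_derivs u ut ux uxx" and s: "smooth \<zeta>"
  shows "weak_derivs (\<lambda>z. \<zeta> z * u z) (mult_t \<zeta> u ut) (mult_x \<zeta> u ux) (mult_xx \<zeta> u ux uxx)"
proof -
  note L = weak_derivsD(1-4)[OF d] and w = weak_derivsD(5-7)[OF d]
  have c: "continuous_on UNIV \<zeta>" "continuous_on UNIV (dt \<zeta>)" "continuous_on UNIV (dx i \<zeta>)" "continuous_on UNIV (dx j (dx i \<zeta>))" for i j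
   using s by (auto intro!: smooth_continuous smooth_dx smooth_dt)
  have e: "set [e_space j :: real \<times> (real ^ 'n)] \<subseteq> Basis" for j by (simp add: e_space_Basis)
  show ?thesis unfolding weak_derivs_def mult_defs
   by (intro conjI allI is_weak_deriv_mult[OF w(1) L(1,2) s e_time_Basis] is_weak_deriv_mult[OF w(2) L(1,3) s e_space_Basis]
     is_weak_deriv_add[OF is_weak_deriv_mult[OF w(3) L(3,4) s e_space_Basis]
      is_weak_deriv_mult[OF w(2) L(1,3) smooth_dx[OF s] e_space_Basis] e]
     L2_loc_add L2_loc_mult_continuous[OF L(1)] L2_loc_mult_continuous[OF L(2)] L2_loc_mult_continuous[OF L(3)] L2_loc_mult_continuous[OF L(4)] c)
qed

context ou_family
begin

definition Gw where
  "Gw ut ux uxx z = ut z + 1/2 * (\<Sum>i\<in>UNIV. \<Sum>j\<in>UNIV. C (fst z) $ i $ j * uxx i j z) + (\<Sum>i\<in>UNIV. drift z $ i * ux i z)"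

lemma Gw_L2_loc:
  assumes "weak_derivs u ut ux uxx" shows "Gw ut ux uxx \<in> L2_loc" unfolding Gw_def[abs_def]
  by (intro L2_loc_add L2_loc_sum L2_loc_mult_continuous continuous_entries continuous_on_const weak_derivsD[OF assms])

text \<open>The trace pairs the entry (i,k) of \<open>C\<close> with the derivative in the order
  [k,i]; symmetry of \<open>C\<close> restores the order used in \<open>Gw\<close>.\<close>

lemma Gop_eq: "Gop A B f u = Gw (Dt 1 u) (\<lambda>i. Dx [i] u) (\<lambda>i j. Dx [i, j] u)"
proof (rule ext)
  fix z :: "real \<times> (real ^ 'n)"
  obtain t x where z: "z = (t, x)" by (cases z)
  have "trace (C t ** (\<chi> i j. Dx [i, j] u z)) = (\<Sum>i\<in>UNIV. \<Sum>k\<in>UNIV. C t $ i $ k * Dx [k, i] u z)"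
   by (simp add: trace_def matrix_matrix_mult_def)
  also have "\<dots> = (\<Sum>k\<in>UNIV. \<Sum>i\<in>UNIV. C t $ i $ k * Dx [k, i] u z)" by (rule sum.swap)
  also have "\<dots> = (\<Sum>k\<in>UNIV. \<Sum>i\<in>UNIV. C t $ k $ i * Dx [k, i] u z)" by (simp only: C_sym)
  finally show "Gop A B f u z = Gw (Dt 1 u) (\<lambda>i. Dx [i] u) (\<lambda>i j. Dx [i, j] u) z"
   by (simp add: Gop_def Gw_def z C_def drift_def inner_vec_def)
qed

lemma Gop_AE:
  assumes "weak_derivs u ut ux uxx"
  shows "AE z in dens \<rho>. Gop A B f u z = Gw ut ux uxx z" "Gop A B f u \<in> borel_measurable borel"
proof -
  note ae = weak_derivs_AE[OF assms] and m = weak_derivs_measurable[OF assms]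
  have 1: "AE z in lborel. \<forall>i\<in>UNIV. Dx [i] u z = ux i z" by (rule AE_finite_allI[OF finite_class.finite_UNIV ae(4)])
  have 2: "AE z in lborel. \<forall>i\<in>UNIV. \<forall>j\<in>UNIV. Dx [i, j] u z = uxx i j z"
   by (intro AE_finite_allI finite_class.finite_UNIV ae(5))
  show "AE z in dens \<rho>. Gop A B f u z = Gw ut ux uxx z" unfolding AE_dens Gop_eq using ae(2) 1 2 by eventually_elim (simp add: Gw_def)
  show "Gop A B f u \<in> borel_measurable borel" unfolding Gop_eq Gw_def[abs_def]
   by (intro borel_measurable_add borel_measurable_sum borel_measurable_times borel_measurable_const m
     borel_measurable_continuous_onI continuous_entries)
qed

text \<open>Versions agree almost everywhere and the density is positive, so square integrability
  may be checked on any tuple of versions.\<close>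

lemma H_space_iff:
  "u \<in> H_space 1 2 (dens \<rho>) \<longleftrightarrow> (\<exists>ut ux uxx. weak_derivs u ut ux uxx \<and> u \<in> L2w \<and> ut \<in> L2w \<and>
   (\<forall>i. ux i \<in> L2w) \<and> (\<forall>i j. uxx i j \<in> L2w))"
proof
  assume h: "u \<in> H_space 1 2 (dens \<rho>)"
  then have "u \<in> H_loc 1 2" by (simp add: H_space_def)
  then obtain ut ux uxx where w: "weak_derivs u ut ux uxx" using H_loc_weak_derivs by blast
  note ae = weak_derivs_AE[OF w, folded AE_dens]
  have m: "u \<in> borel_measurable (dens \<rho>)" "ut \<in> borel_measurable (dens \<rho>)" "ux i \<in> borel_measurable (dens \<rho>)" "uxx i j \<in> borel_measurable (dens \<rho>)" for i j
   using weak_derivsD(1-4)[OF w] by (auto simp: L2_loc_def)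
  have l: "Dt l u \<in> L2w" if "l \<le> 1" for l using h that by (simp add: H_space_def)
  have a: "Dx \<alpha> u \<in> L2w" if "length \<alpha> \<le> 2" for \<alpha> using h that by (simp add: H_space_def)
  have "u \<in> L2w" by (rule L2_space_AE_cong[OF l[of 0] m(1)]) (use ae(1) in \<open>auto elim: eventually_mono\<close>)
  moreover have "ut \<in> L2w" by (rule L2_space_AE_cong[OF l[of 1] m(2)]) (use ae(2) in \<open>auto elim: eventually_mono\<close>)
  moreover have "ux i \<in> L2w" for i by (rule L2_space_AE_cong[OF a[of "[i]"] m(3)]) (use ae(4)[of i] in \<open>auto elim: eventually_mono\<close>)
  moreover have "uxx i j \<in> L2w" for i j by (rule L2_space_AE_cong[OF a[of "[i, j]"] m(4)]) (use ae(5)[of i j] in \<open>auto elim: eventually_mono\<close>)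
  ultimately show "\<exists>ut ux uxx. weak_derivs u ut ux uxx \<and> u \<in> L2w \<and> ut \<in> L2w \<and>
   (\<forall>i. ux i \<in> L2w) \<and> (\<forall>i j. uxx i j \<in> L2w)" using w by blast
next
  assume "\<exists>ut ux uxx. weak_derivs u ut ux uxx \<and> u \<in> L2w \<and> ut \<in> L2w \<and>
   (\<forall>i. ux i \<in> L2w) \<and> (\<forall>i j. uxx i j \<in> L2w)"
  then obtain ut ux uxx where w: "weak_derivs u ut ux uxx" and L: "u \<in> L2w" "ut \<in> L2w"
   "\<And>i. ux i \<in> L2w" "\<And>i j. uxx i j \<in> L2w" by blast
  note ae = weak_derivs_AE[OF w, folded AE_dens] and m = weak_derivs_measurable[OF w]
  have 0: "Dt 0 u \<in> L2w" by (rule L2_space_AE_cong[OF L(1) _ ae(1)]) (use m in simp)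
  have 1: "Dt 1 u \<in> L2w" by (rule L2_space_AE_cong[OF L(2) _ ae(2)]) (use m in simp)
  have 2: "Dx [] u \<in> L2w" by (rule L2_space_AE_cong[OF L(1) _ ae(3)]) (use m in simp)
  have 3: "Dx [i] u \<in> L2w" for i by (rule L2_space_AE_cong[OF L(3) _ ae(4)]) (use m in simp)
  have 4: "Dx [i, j] u \<in> L2w" for i j by (rule L2_space_AE_cong[OF L(4) _ ae(5)]) (use m in simp)
  have "Dt l u \<in> L2w" if "l \<le> 1" for l using le_Suc_0_cases[of l] that 0 1 by auto
  moreover have "Dx \<alpha> u \<in> L2w" if "length \<alpha> \<le> 2" for \<alpha> using length_le_2_cases[OF that] 2 3 4 by auto
  ultimately show "u \<in> H_space 1 2 (dens \<rho>)" using weak_derivs_H_loc[OF w] by (simp add: H_space_def)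
qed

definition test_graph where "test_graph = {(\<phi>, Gc \<phi>) | \<phi>. test_function \<phi>}"

text \<open>Convolution is applied to each weak derivative separately and the coefficients are
  multiplied in afterwards. This is possible since every derivative is locally square integrable,
  and it leaves no commutator of coefficient and mollifier.\<close>

lemma mollify:
  assumes w: "weak_derivs v vt vx vxx" and z: "\<forall>z. r < norm z \<longrightarrow> v z = 0 \<and> vt z = 0 \<and> (\<forall>i. vx i z = 0) \<and> (\<forall>i j. vxx i j z = 0)"
  shows "test_function (conv v (moll k))" "tendsw (\<lambda>k. conv v (moll k)) v"
   "tendsw (\<lambda>k. dx i (conv v (moll k))) (vx i)" "tendsw (\<lambda>k. Gc (conv v (moll k))) (Gw vt vx vxx)"
proof -
  note L = weak_derivsD(1-4)[OF w] and d = weak_derivsD(5-7)[OF w]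
  have cs: "csupp v" "csupp (vx i)" for i using z by (auto intro: csuppI[of r])
  note int = csupp_L2_loc(2)[OF L(1) cs(1)] csupp_L2_loc(2)[OF L(3) cs(2)]
  show "test_function (conv v (moll k))" by (rule test_function_conv[OF test_function_moll int(1) cs(1)])
  have e: "set [e_time :: real \<times> (real ^ 'n)] \<subseteq> Basis" "set [e_space i :: real \<times> (real ^ 'n)] \<subseteq> Basis" for i by (simp_all add: e_space_Basis e_time_Basis)
  have pt: "dt (conv v (moll k)) = conv vt (moll k)" for k using is_weak_deriv_conv[OF d(1) int(1) test_function_moll e(1)] by simp
  have px: "dx i (conv v (moll k)) = conv (vx i) (moll k)" for k i using is_weak_deriv_conv[OF d(2) int(1) test_function_moll e(2)] by simp
  have pxx: "dx j (dx i (conv v (moll k))) = conv (vxx i j) (moll k)" for k i j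
   unfolding px using is_weak_deriv_conv[OF d(3) int(2) test_function_moll e(2)] by simp
  note t = l2_tends_conv_moll_dens[OF L(1), of r] l2_tends_conv_moll_dens[OF L(2), of r] l2_tends_conv_moll_dens[OF L(3), of r]
   l2_tends_conv_moll_dens[OF L(4), of r]
  show "tendsw (\<lambda>k. conv v (moll k)) v" using t(1)[of "\<lambda>z. 1"] z by simp
  show "tendsw (\<lambda>k. dx i (conv v (moll k))) (vx i)" unfolding px using t(3)[of i "\<lambda>z. 1"] z by simp
  have vt: "tendsw (\<lambda>k. conv vt (moll k)) vt" using t(2)[of "\<lambda>z. 1"] z by simp
  show "tendsw (\<lambda>k. Gc (conv v (moll k))) (Gw vt vx vxx)" unfolding Gc_def[abs_def] Gw_def[abs_def] pxx pt unfolding px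
   by (intro l2_tends_add vt l2_tends_cmult l2_tends_sum t continuous_entries) (use z in auto)
qed

end

section \<open>Gradient bounds on the maximal domain; test functions as a core\<close>

context ou_family
begin

definition "M0 = (SOME K. K > 0 \<and> (\<forall>k z. (\<forall>i. \<bar>dx i (cut k) z\<bar> \<le> K) \<and> \<bar>Gc (cut k) z\<bar> \<le> K))"

lemma M0: "M0 > 0" "\<bar>dx i (cut k) z\<bar> \<le> M0" "\<bar>Gc (cut k) z\<bar> \<le> M0"
  unfolding M0_def using someI_ex[OF ex_cut_bound] by blast+

definition "E0 = (SOME K. K > 0 \<and> (\<forall>t i j. \<bar>Q t $ i $ j\<bar> \<le> K \<and> \<bar>C t $ i $ j\<bar> \<le> K \<and> \<bar>A t $ i $ j\<bar> \<le> K \<and> \<bar>g' t $ i\<bar> \<le> K \<and> \<bar>g t $ i\<bar> \<le> K))"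

lemma E0: "E0 > 0" "\<bar>C t $ i $ j\<bar> \<le> E0" "\<bar>A t $ i $ j\<bar> \<le> E0" "\<bar>g' t $ i\<bar> \<le> E0"
  unfolding E0_def using someI_ex[OF ex_entry_bound] by auto

lemma smooth_cut: "smooth (cut k)" by (rule test_function_smooth[OF test_function_cut])

text \<open>The last term pairs the gradient of the cut-off with the gradient of \<open>u\<close>;
  it is the reason why square integrability of the gradient has to be proved before cutting
  off.\<close>

lemma Gw_cut:
  "Gw (mult_t \<zeta> u ut) (mult_x \<zeta> u ux) (mult_xx \<zeta> u ux uxx) z
  = \<zeta> z * Gw ut ux uxx z + u z * Gc \<zeta> z + (\<Sum>i\<in>UNIV. \<Sum>j\<in>UNIV. C (fst z) $ i $ j * (dx i \<zeta> z * ux j z))"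
proof -
  let ?c = "\<lambda>i j. C (fst z) $ i $ j"
  have s: "(\<Sum>i\<in>UNIV. \<Sum>j\<in>UNIV. ?c i j * (dx j \<zeta> z * ux i z)) = (\<Sum>i\<in>UNIV. \<Sum>j\<in>UNIV. ?c i j * (dx i \<zeta> z * ux j z))"
   by (subst sum.swap) (simp only: C_sym)
  have 1: "(\<Sum>i\<in>UNIV. \<Sum>j\<in>UNIV. ?c i j * ((\<zeta> z * uxx i j z + dx j \<zeta> z * ux i z) + (dx i \<zeta> z * ux j z + dx j (dx i \<zeta>) z * u z)))
   = \<zeta> z * (\<Sum>i\<in>UNIV. \<Sum>j\<in>UNIV. ?c i j * uxx i j z) + (\<Sum>i\<in>UNIV. \<Sum>j\<in>UNIV. ?c i j * (dx j \<zeta> z * ux i z))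
    + (\<Sum>i\<in>UNIV. \<Sum>j\<in>UNIV. ?c i j * (dx i \<zeta> z * ux j z)) + u z * (\<Sum>i\<in>UNIV. \<Sum>j\<in>UNIV. ?c i j * dx j (dx i \<zeta>) z)"
   unfolding sum_distrib_left sum.distrib[symmetric] by (intro sum.cong refl) (simp add: algebra_simps)
  have 2: "(\<Sum>i\<in>UNIV. drift z $ i * (\<zeta> z * ux i z + dx i \<zeta> z * u z)) = \<zeta> z * (\<Sum>i\<in>UNIV. drift z $ i * ux i z) + u z * (\<Sum>i\<in>UNIV. drift z $ i * dx i \<zeta> z)"
   unfolding sum_distrib_left sum.distrib[symmetric] by (intro sum.cong refl) (simp add: algebra_simps)
  show ?thesis unfolding Gw_def Gc_def mult_defs 1 2 s by (simp add: algebra_simps)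
qed

lemma cut_tuple:
  fixes k :: nat and u :: "real \<times> (real ^ 'n) \<Rightarrow> real"
  assumes w: "weak_derivs u ut ux uxx"
  shows "weak_derivs (\<lambda>z. cut k z * u z) (mult_t (cut k) u ut) (mult_x (cut k) u ux) (mult_xx (cut k) u ux uxx)"
   "\<exists>r. \<forall>z. r < norm z \<longrightarrow> cut k z * u z = 0 \<and> mult_t (cut k) u ut z = 0 \<and> (\<forall>i. mult_x (cut k) u ux i z = 0) \<and> (\<forall>i j. mult_xx (cut k) u ux uxx i j z = 0)"
proof -
  show "weak_derivs (\<lambda>z. cut k z * u z) (mult_t (cut k) u ut) (mult_x (cut k) u ux) (mult_xx (cut k) u ux uxx)" by (rule weak_derivs_mult[OF w smooth_cut])
  obtain r where r: "\<And>z :: real \<times> (real ^ 'n). r < norm z \<Longrightarrow> cut k z = 0 \<and> (\<forall>b. pd b (cut k) z = 0) \<and> (\<forall>b c. pd c (pd b (cut k)) z = 0)"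
   using test_function_csupp_cut by blast
  show "\<exists>r. \<forall>z. r < norm z \<longrightarrow> cut k z * u z = 0 \<and> mult_t (cut k) u ut z = 0 \<and> (\<forall>i. mult_x (cut k) u ux i z = 0) \<and> (\<forall>i j. mult_xx (cut k) u ux uxx i j z = 0)"
  proof (intro exI[of _ r] allI impI)
   fix z :: "real \<times> (real ^ 'n)" assume "r < norm z"
   from r[OF this] show "cut k z * u z = 0 \<and> mult_t (cut k) u ut z = 0 \<and> (\<forall>i. mult_x (cut k) u ux i z = 0) \<and> (\<forall>i j. mult_xx (cut k) u ux uxx i j z = 0)"
    by (simp only: mult_defs mult_zero_left mult_zero_right add_0 simp_thms)
  qed
qed

text \<open>Invariance of \<nu> for \<phi>^2: the integral of G(\<phi>^2) vanishes, and its carre du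
  champ is bounded below by the ellipticity of \<open>C\<close>. This is dissipativity with the
  gradient kept.\<close>

lemma gradient_le_generator:
  assumes \<phi>: "test_function \<phi>"
  shows "\<mu>0\<^sup>2 * (LINT z|dens \<rho>. grad_sq \<phi> z) \<le> - 2 * (LINT z|dens \<rho>. \<phi> z * Gc \<phi> z)"
proof -
  have s: "smooth \<phi>" by (rule test_function_smooth[OF \<phi>])
  have t: "test_function (\<lambda>z. \<phi> z * \<phi> z)" by (rule test_function_mult[OF \<phi> \<phi>])
  have "has_bochner_integral lborel (\<lambda>z. \<rho> z * (0 * (\<phi> z * \<phi> z) + 1 * Gc (\<lambda>z. \<phi> z * \<phi> z) z)) 0"
   using invariance[OF t, of "\<lambda>t. 1" "\<lambda>t. 0"] by simp
  then have "has_bochner_integral lborel (\<lambda>z. \<rho> z * Gc (\<lambda>z. \<phi> z * \<phi> z) z) 0" by simp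
  then have "(LINT z|dens \<rho>. Gc (\<lambda>z. \<phi> z * \<phi> z) z) = 0" by (rule dens_integral_zero) (rule cc_measurable[OF cc_Gc[OF t]])
  moreover have "Gc (\<lambda>z. \<phi> z * \<phi> z) z = 2 * (\<phi> z * Gc \<phi> z) + bil (C (fst z)) \<phi> z" for z
   unfolding Gc_mult[OF s s] bil_def by simp
  moreover have c: "cc (\<lambda>z. \<phi> z * Gc \<phi> z)" by (rule cc_mult_left[OF test_function_cc[OF \<phi>] continuous_Gc[OF s]])
  note i = integrable_dens_cc[OF c] integrable_dens_cc[OF cc_forms(1)[OF \<phi>]] integrable_dens_cc[OF cc_forms(5)[OF \<phi>]]
  ultimately have 1: "2 * (LINT z|dens \<rho>. \<phi> z * Gc \<phi> z) + (LINT z|dens \<rho>. bil (C (fst z)) \<phi> z) = 0" using i by simp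
  have "(LINT z|dens \<rho>. \<mu>0\<^sup>2 * grad_sq \<phi> z) \<le> (LINT z|dens \<rho>. bil (C (fst z)) \<phi> z)"
   by (rule integral_mono) (use i bil_C_lower in auto)
  then show ?thesis using 1 by simp
qed

lemma gradient_le_generator_weak:
  assumes w: "weak_derivs v vt vx vxx" and z: "\<forall>z. r < norm z \<longrightarrow> v z = 0 \<and> vt z = 0 \<and> (\<forall>i. vx i z = 0) \<and> (\<forall>i j. vxx i j z = 0)"
  shows "vx i \<in> L2w" "v \<in> L2w" "Gw vt vx vxx \<in> L2w"
   "\<mu>0\<^sup>2 * (\<Sum>i\<in>UNIV. LINT z|dens \<rho>. (vx i z)\<^sup>2) \<le> - 2 * (LINT z|dens \<rho>. v z * Gw vt vx vxx z)"
proof -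
  note m = mollify[OF w z]
  show "vx i \<in> L2w" "v \<in> L2w" "Gw vt vx vxx \<in> L2w"
   by (rule l2_tendsD(2)[OF m(3)] l2_tendsD(2)[OF m(2)] l2_tendsD(2)[OF m(4)])+
  have "(LINT z|dens \<rho>. grad_sq (conv v (moll k)) z) = (\<Sum>i\<in>UNIV. LINT z|dens \<rho>. (dx i (conv v (moll k)) z)\<^sup>2)" for k
   unfolding grad_sq_def
   by (rule Bochner_Integration.integral_sum) (rule integrable_dens_cc[OF cc_square[OF test_function_cc[OF test_function_dx[OF m(1)]]]])
  then have le: "\<mu>0\<^sup>2 * (\<Sum>i\<in>UNIV. LINT z|dens \<rho>. (dx i (conv v (moll k)) z)\<^sup>2) \<le> - 2 * (LINT z|dens \<rho>. conv v (moll k) z * Gc (conv v (moll k)) z)" for k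
   using gradient_le_generator[OF m(1)[of k]] by simp
  show "\<mu>0\<^sup>2 * (\<Sum>i\<in>UNIV. LINT z|dens \<rho>. (vx i z)\<^sup>2) \<le> - 2 * (LINT z|dens \<rho>. v z * Gw vt vx vxx z)"
  proof (rule LIMSEQ_le)
   show "(\<lambda>k. \<mu>0\<^sup>2 * (\<Sum>i\<in>UNIV. LINT z|dens \<rho>. (dx i (conv v (moll k)) z)\<^sup>2)) \<longlonglongrightarrow> \<mu>0\<^sup>2 * (\<Sum>i\<in>UNIV. LINT z|dens \<rho>. (vx i z)\<^sup>2)"
    by (intro tendsto_mult tendsto_const tendsto_sum l2_tends_integral_power2 m(3))
   show "(\<lambda>k. - 2 * (LINT z|dens \<rho>. conv v (moll k) z * Gc (conv v (moll k)) z)) \<longlonglongrightarrow> - 2 * (LINT z|dens \<rho>. v z * Gw vt vx vxx z)"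
    by (intro tendsto_mult tendsto_const l2_tends_integral_mult m(2,4))
  qed (use le in auto)
qed

text \<open>The gradient energy of the cut-off function is bounded independently of \<open>k\<close>
  by \<open>u\<close> and G u alone. At this stage the gradient of \<open>u\<close> itself is only
  known locally, so it may not appear on the right.\<close>

lemma caccioppoli:
  assumes w: "weak_derivs u ut ux uxx" and u: "u \<in> L2w" and g: "Gw ut ux uxx \<in> L2w"
  shows "\<exists>K. \<forall>k i. mult_x (cut k) u ux i \<in> L2w \<and>
   sq (mult_x (cut k) u ux i) \<le> K"
proof -
  define n where "n = real CARD('n)"
  have n: "n \<ge> 1" by (simp add: n_def Suc_le_eq)
  \<comment> \<open>The choice makes the gradient term produced by Young's inequality equal to half
    of the coercive one.\<close>
  define e where "e = \<mu>0\<^sup>2 / (2 * n)"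
  have e: "e > 0" "n * e = \<mu>0\<^sup>2 / 2" using \<mu>0_pos n by (simp_all add: e_def)
  define D where "D = n * M0\<^sup>2"
  \<comment> \<open>One summand for each of the four terms estimated below: the product of
    \<open>u\<close> and G u, the generator of the cut-off, the mixed gradient term, and the square
    of the gradient of the cut-off.\<close>
  define K where "K = 1 + 2 * M0 + n * (E0\<^sup>2 / e) * D + 2 * n * E0 * D"
  define I where "I = K * sq u + sq (Gw ut ux uxx)"
  have main: "mult_x (cut k) u ux i \<in> L2w \<and>
   sq (mult_x (cut k) u ux i) \<le> 2 / \<mu>0\<^sup>2 * I" for k i
  proof -
   define v where "v = (\<lambda>z. cut k z * u z)"
   define vt where "vt = mult_t (cut k) u ut"
   define vx where "vx = mult_x (cut k) u ux"
   define vxx where "vxx = mult_xx (cut k) u ux uxx"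
   note v_defs = v_def vt_def vx_def vxx_def
   obtain r where r: "\<forall>z. r < norm z \<longrightarrow> v z = 0 \<and> vt z = 0 \<and> (\<forall>i. vx i z = 0) \<and> (\<forall>i j. vxx i j z = 0)"
    using cut_tuple(2)[OF w, of k] unfolding v_defs by blast
   note en = gradient_le_generator_weak[OF cut_tuple(1)[OF w, of k, folded v_defs] r]
   let ?G = "Gw vt vx vxx"
   have pt: "- 2 * (v z * ?G z) \<le> K * (u z)\<^sup>2 + (Gw ut ux uxx z)\<^sup>2 + \<mu>0\<^sup>2 / 2 * (\<Sum>j\<in>UNIV. (vx j z)\<^sup>2)" for z
   proof -
    let ?w = "Gw ut ux uxx z" and ?c = "cut k z" and ?S = "\<lambda>h. (\<Sum>i\<in>UNIV. \<Sum>j\<in>UNIV. C (fst z) $ i $ j * (dx i (cut k) z * h j))"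
    note c = cut_bounds[of k z]
    have "(\<Sum>i\<in>UNIV. (dx i (cut k) z)\<^sup>2) \<le> (\<Sum>i\<in>(UNIV::'n set). M0\<^sup>2)" by (intro sum_mono power2_le_if_abs_le M0)
    then have D: "(\<Sum>i\<in>UNIV. (dx i (cut k) z)\<^sup>2) \<le> D" by (simp add: D_def n_def)
    \<comment> \<open>The cut-off times the gradient of \<open>u\<close> is rewritten as the
      gradient of the product minus a term without derivatives of \<open>u\<close>; only the former
      has finite energy so far, and it can be absorbed.\<close>
    have S: "?c * ?S (\<lambda>j. ux j z) = ?S (\<lambda>j. vx j z) - u z * ?S (\<lambda>j. dx j (cut k) z)"
     unfolding vx_def mult_x_def sum_distrib_left sum_subtractf[symmetric] by (intro sum.cong refl) (simp add: algebra_simps)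
    have vG: "v z * ?G z = ?c\<^sup>2 * (u z * ?w) + ?c * ((u z)\<^sup>2 * Gc (cut k) z) + u z * (?c * ?S (\<lambda>j. ux j z))"
     unfolding v_defs Gw_cut by (simp add: algebra_simps power2_eq_square)
    have c2: "?c\<^sup>2 \<le> 1" using c by (simp add: power_le_one)
    have 1: "- 2 * (?c\<^sup>2 * (u z * ?w)) \<le> (u z)\<^sup>2 + ?w\<^sup>2"
    proof -
     have "- 2 * (u z * ?w) \<le> (u z)\<^sup>2 + ?w\<^sup>2" using zero_le_power2[of "u z + ?w"] by (simp add: power2_sum)
     then have "?c\<^sup>2 * (- 2 * (u z * ?w)) \<le> ?c\<^sup>2 * ((u z)\<^sup>2 + ?w\<^sup>2)" by (rule mult_left_mono) simp
     also have "\<dots> \<le> 1 * ((u z)\<^sup>2 + ?w\<^sup>2)" using c2 by (rule mult_right_mono) simp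
     finally show ?thesis by simp
    qed
    have 2: "- 2 * (?c * ((u z)\<^sup>2 * Gc (cut k) z)) \<le> 2 * M0 * (u z)\<^sup>2"
    proof -
     have "- Gc (cut k) z \<le> M0" using M0(3)[of k z] by linarith
     then have "(u z)\<^sup>2 * - Gc (cut k) z \<le> (u z)\<^sup>2 * M0" by (rule mult_left_mono) simp
     then have "?c * ((u z)\<^sup>2 * - Gc (cut k) z) \<le> ?c * ((u z)\<^sup>2 * M0)" by (rule mult_left_mono) (rule c)
     also have "\<dots> \<le> 1 * ((u z)\<^sup>2 * M0)" using c M0(1) by (intro mult_right_mono) auto
     finally show ?thesis by (simp add: mult.commute)
    qed
    have 3: "- 2 * (u z * ?S (\<lambda>j. vx j z)) \<le> n * (E0\<^sup>2 / e) * D * (u z)\<^sup>2 + \<mu>0\<^sup>2 / 2 * (\<Sum>j\<in>UNIV. (vx j z)\<^sup>2)"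
    proof -
     have "- 2 * (u z * ?S (\<lambda>j. vx j z)) = 2 * (\<Sum>i\<in>UNIV. \<Sum>j\<in>UNIV. C (fst z) $ i $ j * ((- u z * dx i (cut k) z) * vx j z))"
      by (simp add: sum_distrib_left mult_ac sum_negf)
     also have "\<dots> \<le> n * (E0\<^sup>2 / e) * (\<Sum>i\<in>UNIV. (- u z * dx i (cut k) z)\<^sup>2) + n * e * (\<Sum>j\<in>UNIV. (vx j z)\<^sup>2)"
      unfolding n_def by (rule bilinear_young[OF E0(2) e(1)])
     also have "(\<Sum>i\<in>UNIV. (- u z * dx i (cut k) z)\<^sup>2) = (\<Sum>i\<in>UNIV. (dx i (cut k) z)\<^sup>2) * (u z)\<^sup>2"
      by (simp add: sum_distrib_left power_mult_distrib mult.commute)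
     also have "n * (E0\<^sup>2 / e) * ((\<Sum>i\<in>UNIV. (dx i (cut k) z)\<^sup>2) * (u z)\<^sup>2) \<le> n * (E0\<^sup>2 / e) * (D * (u z)\<^sup>2)"
      using n e by (intro mult_left_mono mult_right_mono D) auto
     finally show ?thesis using e(2) by (simp add: mult.assoc)
    qed
    have 4: "2 * ((u z)\<^sup>2 * ?S (\<lambda>j. dx j (cut k) z)) \<le> 2 * n * E0 * D * (u z)\<^sup>2"
    proof -
     have "2 * ?S (\<lambda>j. dx j (cut k) z) \<le> n * (E0\<^sup>2 / E0) * (\<Sum>i\<in>UNIV. (dx i (cut k) z)\<^sup>2) + n * E0 * (\<Sum>i\<in>UNIV. (dx i (cut k) z)\<^sup>2)"
      unfolding n_def by (rule bilinear_young[OF E0(2,1)])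
     also have "\<dots> = 2 * n * E0 * (\<Sum>i\<in>UNIV. (dx i (cut k) z)\<^sup>2)" using E0(1) by (simp add: power2_eq_square)
     also have "\<dots> \<le> 2 * n * E0 * D" using n E0(1) by (intro mult_left_mono D) auto
     finally show ?thesis using mult_left_mono[of "2 * ?S (\<lambda>j. dx j (cut k) z)" "2 * n * E0 * D" "(u z)\<^sup>2"] by (simp add: mult_ac)
    qed
    have 5: "u z * (?c * ?S (\<lambda>j. ux j z)) = u z * ?S (\<lambda>j. vx j z) - (u z)\<^sup>2 * ?S (\<lambda>j. dx j (cut k) z)"
     unfolding S by (simp add: algebra_simps power2_eq_square)
    have 6: "K * (u z)\<^sup>2 = (u z)\<^sup>2 + 2 * M0 * (u z)\<^sup>2 + n * (E0\<^sup>2 / e) * D * (u z)\<^sup>2 + 2 * n * E0 * D * (u z)\<^sup>2" by (simp add: K_def distrib_right)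
    have comb: "- 2 * (a + b + (c - d)) \<le> (p + X + Y + Z) + W + S" if "- 2 * a \<le> p + W" "- 2 * b \<le> X" "- 2 * c \<le> Y + S" "2 * d \<le> Z"
     for a b c d p W X Y Z S :: real using that by argo
    show ?thesis unfolding vG 5 6 by (rule comb[OF 1 2 3 4])
   qed
   note ii = L2_spaceD(2)[OF en(1)] and iu = L2_spaceD(2)[OF u] L2_spaceD(2)[OF g]
   define T where "T = (\<Sum>j\<in>UNIV. LINT z|dens \<rho>. (vx j z)\<^sup>2)"
   have "(LINT z|dens \<rho>. - 2 * (v z * ?G z)) \<le> (LINT z|dens \<rho>. K * (u z)\<^sup>2 + (Gw ut ux uxx z)\<^sup>2 + \<mu>0\<^sup>2 / 2 * (\<Sum>j\<in>UNIV. (vx j z)\<^sup>2))"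
    by (intro integral_mono pt integrable_mult_right L2_space_mult_integrable en Bochner_Integration.integrable_add Bochner_Integration.integrable_sum ii iu)
   also have "\<dots> = I + \<mu>0\<^sup>2 / 2 * T" using iu ii by (simp add: I_def T_def Bochner_Integration.integral_sum)
   finally have "\<mu>0\<^sup>2 * T \<le> I + \<mu>0\<^sup>2 / 2 * T" using en(4) by (simp add: T_def)
   then have T: "T \<le> 2 / \<mu>0\<^sup>2 * I" using \<mu>0_pos by (simp add: field_simps)
   have "sq (vx i) \<le> T" unfolding T_def by (rule member_le_sum[where f="\<lambda>j. LINT z|dens \<rho>. (vx j z)\<^sup>2"]) auto
   then show ?thesis using T en(1)[of i] unfolding vx_def by auto
  qed
  then show ?thesis by blast
qed

text \<open>At each point the cut-off derivatives are eventually equal to the derivative itself, so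
  Fatou turns the uniform bound into membership.\<close>

lemma gradient_L2:
  assumes w: "weak_derivs u ut ux uxx" and u: "u \<in> L2w" and g: "Gw ut ux uxx \<in> L2w"
  shows "ux i \<in> L2w"
proof -
  obtain K where K: "\<And>k i. mult_x (cut k) u ux i \<in> L2w"
   "\<And>k i. sq (mult_x (cut k) u ux i) \<le> K" using caccioppoli[OF assms] by blast
  show ?thesis
  proof (rule L2_Fatou(1)[OF K(1)])
   show "ux i \<in> borel_measurable (dens \<rho>)" using weak_derivsD(3)[OF w] by (simp add: L2_loc_def)
   have "\<forall>\<^sub>F k in sequentially. mult_x (cut k) u ux i z = ux i z" for z
    using eventually_norm_less[of z] by eventually_elim (simp add: mult_x_def cut_eq_1 less_imp_le pd_cut_eventually del: of_nat_Suc)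
   then show "AE z in dens \<rho>. (\<lambda>k. mult_x (cut k) u ux i z) \<longlonglongrightarrow> ux i z" by (intro AE_I2 tendsto_eventually)
   show "\<forall>\<^sub>F k in sequentially. sq (mult_x (cut k) u ux i) \<le> K" using K(2) by simp
  qed
qed

text \<open>Cutting off, then mollifying. Both limits are in the graph norm; only the first uses the
  global bounds, the second takes place in a fixed ball.\<close>

lemma graph_approx_test:
  assumes w: "weak_derivs u ut ux uxx" and u: "u \<in> L2w" and g: "Gw ut ux uxx \<in> L2w"
  shows "graph_approx (dens \<rho>) test_graph u (Gw ut ux uxx)"
proof -
  define n where "n = real CARD('n)"
  define vt where "vt = (\<lambda>k. mult_t (cut k) u ut)"
  define vx where "vx = (\<lambda>k. mult_x (cut k) u ux)"
  define vxx where "vxx = (\<lambda>k. mult_xx (cut k) u ux uxx)"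
  note ux = gradient_L2[OF w u g]
  have mc: "cut k \<in> borel_measurable borel" "Gc (cut k) \<in> borel_measurable borel" "dx i (cut k) \<in> borel_measurable borel" for k i
   by (rule borel_measurable_continuous_onI, intro continuous_Gc smooth_continuous smooth_dx smooth_cut)+
  have mu: "u \<in> borel_measurable borel" "ux i \<in> borel_measurable borel" "Gw ut ux uxx \<in> borel_measurable borel" for i
   using L2_spaceD(1)[OF u] L2_spaceD(1)[OF ux] L2_spaceD(1)[OF g] by simp_all
  have mC: "(\<lambda>z :: real \<times> (real ^ 'n). C (fst z) $ i $ j) \<in> borel_measurable borel" for i j by (rule borel_measurable_continuous_onI[OF continuous_entries(1)])
  have mG: "Gw (vt k) (vx k) (vxx k) \<in> borel_measurable borel" for k unfolding Gw_cut vt_def vx_def vxx_def using mc mu mC by measurable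
  have t1: "tendsw (\<lambda>k z. cut k z * u z) u"
  proof (rule l2_tends_dominated)
   show "(\<lambda>z. \<bar>u z\<bar>) \<in> L2w" by (rule L2_space_bound[OF u]) (use mu in auto)
   have "(\<lambda>k. cut k z * u z) \<longlonglongrightarrow> u z" for z using tendsto_mult[OF tendsto_cut[of z] tendsto_const[of "u z"]] by simp
   then show "AE z in dens \<rho>. (\<lambda>k. cut k z * u z) \<longlonglongrightarrow> u z" by simp
   show "(\<lambda>z. cut k z * u z) \<in> borel_measurable (dens \<rho>)" for k using borel_measurable_times[OF mc(1)[of k] mu(1)] by simp
   have "\<bar>cut k z * u z\<bar> \<le> \<bar>u z\<bar>" for k z using cut_bounds[of k z] by (simp add: abs_mult mult_left_le_one_le)
   then show "AE z in dens \<rho>. \<bar>cut k z * u z\<bar> \<le> \<bar>u z\<bar>" for k by simp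
  qed (use mu in auto)
  have t2: "tendsw (\<lambda>k. Gw (vt k) (vx k) (vxx k)) (Gw ut ux uxx)"
  proof (rule l2_tends_dominated)
   \<comment> \<open>The majorant contains the first derivatives of \<open>u\<close>, square
     integrable by \<open>gradient_L2\<close>; derivatives of the cut-off enter only through bounds
     uniform in \<open>k\<close>.\<close>
   let ?W = "\<lambda>z. \<bar>Gw ut ux uxx z\<bar> + M0 * \<bar>u z\<bar> + (\<Sum>i\<in>(UNIV::'n set). \<Sum>j\<in>UNIV. E0 * M0 * \<bar>ux j z\<bar>)"
   have ab: "(\<lambda>z. \<bar>h z\<bar>) \<in> L2w" if "h \<in> L2w" for h
    by (rule L2_space_bound[OF that]) (use L2_spaceD(1)[OF that] in auto)
   show "?W \<in> L2w" by (intro L2_space_add L2_space_sum L2_space_cmult ab u g ux)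
   have "(\<lambda>k. Gw (vt k) (vx k) (vxx k) z) \<longlonglongrightarrow> Gw ut ux uxx z" for z
   proof (rule tendsto_eventually)
    show "\<forall>\<^sub>F k in sequentially. Gw (vt k) (vx k) (vxx k) z = Gw ut ux uxx z" using eventually_norm_less[of z]
    proof eventually_elim
     fix k assume "norm z < real (Suc k)"
     then show "Gw (vt k) (vx k) (vxx k) z = Gw ut ux uxx z" unfolding vt_def vx_def vxx_def Gw_cut Gc_def
      by (simp add: cut_eq_1 less_imp_le pd_cut_eventually pd_pd_cut_eventually del: of_nat_Suc)
    qed
   qed
   then show "AE z in dens \<rho>. (\<lambda>k. Gw (vt k) (vx k) (vxx k) z) \<longlonglongrightarrow> Gw ut ux uxx z" by simp
   have "\<bar>Gw (vt k) (vx k) (vxx k) z\<bar> \<le> ?W z" for k z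
   proof -
    have "\<bar>cut k z * Gw ut ux uxx z\<bar> \<le> \<bar>Gw ut ux uxx z\<bar>" using cut_bounds[of k z] by (simp add: abs_mult mult_left_le_one_le)
    moreover have "\<bar>u z * Gc (cut k) z\<bar> \<le> M0 * \<bar>u z\<bar>" using M0(3)[of k z] by (simp add: abs_mult mult.commute mult_left_mono)
    moreover have "\<bar>\<Sum>i\<in>UNIV. \<Sum>j\<in>UNIV. C (fst z) $ i $ j * (dx i (cut k) z * ux j z)\<bar> \<le> (\<Sum>i\<in>(UNIV::'n set). \<Sum>j\<in>UNIV. E0 * M0 * \<bar>ux j z\<bar>)"
    proof (intro order_trans[OF sum_abs] sum_mono)
     fix i j show "\<bar>C (fst z) $ i $ j * (dx i (cut k) z * ux j z)\<bar> \<le> E0 * M0 * \<bar>ux j z\<bar>"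
      unfolding abs_mult mult.assoc[symmetric] using E0 M0 by (intro mult_mono) auto
    qed
    ultimately show ?thesis unfolding vt_def vx_def vxx_def Gw_cut by linarith
   qed
   then show "AE z in dens \<rho>. \<bar>Gw (vt k) (vx k) (vxx k) z\<bar> \<le> ?W z" for k by simp
  qed (use mG mu in auto)
  show ?thesis
  proof (rule graph_approx_limit[OF t1 t2])
   fix k
   have c: "weak_derivs (\<lambda>z. cut k z * u z) (vt k) (vx k) (vxx k)" unfolding vt_def vx_def vxx_def by (rule cut_tuple(1)[OF w])
   obtain r where r: "\<forall>z. r < norm z \<longrightarrow> cut k z * u z = 0 \<and> vt k z = 0 \<and> (\<forall>i. vx k i z = 0) \<and> (\<forall>i j. vxx k i j z = 0)"
    unfolding vt_def vx_def vxx_def using cut_tuple(2)[OF w, of k] by blast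
   note m = mollify(1)[OF c r] mollify(2)[OF c r] mollify(4)[OF c r]
   show "graph_approx (dens \<rho>) test_graph (\<lambda>z. cut k z * u z) (Gw (vt k) (vx k) (vxx k))"
   proof (rule graph_approx_limit[OF m(2,3)])
    fix l
    have t: "test_function (conv (\<lambda>z. cut k z * u z) (moll l))" by (rule m(1))
    show "graph_approx (dens \<rho>) test_graph (conv (\<lambda>z. cut k z * u z) (moll l)) (Gc (conv (\<lambda>z. cut k z * u z) (moll l)))"
     by (rule graph_approx_base) (use t in \<open>auto simp: test_graph_def intro: cc_L2_dens test_function_cc cc_Gc\<close>)
   qed
  qed
qed

end

section \<open>From the closure on test functions to the Sobolev space\<close>

context ou_family
begin

text \<open>Applied to differences of approximants: by linearity the a priori estimate turns
  convergence of the images under G into convergence of each spatial derivative.\<close>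

lemma l2_Cauchy_if_le:
  assumes W: "l2_tends M W w" and F: "\<And>k. F k \<in> L2_space M"
   and le: "\<And>m n. (LINT z|M. (F m z - F n z)\<^sup>2) \<le> K * (LINT z|M. (W m z - W n z)\<^sup>2)" and K: "K > 0"
  shows "\<exists>f. l2_tends M F f"
proof (rule L2_complete[OF F])
  fix e :: real assume "e > 0"
  then have e: "e / (4 * K) > 0" using K by simp
  obtain N where N: "\<And>k. k \<ge> N \<Longrightarrow> norm ((LINT z|M. (W k z - w z)\<^sup>2) - 0) < e / (4 * K)" using LIMSEQ_D[OF l2_tendsD(3)[OF W] e] by blast
  have "(LINT z|M. (F m z - F n z)\<^sup>2) < e" if "m \<ge> N" "n \<ge> N" for m n
  proof -
   note L = l2_tendsD(1)[OF W] l2_tendsD(2)[OF W]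
   have "(LINT z|M. ((W m z - w z) + (w z - W n z))\<^sup>2) \<le> 2 * (LINT z|M. (W m z - w z)\<^sup>2) + 2 * (LINT z|M. (w z - W n z)\<^sup>2)"
    by (intro L2_integral_le_square_add L2_space_diff L)
   moreover have "(LINT z|M. (w z - W n z)\<^sup>2) = (LINT z|M. (W n z - w z)\<^sup>2)" by (simp only: power2_commute)
   ultimately have "(LINT z|M. (W m z - W n z)\<^sup>2) < 4 * (e / (4 * K))" using N[OF that(1)] N[OF that(2)] by simp
   then have "K * (LINT z|M. (W m z - W n z)\<^sup>2) < e" using K by (simp add: field_simps)
   then show ?thesis using le[of m n] by linarith
  qed
  then show "\<exists>N. \<forall>m\<ge>N. \<forall>n\<ge>N. (LINT z|M. (F m z - F n z)\<^sup>2) < e" by blast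
qed

lemma Gc_diff: "smooth p \<Longrightarrow> smooth q \<Longrightarrow> Gc (\<lambda>z. p z - q z) z = Gc p z - Gc q z" unfolding Gc_def
  by (simp add: pd_diff smooth_dx smooth_dt sum_subtractf algebra_simps)

text \<open>The weighted inequality beyond test functions, by cut-off, mollification and Fatou. Only
  first derivatives of \<open>p\<close> are involved, so \<open>p\<close> may be a first derivative
  of a function in the Sobolev space.\<close>

lemma weighted_L2:
  assumes p: "p \<in> L2w" and px: "\<And>i. px i \<in> L2w" and d: "\<And>i. is_weak_deriv [e_space i] p (px i)"
  shows "(\<lambda>z. norm (y z) * p z) \<in> L2w"
proof -
  obtain W where W: "W > 0" "\<And>p. test_function p \<Longrightarrow> (LINT z|dens \<rho>. (norm (y z) * p z)\<^sup>2) \<le> W * (sq p + (LINT z|dens \<rho>. grad_sq p z))"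
   using weighted_bound by blast
  note pl = L2_space_dens_L2_loc[OF p] L2_space_dens_L2_loc[OF px]
  define v where "v = (\<lambda>k z. cut k z * p z)"
  define vx where "vx = (\<lambda>k i z. cut k z * px i z + dx i (cut k) z * p z)"
  have mc: "cut k \<in> borel_measurable borel" "dx i (cut k) \<in> borel_measurable borel" for k and i :: 'n
   by (rule borel_measurable_continuous_onI, intro smooth_continuous smooth_dx smooth_cut)+
  have cb: "\<bar>cut k z\<bar> \<le> 1" for k and z :: "real \<times> (real ^ 'n)" using cut_bounds[of k z] by simp
  have vL: "v k \<in> L2w" "vx k i \<in> L2w" for k i unfolding v_def vx_def
   by (rule L2_space_bounded_mult[OF p, where K=1] L2_space_add[OF L2_space_bounded_mult[OF px, where K=1] L2_space_bounded_mult[OF p, where K=M0]];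
     (simp add: mc cb M0(2) split_paired_all del: split_paired_All)?)+
  \<comment> \<open>A bound, independent of \<open>k\<close>, for the norms of the cut-off function
    and its gradient.\<close>
  define J where "J = sq p + (\<Sum>i\<in>UNIV. 2 * sq (px i) + 2 * (M0\<^sup>2 * sq p))"
  have key: "(\<lambda>z. norm (y z) * v k z) \<in> L2w \<and> (LINT z|dens \<rho>. (norm (y z) * v k z)\<^sup>2) \<le> W * J" for k
  proof -
   obtain r where r: "\<And>z :: real \<times> (real ^ 'n). r < norm z \<Longrightarrow> cut k z = 0 \<and> (\<forall>b. pd b (cut k) z = 0)"
    using test_function_csupp_cut by blast
   have z: "v k z = 0" "vx k i z = 0" if "r < norm z" for z i using r[OF that] by (simp_all only: v_def vx_def mult_zero_left add_0)
   have cs: "csupp (v k)" using z(1) by (intro csuppI[of r])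
   have wd: "is_weak_deriv [e_space i] (v k) (vx k i)" for i unfolding v_def vx_def by (rule is_weak_deriv_mult[OF d pl smooth_cut e_space_Basis])
   have e: "set [e_space i :: real \<times> (real ^ 'n)] \<subseteq> Basis" for i by (simp add: e_space_Basis)
   note vloc = L2_space_dens_L2_loc[OF vL(1)] L2_space_dens_L2_loc[OF vL(2)]
   note int = csupp_L2_loc(2)[OF vloc(1) cs]
   have t: "test_function (conv (v k) (moll l))" for l by (rule test_function_conv[OF test_function_moll int cs])
   have px: "dx i (conv (v k) (moll l)) = conv (vx k i) (moll l)" for l i using is_weak_deriv_conv[OF wd int test_function_moll e] by simp
   \<comment> \<open>The weight is unbounded but continuous, which suffices because all
     mollifications share one compact support.\<close>
   have T1: "tendsw (\<lambda>l z. norm (y z) * conv (v k) (moll l) z) (\<lambda>z. norm (y z) * v k z)"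
    by (rule l2_tends_conv_moll_dens[OF vloc(1) z(1)]) (auto intro: continuous_on_norm continuous_y)
   have T2: "tendsw (\<lambda>l. conv (v k) (moll l)) (v k)"
    using l2_tends_conv_moll_dens[OF vloc(1) z(1) continuous_on_const[of _ 1]] by simp
   have T3: "tendsw (\<lambda>l. conv (vx k i) (moll l)) (vx k i)" for i
    using l2_tends_conv_moll_dens[OF vloc(2) z(2) continuous_on_const[of _ 1]] by simp
   have "(LINT z|dens \<rho>. grad_sq (conv (v k) (moll l)) z) = (\<Sum>i\<in>UNIV. LINT z|dens \<rho>. (conv (vx k i) (moll l) z)\<^sup>2)" for l
    unfolding grad_sq_def px[symmetric]
    by (rule Bochner_Integration.integral_sum) (rule integrable_dens_cc[OF cc_square[OF test_function_cc[OF test_function_dx[OF t]]]])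
   then have le: "(LINT z|dens \<rho>. (norm (y z) * conv (v k) (moll l) z)\<^sup>2) \<le> W * (sq (conv (v k) (moll l)) + (\<Sum>i\<in>UNIV. LINT z|dens \<rho>. (conv (vx k i) (moll l) z)\<^sup>2))" for l
    using W(2)[OF t, of l] by simp
   have "(LINT z|dens \<rho>. (norm (y z) * v k z)\<^sup>2) \<le> W * (sq (v k) + (\<Sum>i\<in>UNIV. LINT z|dens \<rho>. (vx k i z)\<^sup>2))"
   proof (rule LIMSEQ_le[OF l2_tends_integral_power2[OF T1]])
    show "(\<lambda>l. W * (sq (conv (v k) (moll l)) + (\<Sum>i\<in>UNIV. LINT z|dens \<rho>. (conv (vx k i) (moll l) z)\<^sup>2))) \<longlonglongrightarrow>
     W * (sq (v k) + (\<Sum>i\<in>UNIV. LINT z|dens \<rho>. (vx k i z)\<^sup>2))"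
     by (intro tendsto_mult tendsto_const tendsto_add tendsto_sum l2_tends_integral_power2 T2 T3)
   qed (use le in auto)
   also have "\<dots> \<le> W * J"
   proof -
    have "sq (v k) \<le> sq p"
     by (rule integral_mono[OF L2_spaceD(2)[OF vL(1)] L2_spaceD(2)[OF p]])
      (use cb in \<open>auto simp: v_def power_mult_distrib abs_square_le_1 intro!: mult_left_le_one_le\<close>)
    moreover have "sq (vx k i) \<le> 2 * sq (px i) + 2 * (M0\<^sup>2 * sq p)" for i
    proof -
     have "sq (vx k i) \<le> (LINT z|dens \<rho>. 2 * (px i z)\<^sup>2 + 2 * (M0\<^sup>2 * (p z)\<^sup>2))"
     proof (rule integral_mono[OF L2_spaceD(2)[OF vL(2)]])
      show "integrable (dens \<rho>) (\<lambda>z. 2 * (px i z)\<^sup>2 + 2 * (M0\<^sup>2 * (p z)\<^sup>2))" using L2_spaceD(2)[OF assms(2)] L2_spaceD(2)[OF p] by simp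
      fix z
      have "(a + b)\<^sup>2 \<le> 2 * a\<^sup>2 + 2 * b\<^sup>2" for a b :: real using sum_squares_bound[of a b] by (simp add: power2_sum)
      moreover have "(cut k z * px i z)\<^sup>2 \<le> (px i z)\<^sup>2"
       unfolding power_mult_distrib using cb[of k z] by (intro mult_left_le_one_le) (auto simp: abs_square_le_1)
      moreover have "(dx i (cut k) z * p z)\<^sup>2 \<le> M0\<^sup>2 * (p z)\<^sup>2"
       unfolding power_mult_distrib by (intro mult_right_mono power2_le_if_abs_le M0) simp
      ultimately show "(vx k i z)\<^sup>2 \<le> 2 * (px i z)\<^sup>2 + 2 * (M0\<^sup>2 * (p z)\<^sup>2)" unfolding vx_def by (smt (verit))
     qed
     also have "\<dots> = 2 * sq (px i) + 2 * (M0\<^sup>2 * sq p)"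
      using L2_spaceD(2)[OF assms(2)] L2_spaceD(2)[OF p] by simp
     finally show ?thesis .
    qed
    ultimately show ?thesis using W(1) unfolding J_def by (intro mult_left_mono add_mono sum_mono) auto
   qed
   finally show ?thesis using l2_tendsD(2)[OF T1] by blast
  qed
  show ?thesis
  proof (rule L2_Fatou(1)[OF conjunct1[OF key]])
   show "(\<lambda>z. norm (y z) * p z) \<in> borel_measurable (dens \<rho>)"
    using L2_spaceD(1)[OF p] borel_measurable_continuous_onI[OF continuous_on_norm[OF continuous_y]] by simp
   have "(\<lambda>k. norm (y z) * v k z) \<longlonglongrightarrow> norm (y z) * p z" for z
    unfolding v_def using tendsto_mult[OF tendsto_const[of "norm (y z)"] tendsto_mult[OF tendsto_cut[of z] tendsto_const[of "p z"]]] by simp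
   then show "AE z in dens \<rho>. (\<lambda>k. norm (y z) * v k z) \<longlonglongrightarrow> norm (y z) * p z" by simp
   show "\<forall>\<^sub>F k in sequentially. (LINT z|dens \<rho>. (norm (y z) * v k z)\<^sup>2) \<le> W * J" using key by simp
  qed
qed

text \<open>The drift grows at most linearly in |y|, and one power of |y| is paid for by one
  derivative of \<open>v\<close>.\<close>

lemma drift_L2:
  assumes v: "v \<in> L2w" "\<And>j. vx j \<in> L2w" "\<And>j. is_weak_deriv [e_space j] v (vx j)"
  shows "(\<lambda>z. drift z $ i * v z) \<in> L2w"
proof -
  obtain D where D: "D > 0" "\<And>z i. \<bar>drift z $ i\<bar> \<le> D * (1 + norm (y z))" using ex_drift_bound by blast
  have ab: "(\<lambda>z. \<bar>h z\<bar>) \<in> L2w" if "h \<in> L2w" for h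
   by (rule L2_space_bound[OF that]) (use L2_spaceD(1)[OF that] in auto)
  show ?thesis
  proof (rule L2_space_bound)
   show "(\<lambda>z. D * \<bar>norm (y z) * v z\<bar> + D * \<bar>v z\<bar>) \<in> L2w" by (intro L2_space_add L2_space_cmult ab weighted_L2[OF v] v)
   show "(\<lambda>z. drift z $ i * v z) \<in> borel_measurable (dens \<rho>)"
    using L2_spaceD(1)[OF v(1)] borel_measurable_continuous_onI[OF continuous_entries(8)] by simp
   have "\<bar>drift z $ i * v z\<bar> \<le> D * \<bar>norm (y z) * v z\<bar> + D * \<bar>v z\<bar>" for z
    using mult_right_mono[OF D(2)[of z i], of "\<bar>v z\<bar>"] by (simp add: abs_mult algebra_simps)
   then show "AE z in dens \<rho>. \<bar>drift z $ i * v z\<bar> \<le> \<bar>D * \<bar>norm (y z) * v z\<bar> + D * \<bar>v z\<bar>\<bar>" by (intro AE_I2 order_trans[OF _ abs_ge_self])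
  qed
qed

lemma C_L2: "v \<in> L2w \<Longrightarrow> (\<lambda>z. C (fst z) $ i $ j * v z) \<in> L2w"
  by (rule L2_space_bounded_mult[OF _ _ E0(2)]) (assumption, simp only: measurable_dens, rule borel_measurable_continuous_onI[OF continuous_entries(1)])

text \<open>In the drift term the function is a first derivative of \<open>u\<close>; its own
  gradient consists of second derivatives, so the weighted inequality applies.\<close>

lemma H_space_Gop:
  assumes "u \<in> H_space 1 2 (dens \<rho>)"
  shows "u \<in> H_loc 1 2" "u \<in> L2w" "Gop A B f u \<in> L2w"
proof -
  obtain ut ux uxx where w: "weak_derivs u ut ux uxx" and L: "u \<in> L2w" "ut \<in> L2w"
   "\<And>i. ux i \<in> L2w" "\<And>i j. uxx i j \<in> L2w" using assms unfolding H_space_iff by blast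
  show "u \<in> H_loc 1 2" by (rule weak_derivs_H_loc[OF w])
  show "u \<in> L2w" by (rule L)
  have "Gw ut ux uxx \<in> L2w" unfolding Gw_def[abs_def]
   by (intro L2_space_add L2_space_cmult L2_space_sum C_L2 drift_L2[OF L(3) L(4) weak_derivsD(7)[OF w]] L)
  then show "Gop A B f u \<in> L2w" by (rule L2_space_AE_cong) (use Gop_AE[OF w] in auto)
qed

text \<open>The a priori estimate yields limits of all spatial derivatives. The time derivative is
  not estimated but solved for in the limit equation, and is square integrable because every other
  term is.\<close>

lemma closure_test_H_space:
  assumes "graph_approx (dens \<rho>) test_graph u w" shows "u \<in> H_space 1 2 (dens \<rho>)"
proof -
  obtain p q where pq: "\<And>k. (p k, q k) \<in> test_graph" and U: "tendsw p u" and W: "tendsw q w"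
   using graph_approx_seq[OF assms] by blast
  have t: "test_function (p k)" and q: "q k = Gc (p k)" for k using pq[of k] by (auto simp: test_graph_def)
  note s = test_function_smooth[OF t]
  obtain K where K: "K > 0" "\<And>\<phi> i. test_function \<phi> \<Longrightarrow> sq (dx i \<phi>) \<le> K * sq (Gc \<phi>)"
   "\<And>\<phi> i j. test_function \<phi> \<Longrightarrow> sq (dx j (dx i \<phi>)) \<le> K * sq (Gc \<phi>)"
   using a_priori by blast
  have d: "test_function (\<lambda>z. p m z - p n z)" for m n by (rule test_function_diff[OF t t])
  have G: "Gc (\<lambda>z. p m z - p n z) z = q m z - q n z" for m n z unfolding q by (rule Gc_diff[OF s s])
  have e1: "dx i (\<lambda>z. p m z - p n z) = (\<lambda>z. dx i (p m) z - dx i (p n) z)" for i m n by (rule pd_diff[OF s s])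
  have e2: "dx j (dx i (\<lambda>z. p m z - p n z)) = (\<lambda>z. dx j (dx i (p m)) z - dx j (dx i (p n)) z)" for i j m n
   unfolding e1 by (rule pd_diff[OF smooth_dx[OF s] smooth_dx[OF s]])
  have ccp: "cc (dx i (p k))" "cc (dx j (dx i (p k)))" "cc (q k)" for i j k unfolding q by (intro test_function_cc test_function_dx t cc_Gc)+
  have "\<exists>f. tendsw (\<lambda>k. dx i (p k)) f" for i
   by (rule l2_Cauchy_if_le[OF W cc_L2_dens[OF ccp(1)] _ K(1)]) (use K(2)[OF d] in \<open>simp only: G e1\<close>)
  then obtain ux where ux: "\<And>i. tendsw (\<lambda>k. dx i (p k)) (ux i)" by metis
  have "\<exists>f. tendsw (\<lambda>k. dx j (dx i (p k))) f" for i j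
   by (rule l2_Cauchy_if_le[OF W cc_L2_dens[OF ccp(2)] _ K(1)]) (use K(3)[OF d] in \<open>simp only: G e2\<close>)
  then have "\<forall>j. \<exists>f. tendsw (\<lambda>k. dx j (dx i (p k))) f" for i by (rule allI)
  then have "\<forall>i. \<exists>F. \<forall>j. tendsw (\<lambda>k. dx j (dx i (p k))) (F j)" by (rule allI[OF choice])
  from choice[OF this] obtain uxx where "\<forall>i j. tendsw (\<lambda>k. dx j (dx i (p k))) (uxx i j)" by (elim exE) (rule that)
  then have uxx: "tendsw (\<lambda>k. dx j (dx i (p k))) (uxx i j)" for i j by (elim allE)
  note L = l2_tendsD(2)[OF U] l2_tendsD(2)[OF W] l2_tendsD(2)[OF ux] l2_tendsD(2)[OF uxx]
  have e: "set [e_space i :: real \<times> (real ^ 'n)] \<subseteq> Basis" for i by (simp add: e_space_Basis)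
  have d1: "is_weak_deriv [e_space i] u (ux i)" for i by (rule is_weak_deriv_limit[OF U ux is_weak_deriv_pd[OF s e_space_Basis] e])
  have d2: "is_weak_deriv [e_space j] (ux i) (uxx i j)" for i j
   by (rule is_weak_deriv_limit[OF ux uxx is_weak_deriv_pd[OF smooth_dx[OF s] e_space_Basis] e])
  \<comment> \<open>The equation solved for the time derivative.\<close>
  define R where "R = (\<lambda>w ux uxx z. w z + (- 1/2) * (\<Sum>i\<in>UNIV. \<Sum>j\<in>UNIV. C (fst z) $ i $ j * uxx i j z) + (- 1) * (\<Sum>i\<in>UNIV. drift z $ i * ux i z))"
  have Rp: "dt (p k) = R (q k) (\<lambda>i. dx i (p k)) (\<lambda>i j. dx j (dx i (p k)))" for k by (simp add: R_def q Gc_def fun_eq_iff)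
  have RL: "R w ux uxx \<in> L2w" unfolding R_def
   by (intro L2_space_add L2_space_cmult L2_space_sum C_L2 drift_L2[OF L(3) L(4) d2] L)
  have "is_weak_deriv [e_time] u (R w ux uxx)" unfolding is_weak_deriv_def
  proof (intro conjI allI impI)
   show "u \<in> L1_loc" "R w ux uxx \<in> L1_loc" using L(1) RL by (auto intro: L2_loc_imp_L1_loc L2_space_dens_L2_loc)
   fix \<phi> :: "real \<times> (real ^ 'n) \<Rightarrow> real" assume \<phi>: "test_function \<phi>"
   note cp = test_function_cc[OF \<phi>]
   note cC = cc_mult_right[OF cp continuous_entries(1)] and cD = cc_mult_right[OF cp continuous_entries(8)]
   let ?J = "\<lambda>w ux uxx. (LINT z|lborel. w z * \<phi> z) + (- 1/2) * (\<Sum>i\<in>UNIV. \<Sum>j\<in>UNIV. LINT z|lborel. uxx i j z * (C (fst z) $ i $ j * \<phi> z))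
    + (- 1) * (\<Sum>i\<in>UNIV. LINT z|lborel. ux i z * (drift z $ i * \<phi> z))"
   have J: "(LINT z|lborel. R w ux uxx z * \<phi> z) = ?J w ux uxx"
    if "w \<in> L2_loc" "\<And>i. ux i \<in> L2_loc" "\<And>i j. uxx i j \<in> L2_loc" for w ux uxx
   proof -
    note i = L1_loc_integrable_cc[OF L2_loc_imp_L1_loc[OF that(1)] cp] L1_loc_integrable_cc[OF L2_loc_imp_L1_loc[OF that(3)] cC]
     L1_loc_integrable_cc[OF L2_loc_imp_L1_loc[OF that(2)] cD]
    have "R w ux uxx z * \<phi> z = w z * \<phi> z + (- 1/2) * (\<Sum>i\<in>UNIV. \<Sum>j\<in>UNIV. uxx i j z * (C (fst z) $ i $ j * \<phi> z))
     + (- 1) * (\<Sum>i\<in>UNIV. ux i z * (drift z $ i * \<phi> z))" for z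
     unfolding R_def distrib_right mult.assoc sum_distrib_right by (simp only: mult_ac)
    then show ?thesis using i by (simp add: Bochner_Integration.integral_sum)
   qed
   have Lp: "dx i (p k) \<in> L2_loc" "dx j (dx i (p k)) \<in> L2_loc" "q k \<in> L2_loc" for i j k
    using ccp by (auto intro: L2_loc_continuous simp: cc_def)
   have "(LINT z|lborel. p k z * dt \<phi> z) = - (LINT z|lborel. dt (p k) z * \<phi> z)" for k
    using is_weak_deriv_pd[OF s e_time_Basis, of k] \<phi> by (simp add: is_weak_deriv_def)
   then have "(LINT z|lborel. p k z * dt \<phi> z) = - ?J (q k) (\<lambda>i. dx i (p k)) (\<lambda>i j. dx j (dx i (p k)))" for k
    unfolding Rp J[OF Lp(3) Lp(1,2)] .
   moreover have "(\<lambda>k. - ?J (q k) (\<lambda>i. dx i (p k)) (\<lambda>i j. dx j (dx i (p k)))) \<longlonglongrightarrow> - ?J w ux uxx"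
    by (intro tendsto_minus tendsto_add tendsto_mult_left tendsto_sum l2_tends_dens_integral_cc[OF W cp] l2_tends_dens_integral_cc[OF uxx cC]
      l2_tends_dens_integral_cc[OF ux cD])
   moreover have "(\<lambda>k. LINT z|lborel. p k z * dt \<phi> z) \<longlonglongrightarrow> (LINT z|lborel. u z * dt \<phi> z)"
    by (rule l2_tends_dens_integral_cc[OF U test_function_cc[OF test_function_dt[OF \<phi>]]])
   ultimately have "(LINT z|lborel. u z * dt \<phi> z) = - ?J w ux uxx" by (simp only:) (rule LIMSEQ_unique)
   then show "(LINT z|lborel. u z * iter_deriv [e_time] \<phi> z) = (- 1) ^ length [e_time :: real \<times> (real ^ 'n)] * (LINT z|lborel. R w ux uxx z * \<phi> z)"
    using J[OF L(2,3,4)[THEN L2_space_dens_L2_loc]] by simp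
  qed
  then have "weak_derivs u (R w ux uxx) ux uxx" using L(1,3,4)[THEN L2_space_dens_L2_loc] RL[THEN L2_space_dens_L2_loc] d1 d2 by (simp add: weak_derivs_def)
  then show ?thesis unfolding H_space_iff using L RL by blast
qed

lemma domain_graph_approx:
  assumes "u \<in> H_loc 1 2" "u \<in> L2w" "Gop A B f u \<in> L2w"
  shows "graph_approx (dens \<rho>) test_graph u (Gop A B f u)"
proof -
  obtain ut ux uxx where w: "weak_derivs u ut ux uxx" using H_loc_weak_derivs[OF assms(1)] by blast
  have ae: "AE z in dens \<rho>. Gw ut ux uxx z = Gop A B f u z" using Gop_AE(1)[OF w] by eventually_elim simp
  have "Gw ut ux uxx \<in> L2w"
   by (rule L2_space_AE_cong[OF assms(3) _ ae]) (use Gw_L2_loc[OF w] in \<open>simp add: L2_loc_def\<close>)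
  from graph_approx_test[OF w assms(2) this] show ?thesis by (rule graph_approx_AE_cong) (use Gop_AE[OF w] in auto)
qed

end

section \<open>Polynomial growth on time strips; regularity of D(G0)\<close>

lemma integrable_gaussian:
  fixes c :: real
  assumes "c > 0" shows "integrable lborel (\<lambda>z::'a::euclidean_space. exp (- c * (norm z)\<^sup>2))"
proof (rule integrableI_nonneg)
  define s where "s = sqrt (1 / (2 * c))"
  have s: "s > 0" "2 * s\<^sup>2 = 1 / c" using assms by (auto simp: s_def)
  have e: "exp (- c * x\<^sup>2) = sqrt (2 * pi * s\<^sup>2) * normal_density 0 s x" for x :: real using s assms by (simp add: normal_density_def)
  have "integrable lborel (\<lambda>x::real. exp (- c * x\<^sup>2))" unfolding e using s by (intro integrable_mult_right integrable_normal_density)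
  then have 1: "(\<integral>\<^sup>+x. ennreal (exp (- c * x\<^sup>2)) \<partial>(lborel :: real measure)) < \<infinity>"
   by (subst nn_integral_eq_integral) auto
  have "ennreal (exp (- c * (norm z)\<^sup>2)) = (\<Prod>b\<in>Basis. ennreal (exp (- c * (z \<bullet> b)\<^sup>2)))" for z :: 'a
  proof -
   have "(norm z)\<^sup>2 = (\<Sum>b\<in>Basis. (z \<bullet> b)\<^sup>2)" unfolding power2_norm_eq_inner by (subst euclidean_inner) (simp add: power2_eq_square)
   then show ?thesis by (simp add: sum_distrib_left sum_negf[symmetric] exp_sum prod_ennreal)
  qed
  then have "(\<integral>\<^sup>+z. ennreal (exp (- c * (norm z)\<^sup>2)) \<partial>(lborel :: 'a measure)) = (\<Prod>b\<in>(Basis :: 'a set). (\<integral>\<^sup>+x. ennreal (exp (- c * x\<^sup>2)) \<partial>(lborel :: real measure)))"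
   by (subst nn_integral_lborel_prod[symmetric]) auto
  also have "\<dots> < \<infinity>" using 1 by (simp add: less_top[symmetric] power_eq_top_ennreal)
  finally show "(\<integral>\<^sup>+z. ennreal (exp (- c * (norm z)\<^sup>2)) \<partial>(lborel :: 'a measure)) < \<infinity>" .
qed auto

lemma power_le_gaussian:
  fixes c :: real
  assumes "c > 0" shows "\<exists>K>0. \<forall>s\<ge>0. (1 + s) ^ m \<le> K * exp (c * s\<^sup>2)"
proof (intro exI conjI allI impI)
  \<comment> \<open>One term of the exponential series bounds the power by m! exp(1+s), and
    completing the square gives s \<le> c s^2 + 1/(4c).\<close>
  show "fact m * exp (1 + 1 / (4 * c)) > (0::real)" by simp
  fix s :: real assume s: "s \<ge> 0"
  have "(1 + s) ^ m / fact m \<le> exp (1 + s)"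
   using sum_le_suminf[OF summable_exp[of "1 + s"], of "{m}"] s by (simp add: exp_def divide_inverse mult.commute)
  also have "\<dots> \<le> exp (1 + 1 / (4 * c) + c * s\<^sup>2)"
  proof -
   have "0 \<le> c * (s - 1 / (2 * c))\<^sup>2" using assms by simp
   also have "\<dots> = c * s\<^sup>2 - s + 1 / (4 * c)" using assms by (simp add: power2_eq_square field_simps)
   finally show ?thesis by simp
  qed
  finally show "(1 + s) ^ m \<le> fact m * exp (1 + 1 / (4 * c)) * exp (c * s\<^sup>2)" by (simp add: exp_add field_simps)
qed

text \<open>The growth allowed in D(G0): compact in time, polynomial in space. Compactness in time
  is essential, as \<nu> gives finite measure to bounded strips only.\<close>

definition strip_weight :: "real \<Rightarrow> nat \<Rightarrow> real \<times> (real ^ 'n) \<Rightarrow> real" where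
  "strip_weight T m z = indicator {-T..T} (fst z) * (1 + norm (snd z)) ^ m"

text \<open>A domination uniform along the sequence, ready for dominated convergence; a constant
  sequence expresses growth of a single function.\<close>

definition tempered :: "(nat \<Rightarrow> real \<times> (real ^ 'n) \<Rightarrow> real) \<Rightarrow> bool" where
  "tempered F \<longleftrightarrow> (\<exists>T m K. K \<ge> 0 \<and> (\<forall>k z. \<bar>F k z\<bar> \<le> K * strip_weight T m z))"

lemma strip_weight_nonneg: "0 \<le> strip_weight T m z" by (simp add: strip_weight_def)

lemma strip_weight_mono: "T \<le> T' \<Longrightarrow> m \<le> m' \<Longrightarrow> strip_weight T m z \<le> strip_weight T' m' z"
  unfolding strip_weight_def by (intro mult_mono power_increasing) (auto simp: indicator_def)

lemma temperedI: "(\<And>k z. \<bar>F k z\<bar> \<le> K * strip_weight T m z) \<Longrightarrow> K \<ge> 0 \<Longrightarrow> tempered F"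
  unfolding tempered_def by blast

lemma tempered_add:
  fixes F G :: "nat \<Rightarrow> real \<times> (real ^ 'n) \<Rightarrow> real"
  assumes "tempered F" "tempered G" shows "tempered (\<lambda>k z. F k z + G k z)"
proof -
  obtain T m K where F: "K \<ge> 0" "\<And>k z. \<bar>F k z\<bar> \<le> K * strip_weight T m z" using assms unfolding tempered_def by blast
  obtain S p L where G: "L \<ge> 0" "\<And>k z. \<bar>G k z\<bar> \<le> L * strip_weight S p z" using assms unfolding tempered_def by blast
  show ?thesis
  proof (rule temperedI)
   fix k and z :: "real \<times> (real ^ 'n)"
   have "K * strip_weight T m z \<le> K * strip_weight (max T S) (max m p) z" "L * strip_weight S p z \<le> L * strip_weight (max T S) (max m p) z"
    using F G by (auto intro!: mult_left_mono strip_weight_mono)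
   then show "\<bar>F k z + G k z\<bar> \<le> (K + L) * strip_weight (max T S) (max m p) z" using F(2)[of k z] G(2)[of k z] unfolding distrib_right by linarith
  qed (use F G in auto)
qed

lemma tempered_zero: "tempered (\<lambda>k z. 0)" by (rule temperedI[of _ 0]) auto

lemma tempered_sum: "finite I \<Longrightarrow> (\<And>i. i \<in> I \<Longrightarrow> tempered (F i)) \<Longrightarrow> tempered (\<lambda>k z. \<Sum>i\<in>I. F i k z)"
  by (induction I rule: finite_induct) (auto intro: tempered_add tempered_zero)

lemma tempered_mult:
  fixes F :: "nat \<Rightarrow> real \<times> (real ^ 'n) \<Rightarrow> real"
  assumes F: "tempered F" and c: "\<And>z. \<bar>c z\<bar> \<le> L * (1 + norm (snd z)) ^ p" "L \<ge> 0"
  shows "tempered (\<lambda>k z. c z * F k z)"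
proof -
  obtain T m K where F: "K \<ge> 0" "\<And>k z. \<bar>F k z\<bar> \<le> K * strip_weight T m z" using F unfolding tempered_def by blast
  show ?thesis
  proof (rule temperedI)
   fix k and z :: "real \<times> (real ^ 'n)"
   have "\<bar>c z * F k z\<bar> \<le> (L * (1 + norm (snd z)) ^ p) * (K * strip_weight T m z)"
    unfolding abs_mult using c F by (intro mult_mono) (auto simp: strip_weight_nonneg)
   then show "\<bar>c z * F k z\<bar> \<le> (L * K) * strip_weight T (p + m) z" by (simp add: strip_weight_def power_add mult_ac)
  qed (use F c in auto)
qed

lemma tempered_cmult: "tempered F \<Longrightarrow> tempered (\<lambda>k z. c * F k z)" by (rule tempered_mult[of _ _ "\<bar>c\<bar>" 0]) auto

lemma borel_measurable_strip_weight: "strip_weight T m \<in> borel_measurable borel"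
proof -
  have "(\<lambda>z :: real \<times> (real ^ 'n). indicator {-T..T} (fst z) :: real) \<in> borel_measurable borel"
   by (rule measurable_compose[OF borel_measurable_continuous_onI[OF continuous_on_fst[OF continuous_on_id]]]) simp
  moreover have "(\<lambda>z :: real \<times> (real ^ 'n). (1 + norm (snd z)) ^ m) \<in> borel_measurable borel"
   by (intro borel_measurable_continuous_onI continuous_intros)
  ultimately show ?thesis unfolding strip_weight_def[abs_def] by (rule borel_measurable_times)
qed

text \<open>One continuous derivative in time and two in space, all of polynomial growth on a strip:
  the regularity shared by D(G0) and by spatial convolutions of test functions with the kernels
  \<open>nkern k\<close>.\<close>

definition classical ::
   "(real \<times> (real ^ 'n) \<Rightarrow> real) \<Rightarrow> (real \<times> (real ^ 'n) \<Rightarrow> real) \<Rightarrow> ('n \<Rightarrow> real \<times> (real ^ 'n) \<Rightarrow> real) \<Rightarrow>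
   ('n \<Rightarrow> 'n \<Rightarrow> real \<times> (real ^ 'n) \<Rightarrow> real) \<Rightarrow> bool" where
  "classical u ut ux uxx \<longleftrightarrow>
   (continuous_on UNIV u \<and> continuous_on UNIV ut \<and> (\<forall>i. continuous_on UNIV (ux i)) \<and> (\<forall>i j. continuous_on UNIV (uxx i j))) \<and>
   (dirder e_time u ut \<and> (\<forall>i. dirder (e_space i) u (ux i)) \<and> (\<forall>i j. dirder (e_space j) (ux i) (uxx i j))) \<and>
   (tempered (\<lambda>_. u) \<and> tempered (\<lambda>_. ut) \<and> (\<forall>i. tempered (\<lambda>_. ux i)) \<and> (\<forall>i j. tempered (\<lambda>_. uxx i j)))"

lemma classical_zero: "classical (\<lambda>z. 0) (\<lambda>z. 0) (\<lambda>i z. 0) (\<lambda>i j z. 0)"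
  by (simp add: classical_def dirder_def tempered_zero)

lemma classical_add:
  assumes "classical u ut ux uxx" "classical v vt vx vxx"
  shows "classical (\<lambda>z. c * u z + v z) (\<lambda>z. c * ut z + vt z) (\<lambda>i z. c * ux i z + vx i z) (\<lambda>i j z. c * uxx i j z + vxx i j z)"
  using assms unfolding classical_def
  by (auto intro!: continuous_on_add continuous_on_mult continuous_on_const dirder_add dirder_cmult tempered_add tempered_cmult)

lemma classical_weak_derivs: "classical u ut ux uxx \<Longrightarrow> weak_derivs u ut ux uxx" unfolding weak_derivs_def classical_def
  by (intro conjI allI L2_loc_continuous is_weak_deriv_dirder e_time_Basis e_space_Basis) blast+

lemma tempered_fst:
  assumes "cc \<Phi>" shows "tempered (\<lambda>_ z. \<Phi> (fst z))"
proof -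
  obtain K where K: "K > 0" "\<And>t. \<bar>\<Phi> t\<bar> \<le> K" using cc_bounded[OF assms] by blast
  obtain T where T: "\<And>t. T < norm t \<Longrightarrow> \<Phi> t = 0" using assms by (auto simp: cc_def csupp_def)
  have "\<bar>\<Phi> t\<bar> \<le> K * indicator {-T..T} t" for t using K(2)[of t] T[of t] by (cases "t \<in> {-T..T}") auto
  then show ?thesis by (intro temperedI[where K=K and T=T and m=0]) (use K(1) in \<open>auto simp: strip_weight_def\<close>)
qed

text \<open>The phase \<theta> treats real part (0) and imaginary part (\<pi>/2) at once. Growth in
  \<open>x\<close> arises only in the time derivative, where the inner product of \<open>x\<close>
  with h' is a factor.\<close>

lemma classical_generator:
  fixes h :: "real \<Rightarrow> real ^ 'n"
  assumes \<Phi>: "\<And>t. (\<Phi> has_real_derivative \<Phi>' t) (at t)" "continuous_on UNIV \<Phi>'" "csupp \<Phi>"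
   and h: "\<And>t. (h has_vector_derivative h' t) (at t)" "continuous_on UNIV h'" "\<And>t. norm (h t) \<le> H" "\<And>t. norm (h' t) \<le> H"
  shows "\<exists>ut ux uxx. classical (\<lambda>z. \<Phi> (fst z) * cos (snd z \<bullet> h (fst z) - \<theta>)) ut ux uxx"
proof -
  have c: "continuous_on UNIV \<Phi>" by (rule continuous_at_imp_continuous_on, rule ballI, rule DERIV_isCont[OF \<Phi>(1)])
  have d1: "dirder (1::real) \<Phi> \<Phi>'" using \<Phi>(1) DERIV_shift[of \<Phi> _ 0] unfolding dirder_def by (simp add: add.commute)
  have ccs: "cc \<Phi>" "cc \<Phi>'" using c \<Phi> dirder_csupp[OF d1] by (auto simp: cc_def)
  note t1 = tempered_fst[OF ccs(1)] and t2 = tempered_fst[OF ccs(2)]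
  let ?a = "\<lambda>z :: real \<times> (real ^ 'n). snd z \<bullet> h (fst z) - \<theta>"
  define ut where "ut = (\<lambda>z. cos (?a z) * \<Phi>' (fst z) + - (sin (?a z) * (snd z \<bullet> h' (fst z))) * \<Phi> (fst z))"
  define ux where "ux = (\<lambda>i z. - (sin (?a z) * h (fst z) $ i) * \<Phi> (fst z))"
  define uxx where "uxx = (\<lambda>i j z. - (cos (?a z) * (h (fst z) $ i * h (fst z) $ j)) * \<Phi> (fst z))"
  have H: "H \<ge> 0" using h(3)[of 0] norm_ge_zero order_trans by blast
  have hc: "continuous_on UNIV h" by (rule continuous_at_imp_continuous_on, rule ballI, rule has_vector_derivative_continuous[OF h(1)])
  have cf: "continuous_on UNIV (\<lambda>z :: real \<times> (real ^ 'n). k (fst z))" if "continuous_on UNIV k" for k :: "real \<Rightarrow> 'z::topological_space"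
   by (rule continuous_on_compose2[OF that continuous_on_fst[OF continuous_on_id]]) simp
  note ci = continuous_on_mult continuous_on_add continuous_on_minus continuous_on_cos continuous_on_sin continuous_on_inner continuous_on_diff
   continuous_on_snd continuous_on_id continuous_on_const cf hc c \<Phi>(2) h(2) bounded_linear.continuous_on[OF bounded_linear_vec_nth]
  have "dirder e_time (\<lambda>z. \<Phi> (fst z) * cos (?a z)) ut"
  proof (rule dirder_time_fixed_space)
   fix t and x :: "real ^ 'n"
   have hx: "((\<lambda>t. x \<bullet> h t) has_real_derivative x \<bullet> h' t) (at t)" unfolding has_real_derivative_iff_has_vector_derivative
    by (rule bounded_linear.has_vector_derivative[OF bounded_linear_inner_right h(1)])
   show "((\<lambda>t. \<Phi> (fst (t, x)) * cos (snd (t, x) \<bullet> h (fst (t, x)) - \<theta>)) has_real_derivative ut (t, x)) (at t)"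
    unfolding ut_def by (auto intro!: derivative_eq_intros \<Phi>(1) hx simp: algebra_simps)
  qed
  moreover have "dirder (e_space i) (\<lambda>z. \<Phi> (fst z) * cos (?a z)) (ux i)" for i
   unfolding dirder_def ux_def by (auto intro!: derivative_eq_intros simp: inner_add_left inner_axis' algebra_simps)
  moreover have "dirder (e_space j) (ux i) (uxx i j)" for i j
   unfolding dirder_def ux_def uxx_def by (auto intro!: derivative_eq_intros simp: inner_add_left inner_axis' algebra_simps)
  moreover have "continuous_on UNIV (\<lambda>z. \<Phi> (fst z) * cos (?a z))" "continuous_on UNIV ut" "continuous_on UNIV (ux i)" "continuous_on UNIV (uxx i j)" for i j
   unfolding ut_def ux_def uxx_def by (intro ci)+
  moreover have "tempered (\<lambda>_ z. cos (?a z) * \<Phi> (fst z))" by (rule tempered_mult[OF t1, where L=1 and p=0]) auto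
  then have "tempered (\<lambda>_ z. \<Phi> (fst z) * cos (?a z))" by (simp only: mult.commute)
  moreover have "tempered (\<lambda>_. ut)" unfolding ut_def
  proof (rule tempered_add[OF tempered_mult[OF t2, where L=1 and p=0] tempered_mult[OF t1, where L=H and p=1]])
   fix z :: "real \<times> (real ^ 'n)"
   have "\<bar>sin (?a z)\<bar> * \<bar>snd z \<bullet> h' (fst z)\<bar> \<le> 1 * (norm (snd z) * H)"
    by (intro mult_mono order_trans[OF Cauchy_Schwarz_ineq2] mult_left_mono h) auto
   then show "\<bar>- (sin (?a z) * (snd z \<bullet> h' (fst z)))\<bar> \<le> H * (1 + norm (snd z)) ^ 1" using H by (simp add: abs_mult algebra_simps)
  qed (use H in auto)
  moreover have hi: "\<bar>h t $ i\<bar> \<le> H" for t i by (rule order_trans[OF component_le_norm_cart h(3)])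
  have "tempered (\<lambda>_. ux i)" for i unfolding ux_def
  proof (rule tempered_mult[OF t1, where L=H and p=0])
   fix z :: "real \<times> (real ^ 'n)"
   have "\<bar>sin (?a z)\<bar> * \<bar>h (fst z) $ i\<bar> \<le> 1 * H" by (intro mult_mono hi) auto
   then show "\<bar>- (sin (?a z) * h (fst z) $ i)\<bar> \<le> H * (1 + norm (snd z)) ^ 0" by (simp add: abs_mult)
  qed (use H in auto)
  moreover have "tempered (\<lambda>_. uxx i j)" for i j unfolding uxx_def
  proof (rule tempered_mult[OF t1, where L="H * H" and p=0])
   fix z :: "real \<times> (real ^ 'n)"
   have "\<bar>cos (?a z)\<bar> * (\<bar>h (fst z) $ i\<bar> * \<bar>h (fst z) $ j\<bar>) \<le> 1 * (H * H)" using H by (intro mult_mono hi) auto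
   then show "\<bar>- (cos (?a z) * (h (fst z) $ i * h (fst z) $ j))\<bar> \<le> H * H * (1 + norm (snd z)) ^ 0" by (simp add: abs_mult)
  qed (use H in auto)
  ultimately have "classical (\<lambda>z. \<Phi> (fst z) * cos (?a z)) ut ux uxx" unfolding classical_def by blast
  then show ?thesis by blast
qed

lemma DG0_generators_classical:
  fixes u :: "real \<times> (real ^ 'n) \<Rightarrow> real"
  assumes "u \<in> DG0_generators" shows "\<exists>ut ux uxx. classical u ut ux uxx"
proof -
  obtain \<Phi> and h :: "real \<Rightarrow> real ^ 'n" where h: "\<Phi> C1_differentiable_on UNIV" "compact (closure {t. \<Phi> t \<noteq> 0})" "h C1_differentiable_on UNIV"
    "bounded (range h)" "bounded (range (\<lambda>t. vector_derivative h (at t)))"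
   and u: "u = (\<lambda>(t, x). Re (complex_of_real (\<Phi> t) * exp (\<i> * complex_of_real (x \<bullet> h t)))) \<or>
    u = (\<lambda>(t, x). Im (complex_of_real (\<Phi> t) * exp (\<i> * complex_of_real (x \<bullet> h t))))"
   using assms unfolding DG0_generators_def by blast
  have "\<exists>\<theta>. u = (\<lambda>z. \<Phi> (fst z) * cos (snd z \<bullet> h (fst z) - \<theta>))" using u
  proof
   assume "u = (\<lambda>(t, x). Re (complex_of_real (\<Phi> t) * exp (\<i> * complex_of_real (x \<bullet> h t))))"
   then show ?thesis by (intro exI[of _ 0]) (auto simp: exp_eq_polar cis.simps)
  next
   assume "u = (\<lambda>(t, x). Im (complex_of_real (\<Phi> t) * exp (\<i> * complex_of_real (x \<bullet> h t))))"
   then show ?thesis by (intro exI[of _ "pi / 2"]) (auto simp: exp_eq_polar cis.simps cos_diff)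
  qed
  then obtain \<theta> where \<theta>: "u = (\<lambda>z. \<Phi> (fst z) * cos (snd z \<bullet> h (fst z) - \<theta>))" by blast
  obtain \<Phi>' where P: "\<And>t. (\<Phi> has_vector_derivative \<Phi>' t) (at t)" "continuous_on UNIV \<Phi>'" using h(1) unfolding C1_differentiable_on_def by blast
  obtain h' where h': "\<And>t. (h has_vector_derivative h' t) (at t)" "continuous_on UNIV h'" using h(3) unfolding C1_differentiable_on_def by blast
  obtain H1 where H1: "\<And>t. norm (h t) \<le> H1" using h(4) unfolding bounded_iff by blast
  obtain H2 where H2: "\<And>t. norm (h' t) \<le> H2" using h(5) unfolding bounded_iff vector_derivative_at[OF h'(1)] by blast
  have "csupp \<Phi>" using h(2) compact_support_iff_csupp[of \<Phi>] by blast
  then show ?thesis unfolding \<theta> using H1 H2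
   by (intro classical_generator[OF P(1)[folded has_real_derivative_iff_has_vector_derivative] P(2) _ h', where H="max H1 H2"]) (auto simp: le_max_iff_disj)
qed

lemma DG0_classical:
  assumes "u \<in> DG0" shows "\<exists>ut ux uxx. classical u ut ux uxx"
proof -
  obtain S c where S: "finite S" "S \<subseteq> DG0_generators" "u = (\<lambda>z. \<Sum>\<psi>\<in>S. c \<psi> * \<psi> z)" using assms unfolding DG0_def by blast
  have "\<exists>ut ux uxx. classical (\<lambda>z. \<Sum>\<psi>\<in>S. c \<psi> * \<psi> z) ut ux uxx" using S(1,2)
  proof (induction S rule: finite_induct)
   case empty then show ?case using classical_zero by auto
  next
   case (insert \<psi> S)
   then obtain vt vx vxx where "classical (\<lambda>z. \<Sum>\<psi>\<in>S. c \<psi> * \<psi> z) vt vx vxx" by blast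
   moreover obtain ut ux uxx where "classical \<psi> ut ux uxx" using DG0_generators_classical insert.prems by blast
   ultimately show ?case using classical_add[of \<psi> ut ux uxx "\<lambda>z. \<Sum>\<psi>\<in>S. c \<psi> * \<psi> z" vt vx vxx "c \<psi>"] insert.hyps by auto
  qed
  then show ?thesis unfolding S(3) .
qed

context ou_family
begin

text \<open>The covariance bounds give Gaussian decay uniformly in time, which beats every power of
  |x|; the time cut-off supplies integrability in \<open>t\<close>.\<close>

lemma strip_weight_L2: "strip_weight T m \<in> L2w"
proof -
  obtain p where p: "p > 0" "\<And>t v. v \<bullet> (P t *v v) \<ge> p * (norm v)\<^sup>2" using P_lower by blast
  obtain G where G: "\<And>t. norm (g t) \<le> G" using g_Q_bounded by blast
  \<comment> \<open>On a compact interval the continuous positive normalising factor has a positive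
    minimum.\<close>
  have "\<exists>d>0. \<forall>t\<in>{-T..T}. d \<le> sqrt ((2 * pi) ^ CARD('n) * det (Q t))"
  proof (cases "{-T..T} = {}")
   case False
   have "continuous_on {-T..T} (\<lambda>t. sqrt ((2 * pi) ^ CARD('n) * det (Q t)))"
    by (intro continuous_on_real_sqrt continuous_on_mult continuous_on_const continuous_on_subset[OF continuous_det_Q]) simp
   from continuous_attains_inf[OF compact_Icc False this] show ?thesis
    using det_Q_pos by (metis mult_pos_pos pi_gt_zero real_sqrt_gt_zero zero_less_mult_iff zero_less_numeral zero_less_power)
  qed (auto intro: exI[of _ 1])
  then obtain d where d: "d > 0" "\<And>t. t \<in> {-T..T} \<Longrightarrow> d \<le> sqrt ((2 * pi) ^ CARD('n) * det (Q t))" by blast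
  \<comment> \<open>Budget of the exponent: passing from |y| to |x| leaves decay at rate p/4, the
    polynomial weight consumes p/8, and the remaining p/8 makes the majorant integrable. As |t|
    \<le> T, decay in \<open>t\<close> is inserted at the cost of a constant.\<close>
  obtain K where K: "K > 0" "\<And>s. s \<ge> 0 \<Longrightarrow> (1 + s) ^ (2 * m) \<le> K * exp (p / 8 * s\<^sup>2)" using power_le_gaussian[of "p / 8" "2 * m"] p(1) by auto
  define L where "L = K / d * exp (p / 2 * G\<^sup>2 + p / 8 * T\<^sup>2)"
  have b: "\<rho> z * (strip_weight T m z)\<^sup>2 \<le> L * exp (- (p / 8) * (norm z)\<^sup>2)" for z
  proof (cases "fst z \<in> {-T..T}")
   case False then show ?thesis using K(1) d(1) by (simp add: strip_weight_def L_def)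
  next
   case True
   let ?s = "norm (snd z)"
   have nz: "(norm z)\<^sup>2 = (fst z)\<^sup>2 + ?s\<^sup>2" by (cases z) (simp add: norm_Pair)
   have tT: "(fst z)\<^sup>2 \<le> T\<^sup>2" using True by (intro power2_le_if_abs_le) auto
   have "?s \<le> norm (y z) + G" using norm_triangle_ineq[of "y z" "g (fst z)"] G[of "fst z"] by (simp add: y_def)
   then have "?s\<^sup>2 \<le> (norm (y z) + G)\<^sup>2" by (intro power_mono) auto
   also have "\<dots> \<le> 2 * (norm (y z))\<^sup>2 + 2 * G\<^sup>2" using sum_squares_bound[of "norm (y z)" G] by (simp add: power2_sum)
   finally have "p * ?s\<^sup>2 \<le> p * (2 * (norm (y z))\<^sup>2 + 2 * G\<^sup>2)" using p(1) by (intro mult_left_mono) auto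
   moreover have "p * (norm (y z))\<^sup>2 \<le> y z \<bullet> (P (fst z) *v y z)" by (rule p(2))
   ultimately have "- (1/2) * (y z \<bullet> pv z) \<le> p / 2 * G\<^sup>2 - p / 4 * ?s\<^sup>2" by (simp add: pv_def algebra_simps)
   then have "\<rho> z \<le> exp (p / 2 * G\<^sup>2 - p / 4 * ?s\<^sup>2) / d" unfolding \<rho>_def using d(1) d(2)[OF True] by (intro frac_le) auto
   moreover have "(strip_weight T m z)\<^sup>2 = (1 + ?s) ^ (2 * m)" using True by (simp add: strip_weight_def power_mult[symmetric] mult.commute)
   then have "(strip_weight T m z)\<^sup>2 \<le> K * exp (p / 8 * ?s\<^sup>2)" using K(2)[of ?s] by simp
   ultimately have "\<rho> z * (strip_weight T m z)\<^sup>2 \<le> exp (p / 2 * G\<^sup>2 - p / 4 * ?s\<^sup>2) / d * (K * exp (p / 8 * ?s\<^sup>2))"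
    using d(1) by (intro mult_mono) (auto simp: less_imp_le[OF \<rho>_pos])
   also have "\<dots> = K / d * exp (p / 2 * G\<^sup>2 - p / 8 * ?s\<^sup>2)" by (simp add: mult_exp_exp)
   also have "\<dots> \<le> K / d * exp (p / 2 * G\<^sup>2 + p / 8 * T\<^sup>2 - p / 8 * (norm z)\<^sup>2)"
    using K(1) d(1) mult_left_mono[OF tT, of "p / 8"] p(1) by (intro mult_left_mono) (auto simp: nz distrib_left)
   also have "\<dots> = L * exp (- (p / 8) * (norm z)\<^sup>2)" by (simp add: L_def mult.assoc mult_exp_exp)
   finally show ?thesis .
  qed
  have "integrable lborel (\<lambda>z. \<rho> z * (strip_weight T m z)\<^sup>2)"
  proof (rule Bochner_Integration.integrable_bound)
   show "integrable lborel (\<lambda>z :: real \<times> (real ^ 'n). L * exp (- (p / 8) * (norm z)\<^sup>2))"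
    using p(1) by (intro integrable_mult_right integrable_gaussian) simp
   show "(\<lambda>z. \<rho> z * (strip_weight T m z)\<^sup>2) \<in> borel_measurable lborel"
    using borel_measurable_times[OF weight_measurable borel_measurable_power[OF borel_measurable_strip_weight[of T m], of 2]] by simp
   show "AE z in lborel. norm (\<rho> z * (strip_weight T m z)\<^sup>2) \<le> norm (L * exp (- (p / 8) * (norm z)\<^sup>2))"
   proof (rule AE_I2)
    fix z
    have "norm (\<rho> z * (strip_weight T m z)\<^sup>2) = \<rho> z * (strip_weight T m z)\<^sup>2" by (simp add: less_imp_le[OF \<rho>_pos])
    also have "\<dots> \<le> norm (L * exp (- (p / 8) * (norm z)\<^sup>2))" unfolding real_norm_def by (rule order_trans[OF b abs_ge_self])
    finally show "norm (\<rho> z * (strip_weight T m z)\<^sup>2) \<le> norm (L * exp (- (p / 8) * (norm z)\<^sup>2))" .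
   qed
  qed
  then show ?thesis unfolding L2_space_def using borel_measurable_strip_weight[of T m] by (subst (asm) integrable_dens[symmetric]) auto
qed

lemma tempered_l2_tends:
  assumes F: "tempered F" and m: "\<And>k. F k \<in> borel_measurable borel" "v \<in> borel_measurable borel" and lim: "\<And>z. (\<lambda>k. F k z) \<longlonglongrightarrow> v z"
  shows "tendsw F v"
proof -
  obtain T p K where F: "\<And>k z. \<bar>F k z\<bar> \<le> K * strip_weight T p z" using F unfolding tempered_def by blast
  show ?thesis by (rule l2_tends_dominated[OF _ _ L2_space_cmult[OF strip_weight_L2[of T p], of K]]) (use m lim F in auto)
qed

lemma tempered_Gw:
  assumes "tempered ut" "\<And>i. tempered (\<lambda>k. ux k i)" "\<And>i j. tempered (\<lambda>k. uxx k i j)"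
  shows "tempered (\<lambda>k. Gw (ut k) (ux k) (uxx k))"
proof -
  obtain D where D: "D > 0" "\<And>z i. \<bar>drift z $ i\<bar> \<le> D * (1 + norm (snd z))" using ex_drift_bound by blast
  then have d: "\<bar>drift z $ i\<bar> \<le> D * (1 + norm (snd z)) ^ 1" for z i by simp
  show ?thesis unfolding Gw_def by (intro tempered_add assms tempered_cmult tempered_sum tempered_mult[OF assms(3), where L=E0 and p=0]
     tempered_mult[OF assms(2) d]) (use E0 D(1) in auto)
qed

lemma classical_L2:
  assumes "classical u ut ux uxx" shows "u \<in> L2w" "Gw ut ux uxx \<in> L2w"
proof -
  note w = classical_weak_derivs[OF assms]
  have t: "tempered (\<lambda>_. u)" "tempered (\<lambda>_. ut)" "tempered (\<lambda>_. ux i)" "tempered (\<lambda>_. uxx i j)" for i j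
   using assms unfolding classical_def by blast+
  have m: "u \<in> borel_measurable borel" "Gw ut ux uxx \<in> borel_measurable borel" using L2_locD(1) weak_derivsD(1)[OF w] Gw_L2_loc[OF w] by blast+
  show "u \<in> L2w" by (rule l2_tendsD(2)[OF tempered_l2_tends[OF t(1) m(1) m(1) tendsto_const]])
  have "tempered (\<lambda>_. Gw ut ux uxx)" by (rule tempered_Gw[OF t(2-4)])
  then show "Gw ut ux uxx \<in> L2w" by (rule l2_tendsD(2)[OF tempered_l2_tends[OF _ m(2) m(2) tendsto_const]])
qed

lemma classical_Gop:
  assumes "classical u ut ux uxx"
  shows "u \<in> H_loc 1 2" "Gop A B f u \<in> L2w" "AE z in dens \<rho>. Gop A B f u z = Gw ut ux uxx z"
proof -
  note w = classical_weak_derivs[OF assms]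
  show "u \<in> H_loc 1 2" by (rule weak_derivs_H_loc[OF w])
  show ae: "AE z in dens \<rho>. Gop A B f u z = Gw ut ux uxx z" by (rule Gop_AE(1)[OF w])
  show "Gop A B f u \<in> L2w" by (rule L2_space_AE_cong[OF classical_L2(2)[OF assms] _ ae]) (use Gop_AE(2)[OF w] in simp)
qed

end

lemma DG0_generator_DG0: "u \<in> DG0_generators \<Longrightarrow> u \<in> DG0"
  unfolding DG0_def by (intro CollectI exI[of _ "{u}"] exI[of _ "\<lambda>_. 1"]) auto

lemma DG0_lin:
  assumes "u \<in> DG0" "v \<in> DG0" shows "(\<lambda>z. a * u z + b * v z) \<in> DG0"
proof -
  obtain S c where S: "finite S" "S \<subseteq> DG0_generators" "u = (\<lambda>z. \<Sum>\<psi>\<in>S. c \<psi> * \<psi> z)" using assms(1) unfolding DG0_def by blast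
  obtain R d where R: "finite R" "R \<subseteq> DG0_generators" "v = (\<lambda>z. \<Sum>\<psi>\<in>R. d \<psi> * \<psi> z)" using assms(2) unfolding DG0_def by blast
  define e where "e = (\<lambda>\<psi>. a * (if \<psi> \<in> S then c \<psi> else 0) + b * (if \<psi> \<in> R then d \<psi> else 0))"
  have 1: "(\<Sum>\<psi>\<in>S \<union> R. (if \<psi> \<in> S then c \<psi> else 0) * \<psi> z) = (\<Sum>\<psi>\<in>S. c \<psi> * \<psi> z)" for z
   using S(1) R(1) by (intro sum.mono_neutral_cong_right) auto
  have 2: "(\<Sum>\<psi>\<in>S \<union> R. (if \<psi> \<in> R then d \<psi> else 0) * \<psi> z) = (\<Sum>\<psi>\<in>R. d \<psi> * \<psi> z)" for z
   using S(1) R(1) by (intro sum.mono_neutral_cong_right) auto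
  have "a * u z + b * v z = (\<Sum>\<psi>\<in>S \<union> R. e \<psi> * \<psi> z)" for z
   unfolding S(3) R(3) 1[of z, symmetric] 2[of z, symmetric] sum_distrib_left sum.distrib[symmetric] e_def
   by (intro sum.cong refl) (simp add: algebra_simps)
  then have "(\<lambda>z. a * u z + b * v z) = (\<lambda>z. \<Sum>\<psi>\<in>S \<union> R. e \<psi> * \<psi> z)" by (rule ext)
  moreover have "finite (S \<union> R)" "S \<union> R \<subseteq> DG0_generators" using S(1,2) R(1,2) by auto
  ultimately show ?thesis unfolding DG0_def by (intro CollectI exI[of _ "S \<union> R"] exI[of _ e] conjI)
qed

text \<open>Constant frequencies \<open>h\<close> are all that the approximation below uses.\<close>

lemma DG0_generatorsI:
  assumes "\<Phi> C1_differentiable_on UNIV" "compact (closure {t. \<Phi> t \<noteq> 0})"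
  shows "(\<lambda>(t, x :: real ^ 'n). Re (complex_of_real (\<Phi> t) * exp (\<i> * complex_of_real (x \<bullet> h)))) \<in> DG0_generators"
   "(\<lambda>(t, x :: real ^ 'n). Im (complex_of_real (\<Phi> t) * exp (\<i> * complex_of_real (x \<bullet> h)))) \<in> DG0_generators"
proof -
  have "(\<lambda>_::real. h) C1_differentiable_on UNIV" by (auto simp: C1_differentiable_on_def intro!: exI[of _ "\<lambda>_. 0"])
  moreover have "bounded (range (\<lambda>_::real. h))" "bounded (range (\<lambda>t::real. vector_derivative (\<lambda>_. h) (at t)))" by auto
  ultimately have m: "(\<Phi>, \<lambda>_. h) \<in> {(\<Phi> :: real \<Rightarrow> real, h :: real \<Rightarrow> real ^ 'n).
     \<Phi> C1_differentiable_on UNIV \<and> compact (closure {t. \<Phi> t \<noteq> 0}) \<and> h C1_differentiable_on UNIV \<and> bounded (range h) \<and>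
     bounded (range (\<lambda>t. vector_derivative h (at t)))}" using assms by blast
  show "(\<lambda>(t, x :: real ^ 'n). Re (complex_of_real (\<Phi> t) * exp (\<i> * complex_of_real (x \<bullet> h)))) \<in> DG0_generators"
   "(\<lambda>(t, x :: real ^ 'n). Im (complex_of_real (\<Phi> t) * exp (\<i> * complex_of_real (x \<bullet> h)))) \<in> DG0_generators"
   unfolding DG0_generators_def by (rule UN_I[OF m]; unfold prod.case; rule insertI1 insertI2[OF insertI1])+
qed

section \<open>Spatial convolution with trigonometric kernels\<close>

text \<open>Time is left untouched: the result inherits smoothness and compact support in
  \<open>t\<close> from \<phi>, as the amplitudes in D(G0) require.\<close>

definition sconv :: "(real ^ 'n \<Rightarrow> real) \<Rightarrow> (real \<times> (real ^ 'n) \<Rightarrow> real) \<Rightarrow> real \<times> (real ^ 'n) \<Rightarrow> real" where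
  "sconv q \<phi> z = (LINT x|lborel. \<phi> (z - (0, x)) * q x)"

lemma continuous_slice:
  assumes "cc \<phi>" shows "continuous_on UNIV (\<lambda>x. \<phi> (z - (0, x)))"
proof (rule continuous_on_compose2[of UNIV \<phi>])
  show "continuous_on UNIV (\<lambda>x. z - (0, x))" by (intro continuous_on_diff continuous_on_Pair continuous_on_const continuous_on_id)
qed (use assms in \<open>auto simp: cc_def\<close>)

lemma cc_sconv:
  fixes \<phi> :: "real \<times> (real ^ 'n) \<Rightarrow> real"
  assumes \<phi>: "cc \<phi>" and q: "continuous_on UNIV q" shows "cc (\<lambda>x. \<phi> (z - (0, x)) * q x)"
proof -
  obtain r where r: "\<And>w. r < norm w \<Longrightarrow> \<phi> w = 0" using \<phi> by (auto simp: cc_def csupp_def)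
  have "continuous_on UNIV (\<lambda>x. \<phi> (z - (0, x)) * q x)" by (intro continuous_on_mult q continuous_slice \<phi>)
  moreover have "csupp (\<lambda>x. \<phi> (z - (0, x)) * q x)"
  proof (rule csuppI)
   fix x :: "real ^ 'n" assume "r + norm z < norm x"
   then have "r < norm (z - (0, x))" using norm_triangle_ineq2[of "(0, x) :: real \<times> (real ^ 'n)" z] by (simp add: norm_minus_commute norm_Pair)
   then show "\<phi> (z - (0, x)) * q x = 0" using r by simp
  qed
  ultimately show ?thesis by (simp add: cc_def)
qed

lemmas sconv_integrable = cc_integrable[OF cc_sconv]

lemma sconv_lin:
  assumes "cc \<phi>" "continuous_on UNIV p" "continuous_on UNIV q"
  shows "sconv (\<lambda>x. a * p x + b * q x) \<phi> z = a * sconv p \<phi> z + b * sconv q \<phi> z"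
  using sconv_integrable[OF assms(1,2), of z] sconv_integrable[OF assms(1,3), of z] unfolding sconv_def by (simp add: distrib_left mult.left_commute)

lemma integrable_indicator_cball_mult:
  fixes q :: "'a::euclidean_space \<Rightarrow> real"
  assumes "continuous_on UNIV q" shows "integrable lborel (\<lambda>x. indicator (cball 0 r) x * q x)"
  using borel_integrable_compact[OF compact_cball, of 0 r q] continuous_on_subset[OF assms] by (simp add: set_integrable_def)

lemma sconv_bound:
  assumes \<phi>: "cc \<phi>" "\<And>w. r < norm w \<Longrightarrow> \<phi> w = 0" "\<And>w. \<bar>\<phi> w\<bar> \<le> e" and q: "continuous_on UNIV q"
  shows "\<bar>sconv q \<phi> z\<bar> \<le> e * (LINT x|lborel. indicator (cball 0 (norm z + r)) x * \<bar>q x\<bar>)"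
proof -
  have e: "e \<ge> 0" using \<phi>(3)[of 0] by linarith
  note ii = integrable_indicator_cball_mult[OF continuous_on_rabs[OF q], of "norm z + r"]
  have "norm (sconv q \<phi> z) \<le> (LINT x|lborel. e * (indicator (cball 0 (norm z + r)) x * \<bar>q x\<bar>))" unfolding sconv_def
  proof (rule Bochner_Integration.integral_norm_bound_integral[OF sconv_integrable[OF \<phi>(1) q] integrable_mult_right[OF ii]])
   fix x
   show "norm (\<phi> (z - (0, x)) * q x) \<le> e * (indicator (cball 0 (norm z + r)) x * \<bar>q x\<bar>)"
   proof (cases "norm x \<le> norm z + r")
    case True then show ?thesis using mult_right_mono[OF \<phi>(3)[of "z - (0, x)"], of "\<bar>q x\<bar>"] by (simp add: abs_mult)
   next
    case False
    then have "r < norm (z - (0, x))" using norm_triangle_ineq2[of "(0, x)" z] by (simp add: norm_minus_commute norm_Pair)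
    then show ?thesis using \<phi>(2) e by simp
   qed
  qed
  then show ?thesis by simp
qed

text \<open>The kernel is continuous but not integrable. For points near \<open>z\<close> only its
  values on a fixed ball matter, so it may be truncated and the general differentiation lemma
  applies.\<close>

lemma sconv_has_derivative:
  fixes \<phi> :: "real \<times> (real ^ 'n) \<Rightarrow> real"
  assumes t: "test_function \<phi>" and q: "continuous_on UNIV q"
  shows "(sconv q \<phi> has_derivative (\<lambda>h. \<Sum>b\<in>Basis. (h \<bullet> b) * sconv q (pd b \<phi>) z)) (at z)"
proof -
  define r where "r = norm z + 1"
  obtain s where s: "\<And>w. s < norm w \<Longrightarrow> \<phi> w = 0" using test_function_csupp[OF t] by (auto simp: csupp_def)
  note s' = pd_eq_0_outside[OF s]
  let ?v = "\<lambda>x. indicator (cball 0 (r + s)) x * q x"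
  have v: "integrable lborel ?v" by (rule integrable_indicator_cball_mult[OF q])
  have eq: "sconv q \<psi> w = (LINT x|lborel. ?v x * \<psi> (w - (0, x)))" if w: "w \<in> ball 0 r" and \<psi>: "\<And>w. s < norm w \<Longrightarrow> \<psi> w = 0" for \<psi> w
   unfolding sconv_def
  proof (intro Bochner_Integration.integral_cong refl)
   fix x :: "real ^ 'n"
   show "\<psi> (w - (0, x)) * q x = ?v x * \<psi> (w - (0, x))"
   proof (cases "norm x \<le> r + s")
    case False
    then have "s < norm (w - (0, x))" using norm_triangle_ineq2[of "(0, x)" w] w by (simp add: norm_minus_commute norm_Pair)
    then show ?thesis using \<psi> by simp
   qed (simp add: mult.commute)
  qed
  have m: "(\<lambda>x. (0, x) :: real \<times> (real ^ 'n)) \<in> borel_measurable lborel" by simp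
  have z: "z \<in> ball 0 r" by (simp add: r_def)
  have eb: "sconv q (pd b \<phi>) z = (LINT x|lborel. ?v x * pd b \<phi> (z - (0, x)))" for b by (rule eq[OF z]) (rule s')
  have "((\<lambda>w. LINT x|lborel. ?v x * \<phi> (w - (0, x))) has_derivative (\<lambda>h. \<Sum>b\<in>Basis. (h \<bullet> b) * sconv q (pd b \<phi>) z)) (at z)"
   using translates_has_derivative[OF t v m, of z] unfolding eb .
  from has_derivative_transform_within_open[OF this open_ball z] show ?thesis by (simp add: eq[OF _ s])
qed

lemma sconv_regular:
  fixes \<phi> :: "real \<times> (real ^ 'n) \<Rightarrow> real"
  assumes t: "test_function \<phi>" and q: "continuous_on UNIV q"
  shows "continuous_on UNIV (sconv q \<phi>)" "b \<in> Basis \<Longrightarrow> dirder b (sconv q \<phi>) (sconv q (pd b \<phi>))"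
proof -
  note d = sconv_has_derivative[OF t q]
  show "continuous_on UNIV (sconv q \<phi>)" by (intro continuous_at_imp_continuous_on ballI has_derivative_continuous[OF d])
  assume b: "b \<in> Basis"
  show "dirder b (sconv q \<phi>) (sconv q (pd b \<phi>))" unfolding dirder_def has_field_derivative_def
  proof
   fix z
   have "((\<lambda>s. z + s *\<^sub>R b) has_derivative (\<lambda>s. s *\<^sub>R b)) (at 0)" by (auto intro!: derivative_eq_intros)
   from has_derivative_compose[OF this d]
   have "((\<lambda>s. sconv q \<phi> (z + s *\<^sub>R b)) has_derivative (\<lambda>s. \<Sum>c\<in>Basis. (s *\<^sub>R b \<bullet> c) * sconv q (pd c \<phi>) (z + 0 *\<^sub>R b))) (at 0)" .
   moreover have "(\<lambda>s. \<Sum>c\<in>Basis. (s *\<^sub>R b \<bullet> c) * sconv q (pd c \<phi>) (z + 0 *\<^sub>R b)) = (*) (sconv q (pd b \<phi>) z)"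
    using basis_expansion[OF b, of "\<lambda>c. sconv q (pd c \<phi>) z"] by (simp add: fun_eq_iff mult.assoc sum_distrib_left[symmetric])
   ultimately show "((\<lambda>s. sconv q \<phi> (z + s *\<^sub>R b)) has_derivative (*) (sconv q (pd b \<phi>) z)) (at 0)" by (simp only:)
  qed
qed

text \<open>The span of cosines is closed under products by the addition formulas, hence contains
  powers of trigonometric polynomials; even functions suffice for the kernels.\<close>

inductive_set trig_kernels :: "(real ^ 'n \<Rightarrow> real) set" where
  cos: "(\<lambda>x. cos (x \<bullet> h)) \<in> trig_kernels"
| lin: "p \<in> trig_kernels \<Longrightarrow> q \<in> trig_kernels \<Longrightarrow> (\<lambda>x. a * p x + b * q x) \<in> trig_kernels"

lemma trig_kernels_continuous: "q \<in> trig_kernels \<Longrightarrow> continuous_on UNIV q"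
  by (induction rule: trig_kernels.induct) (auto intro!: continuous_intros)

lemma trig_kernels_mult_cos:
  assumes "q \<in> trig_kernels" shows "(\<lambda>x. cos (x \<bullet> h) * q x) \<in> trig_kernels" using assms
proof (induction rule: trig_kernels.induct)
  case (cos g)
  have "(\<lambda>x. cos (x \<bullet> h) * cos (x \<bullet> g)) = (\<lambda>x. 1/2 * cos (x \<bullet> (h - g)) + 1/2 * cos (x \<bullet> (h + g)))"
   unfolding cos_times_cos inner_diff_right inner_add_right by (simp add: add_divide_distrib)
  then show ?case using trig_kernels.lin[OF trig_kernels.cos[of "h - g"] trig_kernels.cos[of "h + g"], of "1/2" "1/2"] by simp
next
  case (lin p q a b)
  have "(\<lambda>x. cos (x \<bullet> h) * (a * p x + b * q x)) = (\<lambda>x. a * (cos (x \<bullet> h) * p x) + b * (cos (x \<bullet> h) * q x))"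
   by (simp add: fun_eq_iff algebra_simps)
  then show ?case using trig_kernels.lin[OF lin.IH, of a b] by simp
qed

lemma trig_kernels_mult:
  assumes "p \<in> trig_kernels" "q \<in> trig_kernels" shows "(\<lambda>x. p x * q x) \<in> trig_kernels" using assms(1)
proof (induction rule: trig_kernels.induct)
  case (cos h) show ?case by (rule trig_kernels_mult_cos[OF assms(2)])
next
  case (lin p p' a b)
  have "(\<lambda>x. (a * p x + b * p' x) * q x) = (\<lambda>x. a * (p x * q x) + b * (p' x * q x))" by (simp add: fun_eq_iff algebra_simps)
  then show ?case using trig_kernels.lin[OF lin.IH, of a b] by simp
qed

lemma trig_kernels_power: "q \<in> trig_kernels \<Longrightarrow> (\<lambda>x. q x ^ m) \<in> trig_kernels"
proof (induction m)
  case 0 show ?case using trig_kernels.cos[of 0] by simp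
next
  case (Suc m) then show ?case using trig_kernels_mult by simp
qed

lemma trig_kernels_cmult: "q \<in> trig_kernels \<Longrightarrow> (\<lambda>x. c * q x) \<in> trig_kernels" using trig_kernels.lin[of q q c 0] by simp

lemma trig_kernels_sum_cos: "finite I \<Longrightarrow> (\<lambda>x. \<Sum>i\<in>I. cos (x \<bullet> h i)) \<in> trig_kernels"
proof (induction I rule: finite_induct)
  case empty show ?case using trig_kernels_cmult[OF trig_kernels.cos, of 0] by simp
next
  case (insert i I) then show ?case using trig_kernels.lin[OF trig_kernels.cos[of "h i"] insert.IH, of 1 1] by simp
qed

text \<open>Translating the integration variable by \<open>x\<close> and expanding the cosine
  separates the variables: cos and sin of \<open>x \<bullet> h\<close> appear with coefficients
  depending on time only, one real and one imaginary part of a generator.\<close>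

lemma sconv_cos_DG0:
  fixes h :: "real ^ 'n"
  assumes t: "test_function \<phi>" shows "sconv (\<lambda>x. cos (x \<bullet> h)) \<phi> \<in> DG0"
proof -
  note s = test_function_cc[OF t]
  have c: "continuous_on UNIV (\<lambda>x. cos (x \<bullet> h))" "continuous_on UNIV (\<lambda>x. sin (x \<bullet> h))" by (intro continuous_intros)+
  define F where "F = (\<lambda>q t. sconv q \<phi> (t, 0))"
  define F' where "F' = (\<lambda>q t. sconv q (dt \<phi>) (t, 0))"
  have key: "F q C1_differentiable_on UNIV" "compact (closure {t. F q t \<noteq> 0})" if q: "continuous_on UNIV q" for q
  proof -
   have "((F q) has_real_derivative F' q t) (at t)" for t
    using dirder_line[OF sconv_regular(2)[OF t q e_time_Basis], of "(0, 0)" t] by (simp add: F_def F'_def zero_prod_def)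
   moreover have "continuous_on UNIV (F' q)" unfolding F'_def
    by (rule continuous_on_compose2[OF sconv_regular(1)[OF test_function_dt[OF t] q]]) (auto intro: continuous_intros)
   ultimately show "F q C1_differentiable_on UNIV" unfolding C1_differentiable_on_def has_real_derivative_iff_has_vector_derivative by blast
   obtain r where r: "\<And>w. r < norm w \<Longrightarrow> \<phi> w = 0" using test_function_csupp[OF t] by (auto simp: csupp_def)
   have "F q t = 0" if "r < norm t" for t
   proof -
    have "\<phi> ((t, 0) - (0, x)) = 0" for x by (rule r) (use that norm_fst_le[of t "- x"] in simp)
    then show ?thesis by (simp add: F_def sconv_def)
   qed
   then show "compact (closure {t. F q t \<noteq> 0})" unfolding compact_support_iff_csupp by (rule csuppI)
  qed
  define c1 where "c1 = (\<lambda>(t, x). Re (complex_of_real (F (\<lambda>x. cos (x \<bullet> h)) t) * exp (\<i> * complex_of_real (x \<bullet> h))))"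
  define c2 where "c2 = (\<lambda>(t, x). Im (complex_of_real (F (\<lambda>x. sin (x \<bullet> h)) t) * exp (\<i> * complex_of_real (x \<bullet> h))))"
  have "c1 \<in> DG0" "c2 \<in> DG0" unfolding c1_def c2_def by (intro DG0_generator_DG0 DG0_generatorsI key c)+
  from DG0_lin[OF this, of 1 "-1"] have "(\<lambda>z. 1 * c1 z + -1 * c2 z) \<in> DG0" .
  moreover have "sconv (\<lambda>x. cos (x \<bullet> h)) \<phi> z = 1 * c1 z + -1 * c2 z" for z
  proof -
   obtain t x where z: "z = (t, x)" by (cases z)
   have "sconv (\<lambda>x. cos (x \<bullet> h)) \<phi> z = (LINT v|lborel. \<phi> (t, x - v) * cos (v \<bullet> h))" by (simp add: sconv_def z)
   also have "\<dots> = (LINT v|lborel. \<phi> (t, x - (v + x)) * cos ((v + x) \<bullet> h))"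
    using lborel_has_bochner_integral_translate(2)[of "\<lambda>v. \<phi> (t, x - v) * cos (v \<bullet> h)" x] sconv_integrable[OF s c(1), of z] by (simp add: z)
   also have "\<dots> = (LINT v|lborel. cos (x \<bullet> h) * (\<phi> ((t, 0) - (0, v)) * cos (v \<bullet> h)) - sin (x \<bullet> h) * (\<phi> ((t, 0) - (0, v)) * sin (v \<bullet> h)))"
    by (intro Bochner_Integration.integral_cong refl) (simp add: inner_add_left cos_add algebra_simps)
   also have "\<dots> = cos (x \<bullet> h) * F (\<lambda>x. cos (x \<bullet> h)) t - sin (x \<bullet> h) * F (\<lambda>x. sin (x \<bullet> h)) t"
    unfolding F_def sconv_def using sconv_integrable[OF s c(1), of "(t, 0)"] sconv_integrable[OF s c(2), of "(t, 0)"] by simp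
   finally show ?thesis by (simp add: c1_def c2_def z exp_eq_polar cis.simps mult.commute)
  qed
  ultimately show ?thesis by (metis (no_types, lifting) ext)
qed

lemma trig_kernels_sconv_DG0:
  assumes "q \<in> trig_kernels" "test_function \<phi>" shows "sconv q \<phi> \<in> DG0" using assms(1)
proof (induction rule: trig_kernels.induct)
  case (cos h) show ?case by (rule sconv_cos_DG0[OF assms(2)])
next
  case (lin p q a b)
  have "sconv (\<lambda>x. a * p x + b * q x) \<phi> = (\<lambda>z. a * sconv p \<phi> z + b * sconv q \<phi> z)"
   by (rule ext) (rule sconv_lin[OF test_function_cc[OF assms(2)] trig_kernels_continuous[OF lin.hyps(1)] trig_kernels_continuous[OF lin.hyps(2)]])
  then show ?case using DG0_lin[OF lin.IH, of a b] by simp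
qed

section \<open>The trigonometric approximate identity\<close>

text \<open>Taylor expansion. For the upper bound the remainder of order 4 is at most \<theta>^2/24
  when |\<theta>| \<le> 1, which leaves at least a quarter of \<theta>^2.\<close>

lemma cos_bounds:
  fixes \<theta> :: real
  shows "1 - \<theta>\<^sup>2 / 2 \<le> cos \<theta>" "\<bar>\<theta>\<bar> \<le> 1 \<Longrightarrow> cos \<theta> \<le> 1 - \<theta>\<^sup>2 / 4"
proof -
  obtain t where t: "cos \<theta> = (\<Sum>m<2. cos_coeff m * \<theta> ^ m) + cos (t + 1/2 * real 2 * pi) / fact 2 * \<theta> ^ 2"
   using Maclaurin_cos_expansion[of \<theta> 2] by blast
  have "(-1) * \<theta>\<^sup>2 \<le> cos (t + 1/2 * real 2 * pi) * \<theta>\<^sup>2" by (rule mult_right_mono) auto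
  then show "1 - \<theta>\<^sup>2 / 2 \<le> cos \<theta>" unfolding t by (simp add: cos_coeff_def numeral_2_eq_2)
  assume le: "\<bar>\<theta>\<bar> \<le> 1"
  obtain c where c: "c \<le> 1" "cos \<theta> = (\<Sum>m<4. cos_coeff m * \<theta> ^ m) + c / fact 4 * \<theta> ^ 4"
   using Maclaurin_cos_expansion[of \<theta> 4] cos_le_one by blast
  have co: "cos_coeff 0 = 1" "cos_coeff 1 = 0" "cos_coeff 2 = -1/2" "cos_coeff 3 = 0" by (simp_all add: cos_coeff_def)
  have "(\<Sum>m<4. cos_coeff m * \<theta> ^ m) = cos_coeff 0 * \<theta> ^ 0 + cos_coeff 1 * \<theta> ^ 1 + cos_coeff 2 * \<theta> ^ 2 + cos_coeff 3 * \<theta> ^ 3"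
   by (simp add: eval_nat_numeral)
  then have "cos \<theta> = 1 - \<theta>\<^sup>2 / 2 + c * \<theta> ^ 4 / 24" unfolding c(2) co by (simp add: fact_numeral)
  moreover have "c * \<theta> ^ 4 \<le> 1 * \<theta> ^ 4" by (rule mult_right_mono[OF c(1)]) simp
  moreover have "\<theta> ^ 4 \<le> \<theta>\<^sup>2" using power_decreasing[of 2 4 "\<bar>\<theta>\<bar>"] le by simp
  moreover have "0 \<le> \<theta>\<^sup>2" by simp
  ultimately show "cos \<theta> \<le> 1 - \<theta>\<^sup>2 / 4" by linarith
qed

text \<open>Of modulus at most 1, and near 0 it behaves like 1 - |x|^2 / (2n(k+1)^2): a high power
  looks like a Gaussian there.\<close>

definition cos_mean :: "nat \<Rightarrow> real ^ 'n \<Rightarrow> real" where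
  "cos_mean k x = 1 / real CARD('n) * (\<Sum>i\<in>UNIV. cos (x \<bullet> ((1 / real (Suc k)) *\<^sub>R axis i 1)))"

text \<open>The exponent makes the kernel concentrate on the scale \<open>1/k\<close>, much below its period of order \<open>k\<close>.\<close>

definition kern :: "nat \<Rightarrow> real ^ 'n \<Rightarrow> real" where
  "kern k x = cos_mean k x ^ (2 * (CARD('n) * Suc k ^ 4))"

lemma kern_trig: "kern k \<in> trig_kernels"
  unfolding kern_def[abs_def] cos_mean_def by (intro trig_kernels_power trig_kernels_cmult trig_kernels_sum_cos finite_class.finite_UNIV)

lemmas kern_continuous = trig_kernels_continuous[OF kern_trig]

lemma sum_squares_scaled:
  "(\<Sum>i\<in>UNIV. (x \<bullet> ((1 / s) *\<^sub>R axis i 1))\<^sup>2) = (norm x)\<^sup>2 / s\<^sup>2" for x :: "real ^ 'n"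
  by (simp add: inner_axis norm_vec_def L2_set_def sum_nonneg power_divide sum_divide_distrib)

lemma cos_mean_lower: "1 - (norm x)\<^sup>2 / (2 * real CARD('n) * (real (Suc k))\<^sup>2) \<le> cos_mean k (x :: real ^ 'n)"
proof -
  have "real CARD('n) - (norm x)\<^sup>2 / (real (Suc k))\<^sup>2 / 2 = (\<Sum>i\<in>(UNIV::'n set). 1 - (x \<bullet> ((1 / real (Suc k)) *\<^sub>R axis i 1))\<^sup>2 / 2)"
   by (simp only: sum_subtractf sum_divide_distrib[symmetric] sum_squares_scaled) simp
  also have "\<dots> \<le> (\<Sum>i\<in>UNIV. cos (x \<bullet> ((1 / real (Suc k)) *\<^sub>R axis i 1)))" by (intro sum_mono cos_bounds)
  finally have "(real CARD('n) - (norm x)\<^sup>2 / (real (Suc k))\<^sup>2 / 2) / real CARD('n) \<le> (\<Sum>i\<in>UNIV. cos (x \<bullet> ((1 / real (Suc k)) *\<^sub>R axis i 1))) / real CARD('n)"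
   by (rule divide_right_mono) simp
  then show ?thesis unfolding cos_mean_def by (simp add: diff_divide_distrib mult_ac del: of_nat_Suc)
qed

lemma cos_mean_upper:
  fixes x :: "real ^ 'n"
  assumes "norm x \<le> real (Suc k)"
  shows "cos_mean k x \<le> 1 - (norm x)\<^sup>2 / (4 * real CARD('n) * (real (Suc k))\<^sup>2)" "0 \<le> cos_mean k x"
proof -
  have a: "\<bar>x \<bullet> ((1 / real (Suc k)) *\<^sub>R axis i 1)\<bar> \<le> 1" for i
   using order_trans[OF component_le_norm_cart[of x i] assms] by (simp add: inner_axis divide_simps del: of_nat_Suc)
  have "(\<Sum>i\<in>UNIV. cos (x \<bullet> ((1 / real (Suc k)) *\<^sub>R axis i 1))) \<le> (\<Sum>i\<in>(UNIV::'n set). 1 - (x \<bullet> ((1 / real (Suc k)) *\<^sub>R axis i 1))\<^sup>2 / 4)"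
   by (intro sum_mono cos_bounds a)
  also have "\<dots> = real CARD('n) - (norm x)\<^sup>2 / (real (Suc k))\<^sup>2 / 4"
   by (simp only: sum_subtractf sum_divide_distrib[symmetric] sum_squares_scaled) simp
  finally show "cos_mean k x \<le> 1 - (norm x)\<^sup>2 / (4 * real CARD('n) * (real (Suc k))\<^sup>2)"
   unfolding cos_mean_def by (simp add: field_simps del: of_nat_Suc)
  have "0 \<le> cos (x \<bullet> ((1 / real (Suc k)) *\<^sub>R axis i 1))" for i
   using cos_bounds(1)[of "x \<bullet> ((1 / real (Suc k)) *\<^sub>R axis i 1)"] power2_le_if_abs_le[OF a[of i]] by simp
  then show "0 \<le> cos_mean k x" unfolding cos_mean_def by (intro mult_nonneg_nonneg sum_nonneg) auto
qed

lemma kern_bounds: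
  fixes x :: "real ^ 'n"
  shows "0 \<le> kern k x" "kern k x \<le> 1"
   "norm x \<le> real (Suc k) \<Longrightarrow> kern k x \<le> exp (- ((real (Suc k))\<^sup>2 * (norm x)\<^sup>2 / 2))"
   "norm x \<le> 1 / (2 * real (Suc k)) \<Longrightarrow> 1 / 2 \<le> kern k x"
proof -
  define n s M where "n = real CARD('n)" and "s = real (Suc k)" and "M = 2 * (CARD('n) * Suc k ^ 4)"
  have n: "n > 0" and s: "s > 0" and M: "real M = 2 * n * s ^ 4" by (simp_all add: n_def s_def M_def)
  show "0 \<le> kern k x" unfolding kern_def power_mult by (simp add: zero_le_power)
  have "\<bar>\<Sum>i\<in>UNIV. cos (x \<bullet> ((1 / real (Suc k)) *\<^sub>R axis i 1))\<bar> \<le> (\<Sum>i\<in>(UNIV::'n set). 1)"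
   by (intro order_trans[OF sum_abs] sum_mono) auto
  then have "\<bar>cos_mean k x\<bar> \<le> 1" unfolding cos_mean_def abs_mult by (simp add: divide_simps)
  then have "\<bar>cos_mean k x\<bar> ^ M \<le> 1" by (intro power_le_one) auto
  then show "kern k x \<le> 1" unfolding kern_def M_def[symmetric] using abs_ge_self[of "cos_mean k x ^ M"] by (simp add: power_abs)
  show "kern k x \<le> exp (- ((real (Suc k))\<^sup>2 * (norm x)\<^sup>2 / 2))" if "norm x \<le> real (Suc k)"
  proof -
   \<comment> \<open>By 1 + v \<le> exp v; with exponent M = 2n(k+1)^4 the denominator 4n(k+1)^2
     becomes the factor (k+1)^2/2. The exponent is even, so the kernel is nonnegative outside this
     ball as well.\<close>
   have "cos_mean k x \<le> exp (- ((norm x)\<^sup>2 / (4 * n * s\<^sup>2)))"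
    using cos_mean_upper(1)[OF that] exp_ge_add_one_self[of "- ((norm x)\<^sup>2 / (4 * n * s\<^sup>2))"] by (simp add: n_def s_def)
   then have "kern k x \<le> exp (- ((norm x)\<^sup>2 / (4 * n * s\<^sup>2))) ^ M"
    unfolding kern_def M_def[symmetric] using cos_mean_upper(2)[OF that] by (rule power_mono)
   also have "\<dots> = exp (- (s\<^sup>2 * (norm x)\<^sup>2 / 2))"
    unfolding exp_of_nat_mult[symmetric] M using n s by (simp add: field_simps eval_nat_numeral)
   finally show ?thesis by (simp add: s_def)
  qed
  show "1 / 2 \<le> kern k x" if "norm x \<le> 1 / (2 * real (Suc k))"
  proof -
   have "s * norm x \<le> 1 / 2" using mult_left_mono[OF that[folded s_def], of s] s by simp
   then have "(s * norm x)\<^sup>2 \<le> (1/2)\<^sup>2" using s by (intro power_mono) auto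
   then have sx: "s\<^sup>2 * (norm x)\<^sup>2 \<le> 1 / 4" by (simp add: power_mult_distrib power_divide)
   define v where "v = - ((norm x)\<^sup>2 / (2 * n * s\<^sup>2))"
   have Mv: "real M * v = - (s\<^sup>2 * (norm x)\<^sup>2)" unfolding M v_def using n s by (simp add: field_simps eval_nat_numeral)
   have "M \<ge> 1" by (simp add: M_def Suc_le_eq)
   then have "v \<ge> real M * v" using mult_right_mono_neg[of 1 "real M" v] n s by (simp add: v_def)
   then have v: "- 1 \<le> v" using Mv sx by linarith
   \<comment> \<open>Bernoulli: on the ball of radius 1/(2(k+1)) the product of exponent and
     deviation is at least -1/4.\<close>
   have "1 + real M * v \<le> (1 + v) ^ M" by (rule Bernoulli_inequality[OF v])
   also have "\<dots> \<le> kern k x" unfolding kern_def M_def[symmetric]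
    using cos_mean_lower[of x k] v by (intro power_mono) (auto simp: v_def n_def s_def)
   finally show ?thesis using Mv sx by linarith
  qed
qed

text \<open>Only the ball of radius k+1 is counted. The kernel is periodic, so its integral over the
  whole space is infinite, and this ball lies within one period around 0.\<close>

definition mass :: "nat \<Rightarrow> 'n::finite itself \<Rightarrow> real" where
  "mass k _ = (LINT x|lborel. indicator (cball 0 (real (Suc k))) x * kern k (x :: real ^ 'n))"

definition nkern :: "nat \<Rightarrow> real ^ 'n \<Rightarrow> real" where
  "nkern k x = 1 / mass k TYPE('n) * kern k x"

lemma nkern_trig: "nkern k \<in> trig_kernels" unfolding nkern_def[abs_def] by (rule trig_kernels_cmult[OF kern_trig])

lemmas nkern_continuous = trig_kernels_continuous[OF nkern_trig]

lemma ex_nkern_bounds: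
  "\<exists>a>0. \<forall>k (x::real ^ 'n). 0 \<le> nkern k x \<and> nkern k x \<le> a * real (Suc k) ^ CARD('n) * kern k x \<and>
   (LINT x|lborel. indicator (cball 0 (real (Suc k))) x * nkern k (x::real ^ 'n)) = 1"
proof -
  define V where "V = unit_ball_vol (real CARD('n))"
  have V: "V > 0" by (simp add: V_def)
  \<comment> \<open>The kernel is at least 1/2 on a ball of radius 1/(2(k+1)); \<open>a\<close>
    collects the volume of that ball and the factor 1/2.\<close>
  define a where "a = 2 * 2 ^ CARD('n) / V"
  have m: "mass k TYPE('n) \<ge> 1 / (a * real (Suc k) ^ CARD('n))" for k
  proof -
   let ?B = "cball 0 (1 / (2 * real (Suc k))) :: (real ^ 'n) set"
   have le: "1 / (2 * real (Suc k)) \<le> real (Suc k)" by (simp add: field_simps)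
   have ib: "integrable lborel (\<lambda>x. indicator ?B x * (1/2 :: real))" by (rule integrable_indicator_cball_mult) (rule continuous_on_const)
   have "(LINT x|lborel. indicator ?B x * (1/2)) \<le> mass k TYPE('n)" unfolding mass_def
   proof (rule integral_mono[OF ib integrable_indicator_cball_mult[OF kern_continuous]])
    fix x :: "real ^ 'n"
    show "indicator ?B x * (1/2) \<le> indicator (cball 0 (real (Suc k))) x * kern k x"
     using kern_bounds(1,4)[where k=k and x=x] le by (cases "x \<in> ?B") (auto simp: indicator_def simp del: of_nat_Suc)
   qed
   also have "(LINT x|lborel. indicator ?B x * (1/2)) = V * (1 / (2 * real (Suc k))) ^ CARD('n) / 2"
    by (simp add: content_cball V_def del: of_nat_Suc)
   also have "\<dots> = 1 / (a * real (Suc k) ^ CARD('n))" using V by (simp add: a_def power_divide power_mult_distrib field_simps del: of_nat_Suc)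
   finally show ?thesis .
  qed
  have a: "a > 0" using V by (simp add: a_def)
  have as: "a * real (Suc k) ^ CARD('n) > 0" for k using a by simp
  have mp: "mass k TYPE('n) > 0" for k using m[of k] as[of k] by (meson less_le_trans zero_less_divide_1_iff)
  have h: "1 / mass k TYPE('n) \<le> a * real (Suc k) ^ CARD('n)" for k using m[of k] mp[of k] as[of k] by (simp add: field_simps del: of_nat_Suc)
  have "nkern k x \<le> a * real (Suc k) ^ CARD('n) * kern k x" for k and x :: "real ^ 'n"
   unfolding nkern_def by (rule mult_right_mono[OF h kern_bounds(1)])
  moreover have "0 \<le> nkern k x" for k and x :: "real ^ 'n" unfolding nkern_def using kern_bounds(1)[where k=k and x=x] mp[of k] by simp
  moreover have "(LINT x|lborel. indicator (cball 0 (real (Suc k))) x * nkern k (x::real ^ 'n)) = 1" for k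
  proof -
   have "(LINT x|lborel. indicator (cball 0 (real (Suc k))) x * nkern k (x::real ^ 'n)) = (LINT x|lborel. 1 / mass k TYPE('n) * (indicator (cball 0 (real (Suc k))) x * kern k (x::real ^ 'n)))"
    by (intro Bochner_Integration.integral_cong refl) (simp add: nkern_def)
   then show ?thesis using mp[of k] by (simp add: mass_def)
  qed
  ultimately show ?thesis using a by blast
qed

text \<open>Up to radius k+1 the mass is at most 1. Beyond it the kernel is not small, but its
  height of order (k+1)^n is below r^n, and the volume adds another r^n: growth is polynomial,
  uniformly in \<open>k\<close>.\<close>

lemma nkern_mass:
  "\<exists>b\<ge>0. \<forall>k r. r \<ge> 0 \<longrightarrow> (LINT x|lborel. indicator (cball 0 r) x * \<bar>nkern k (x::real ^ 'n)\<bar>) \<le> 1 + b * r ^ (2 * CARD('n))"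
proof -
  obtain a where a: "a > 0" "\<And>k x. 0 \<le> nkern k (x::real ^ 'n)" "\<And>k x. nkern k (x::real ^ 'n) \<le> a * real (Suc k) ^ CARD('n) * kern k x"
   "\<And>k. (LINT x|lborel. indicator (cball 0 (real (Suc k))) x * nkern k (x::real ^ 'n)) = 1" using ex_nkern_bounds[where 'n='n] by blast
  define V where "V = unit_ball_vol (real CARD('n))"
  have V: "V > 0" by (simp add: V_def)
  have "(LINT x|lborel. indicator (cball 0 r) x * \<bar>nkern k (x::real ^ 'n)\<bar>) \<le> 1 + a * V * r ^ (2 * CARD('n))" if r: "r \<ge> 0" for k r
  proof (cases "r \<le> real (Suc k)")
   case True
   have "(LINT x|lborel. indicator (cball 0 r) x * \<bar>nkern k (x::real ^ 'n)\<bar>) \<le> (LINT x|lborel. indicator (cball 0 (real (Suc k))) x * nkern k (x::real ^ 'n))"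
    using a(2) True by (intro integral_mono integrable_indicator_cball_mult nkern_continuous continuous_on_rabs) (auto simp: indicator_def)
   then show ?thesis unfolding a(4) using a(1) V r by (simp add: add_increasing2)
  next
   case False
   have k1: "\<bar>nkern k x\<bar> \<le> a * r ^ CARD('n)" for x :: "real ^ 'n"
   proof -
    have "a * real (Suc k) ^ CARD('n) * kern k x \<le> a * r ^ CARD('n) * 1"
     using a(1) False kern_bounds(1,2)[where k=k and x=x] r by (intro mult_mono mult_left_mono power_mono) auto
    then show ?thesis using a(2)[of k x] a(3)[of k x] by simp
   qed
   have "(LINT x|lborel. indicator (cball 0 r) x * \<bar>nkern k (x::real ^ 'n)\<bar>) \<le> (LINT x|lborel. indicator (cball (0::real ^ 'n) r) x * (a * r ^ CARD('n)))"
    by (intro integral_mono integrable_indicator_cball_mult nkern_continuous continuous_on_rabs continuous_on_const mult_left_mono k1) auto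
   also have "\<dots> = a * V * r ^ (2 * CARD('n))" using r by (simp add: content_cball V_def mult_2 power_add)
   finally show ?thesis by simp
  qed
  then show ?thesis using a(1) V by (intro exI[of _ "a * V"]) auto
qed

text \<open>The uniform polynomial mass bound for the kernels becomes polynomial growth in
  \<open>x\<close>; this is where distant periods of the kernel are paid for.\<close>

lemma tempered_sconv:
  fixes \<psi> :: "real \<times> (real ^ 'n) \<Rightarrow> real"
  assumes \<psi>: "cc \<psi>" shows "tempered (\<lambda>k. sconv (nkern k) \<psi>)"
proof -
  obtain S where S: "S > 0" "\<And>w. \<bar>\<psi> w\<bar> \<le> S" using cc_bounded[OF \<psi>] by blast
  obtain r0 where r0: "\<And>w. r0 < norm w \<Longrightarrow> \<psi> w = 0" using \<psi> by (auto simp: cc_def csupp_def)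
  define r where "r = max r0 0"
  have r: "r \<ge> 0" "\<And>w. r < norm w \<Longrightarrow> \<psi> w = 0" using r0 by (auto simp: r_def)
  obtain b where b: "b \<ge> 0" "\<And>k r. r \<ge> 0 \<Longrightarrow> (LINT x|lborel. indicator (cball 0 r) x * \<bar>nkern k (x::real ^ 'n)\<bar>) \<le> 1 + b * r ^ (2 * CARD('n))"
   using nkern_mass by blast
  let ?m = "2 * CARD('n)"
  show ?thesis
  proof (rule temperedI)
   fix k and z :: "real \<times> (real ^ 'n)"
   show "\<bar>sconv (nkern k) \<psi> z\<bar> \<le> (S * (1 + b * (1 + 2 * r) ^ ?m)) * strip_weight r ?m z"
   proof (cases "fst z \<in> {-r..r}")
    case False
    have "\<psi> (z - (0, x)) = 0" for x
    proof (rule r(2))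
     have "\<bar>fst z\<bar> \<le> norm (z - (0, x))" using norm_fst_le[of "fst z" "snd z - x"] by (simp add: prod_eq_iff minus_prod_def)
     then show "r < norm (z - (0, x))" using False by auto
    qed
    then show ?thesis using False by (simp add: sconv_def strip_weight_def)
   next
    case True
    let ?s = "norm (snd z)"
    have "norm z \<le> r + ?s" using norm_Pair_le[of "fst z" "snd z"] True by auto
    moreover have "(1 + 2 * r) * (1 + ?s) = 1 + 2 * r + ?s + 2 * (r * ?s)" by (simp add: algebra_simps)
    \<comment> \<open>Only kernel values on a ball of radius \<open>norm z + r\<close> contribute;
      this factorisation turns its power into a power of 1 + |x|.\<close>
    ultimately have "norm z + r \<le> (1 + 2 * r) * (1 + ?s)" using mult_nonneg_nonneg[OF r(1), of ?s] by simp
    then have "(norm z + r) ^ ?m \<le> ((1 + 2 * r) * (1 + ?s)) ^ ?m" using r(1) by (intro power_mono) auto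
    then have le: "b * (norm z + r) ^ ?m \<le> b * (1 + 2 * r) ^ ?m * (1 + ?s) ^ ?m" using b(1) by (simp add: power_mult_distrib mult.assoc mult_left_mono)
    have "\<bar>sconv (nkern k) \<psi> z\<bar> \<le> S * (LINT x|lborel. indicator (cball 0 (norm z + r)) x * \<bar>nkern k (x::real ^ 'n)\<bar>)"
     by (rule sconv_bound[OF \<psi> r(2) S(2) nkern_continuous])
    also have "\<dots> \<le> S * (1 + b * (norm z + r) ^ ?m)" using S(1) r(1) by (intro mult_left_mono b) auto
    also have "\<dots> \<le> S * (1 * (1 + ?s) ^ ?m + b * (1 + 2 * r) ^ ?m * (1 + ?s) ^ ?m)"
     using S(1) le one_le_power[of "1 + ?s" ?m] by (intro mult_left_mono add_mono) auto
    also have "\<dots> = (S * (1 + b * (1 + 2 * r) ^ ?m)) * strip_weight r ?m z" using True by (simp add: strip_weight_def algebra_simps)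
    finally show ?thesis .
   qed
  qed (use S b r in auto)
qed

lemma tendsto_power_gaussian:
  fixes d :: real
  assumes "d > 0" shows "(\<lambda>k. real (Suc k) ^ (2 * n) * exp (- ((real (Suc k))\<^sup>2 * d))) \<longlonglongrightarrow> 0"
proof -
  have "filterlim (\<lambda>k. d * (real (Suc k))\<^sup>2) at_top sequentially"
   by (intro filterlim_tendsto_pos_mult_at_top[OF tendsto_const assms] filterlim_pow_at_top filterlim_compose[OF filterlim_real_sequentially filterlim_Suc]) simp
  from filterlim_compose[OF tendsto_power_div_exp_0 this, of n]
  have "(\<lambda>k. (1 / d) ^ n * ((d * (real (Suc k))\<^sup>2) ^ n / exp (d * (real (Suc k))\<^sup>2))) \<longlonglongrightarrow> (1 / d) ^ n * 0" by (intro tendsto_mult tendsto_const)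
  then show ?thesis using assms by (simp add: power_mult_distrib power_mult[symmetric] exp_minus divide_inverse mult_ac power_inverse[symmetric] del: of_nat_Suc)
qed

text \<open>For large \<open>k\<close> the ball carrying the normalised mass contains everything
  \<open>z\<close> can see. Close to 0 uniform continuity applies; away from 0 the kernel is
  exponentially small in (k+1)^2.\<close>

lemma tendsto_sconv:
  fixes \<psi> :: "real \<times> (real ^ 'n) \<Rightarrow> real"
  assumes \<psi>: "cc \<psi>" shows "(\<lambda>k. sconv (nkern k) \<psi> z) \<longlonglongrightarrow> \<psi> z"
proof (rule LIMSEQ_I)
  fix e :: real assume e: "e > 0"
  obtain S where S: "S > 0" "\<And>w. \<bar>\<psi> w\<bar> \<le> S" using cc_bounded[OF \<psi>] by blast
  obtain r where r: "\<And>w. r < norm w \<Longrightarrow> \<psi> w = 0" using \<psi> by (auto simp: cc_def csupp_def)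
  obtain a where a: "a > 0" "\<And>k x. 0 \<le> nkern k (x::real ^ 'n)" "\<And>k x. nkern k (x::real ^ 'n) \<le> a * real (Suc k) ^ CARD('n) * kern k x"
   "\<And>k. (LINT x|lborel. indicator (cball 0 (real (Suc k))) x * nkern k (x::real ^ 'n)) = 1" using ex_nkern_bounds[where 'n='n] by blast
  define V where "V = unit_ball_vol (real CARD('n))"
  have "e / 2 > 0" using e by simp
  from cc_uniformly_continuous[OF \<psi> this] obtain d where d: "d > 0" "\<And>w v. dist w v < d \<Longrightarrow> \<bar>\<psi> w - \<psi> v\<bar> < e / 2" by blast
  \<comment> \<open>One power (k+1)^n comes from normalising the kernel, the other from the volume
    of the ball.\<close>
  define tail where "tail = (\<lambda>k. 2 * S * a * V * (real (Suc k) ^ (2 * CARD('n)) * exp (- ((real (Suc k))\<^sup>2 * (d\<^sup>2 / 2)))))"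
  have "tail \<longlonglongrightarrow> 2 * S * a * V * 0" unfolding tail_def by (intro tendsto_mult tendsto_const tendsto_power_gaussian) (use d in simp)
  then have "tail \<longlonglongrightarrow> 0" by simp
  then have "\<forall>\<^sub>F k in sequentially. tail k < e / 2" by (rule order_tendstoD) (use e in simp)
  moreover have "\<forall>\<^sub>F k in sequentially. norm (norm z + r) < real (Suc k)" by (rule eventually_norm_less)
  ultimately have "\<forall>\<^sub>F k in sequentially. norm (sconv (nkern k) \<psi> z - \<psi> z) < e"
  proof eventually_elim
   fix k assume t: "tail k < e / 2" and k: "norm (norm z + r) < real (Suc k)"
   let ?I = "indicator (cball 0 (real (Suc k))) :: real ^ 'n \<Rightarrow> real"
   have cs: "continuous_on UNIV (\<lambda>x. \<psi> (z - (0, x)))" by (rule continuous_slice[OF \<psi>])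
   have 1: "sconv (nkern k) \<psi> z = (LINT x|lborel. ?I x * (nkern k x * \<psi> (z - (0, x))))" unfolding sconv_def
   proof (intro Bochner_Integration.integral_cong refl)
    fix x :: "real ^ 'n"
    show "\<psi> (z - (0, x)) * nkern k x = ?I x * (nkern k x * \<psi> (z - (0, x)))"
    proof (cases "norm x \<le> real (Suc k)")
     case False
     then have "r < norm (z - (0, x))" using k norm_triangle_ineq2[of "(0, x)" z] by (simp add: norm_minus_commute norm_Pair)
     then show ?thesis using r by simp
    qed (simp add: mult.commute)
   qed
   have i1: "integrable lborel (\<lambda>x. ?I x * (nkern k x * \<psi> (z - (0, x))))"
    and i2: "integrable lborel (\<lambda>x. ?I x * nkern k x)" and i3: "integrable lborel (\<lambda>x. ?I x * c)" for c :: real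
    by (intro integrable_indicator_cball_mult continuous_on_mult nkern_continuous cs continuous_on_const)+
   define T where "T = 2 * S * (a * real (Suc k) ^ CARD('n) * exp (- ((real (Suc k))\<^sup>2 * (d\<^sup>2 / 2))))"
   have T0: "T \<ge> 0" using S a by (simp add: T_def)
   have "sconv (nkern k) \<psi> z - \<psi> z = (LINT x|lborel. ?I x * (nkern k x * \<psi> (z - (0, x)))) - \<psi> z * (LINT x|lborel. ?I x * nkern k x)"
    unfolding 1 a(4) by simp
   also have "\<dots> = (LINT x|lborel. ?I x * (nkern k x * \<psi> (z - (0, x))) - \<psi> z * (?I x * nkern k x))" using i1 i2 by simp
   finally have "norm (sconv (nkern k) \<psi> z - \<psi> z) = norm (LINT x|lborel. ?I x * (nkern k x * \<psi> (z - (0, x))) - \<psi> z * (?I x * nkern k x))" by simp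
   also have "\<dots> \<le> (LINT x|lborel. e / 2 * (?I x * nkern k x) + ?I x * T)"
   proof (rule Bochner_Integration.integral_norm_bound_integral)
    show "integrable lborel (\<lambda>x. ?I x * (nkern k x * \<psi> (z - (0, x))) - \<psi> z * (?I x * nkern k x))"
     by (intro Bochner_Integration.integrable_diff i1 integrable_mult_right i2)
    show "integrable lborel (\<lambda>x. e / 2 * (?I x * nkern k x) + ?I x * T)"
     by (intro Bochner_Integration.integrable_add integrable_mult_right i2 i3)
    fix x :: "real ^ 'n"
    have eq: "?I x * (nkern k x * \<psi> (z - (0, x))) - \<psi> z * (?I x * nkern k x) = ?I x * (nkern k x * (\<psi> (z - (0, x)) - \<psi> z))"
     by (simp add: algebra_simps)
    have N: "norm (?I x * (nkern k x * (\<psi> (z - (0, x)) - \<psi> z))) = ?I x * (nkern k x * \<bar>\<psi> (z - (0, x)) - \<psi> z\<bar>)"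
     using a(2)[of k x] by (simp add: abs_mult indicator_def)
    have "nkern k x * \<bar>\<psi> (z - (0, x)) - \<psi> z\<bar> \<le> e / 2 * nkern k x + T" if x: "norm x \<le> real (Suc k)"
    proof (cases "norm x < d")
     case True
     then have "\<bar>\<psi> (z - (0, x)) - \<psi> z\<bar> \<le> e / 2" by (intro less_imp_le d) (simp add: dist_norm norm_Pair)
     then have "nkern k x * \<bar>\<psi> (z - (0, x)) - \<psi> z\<bar> \<le> nkern k x * (e / 2)" using a(2) by (rule mult_left_mono)
     then show ?thesis using T0 by (simp add: mult.commute)
    next
     case False
     then have "d\<^sup>2 \<le> (norm x)\<^sup>2" using d(1) by (intro power_mono) auto
     then have "kern k x \<le> exp (- ((real (Suc k))\<^sup>2 * (d\<^sup>2 / 2)))"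
      using kern_bounds(3)[OF x] by (elim order_trans) (simp add: mult_left_mono del: of_nat_Suc)
     then have nk: "nkern k x \<le> a * real (Suc k) ^ CARD('n) * exp (- ((real (Suc k))\<^sup>2 * (d\<^sup>2 / 2)))"
      using a(1) by (intro order_trans[OF a(3)] mult_left_mono) auto
     have "\<bar>\<psi> (z - (0, x)) - \<psi> z\<bar> \<le> 2 * S" using S(2)[of z] S(2)[of "z - (0, x)"] by linarith
     then have "nkern k x * \<bar>\<psi> (z - (0, x)) - \<psi> z\<bar> \<le> (a * real (Suc k) ^ CARD('n) * exp (- ((real (Suc k))\<^sup>2 * (d\<^sup>2 / 2)))) * (2 * S)"
      using nk a(1) by (intro mult_mono) auto
     also have "\<dots> = T" by (simp only: T_def mult.commute)
     finally show ?thesis using mult_nonneg_nonneg[OF less_imp_le[OF e] a(2)[of k x]] by simp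
    qed
    then show "norm (?I x * (nkern k x * \<psi> (z - (0, x))) - \<psi> z * (?I x * nkern k x)) \<le> e / 2 * (?I x * nkern k x) + ?I x * T"
     unfolding eq N by (simp add: indicator_def)
   qed
   also have "\<dots> = e / 2 + tail k"
   proof -
    have "(LINT x|lborel. ?I x * T) = V * real (Suc k) ^ CARD('n) * T" by (simp add: content_cball V_def del: of_nat_Suc)
    also have "\<dots> = tail k" unfolding tail_def T_def mult_2 power_add by (simp only: mult.assoc mult.commute mult.left_commute)
    finally have "(LINT x|lborel. ?I x * T) = tail k" .
    then show ?thesis using i2 i3[of T] a(4)[of k] by (simp del: of_nat_Suc)
   qed
   finally show "norm (sconv (nkern k) \<psi> z - \<psi> z) < e" using t by simp
  qed
  then show "\<exists>no. \<forall>k\<ge>no. norm (sconv (nkern k) \<psi> z - \<psi> z) < e" by (simp add: eventually_sequentially)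
qed

section \<open>The closure of G0\<close>

context ou_family
begin

text \<open>Spatial convolution commutes with all derivatives in the generator, so the coefficients
  are simply multiplied in. Convergence is pointwise, and polynomial domination on a strip makes it
  convergence in L2.\<close>

lemma graph_approx_G0:
  assumes t: "test_function \<phi>" shows "graph_approx (dens \<rho>) (G0_graph A B f) \<phi> (Gc \<phi>)"
proof -
  note tt = t test_function_dt[OF t] test_function_dx[OF t] test_function_dx[OF test_function_dx[OF t]]
  note r = tt[THEN sconv_regular(1)[OF _ nkern_continuous]] and tm = tt[THEN test_function_cc, THEN tempered_sconv]
   and lim = tt[THEN test_function_cc, THEN tendsto_sconv]
  have const: "tempered (\<lambda>_. F k)" if "tempered F" for F :: "nat \<Rightarrow> real \<times> (real ^ 'n) \<Rightarrow> real" and k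
   using that unfolding tempered_def by blast
  let ?u = "\<lambda>k. sconv (nkern k) \<phi>" and ?ut = "\<lambda>k. sconv (nkern k) (dt \<phi>)" and ?ux = "\<lambda>k i. sconv (nkern k) (dx i \<phi>)"
   and ?uxx = "\<lambda>k i j. sconv (nkern k) (dx j (dx i \<phi>))"
  have cl: "classical (?u k) (?ut k) (?ux k) (?uxx k)" for k unfolding classical_def
   by (intro conjI allI r const tm sconv_regular(2)[OF t nkern_continuous e_time_Basis] sconv_regular(2)[OF t nkern_continuous e_space_Basis]
     sconv_regular(2)[OF test_function_dx[OF t] nkern_continuous e_space_Basis])
  note L = classical_L2[OF cl]
  have m: "\<phi> \<in> borel_measurable borel" "Gc \<phi> \<in> borel_measurable borel" using cc_measurable[OF test_function_cc[OF t]] cc_measurable[OF cc_Gc[OF t]] by auto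
  have mk: "?u k \<in> borel_measurable borel" "Gw (?ut k) (?ux k) (?uxx k) \<in> borel_measurable borel" for k
   using L2_spaceD(1)[OF L(1)] L2_spaceD(1)[OF L(2)] by simp_all
  show ?thesis
  proof (rule graph_approx_limit)
   show "tendsw ?u \<phi>" by (rule tempered_l2_tends[OF tm(1) mk(1) m(1) lim(1)])
   show "tendsw (\<lambda>k. Gw (?ut k) (?ux k) (?uxx k)) (Gc \<phi>)"
   proof (rule tempered_l2_tends[OF tempered_Gw[OF tm(2-4)] mk(2) m(2)])
    show "(\<lambda>k. Gw (?ut k) (?ux k) (?uxx k) z) \<longlonglongrightarrow> Gc \<phi> z" for z
     unfolding Gw_def Gc_def by (intro tendsto_add tendsto_mult tendsto_sum tendsto_const lim)
   qed
   fix k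
   have "(?u k, Gop A B f (?u k)) \<in> G0_graph A B f" using trig_kernels_sconv_DG0[OF nkern_trig t, of k] by (auto simp: G0_graph_def)
   then have "graph_approx (dens \<rho>) (G0_graph A B f) (?u k) (Gop A B f (?u k))" by (rule graph_approx_base) (rule L classical_Gop[OF cl])+
   then show "graph_approx (dens \<rho>) (G0_graph A B f) (?u k) (Gw (?ut k) (?ux k) (?uxx k))"
    by (rule graph_approx_AE_cong) (use mk(2)[of k] classical_Gop(3)[OF cl, of k] in \<open>auto elim: eventually_mono\<close>)
  qed
qed

text \<open>D(G0) lies in the maximal domain, where test functions are a core, and test functions
  are graph limits from D(G0); so the two closures agree, and closedness of the estimates identifies
  the domain.\<close>

lemma Domain_G0_closure: "Domain (L2_graph_closure (dens \<rho>) (G0_graph A B f)) = H_space 1 2 (dens \<rho>)"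
proof (intro equalityI subsetI)
  fix u assume "u \<in> Domain (L2_graph_closure (dens \<rho>) (G0_graph A B f))"
  then obtain w where w: "graph_approx (dens \<rho>) (G0_graph A B f) u w" by (auto simp: L2_graph_closure_iff)
  have "graph_approx (dens \<rho>) test_graph u w"
  proof (rule graph_approx_trans[OF w])
   fix p q assume pq: "(p, q) \<in> G0_graph A B f"
   then have q: "q = Gop A B f p" and "p \<in> DG0" by (auto simp: G0_graph_def)
   then obtain ut ux uxx where c: "classical p ut ux uxx" using DG0_classical by blast
   show "graph_approx (dens \<rho>) test_graph p q" unfolding q
    by (rule domain_graph_approx[OF classical_Gop(1)[OF c] classical_L2(1)[OF c] classical_Gop(2)[OF c]])
  qed
  then show "u \<in> H_space 1 2 (dens \<rho>)" by (rule closure_test_H_space)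
next
  fix u assume "u \<in> H_space 1 2 (dens \<rho>)"
  from domain_graph_approx[OF H_space_Gop[OF this]] have "graph_approx (dens \<rho>) (G0_graph A B f) u (Gop A B f u)"
   by (rule graph_approx_trans) (auto simp: test_graph_def intro: graph_approx_G0)
  then show "u \<in> Domain (L2_graph_closure (dens \<rho>) (G0_graph A B f))" by (auto simp: L2_graph_closure_iff)
qed

text \<open>The inclusion of the maximal domain is the regularity statement: approximation by test
  functions in the graph norm, then the a priori bounds on the approximants.\<close>

lemma H_space_eq: "H_space 1 2 (dens \<rho>) = {u \<in> H_loc 1 2 \<inter> L2w. Gop A B f u \<in> L2w}"
proof (intro equalityI subsetI)
  fix u assume "u \<in> H_space 1 2 (dens \<rho>)"
  from H_space_Gop[OF this] show "u \<in> {u \<in> H_loc 1 2 \<inter> L2w. Gop A B f u \<in> L2w}" by blast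
next
  fix u assume "u \<in> {u \<in> H_loc 1 2 \<inter> L2w. Gop A B f u \<in> L2w}"
  then show "u \<in> H_space 1 2 (dens \<rho>)" using closure_test_H_space[OF domain_graph_approx] by blast
qed

end

theorem theorem1p1:
  fixes A B :: "real \<Rightarrow> real ^ 'n ^ 'n"
   and f :: "real \<Rightarrow> real ^ 'n"
   and U :: "real \<Rightarrow> real \<Rightarrow> real ^ 'n ^ 'n"
   and \<mu>0 :: real
   and \<nu> :: "(real \<times> (real ^ 'n)) measure"
  assumes "continuous_on UNIV A" and "bounded (range A)"
   and "continuous_on UNIV B" and "bounded (range B)"
   and "continuous_on UNIV f" and "bounded (range f)"
   and "\<mu>0 > 0" and "\<And>t x. norm (B t *v x) \<ge> \<mu>0 * norm x"
   and "evolution_family A U" and "growth_bound U < 0"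
   and "is_nu U B f \<nu>"
  shows "Domain (L2_graph_closure \<nu> (G0_graph A B f)) = H_space 1 2 \<nu>
    \<and> H_space 1 2 \<nu> = {u \<in> H_loc 1 2 \<inter> L2_space \<nu>. Gop A B f u \<in> L2_space \<nu>}"
proof -
  interpret ou_family A B f U \<mu>0 by unfold_locales (fact assms)+
  show ?thesis unfolding is_nu_eq_dens[OF assms(11)] by (rule conjI[OF Domain_G0_closure H_space_eq])
qed

end
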